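(* $$\mu^{sym}_{2,1}(163)\leq 906.$$ In particular there is a symmetric multiplication algorithm of length at most $906$ for $\mathbb{F}_{2^{163}}$ over $\mathbb{F}_2$, constructed from a curve of genus one over $\mathbb{F}_2$.
   Context: For a finite-dimensional commutative $\mathbb{F}_q$-algebra $\mathcal{A}$, a symmetric multiplication algorithm of length $m$ is a collection of linear forms $\phi_1,\dots,\phi_m:\mathcal{A}\to\mathbb{F}_q$ and elements $w_1,\dots,w_m\in\mathcal{A}$ with $xy=\sum_{i=1}^m\phi_i(x)\phi_i(y)w_i$ for all $x,y\in\mathcal{A}$; $\mu^{sym}(\mathcal{A}/\mathbb{F}_q)$ is the minimal such $m$. For $n,l\geq 1$ put $\mathcal{A}_q(n,l)=\mathbb{F}_{q^n}[t]/(t^l)$ and $\mu^{sym}_q(n,l)=\mu^{sym}(\mathcal{A}_q(n,l)/\mathbb{F}_q)$. Curves are smooth, projective and geometrically irreducible. For a closed point $P$ of a curve $\mathcal{C}$ and $u\geq 1$, $P^{[u]}$ is the closed subscheme defined by the $u$-th power of the ideal sheaf of $P$; $\mathcal{L}(D)=\Gamma(\mathcal{C},\mathcal{O}_{\mathcal{C}}(D))$. Symmetric Chudnovsky data for $(n,l)$ on $\mathcal{C}$ is a triple $(Q,D,G)$ with $Q$ a closed point of degree $n$, $D$ a divisor, and $G=u_1P_1+\cdots+u_NP_N$ an effective divisor (the $P_i$ pairwise distinct closed points, $\deg P_i=d_i$, $u_i\ge 1$), such that the natural evaluation map $\mathcal{L}(2D)\to\prod_{i=1}^N\mathcal{O}_{\mathcal{C}}(2D)|_{P_i^{[u_i]}}$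 is injective and the natural evaluation map $\mathcal{L}(D)\to\mathcal{O}_{\mathcal{C}}(D)|_{Q^{[l]}}$ is surjective. Such data gives a symmetric multiplication algorithm for $\mathcal{A}_q(n,l)$ of length $\sum_{i=1}^N\mu^{sym}_q(d_i,u_i)$. $\mu^{sym}_{q,\mathcal{C}}(n)$ denotes the minimum of $\sum_i\mu^{sym}_q(d_i,u_i)$ over all symmetric Chudnovsky data for $(n,1)$ on $\mathcal{C}$ ($+\infty$ if there is none), and $\mu^{sym}_{q,g}(n)$ is the minimum of $\mu^{sym}_{q,\mathcal{C}}(n)$ over all curves $\mathcal{C}$ of genus $g$ over $\mathbb{F}_q$. *)

theory Defs
  imports
    "HOL-Algebra.Algebraic_Closure_Type"
    "HOL-Algebra.Generated_Fields"
    "HOL-Algebra.Ideal"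
    "HOL-Algebra.Module"
    "HOL-Library.Cardinality"
    "HOL-Library.Extended_Nat"
    "HOL-Library.Z2"
begin

text \<open>
  The ground field $\mathbb{F}_q$ is a finite field type \<open>'k\<close>, so $q$ is \<open>CARD('k)\<close>; for $q = 2$
  it is the type \<open>bit\<close>.
\<close>

instance bit :: finite
proof
  have "(UNIV :: bit set) = {0, 1}" by auto
  then show "finite (UNIV :: bit set)" by (metis finite.emptyI finite_insert)
qed


section \<open>Symmetric multiplication algorithms\<close>

text \<open>
  A commutative algebra over \<open>'k\<close> is a \<open>module\<close> record of HOL-Algebra, with scalars of type \<open>'k\<close>.
\<close>

definition linear_map ::
    "('k, 'a, 'm) module_scheme \<Rightarrow> ('k, 'b, 'n) module_scheme \<Rightarrow> ('a \<Rightarrow> 'b) \<Rightarrow> bool" where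
  "linear_map A B f \<longleftrightarrow>
     f \<in> carrier A \<rightarrow> carrier B \<and>
     (\<forall>x\<in>carrier A. \<forall>y\<in>carrier A. f (x \<oplus>\<^bsub>A\<^esub> y) = f x \<oplus>\<^bsub>B\<^esub> f y) \<and>
     (\<forall>c. \<forall>x\<in>carrier A. f (c \<odot>\<^bsub>A\<^esub> x) = c \<odot>\<^bsub>B\<^esub> f x)"

definition linear_form :: "('k::field, 'a, 'm) module_scheme \<Rightarrow> ('a \<Rightarrow> 'k) \<Rightarrow> bool" where
  "linear_form A f \<longleftrightarrow>
     (\<forall>x\<in>carrier A. \<forall>y\<in>carrier A. f (x \<oplus>\<^bsub>A\<^esub> y) = f x + f y) \<and>
     (\<forall>c. \<forall>x\<in>carrier A. f (c \<odot>\<^bsub>A\<^esub> x) = c * f x)"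

text \<open>The algorithm is indexed by a finite set \<open>I\<close>; its length is \<open>card I\<close>.\<close>

definition sym_mult_algorithm ::
    "('k::field, 'a, 'm) module_scheme \<Rightarrow> 'i set \<Rightarrow> ('i \<Rightarrow> 'a \<Rightarrow> 'k) \<Rightarrow> ('i \<Rightarrow> 'a) \<Rightarrow> bool" where
  "sym_mult_algorithm A I \<phi> w \<longleftrightarrow>
     finite I \<and>
     (\<forall>i\<in>I. linear_form A (\<phi> i)) \<and>
     (\<forall>i\<in>I. w i \<in> carrier A) \<and>
     (\<forall>x\<in>carrier A. \<forall>y\<in>carrier A.
        x \<otimes>\<^bsub>A\<^esub> y = (\<Oplus>\<^bsub>A\<^esub>i\<in>I. (\<phi> i x * \<phi> i y) \<odot>\<^bsub>A\<^esub> w i))"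

definition mu_sym :: "('k::field, 'a, 'm) module_scheme \<Rightarrow> enat" where
  "mu_sym A = Inf {enat m | m. \<exists>\<phi> w. sym_mult_algorithm A {..<m} \<phi> w}"

text \<open>$\mathbb{F}_{q^n}$ as a subfield of the algebraic closure of $\mathbb{F}_q$, and as an
  $\mathbb{F}_q$-algebra.\<close>

definition Fqn :: "nat \<Rightarrow> 'k::{field,finite} alg_closure set" where
  "Fqn n = {x. x ^ (CARD('k) ^ n) = x}"

definition Fqn_algebra :: "nat \<Rightarrow> ('k::{field,finite}, 'k alg_closure) module" where
  "Fqn_algebra n =
     \<lparr> carrier = Fqn n, monoid.mult = (*), one = 1, ring.zero = 0, add = (+),
       module.smult = (\<lambda>c x. to_ac c * x) \<rparr>"

text \<open>$\mathcal{A}_q(n,l) = \mathbb{F}_{q^n}[t]/(t^l)$, each class being represented by its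
  element of degree less than \<open>l\<close> (for \<open>l \<ge> 1\<close>).\<close>

definition trunc_algebra :: "nat \<Rightarrow> nat \<Rightarrow> ('k::{field,finite}, 'k alg_closure Polynomial.poly) module" where
  "trunc_algebra n l =
     \<lparr> carrier = {p. Polynomial.degree p < l \<and> (\<forall>i. Polynomial.coeff p i \<in> Fqn n)},
       monoid.mult = (\<lambda>x y. (x * y) mod Polynomial.monom 1 l),
       one = 1, ring.zero = 0, add = (+),
       module.smult = (\<lambda>c p. Polynomial.smult (to_ac c) p) \<rparr>"


section \<open>Smooth projective curves\<close>

text \<open>
  All function fields live in one field $\Omega$, an algebraic closure of the rational function
  field $\mathbb{F}_q(T)$.  A function field in one variable over $\mathbb{F}_q$ is a finite
  extension of $\mathbb{F}_q(T)$ and hence embeds into $\Omega$ over $\mathbb{F}_q$.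
\<close>

type_synonym 'k univ_field = "'k Polynomial.poly fract alg_closure"

definition kconst :: "'k::field \<Rightarrow> 'k univ_field" where
  "kconst c = to_ac (Fract [:c:] 1)"

definition kscale :: "'k::field \<Rightarrow> 'k univ_field \<Rightarrow> 'k univ_field" where
  "kscale c x = kconst c * x"

lemma kconst_add: "kconst (a + b) = kconst a + kconst b"
  by (simp add: kconst_def flip: to_ac_add)

lemma kconst_mult: "kconst (a * b) = kconst a * kconst b"
  by (simp add: kconst_def mult.commute flip: to_ac_mult)

lemma kconst_1: "kconst 1 = 1"
  by (simp add: kconst_def One_fract_def[symmetric] flip: one_pCons)

global_interpretation kspace: vector_space kscale
  by unfold_locales (simp_all add: kscale_def kconst_add kconst_mult kconst_1 algebra_simps)

abbreviation Omega :: "'k::field univ_field ring" where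
  "Omega \<equiv> ring_of_type_algebra"

text \<open>
  A non-empty list $\xi = [\xi_0,\dots,\xi_r]$ of elements of $\Omega$, not all zero, is the generic
  point of an integral closed subscheme of $\mathbb{P}^r$ over $\mathbb{F}_q$ (every one with
  function field inside $\Omega$ arises so), namely of Proj of $\mathbb{F}_q[\xi_0 S,\dots,\xi_r S]$,
  $S$ an indeterminate.  Its standard affine charts are the spectra of the rings
  $\mathbb{F}_q[\xi_0/\xi_i,\dots,\xi_r/\xi_i]$ with $\xi_i\neq 0$, and all the local rings are
  subrings of the function field.  The scheme being separated, a closed point is determined by
  its local ring; a closed point is represented by the carrier of that ring.
\<close>

definition chart :: "'k::field univ_field list \<Rightarrow> 'k univ_field \<Rightarrow> 'k univ_field set" where
  "chart \<xi> a = generate_ring Omega (range kconst \<union> {b / a | b. b \<in> set \<xi>})"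

definition function_field :: "'k::field univ_field list \<Rightarrow> 'k univ_field set" where
  "function_field \<xi> =
     generate_field Omega (range kconst \<union> {b / a | a b. a \<in> set \<xi> \<and> b \<in> set \<xi> \<and> a \<noteq> 0})"

definition localization_at :: "'k::field univ_field set \<Rightarrow> 'k univ_field set \<Rightarrow> 'k univ_field set" where
  "localization_at R M = {a / b | a b. a \<in> R \<and> b \<in> R \<and> b \<notin> M}"

definition closed_points :: "'k::field univ_field list \<Rightarrow> 'k univ_field set set" where
  "closed_points \<xi> =
     {localization_at (chart \<xi> a) M | a M.
        a \<in> set \<xi> \<and> a \<noteq> 0 \<and> maximalideal M (Omega\<lparr>carrier := chart \<xi> a\<rparr>)}"

definition uniformizer :: "'k::field univ_field set \<Rightarrow> 'k univ_field \<Rightarrow> bool" where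
  "uniformizer P t \<longleftrightarrow>
     t \<in> P \<and> t \<noteq> 0 \<and> inverse t \<notin> P \<and>
     (\<forall>x\<in>P. x \<noteq> 0 \<longrightarrow> (\<exists>(n::nat) u. u \<in> P \<and> u \<noteq> 0 \<and> inverse u \<in> P \<and> x = u * t ^ n))"

definition algebraic_over_k :: "'k::field univ_field \<Rightarrow> bool" where
  "algebraic_over_k x \<longleftrightarrow> (\<exists>p :: 'k Polynomial.poly. p \<noteq> 0 \<and> Polynomial.poly (map_poly kconst p) x = 0)"

text \<open>
  Dimension one: the function field contains a transcendental element (its transcendence degree is
  at most one since this holds for $\Omega$).  Geometrically irreducible: $\mathbb{F}_q$ is
  algebraically closed in the function field.  Smooth: since $\mathbb{F}_q$ is perfect, this means
  that the local rings are regular, that is, discrete valuation rings.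
\<close>

definition smooth_projective_curve :: "'k::{field,finite} univ_field list \<Rightarrow> bool" where
  "smooth_projective_curve \<xi> \<longleftrightarrow>
     (\<exists>a\<in>set \<xi>. a \<noteq> 0) \<and>
     (\<exists>x\<in>function_field \<xi>. \<not> algebraic_over_k x) \<and>
     (\<forall>x\<in>function_field \<xi>. algebraic_over_k x \<longrightarrow> x \<in> range kconst) \<and>
     (\<forall>P\<in>closed_points \<xi>. \<exists>t. uniformizer P t)"

text \<open>The fractional ideal $\mathfrak{m}_P^n$ of the local ring at \<open>P\<close>, for any integer \<open>n\<close>.\<close>

definition max_power :: "'k::field univ_field set \<Rightarrow> int \<Rightarrow> 'k univ_field set" where
  "max_power P n = {t powi n * a | t a. uniformizer P t \<and> a \<in> P}"

text \<open>
  \<open>d\<close> is the dimension over $\mathbb{F}_q$ of the residue field $\mathcal{O}_P/\mathfrak{m}_P$: there are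
  \<open>d\<close> elements of the local ring whose residue classes form a basis.
\<close>

definition point_degree :: "'k::field univ_field set \<Rightarrow> nat" where
  "point_degree P = (THE d. \<exists>B. B \<subseteq> P \<and> finite B \<and> card B = d \<and>
     (\<forall>x\<in>P. \<exists>f. x - (\<Sum>b\<in>B. kscale (f b) b) \<in> max_power P 1) \<and>
     (\<forall>f. (\<Sum>b\<in>B. kscale (f b) b) \<in> max_power P 1 \<longrightarrow> (\<forall>b\<in>B. f b = 0)))"


section \<open>Divisors and genus\<close>

definition supp :: "('k::field univ_field set \<Rightarrow> int) \<Rightarrow> 'k univ_field set set" where
  "supp D = {P. D P \<noteq> 0}"

definition is_divisor :: "'k::field univ_field list \<Rightarrow> ('k univ_field set \<Rightarrow> int) \<Rightarrow> bool" where
  "is_divisor \<xi> D \<longleftrightarrow> finite (supp D) \<and> supp D \<subseteq> closed_points \<xi>"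

definition divisor_degree :: "('k::field univ_field set \<Rightarrow> int) \<Rightarrow> int" where
  "divisor_degree D = (\<Sum>P\<in>supp D. D P * int (point_degree P))"

text \<open>
  The stalk of $\mathcal{O}_{\mathcal{C}}(D)$ at \<open>P\<close> as a subset of the function field, and the global
  sections $\mathcal{L}(D)$.
\<close>

definition stalk :: "('k::field univ_field set \<Rightarrow> int) \<Rightarrow> 'k univ_field set \<Rightarrow> 'k univ_field set" where
  "stalk D P = max_power P (- D P)"

definition global_sections :: "'k::field univ_field list \<Rightarrow> ('k univ_field set \<Rightarrow> int) \<Rightarrow> 'k univ_field set" where
  "global_sections \<xi> D = {f \<in> function_field \<xi>. \<forall>P\<in>closed_points \<xi>. f \<in> stalk D P}"

text \<open>Riemann's definition: the genus is the maximum of $\deg D - \dim \mathcal{L}(D) + 1$ over all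
  divisors \<open>D\<close>.\<close>

definition has_genus :: "'k::field univ_field list \<Rightarrow> nat \<Rightarrow> bool" where
  "has_genus \<xi> g \<longleftrightarrow>
     (\<forall>D. is_divisor \<xi> D \<longrightarrow>
        divisor_degree D - int (kspace.dim (global_sections \<xi> D)) + 1 \<le> int g) \<and>
     (\<exists>D. is_divisor \<xi> D \<and>
        divisor_degree D - int (kspace.dim (global_sections \<xi> D)) + 1 = int g)"


section \<open>Symmetric Chudnovsky data\<close>

text \<open>
  The space of sections of $\mathcal{O}_{\mathcal{C}}(D)$ over $P^{[u]}$ is the quotient of the stalk
  $\mathcal{O}_{\mathcal{C}}(D)_P$ by $\mathfrak{m}_P^u\,\mathcal{O}_{\mathcal{C}}(D)_P$; its elements are cosets.
\<close>

definition eval_thick ::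
    "('k::field univ_field set \<Rightarrow> int) \<Rightarrow> 'k univ_field set \<Rightarrow> nat \<Rightarrow> 'k univ_field \<Rightarrow> 'k univ_field set" where
  "eval_thick D P u f = {f + h | h. h \<in> max_power P (int u - D P)}"

definition restriction_thick ::
    "('k::field univ_field set \<Rightarrow> int) \<Rightarrow> 'k univ_field set \<Rightarrow> nat \<Rightarrow> 'k univ_field set set" where
  "restriction_thick D P u = eval_thick D P u ` stalk D P"

definition sym_chudnovsky_data ::
    "'k::field univ_field list \<Rightarrow> nat \<Rightarrow> nat \<Rightarrow> 'k univ_field set \<Rightarrow>
     ('k univ_field set \<Rightarrow> int) \<Rightarrow> ('k univ_field set \<Rightarrow> int) \<Rightarrow> bool" where
  "sym_chudnovsky_data \<xi> n l Q D G \<longleftrightarrow>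
     Q \<in> closed_points \<xi> \<and> point_degree Q = n \<and>
     is_divisor \<xi> D \<and>
     is_divisor \<xi> G \<and> (\<forall>P. G P \<ge> 0) \<and>
     inj_on (\<lambda>f. \<lambda>P\<in>supp G. eval_thick (\<lambda>P. 2 * D P) P (nat (G P)) f)
       (global_sections \<xi> (\<lambda>P. 2 * D P)) \<and>
     eval_thick D Q l ` global_sections \<xi> D = restriction_thick D Q l"

definition data_length :: "('k::{field,finite} univ_field set \<Rightarrow> int) \<Rightarrow> enat" where
  "data_length G =
     (\<Sum>P\<in>supp G. mu_sym (trunc_algebra (point_degree P) (nat (G P)) :: ('k, _) module))"

definition mu_sym_curve :: "'k::{field,finite} univ_field list \<Rightarrow> nat \<Rightarrow> enat" where
  "mu_sym_curve \<xi> n = Inf {data_length G | Q D G. sym_chudnovsky_data \<xi> n 1 Q D G}"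

definition mu_sym_genus :: "'k::{field,finite} itself \<Rightarrow> nat \<Rightarrow> nat \<Rightarrow> enat" where
  "mu_sym_genus _ g n =
     Inf {mu_sym_curve \<xi> n | \<xi> :: 'k univ_field list. smooth_projective_curve \<xi> \<and> has_genus \<xi> g}"


section \<open>The algorithm given by symmetric Chudnovsky data\<close>

text \<open>
  \<open>\<pi>\<close> presents the algebra \<open>A\<close> as $\mathcal{O}_P/\mathfrak{m}_P^u$.
\<close>

definition residue_map ::
    "'k::field univ_field set \<Rightarrow> nat \<Rightarrow> ('k, 'a, 'm) module_scheme \<Rightarrow> ('k univ_field \<Rightarrow> 'a) \<Rightarrow> bool" where
  "residue_map P u A \<pi> \<longleftrightarrow>
     \<pi> \<in> ring_hom (Omega\<lparr>carrier := P\<rparr>) A \<and>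
     (\<forall>c. \<forall>x\<in>P. \<pi> (kscale c x) = c \<odot>\<^bsub>A\<^esub> \<pi> x) \<and>
     \<pi> ` P = carrier A \<and>
     {x \<in> P. \<pi> x = \<zero>\<^bsub>A\<^esub>} = max_power P (int u)"

definition stalk_generator ::
    "('k::field univ_field set \<Rightarrow> int) \<Rightarrow> 'k univ_field set \<Rightarrow> 'k univ_field \<Rightarrow> bool" where
  "stalk_generator D P e \<longleftrightarrow> e \<noteq> 0 \<and> stalk D P = (\<lambda>a. e * a) ` P"

text \<open>
  The evaluation-interpolation construction, for an algebra \<open>B\<close> isomorphic to
  $\mathcal{O}_Q/\mathfrak{m}_Q^l$.  After trivialising the invertible sheaf at \<open>Q\<close> and at the points of \<open>G\<close>
  by local generators \<open>e\<close>, \<open>\<epsilon> P\<close> (and its square by their squares), elements \<open>x\<close> of \<open>B\<close> are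
  lifted to sections \<open>s x\<close> of \<open>D\<close> and these are evaluated at the thickened points of \<open>G\<close>.
  There a symmetric algorithm \<open>\<psi> P\<close>, \<open>v P\<close> of minimal length \<open>m P\<close> multiplies them, and the value at
  \<open>Q\<close> of a section of \<open>2D\<close> is recovered linearly, with components \<open>r P\<close>, from its values along \<open>G\<close>.
\<close>

definition chudnovsky_algorithm ::
    "'k::{field,finite} univ_field list \<Rightarrow> nat \<Rightarrow> 'k univ_field set \<Rightarrow>
     ('k univ_field set \<Rightarrow> int) \<Rightarrow> ('k univ_field set \<Rightarrow> int) \<Rightarrow>
     ('k, 'b, 'm) module_scheme \<Rightarrow> ('k univ_field set \<times> nat) set \<Rightarrow>
     ('k univ_field set \<times> nat \<Rightarrow> 'b \<Rightarrow> 'k) \<Rightarrow> ('k univ_field set \<times> nat \<Rightarrow> 'b) \<Rightarrow> bool" where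
  "chudnovsky_algorithm \<xi> l Q D G B I \<phi> w \<longleftrightarrow>
     (\<exists>e \<pi> s \<epsilon> \<rho> m \<psi> v r.
        stalk_generator D Q e \<and> residue_map Q l B \<pi> \<and>
        (\<forall>x\<in>carrier B. \<forall>y\<in>carrier B. s (x \<oplus>\<^bsub>B\<^esub> y) = s x + s y) \<and>
        (\<forall>c. \<forall>x\<in>carrier B. s (c \<odot>\<^bsub>B\<^esub> x) = kscale c (s x)) \<and>
        (\<forall>x\<in>carrier B. s x \<in> global_sections \<xi> D \<and> \<pi> (s x / e) = x) \<and>
        (\<forall>P\<in>supp G.
           let A = (trunc_algebra (point_degree P) (nat (G P)) :: ('k, _) module) in
             stalk_generator D P (\<epsilon> P) \<and> residue_map P (nat (G P)) A (\<rho> P) \<and>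
             sym_mult_algorithm A {..<m P} (\<psi> P) (v P) \<and> enat (m P) = mu_sym A \<and>
             linear_map A B (r P)) \<and>
        (\<forall>h\<in>global_sections \<xi> (\<lambda>P. 2 * D P).
           \<pi> (h / e\<^sup>2) = (\<Oplus>\<^bsub>B\<^esub>P\<in>supp G. r P (\<rho> P (h / (\<epsilon> P)\<^sup>2)))) \<and>
        I = Sigma (supp G) (\<lambda>P. {..<m P}) \<and>
        (\<forall>P\<in>supp G. \<forall>j<m P.
           (\<forall>x\<in>carrier B. \<phi> (P, j) x = \<psi> P j (\<rho> P (s x / \<epsilon> P))) \<and>
           w (P, j) = r P (v P j)))"

end

theory Submission
  imports Defs "HOL-Library.Function_Algebras"
begin

text \<open>On the curve $y^2+y=x^3+x$ let $O$ be the point at infinity, $A_0=(0,0)$ and $Q$ a point of degree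
  163; such a $Q$ lies over an element $a$ of $\mathbb{F}_{2^{163}}$, not in $\mathbb{F}_2$, with
  $\mathrm{Tr}(a^3+a)=0$. As no function has a simple pole at $O$ as its only pole, $O-A_0$ is not
  principal. Take $D=Q+A_0-O$. Then $\mathcal{L}(D-Q)=0$, so evaluation at $Q$ is injective on
  $\mathcal{L}(D)$, and bijective by Riemann's inequality. If $G_0$ has degree 325, one of the degree
  zero divisors $2D-G_0-O$ and $2D-G_0-A_0$, which differ by $O-A_0$, is not principal; so $G=G_0+O$ or
  $G=G_0+A_0$ satisfies $\mathcal{L}(2D-G)=0$, and evaluation along $G$ is injective on $\mathcal{L}(2D)$.

  Here $G_0$ consists of the five rational points with multiplicity five and of five points of
  degree 4, four of degree 5, ten of degree 6 and 25 of degree 8. The length is at most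
  $4\cdot 11+15+5\cdot 9+4\cdot 13+10\cdot 15+25\cdot 24=906$ by the bounds $\mu(1,5)\le 11$, $\mu(1,6)\le 15$,
  $\mu(4,1)\le 9$, $\mu(5,1)\le 13$, $\mu(6,1)\le 15$ and $\mu(8,1)\le 24$, for which explicit algorithms are
  verified by computation.

  The curve is unramified over the affine $x$-line, so the minimal polynomial of $x$ is a uniformizer at every
  affine point. Conjugation $y\mapsto y+1$ reduces the degree of a principal divisor to that of a
  norm in $\mathbb{F}_2[x]$, and Riemann's inequality follows by counting the functions regular away
  from $O$ of bounded pole order.\<close>

text \<open>No degree is wasted. In genus one dim L(D) = deg D for positive degree, so 163 and 326
  are the smallest degrees for which the two evaluation maps can be surjective and injective; both
  conditions then say that a divisor of degree zero is not principal.

  The evaluation points come from the zeta function. The trace of Frobenius is -2, so the curve has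
  5, 5, 5, 25, 25, 65, 145, 225 points over the extensions of degree 1 to 8. Hence it has 5 rational
  points, the maximum in genus one over F_2, no closed points of degree 2 or 3, and exactly 5, 4,
  10, 25 of degrees 4, 5, 6, 8. All of these are used: those of degree above one contribute 300, and
  multiplicity five at the rational points supplies the other 25. The last unit of degree raises one
  multiplicity from five to six, at the price 15 - 11 = 4.

  Closed points are given only as localizations of charts, so they are first identified with
  valuation rings. Dimensions over F_2 are then obtained as logarithms of cardinalities.\<close>

hide_const (open) Polynomials.degree Divisibility.prime
hide_const (open) UnivPoly.coeff UnivPoly.monom

text \<open>Sums and products of bits stay ring operations, so that the general ring simplification
  rules keep applying.\<close>

declare add_bit_eq_xor [simp del] mult_bit_eq_and [simp del]

section \<open>Characteristic two\<close>

lemma bit_add_self [simp]: "(a :: bit) + a = 0"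
  by (cases a) auto

lemma bit_poly_2 [simp]: "(2 :: bit poly) = 0"
proof -
  have "(2 :: bit poly) = [:1:] + [:1:]" by (simp only: one_add_one flip: one_pCons)
  also have "\<dots> = 0" by simp
  finally show ?thesis .
qed

lemma bit_poly_add_self [simp]: "(p :: bit poly) + p = 0"
  by (metis mult_2 bit_poly_2 mult_zero_left)

lemma bit_poly_minus [simp]: "- (p :: bit poly) = p"
  by (rule minus_unique) simp

text \<open>Differences and negatives are normalised to sums, where equal terms cancel. The same
  normal form is set up for each of the fields below.\<close>

lemma bit_poly_diff [simp]: "(p :: bit poly) - q = p + q"
  using diff_conv_add_uminus[of p q] by simp

lemma bit_poly_add_cancel [simp]: "(p :: bit poly) + (p + q) = q"
  by (metis add.assoc add_0 bit_poly_add_self)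

lemma Omega_2 [simp]: "(2 :: bit univ_field) = 0"
proof -
  have "(1 :: bit univ_field) + 1 = kconst (1 + 1)"
    by (simp only: kconst_add kconst_1)
  also have "\<dots> = 0"
    by (simp add: kconst_def Zero_fract_def[symmetric])
  finally show ?thesis by simp
qed

lemma Omega_add_self [simp]: "(x :: bit univ_field) + x = 0"
  by (metis mult_2 Omega_2 mult_zero_left)

lemma Omega_minus [simp]: "- (x :: bit univ_field) = x"
  by (rule minus_unique) simp

lemma Omega_diff [simp]: "(x :: bit univ_field) - y = x + y"
  using diff_conv_add_uminus[of x y] by simp

lemma ac_2 [simp]: "(2 :: bit alg_closure) = 0"
proof -
  have "(1 :: bit alg_closure) + 1 = to_ac (1 + 1)" by (simp only: to_ac_add to_ac_1)
  also have "\<dots> = 0" by simp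
  finally show ?thesis by simp
qed

lemma ac_add_self [simp]: "(x :: bit alg_closure) + x = 0"
  by (metis mult_2 ac_2 mult_zero_left)

lemma ac_minus [simp]: "- (x :: bit alg_closure) = x"
  by (rule minus_unique) simp

lemma ac_add_cancel [simp]: "(x :: bit alg_closure) + (x + y) = y"
  by (metis add.assoc add_0 ac_add_self)

lemma ac_add_eq_0 [simp]: "(x :: bit alg_closure) + y = 0 \<longleftrightarrow> x = y"
  by (metis ac_add_cancel ac_add_self add.right_neutral)

lemma Omega_add_cancel [simp]: "(x :: bit univ_field) + (x + y) = y"
  by (metis add.assoc add_0 Omega_add_self)

lemma Omega_add_eq_0 [simp]: "(x :: bit univ_field) + y = 0 \<longleftrightarrow> x = y"
  by (metis Omega_add_cancel Omega_add_self add.right_neutral)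

lemma ac_sum_sq: "((x :: bit alg_closure) + y)^2 = x^2 + y^2"
  by (simp add: power2_sum)

lemma ac_sum_pow2: "((x :: bit alg_closure) + y)^(2^n) = x^(2^n) + y^(2^n)"
  by (induction n) (simp_all add: power_mult mult.commute[of 2] ac_sum_sq)

section \<open>The coordinate ring of the affine curve\<close>

text \<open>\<open>Coord a b\<close> stands for $a + b y$ in $\mathbb{F}_2[x,y]/(y^2+y+x^3+x)$.\<close>

datatype coord = Coord (cst: "bit poly") (lin: "bit poly")

definition cubic :: "bit poly" where "cubic = [:0, 1, 0, 1:]"

instantiation coord :: comm_ring_1
begin
definition "0 = Coord 0 0"
definition "1 = Coord 1 0"
definition "r + s = Coord (cst r + cst s) (lin r + lin s)"
definition "- r = Coord (- cst r) (- lin r)"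
definition "r - s = Coord (cst r - cst s) (lin r - lin s)"
definition "r * s = Coord (cst r * cst s + cubic * lin r * lin s)
                          (cst r * lin s + lin r * cst s + lin r * lin s)"
instance
  by standard
    (simp_all add: zero_coord_def one_coord_def plus_coord_def uminus_coord_def minus_coord_def
       times_coord_def coord.expand algebra_simps)
end

lemma coord_simps [simp]:
  "cst 0 = 0" "lin 0 = 0" "cst 1 = 1" "lin 1 = 0"
  "cst (r + s) = cst r + cst s" "lin (r + s) = lin r + lin s"
  "cst (r * s) = cst r * cst s + cubic * lin r * lin s"
  "lin (r * s) = cst r * lin s + lin r * cst s + lin r * lin s"
  by (simp_all add: zero_coord_def one_coord_def plus_coord_def times_coord_def)

lemma coord_eq_iff: "r = s \<longleftrightarrow> cst r = cst s \<and> lin r = lin s"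
  by (cases r; cases s) auto

lemma coord_add_self [simp]: "(r :: coord) + r = 0"
  unfolding coord_eq_iff coord_simps by simp

lemma coord_minus [simp]: "- (r :: coord) = r"
  by (rule minus_unique) simp

definition ofx :: "bit poly \<Rightarrow> coord" where "ofx p = Coord p 0"

lemma ofx_simps [simp]: "cst (ofx p) = p" "lin (ofx p) = 0"
  by (simp_all add: ofx_def)

lemma ofx_hom [simp]:
  "ofx 0 = 0" "ofx 1 = 1" "ofx (p + q) = ofx p + ofx q" "ofx (p * q) = ofx p * ofx q"
  by (simp_all add: coord_eq_iff)

lemma ofx_power [simp]: "ofx (p ^ n) = ofx p ^ n"
  by (induction n) simp_all

lemma ofx_eq_0_iff [simp]: "ofx p = 0 \<longleftrightarrow> p = 0"
  by (simp add: coord_eq_iff)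

section \<open>Conjugation, norm and pole order\<close>

definition conj :: "coord \<Rightarrow> coord" where "conj r = Coord (cst r + lin r) (lin r)"

lemma conj_simps [simp]: "cst (conj r) = cst r + lin r" "lin (conj r) = lin r"
  by (simp_all add: conj_def)

lemma conj_conj [simp]: "conj (conj r) = r"
  by (simp add: coord_eq_iff add.assoc)

lemma conj_mult: "conj (r * s) = conj r * conj s"
  by (simp add: coord_eq_iff algebra_simps)

lemma conj_ofx [simp]: "conj (ofx p) = ofx p"
  by (simp add: coord_eq_iff)

lemma conj_eq_0_iff [simp]: "conj r = 0 \<longleftrightarrow> r = 0"
  by (auto simp add: coord_eq_iff)

text \<open>This is (a + b y)(a + b (y + 1)), because y (y + 1) = x^3 + x. The conjugation y -> y +
  1 is negation on the elliptic curve.\<close>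

definition nrm :: "coord \<Rightarrow> bit poly" where
  "nrm r = cst r ^ 2 + cst r * lin r + cubic * lin r ^ 2"

lemma mult_conj: "r * conj r = ofx (nrm r)"
  by (simp add: coord_eq_iff nrm_def power2_eq_square algebra_simps)

lemma nrm_mult: "nrm (r * s) = nrm r * nrm s"
proof -
  have "ofx (nrm (r * s)) = ofx (nrm r * nrm s)"
    by (simp add: conj_mult mult_ac flip: mult_conj)
  then show ?thesis by (simp add: ofx_def)
qed

lemma nrm_conj [simp]: "nrm (conj r) = nrm r"
  by (simp add: nrm_def power2_eq_square algebra_simps)

lemma degree_cubic [simp]: "Polynomial.degree cubic = 3"
  by (simp add: cubic_def)

lemma cubic_nonzero [simp]: "cubic \<noteq> 0"
  by (simp add: cubic_def)

text \<open>The degrees of $a^2$ and $(x^3+x)b^2$ have different parity, and that of $ab$ is smaller than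
  the larger one.\<close>

lemma degree_square: "Polynomial.degree ((p :: bit poly) ^ 2) = 2 * Polynomial.degree p"
  by (cases "p = 0") (simp_all add: degree_power_eq)

lemma degree_nrm_aux:
  fixes a b :: "bit poly"
  assumes "a \<noteq> 0" "b \<noteq> 0"
  shows "Polynomial.degree (a ^ 2 + a * b + cubic * b ^ 2) =
    max (2 * Polynomial.degree a) (2 * Polynomial.degree b + 3)"
proof -
  let ?m = "Polynomial.degree a" and ?k = "Polynomial.degree b"
  have d: "Polynomial.degree (a^2) = 2 * ?m" "Polynomial.degree (a * b) = ?m + ?k"
     "Polynomial.degree (cubic * b^2) = 2 * ?k + 3"
    using assms by (simp_all add: degree_power_eq degree_mult_eq)
  show ?thesis
  \<comment> \<open>The condition says \<open>2 * ?m > 2 * ?k + 3\<close>; equality is impossible by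
    parity.\<close>
  proof (cases "?m \<ge> ?k + 2")
    case True
    have "Polynomial.degree (a * b + cubic * b ^ 2) < 2 * ?m"
      using d True by (intro degree_add_less) auto
    then have "Polynomial.degree (a ^ 2 + (a * b + cubic * b ^ 2)) = 2 * ?m"
      by (subst degree_add_eq_left) (simp_all add: d)
    then show ?thesis using True by (simp add: add.assoc)
  next
    case False
    have "Polynomial.degree (a ^ 2 + a * b) < 2 * ?k + 3"
      using d False by (intro degree_add_less) auto
    then have "Polynomial.degree (a ^ 2 + a * b + cubic * b ^ 2) = 2 * ?k + 3"
      by (subst degree_add_eq_right) (simp_all add: d)
    then show ?thesis using False by simp
  qed
qed

text \<open>The pole order at infinity: x has order 2 and y has order 3. Taking it from the norm
  makes additivity under products immediate.\<close>

definition dg :: "coord \<Rightarrow> nat" where "dg r = Polynomial.degree (nrm r)"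

lemma dg_eq:
  "dg r = max (2 * Polynomial.degree (cst r)) (if lin r = 0 then 0 else 2 * Polynomial.degree (lin r) + 3)"
proof (cases "cst r = 0 \<or> lin r = 0")
  case False
  then show ?thesis using degree_nrm_aux[of "cst r" "lin r"] by (simp add: dg_def nrm_def)
next
  case True
  then show ?thesis by (auto simp: dg_def nrm_def degree_square degree_mult_eq)
qed

lemma nrm_eq_0_iff [simp]: "nrm r = 0 \<longleftrightarrow> r = 0"
proof
  assume 0: "nrm r = 0"
  then have "dg r = 0" by (simp add: dg_def)
  then have "lin r = 0" using dg_eq[of r] by (auto split: if_splits)
  then show "r = 0" using 0 by (simp add: nrm_def coord_eq_iff)
qed (simp add: nrm_def)

instance coord :: idom
proof
  fix r s :: coord assume "r \<noteq> 0" "s \<noteq> 0"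
  then have "nrm (r * s) \<noteq> 0" by (simp add: nrm_mult)
  then show "r * s \<noteq> 0" by auto
qed

lemma dg_mult: "r \<noteq> 0 \<Longrightarrow> s \<noteq> 0 \<Longrightarrow> dg (r * s) = dg r + dg s"
  by (simp add: dg_def nrm_mult degree_mult_eq)

lemma dg_add: "dg (r + s) \<le> max (dg r) (dg s)"
proof -
  have "Polynomial.degree (cst r + cst s) \<le> max (Polynomial.degree (cst r)) (Polynomial.degree (cst s))"
    "Polynomial.degree (lin r + lin s) \<le> max (Polynomial.degree (lin r)) (Polynomial.degree (lin s))"
    by (rule degree_add_le_max)+
  then show ?thesis by (auto simp: dg_eq)
qed

lemma dg_conj [simp]: "dg (conj r) = dg r"
  by (simp add: dg_def)

lemma dg_ofx [simp]: "dg (ofx p) = 2 * Polynomial.degree p"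
  by (simp add: dg_eq)

lemma dg_1 [simp]: "dg 1 = 0"
  by (simp add: dg_eq)

section \<open>The function field\<close>

definition ofp :: "bit poly \<Rightarrow> bit univ_field" where "ofp p = to_ac (Fract p 1)"

lemma ofp_hom [simp]:
  "ofp 0 = 0" "ofp 1 = 1" "ofp (p + q) = ofp p + ofp q" "ofp (p * q) = ofp p * ofp q"
  by (simp_all add: ofp_def Zero_fract_def[symmetric] One_fract_def[symmetric] flip: to_ac_add to_ac_mult)

lemma ofp_eq_0_iff [simp]: "ofp p = 0 \<longleftrightarrow> p = 0"
  by (simp add: ofp_def Zero_fract_def eq_fract)

text \<open>A root exists because the ambient field is algebraically closed; either of the two roots
  generates the same function field.\<close>

definition ygen :: "bit univ_field" where "ygen = (SOME y. y^2 + y = ofp cubic)"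

lemma ygen_eq: "ygen ^ 2 = ygen + ofp cubic"
proof -
  have "\<exists>y. poly [: ofp cubic, 1, 1 :] y = 0"
    by (rule alg_closed_imp_poly_has_root) simp
  then obtain y where "poly [: ofp cubic, 1, 1 :] y = 0" ..
  then have "ofp cubic + (y^2 + y) = 0"
    by (simp add: algebra_simps power2_eq_square)
  then have "y^2 + y = ofp cubic" by (simp only: Omega_add_eq_0)
  then have "ygen^2 + ygen = ofp cubic" unfolding ygen_def by (rule someI)
  then show ?thesis by (metis Omega_add_cancel add.commute)
qed

definition emb :: "coord \<Rightarrow> bit univ_field" where "emb r = ofp (cst r) + ofp (lin r) * ygen"

lemma emb_hom [simp]:
  "emb 0 = 0" "emb 1 = 1" "emb (r + s) = emb r + emb s"
  by (simp_all add: emb_def algebra_simps)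

lemma emb_mult [simp]: "emb (r * s) = emb r * emb s"
proof -
  have "emb r * emb s = ofp (cst r) * ofp (cst s) + (ofp (cst r) * ofp (lin s) + ofp (lin r) * ofp (cst s)) * ygen
     + ofp (lin r) * ofp (lin s) * ygen ^ 2"
    by (simp add: emb_def algebra_simps power2_eq_square)
  then show ?thesis unfolding ygen_eq by (simp add: emb_def algebra_simps)
qed

lemma emb_power [simp]: "emb (r ^ n) = emb r ^ n"
  by (induction n) simp_all

lemma emb_ofx: "emb (ofx p) = ofp p"
  by (simp add: emb_def)

text \<open>An element that is sent to 0 has a norm that is sent to 0, and F_2[x] embeds faithfully.
  So y satisfies no relation beyond the equation of the curve.\<close>

lemma emb_eq_0_iff [simp]: "emb r = 0 \<longleftrightarrow> r = 0"
proof
  assume "emb r = 0"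
  then have "emb (r * conj r) = 0" by simp
  then have "nrm r = 0" by (simp only: mult_conj emb_ofx ofp_eq_0_iff)
  then show "r = 0" by simp
qed simp

lemma emb_eq_iff [simp]: "emb r = emb s \<longleftrightarrow> r = s"
proof
  assume "emb r = emb s"
  then have "emb (r + s) = 0" by simp
  then have "r + s = 0" by (simp only: emb_eq_0_iff)
  then show "r = s" by (metis add.assoc add_0 add.right_neutral coord_add_self)
qed simp

definition FF :: "bit univ_field set" where "FF = {emb r / emb s | r s. s \<noteq> 0}"

lemma FF_I: "s \<noteq> 0 \<Longrightarrow> emb r / emb s \<in> FF"
  by (auto simp: FF_def)

lemma FF_E:
  assumes "f \<in> FF" obtains r s where "f = emb r / emb s" "s \<noteq> 0"
  using assms by (auto simp: FF_def)

lemma FF_nz_E: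
  assumes "f \<in> FF" "f \<noteq> 0" obtains r s where "f = emb r / emb s" "s \<noteq> 0" "r \<noteq> 0"
  using assms by (auto simp: FF_def)

text \<open>Multiplying numerator and denominator by the conjugate of the denominator makes the
  latter a polynomial in x.\<close>

lemma FF_polyE:
  assumes "f \<in> FF" obtains r p where "f = emb r / ofp p" "p \<noteq> 0"
proof -
  from FF_E[OF assms] obtain r s where f: "f = emb r / emb s" "s \<noteq> 0" .
  have "emb r / emb s = emb (r * conj s) / emb (s * conj s)" using f by simp
  then have "f = emb (r * conj s) / ofp (nrm s)" by (simp only: f mult_conj emb_ofx)
  then show ?thesis using that[of "r * conj s" "nrm s"] f(2) by simp
qed

lemma FF_emb [simp]: "emb r \<in> FF"
  using FF_I[of 1 r] by simp

lemma FF_0 [simp]: "0 \<in> FF" and FF_1 [simp]: "1 \<in> FF"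
  using FF_emb[of 0] FF_emb[of 1] by simp_all

lemma FF_ofp [simp]: "ofp p \<in> FF"
  by (simp flip: emb_ofx)

lemma FF_add [simp]: assumes "f \<in> FF" "g \<in> FF" shows "f + g \<in> FF"
proof -
  from assms obtain r s r' s' where *: "f = emb r / emb s" "s \<noteq> 0" "g = emb r' / emb s'" "s' \<noteq> 0"
    by (auto simp: FF_def)
  then have "f + g = emb (r * s' + r' * s) / emb (s * s')" by (simp add: field_simps)
  then show ?thesis using * by (metis FF_I mult_eq_0_iff)
qed

lemma FF_mult [simp]: assumes "f \<in> FF" "g \<in> FF" shows "f * g \<in> FF"
proof -
  from assms obtain r s r' s' where *: "f = emb r / emb s" "s \<noteq> 0" "g = emb r' / emb s'" "s' \<noteq> 0"
    by (auto simp: FF_def)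
  then have "f * g = emb (r * r') / emb (s * s')" by simp
  then show ?thesis using * by (metis FF_I mult_eq_0_iff)
qed

lemma FF_inverse [simp]: assumes "f \<in> FF" shows "inverse f \<in> FF"
proof (cases "f = 0")
  case False
  from FF_nz_E[OF assms this] obtain r s where "f = emb r / emb s" "s \<noteq> 0" "r \<noteq> 0" .
  then show ?thesis by (auto simp: FF_def)
qed simp

lemma FF_divide [simp]: "f \<in> FF \<Longrightarrow> g \<in> FF \<Longrightarrow> f / g \<in> FF"
  by (simp add: divide_inverse)

lemma FF_power [simp]: "f \<in> FF \<Longrightarrow> f ^ n \<in> FF"
  by (induction n) simp_all

lemma FF_powi [simp]: "f \<in> FF \<Longrightarrow> f powi n \<in> FF"
  by (simp add: power_int_def)

lemma kconst_bit: "kconst c = (if c = 0 then 0 else (1 :: bit univ_field))"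
  by (cases c) (simp_all only: kconst_1, simp_all add: kconst_def Zero_fract_def[symmetric])

lemma kconst_0 [simp]: "kconst (0 :: bit) = 0" and kconst_1' [simp]: "kconst (1 :: bit) = 1"
  by (simp_all add: kconst_bit)

lemma range_kconst: "range (kconst :: bit \<Rightarrow> _) = {0, 1}"
proof -
  have "UNIV = {0, 1 :: bit}" by auto
  then show ?thesis by (metis image_insert image_empty kconst_0 kconst_1')
qed

lemma FF_kconst [simp]: "kconst c \<in> FF"
  by (simp add: kconst_bit)

lemma kscale_bit: "kscale c x = (if c = 0 then 0 else (x :: bit univ_field))"
  by (simp add: kscale_def kconst_bit)

section \<open>Subrings and ideals of the function field\<close>

lemma Omega_ring_simps [simp]:
  "carrier Omega = UNIV" "x \<otimes>\<^bsub>Omega\<^esub> y = x * y" "\<one>\<^bsub>Omega\<^esub> = 1" "\<zero>\<^bsub>Omega\<^esub> = 0" "x \<oplus>\<^bsub>Omega\<^esub> y = x + y"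
  by (simp_all add: ring_of_type_algebra_def)

lemma field_Omega: "field Omega"
  by (rule field_from_type_algebra)

lemma Omega_inv [simp]: "h \<noteq> 0 \<Longrightarrow> inv\<^bsub>Omega\<^esub> h = inverse (h :: 'k::field univ_field)"
proof -
  assume h: "h \<noteq> 0"
  interpret O: field "Omega :: 'k univ_field ring" by (rule field_Omega)
  show ?thesis by (rule O.comm_inv_char) (use h in simp_all)
qed

lemma Omega_a_inv [simp]: "\<ominus>\<^bsub>Omega\<^esub> h = - (h :: 'k::field univ_field)"
proof -
  interpret O: field "Omega :: 'k univ_field ring" by (rule field_Omega)
  show ?thesis by (rule O.minus_equality) simp_all
qed

text \<open>Since -x = x here, these are exactly the subrings of the ambient field.\<close>

definition closed_ring :: "bit univ_field set \<Rightarrow> bool" where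
  "closed_ring C \<longleftrightarrow> 0 \<in> C \<and> 1 \<in> C \<and> (\<forall>x\<in>C. \<forall>y\<in>C. x + y \<in> C \<and> x * y \<in> C)"

lemma closed_ringD:
  assumes "closed_ring C"
  shows "0 \<in> C" "1 \<in> C" "\<And>x y. x \<in> C \<Longrightarrow> y \<in> C \<Longrightarrow> x + y \<in> C" "\<And>x y. x \<in> C \<Longrightarrow> y \<in> C \<Longrightarrow> x * y \<in> C"
    "\<And>x n. x \<in> C \<Longrightarrow> x ^ n \<in> C"
proof -
  show *: "0 \<in> C" "1 \<in> C" "\<And>x y. x \<in> C \<Longrightarrow> y \<in> C \<Longrightarrow> x + y \<in> C" "\<And>x y. x \<in> C \<Longrightarrow> y \<in> C \<Longrightarrow> x * y \<in> C"
    using assms by (auto simp: closed_ring_def)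
  show "x \<in> C \<Longrightarrow> x ^ n \<in> C" for x n by (induction n) (auto intro: *)
qed

lemma closed_ring_generate: "closed_ring (generate_ring Omega H)"
proof -
  have 1: "1 \<in> generate_ring Omega H" using generate_ring.one[of Omega H] by simp
  have add: "x + y \<in> generate_ring Omega H" if "x \<in> generate_ring Omega H" "y \<in> generate_ring Omega H" for x y
    using generate_ring.eng_add[OF that] by simp
  show ?thesis
    using 1 add[OF 1 1] add generate_ring.eng_mult[where R = Omega and H = H]
    by (auto simp: closed_ring_def)
qed

lemma closed_ring_chart: "closed_ring (chart \<xi> a)"
  unfolding chart_def by (rule closed_ring_generate)

lemma generate_ring_least:
  assumes "closed_ring C" "H \<subseteq> C" shows "generate_ring Omega H \<subseteq> C"
proof
  fix x assume "x \<in> generate_ring Omega H"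
  then show "x \<in> C"
    by (induction rule: generate_ring.induct) (use assms in \<open>auto dest: closed_ringD\<close>)
qed

lemma ring_closed_ring:
  assumes "closed_ring C" shows "cring (Omega\<lparr>carrier := C\<rparr>)"
proof -
  interpret O: field "Omega :: bit univ_field ring" by (rule field_Omega)
  have "subring C Omega"
    by (rule O.subringI) (use assms in \<open>auto dest: closed_ringD\<close>)
  then have "subcring C Omega" by (intro O.subcringI') simp_all
  then show ?thesis using O.subcring_iff by simp
qed

text \<open>Maximality in terms of elements: in characteristic two, \<open>c * a + 1 \<in> M\<close>
  says that c inverts a modulo M.\<close>

definition is_max_ideal :: "bit univ_field set \<Rightarrow> bit univ_field set \<Rightarrow> bool" where
  "is_max_ideal M C \<longleftrightarrow> M \<subseteq> C \<and> 0 \<in> M \<and> (\<forall>x\<in>M. \<forall>y\<in>M. x + y \<in> M) \<and> (\<forall>c\<in>C. \<forall>x\<in>M. c * x \<in> M) \<and>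
     1 \<notin> M \<and> (\<forall>a\<in>C - M. \<exists>c\<in>C. c * a + 1 \<in> M)"

lemma maximalideal_iff:
  assumes C: "closed_ring C"
  shows "maximalideal M (Omega\<lparr>carrier := C\<rparr>) \<longleftrightarrow> is_max_ideal M C"
proof -
  let ?C = "Omega\<lparr>carrier := C\<rparr>"
  interpret C: cring ?C by (rule ring_closed_ring[OF C])
  note CD = closed_ringD[OF C]
  have neg: "\<ominus>\<^bsub>?C\<^esub> x = x" if "x \<in> C" for x
    by (rule C.minus_equality) (use that in simp_all)
  have idealI: "ideal J ?C" if "J \<subseteq> C" "0 \<in> J" "\<forall>x\<in>J. \<forall>y\<in>J. x + y \<in> J" "\<forall>c\<in>C. \<forall>x\<in>J. c * x \<in> J" for J
  proof (rule idealI)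
    show "ring ?C" by unfold_locales
    have "inv\<^bsub>add_monoid ?C\<^esub> a \<in> J" if "a \<in> J" for a
      using neg[of a] that \<open>J \<subseteq> C\<close> by (auto simp: a_inv_def)
    then show "subgroup J (add_monoid ?C)"
      using that by (auto simp: subgroup_def)
    fix a x assume ax: "a \<in> J" "x \<in> carrier ?C"
    then show "x \<otimes>\<^bsub>?C\<^esub> a \<in> J" using that by simp
    then show "a \<otimes>\<^bsub>?C\<^esub> x \<in> J" by (simp add: mult.commute)
  qed
  show ?thesis
  proof
    assume "maximalideal M ?C"
    then interpret M: maximalideal M ?C .
    have sub: "M \<subseteq> C" using M.a_subset by simp
    have add: "\<forall>x\<in>M. \<forall>y\<in>M. x + y \<in> M" using M.a_closed by simp
    have zero: "0 \<in> M" using M.zero_closed by simp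
    have mul: "\<forall>c\<in>C. \<forall>x\<in>M. c * x \<in> M" using M.I_l_closed by simp
    have one: "1 \<notin> M"
    proof
      assume "1 \<in> M"
      then have "M = carrier ?C" by (intro M.one_imp_carrier) simp
      then show False using M.I_notcarr by blast
    qed
    have "\<exists>c\<in>C. c * a + 1 \<in> M" if a: "a \<in> C - M" for a
    proof -
      \<comment> \<open>The ideal generated by M and a. Maximality makes it all of C, and writing 1
        as c a + m gives the inverse.\<close>
      let ?J = "{c * a + m | c m. c \<in> C \<and> m \<in> M}"
      have "ideal ?J ?C"
      proof (rule idealI)
        show JC: "?J \<subseteq> C" using CD(3,4) sub a by auto
        have "0 = 0 * a + 0" by simp
        then show "0 \<in> ?J" using CD(1) zero by blast
        show "\<forall>x\<in>?J. \<forall>y\<in>?J. x + y \<in> ?J"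
        proof (intro ballI)
          fix x y assume "x \<in> ?J" "y \<in> ?J"
          then obtain c m c' m' where "x = c * a + m" "y = c' * a + m'" "c \<in> C" "c' \<in> C" "m \<in> M" "m' \<in> M" by auto
          then have "x + y = (c + c') * a + (m + m') \<and> c + c' \<in> C \<and> m + m' \<in> M"
            using CD(3) add by (simp add: algebra_simps)
          then show "x + y \<in> ?J" by blast
        qed
        show "\<forall>d\<in>C. \<forall>x\<in>?J. d * x \<in> ?J"
        proof (intro ballI)
          fix d x assume "d \<in> C" "x \<in> ?J"
          then obtain c m where "x = c * a + m" "c \<in> C" "m \<in> M" by auto
          then have "d * x = (d * c) * a + d * m \<and> d * c \<in> C \<and> d * m \<in> M"
            using CD(4) mul \<open>d \<in> C\<close> by (simp add: algebra_simps)
          then show "d * x \<in> ?J" by blast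
        qed
      qed
      moreover have MJ: "M \<subseteq> ?J"
      proof
        fix m assume "m \<in> M"
        moreover have "m = 0 * a + m" by simp
        ultimately show "m \<in> ?J" using CD(1) by blast
      qed
      moreover have "?J \<subseteq> carrier ?C" using CD(3,4) sub a by auto
      ultimately have "?J = M \<or> ?J = carrier ?C" by (rule M.I_maximal)
      moreover have "a = 1 * a + 0" by simp
      then have "a \<in> ?J" using CD(2) zero by blast
      ultimately have "?J = C" using a by auto
      then have "1 \<in> ?J" using CD(2) by simp
      then obtain c m where cm: "1 = c * a + m" "c \<in> C" "m \<in> M" by blast
      then have "c * a + 1 = m" by (metis Omega_add_cancel)
      then show ?thesis using cm by auto
    qed
    then show "is_max_ideal M C" unfolding is_max_ideal_def using sub add zero mul one by blast
  next
    assume M: "is_max_ideal M C"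
    have iM: "ideal M ?C" by (rule idealI) (use M in \<open>auto simp: is_max_ideal_def\<close>)
    show "maximalideal M ?C"
    proof (rule maximalidealI[OF iM])
      show "carrier ?C \<noteq> M" using M CD(2) by (auto simp: is_max_ideal_def)
      fix J assume J: "ideal J ?C" "M \<subseteq> J" "J \<subseteq> carrier ?C"
      interpret J: ideal J ?C by fact
      show "J = M \<or> J = carrier ?C"
      proof (rule disjCI)
        assume "J \<noteq> carrier ?C"
        have "a \<in> M" if a: "a \<in> J" for a
        proof (rule ccontr)
          assume "a \<notin> M"
          moreover have "a \<in> C" using a J by auto
          ultimately obtain c where c: "c \<in> C" "c * a + 1 \<in> M" using M unfolding is_max_ideal_def by blast
          then have "c * a + 1 \<in> J" "c * a \<in> J" using J(2) J.I_l_closed[OF a, of c] by auto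
          then have "c * a + (c * a + 1) \<in> J" using J.a_closed[of "c * a" "c * a + 1"] by simp
          then have "1 \<in> J" by simp
          then have "J = carrier ?C" by (intro J.one_imp_carrier) simp
          then show False using \<open>J \<noteq> carrier ?C\<close> by blast
        qed
        then show "J = M" using J by auto
      qed
    qed
  qed
qed

section \<open>The curve\<close>

definition xgen :: "bit univ_field" where "xgen = ofp [:0, 1:]"

text \<open>Homogeneous coordinates [1 : x : y]: the plane cubic itself, with (0 : 0 : 1) as its
  only point at infinity.\<close>

definition xi :: "bit univ_field list" where "xi = [1, xgen, ygen]"

lemma xgen_emb: "xgen = emb (ofx [:0, 1:])" and ygen_emb: "ygen = emb (Coord 0 1)"
  by (simp_all add: xgen_def emb_ofx) (simp add: emb_def)

lemma xgen_FF [simp]: "xgen \<in> FF" and ygen_FF [simp]: "ygen \<in> FF"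
  unfolding xgen_emb ygen_emb by simp_all

lemma xgen_nz [simp]: "xgen \<noteq> 0" and ygen_nz [simp]: "ygen \<noteq> 0"
  unfolding xgen_emb ygen_emb by (simp_all add: coord_eq_iff)

lemma set_xi [simp]: "set xi = {1, xgen, ygen}"
  by (simp add: xi_def)

lemma emb_in_ring:
  assumes "0 \<in> C" "1 \<in> C" "xgen \<in> C" "ygen \<in> C"
    "\<And>x y. x \<in> C \<Longrightarrow> y \<in> C \<Longrightarrow> x + y \<in> C" "\<And>x y. x \<in> C \<Longrightarrow> y \<in> C \<Longrightarrow> x * y \<in> C"
  shows "emb r \<in> C"
proof -
  have p: "ofp p \<in> C" for p
  proof (induction p)
    case (pCons c p)
    have "pCons c p = [:c:] + [:0, 1:] * p" by simp
    then have "ofp (pCons c p) = ofp [:c:] + xgen * ofp p" by (simp only: ofp_hom xgen_def)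
    moreover have "ofp [:c:] \<in> C" using assms(1,2) by (cases c) (simp_all flip: one_pCons)
    ultimately show ?case using pCons assms by simp
  qed (simp add: assms)
  show ?thesis unfolding emb_def using p assms by simp
qed

lemma function_field_xi: "function_field xi = FF"
proof (rule antisym)
  let ?H = "range kconst \<union> {b / a | a b. a \<in> set xi \<and> b \<in> set xi \<and> a \<noteq> 0}"
  let ?G = "generate_field Omega ?H"
  have H: "?H \<subseteq> FF" by auto
  show "function_field xi \<subseteq> FF"
  proof
    fix x assume "x \<in> function_field xi"
    then have "x \<in> ?G" by (simp add: function_field_def)
    then show "x \<in> FF"
      by (induction rule: generate_field.induct) (use H in auto)
  qed
  have 1: "1 \<in> ?G" using generate_field.one[of Omega ?H] by simp
  have add: "x + y \<in> ?G" if "x \<in> ?G" "y \<in> ?G" for x y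
    using generate_field.eng_add[OF that] by simp
  have mult: "x * y \<in> ?G" if "x \<in> ?G" "y \<in> ?G" for x y
    using generate_field.eng_mult[OF that] by simp
  have inv: "inverse x \<in> ?G" if "x \<in> ?G" "x \<noteq> 0" for x
    using generate_field.m_inv[of x Omega ?H] that by simp
  have xg: "xgen \<in> ?H" by (rule UnI2, rule CollectI, rule exI[of _ 1]) auto
  have yg: "ygen \<in> ?H" by (rule UnI2, rule CollectI, rule exI[of _ 1]) auto
  have emb: "emb r \<in> ?G" for r
    by (rule emb_in_ring[OF _ 1 generate_field.incl[OF xg] generate_field.incl[OF yg] add mult])
       (use add[OF 1 1] in simp)
  show "FF \<subseteq> function_field xi"
  proof
    fix f assume "f \<in> FF"
    then obtain r s where "f = emb r / emb s" "s \<noteq> 0" by (rule FF_E)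
    then have "f \<in> ?G" using emb inv[of "emb s"] mult by (simp add: divide_inverse)
    then show "f \<in> function_field xi" by (simp add: function_field_def)
  qed
qed

lemma chart_one: "chart xi 1 = range emb"
proof (rule antisym)
  have "closed_ring (range emb)"
    unfolding closed_ring_def
    by (metis emb_hom emb_mult rangeE rangeI)
  moreover have "kconst c \<in> range emb" for c by (metis emb_hom(1,2) kconst_bit rangeI)
  ultimately show "chart xi 1 \<subseteq> range emb"
    unfolding chart_def by (intro generate_ring_least) (auto simp: xgen_emb ygen_emb intro: range_eqI[of 1 emb 1])
  have gen: "b / 1 \<in> chart xi 1" if "b \<in> set xi" for b
    unfolding chart_def by (rule generate_ring.incl) (use that in blast)
  have xy: "xgen \<in> chart xi 1" "ygen \<in> chart xi 1"
    using gen[of xgen] gen[of ygen] by simp_all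
  have "emb r \<in> chart xi 1" for r
    by (rule emb_in_ring[OF closed_ringD(1,2)[OF closed_ring_chart] xy closed_ringD(3,4)[OF closed_ring_chart]])
  then show "range emb \<subseteq> chart xi 1" by auto
qed

lemma chart_subset_FF: "chart xi a \<subseteq> FF" if "a \<in> set xi"
  unfolding chart_def
  by (rule generate_ring_least) (use that in \<open>auto simp: closed_ring_def\<close>)

section \<open>Valuations\<close>

text \<open>A normalised discrete valuation of the function field with valuation ring P. Its values
  at 0 and outside \<open>FF\<close> are left open, hence the many nonvanishing conditions
  below.\<close>

definition is_val :: "bit univ_field set \<Rightarrow> (bit univ_field \<Rightarrow> int) \<Rightarrow> bool" where
  "is_val P v \<longleftrightarrow>
     (\<forall>f\<in>FF. \<forall>g\<in>FF. f \<noteq> 0 \<longrightarrow> g \<noteq> 0 \<longrightarrow> v (f * g) = v f + v g \<and> (f + g \<noteq> 0 \<longrightarrow> min (v f) (v g) \<le> v (f + g))) \<and>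
     (\<exists>t\<in>FF. t \<noteq> 0 \<and> v t = 1) \<and> P = {f \<in> FF. f = 0 \<or> 0 \<le> v f}"

locale valn =
  fixes P :: "bit univ_field set" and v :: "bit univ_field \<Rightarrow> int"
  assumes is_val: "is_val P v"
begin

lemma v_mult: "f \<in> FF \<Longrightarrow> g \<in> FF \<Longrightarrow> f \<noteq> 0 \<Longrightarrow> g \<noteq> 0 \<Longrightarrow> v (f * g) = v f + v g"
  using is_val by (simp add: is_val_def)

lemma v_add: "f \<in> FF \<Longrightarrow> g \<in> FF \<Longrightarrow> f \<noteq> 0 \<Longrightarrow> g \<noteq> 0 \<Longrightarrow> f + g \<noteq> 0 \<Longrightarrow> min (v f) (v g) \<le> v (f + g)"
  using is_val by (simp add: is_val_def)

lemma P_iff: "f \<in> P \<longleftrightarrow> f \<in> FF \<and> (f = 0 \<or> 0 \<le> v f)"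
  using is_val by (simp add: is_val_def)

lemma v_1 [simp]: "v 1 = 0"
  using v_mult[of 1 1] by simp

lemma v_inverse: "f \<in> FF \<Longrightarrow> f \<noteq> 0 \<Longrightarrow> v (inverse f) = - v f"
  using v_mult[of f "inverse f"] by simp

lemma v_divide: "f \<in> FF \<Longrightarrow> g \<in> FF \<Longrightarrow> f \<noteq> 0 \<Longrightarrow> g \<noteq> 0 \<Longrightarrow> v (f / g) = v f - v g"
  using v_mult[of f "inverse g"] v_inverse[of g] by (simp add: divide_inverse)

lemma v_power: "f \<in> FF \<Longrightarrow> f \<noteq> 0 \<Longrightarrow> v (f ^ n) = int n * v f"
  by (induction n) (simp_all add: v_mult algebra_simps)

lemma v_powi: "f \<in> FF \<Longrightarrow> f \<noteq> 0 \<Longrightarrow> v (f powi n) = n * v f"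
  by (cases n rule: int_cases2) (simp_all add: v_power power_int_minus v_inverse)

lemma closed_ring_P: "closed_ring P"
  unfolding closed_ring_def
proof (intro conjI ballI)
  fix f g assume fg: "f \<in> P" "g \<in> P"
  show "f + g \<in> P" using fg v_add[of f g] by (cases "f = 0"; cases "g = 0"; cases "f = g") (auto simp: P_iff)
  show "f * g \<in> P" using fg v_mult[of f g] by (cases "f = 0"; cases "g = 0") (auto simp: P_iff)
qed (auto simp: P_iff)

lemma ex_unif: obtains t where "t \<in> FF" "t \<noteq> 0" "v t = 1"
  using is_val by (auto simp: is_val_def)

text \<open>An element of value one is a unit times a power of t, so the value of t divides one.
  This connects the uniformizers in the definition of a curve with valuations.\<close>

lemma uniformizer_iff: "uniformizer P t \<longleftrightarrow> t \<in> FF \<and> t \<noteq> 0 \<and> v t = 1"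
proof
  assume t: "uniformizer P t"
  then have t1: "t \<in> FF" "t \<noteq> 0" by (auto simp: uniformizer_def P_iff)
  obtain s where s: "s \<in> FF" "s \<noteq> 0" "v s = 1" by (rule ex_unif)
  then have "s \<in> P" by (simp add: P_iff)
  with t s obtain n u where u: "u \<in> P" "u \<noteq> 0" "inverse u \<in> P" "s = u * t ^ n"
    unfolding uniformizer_def by blast
  then have "v u = 0" using v_inverse[of u] by (auto simp: P_iff)
  then have "1 = int n * v t" using s u t1 v_mult[of u "t ^ n"] v_power[of t n] by (auto simp: P_iff)
  then have "v t = 1 \<or> v t = -1" by (metis zmult_eq_1_iff mult.commute)
  moreover have "v t \<ge> 0" using t t1 by (auto simp: uniformizer_def P_iff)
  ultimately show "t \<in> FF \<and> t \<noteq> 0 \<and> v t = 1" using t1 by auto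
next
  assume t: "t \<in> FF \<and> t \<noteq> 0 \<and> v t = 1"
  show "uniformizer P t"
    unfolding uniformizer_def
  proof (intro conjI ballI impI)
    show "t \<in> P" "t \<noteq> 0" "inverse t \<notin> P" using t v_inverse[of t] by (auto simp: P_iff)
    fix x assume x: "x \<in> P" "x \<noteq> 0"
    let ?n = "nat (v x)" and ?u = "x / t ^ nat (v x)"
    have v: "v ?u = 0" using x t v_divide[of x "t ^ ?n"] v_power[of t ?n] by (auto simp: P_iff)
    show "\<exists>n u. u \<in> P \<and> u \<noteq> 0 \<and> inverse u \<in> P \<and> x = u * t ^ n"
      by (rule exI[of _ ?n], rule exI[of _ ?u]) (use x t v v_inverse[of ?u] in \<open>auto simp: P_iff\<close>)
  qed
qed

lemma max_power_eq: "max_power P n = {f \<in> FF. f = 0 \<or> n \<le> v f}"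
proof (rule antisym)
  show "max_power P n \<subseteq> {f \<in> FF. f = 0 \<or> n \<le> v f}"
  proof
    fix f assume "f \<in> max_power P n"
    then obtain t a where "f = t powi n * a" "uniformizer P t" "a \<in> P" by (auto simp: max_power_def)
    then show "f \<in> {f \<in> FF. f = 0 \<or> n \<le> v f}"
      using v_mult[of "t powi n" a] v_powi[of t n]
      by (cases "a = 0") (auto simp: uniformizer_iff P_iff)
  qed
  show "{f \<in> FF. f = 0 \<or> n \<le> v f} \<subseteq> max_power P n"
  proof
    fix f assume f: "f \<in> {f \<in> FF. f = 0 \<or> n \<le> v f}"
    obtain t where t: "t \<in> FF" "t \<noteq> 0" "v t = 1" by (rule ex_unif)
    have "f / t powi n \<in> P"
      using f t v_divide[of f "t powi n"] v_powi[of t n] by (cases "f = 0") (auto simp: P_iff)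
    moreover have "f = t powi n * (f / t powi n)" "uniformizer P t" using t by (simp_all add: uniformizer_iff)
    ultimately show "f \<in> max_power P n" unfolding max_power_def by blast
  qed
qed

text \<open>A discrete valuation ring is maximal among proper subrings of its field: if L contained
  an f with a pole, then \<open>inverse t / f\<close> would lie in P and hence
  \<open>inverse t\<close> in L. Localizations are identified with valuation rings in this way, from
  one inclusion and one non-unit.\<close>

lemma maximal_subring:
  assumes L: "closed_ring L" "L \<subseteq> FF" "P \<subseteq> L" and t: "t \<in> FF" "t \<noteq> 0" "v t = 1" "inverse t \<notin> L"
  shows "L = P"
proof (rule ccontr)
  assume "L \<noteq> P"
  then obtain f where f: "f \<in> L" "f \<notin> P" using L by auto
  then have f': "f \<in> FF" "f \<noteq> 0" "v f < 0" using L by (auto simp: P_iff)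
  have "inverse t / f \<in> P" using t f' v_divide[of "inverse t" f] v_inverse[of t] by (simp add: P_iff)
  then have "f * (inverse t / f) \<in> L" using L(3) f by (intro closed_ringD(4)[OF L(1)]) auto
  then show False using t f' by simp
qed

end

text \<open>The powers of the maximal ideal are determined by P alone, and the value of f is the
  last power that contains it.\<close>

lemma is_val_unique:
  assumes "is_val P v" "is_val P w" "f \<in> FF" "f \<noteq> 0"
  shows "v f = w f"
proof -
  interpret v: valn P v by (unfold_locales) fact
  interpret w: valn P w by (unfold_locales) fact
  have "n \<le> v f \<longleftrightarrow> n \<le> w f" for n
    using v.max_power_eq[of n] w.max_power_eq[of n] assms by auto
  then show ?thesis by (meson order_antisym order_refl)
qed

text \<open>By \<open>is_val_unique\<close> the choice does not affect the values at nonzero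
  elements of \<open>FF\<close>.\<close>

definition ordv :: "bit univ_field set \<Rightarrow> bit univ_field \<Rightarrow> int" where
  "ordv P = (SOME v. is_val P v)"

definition is_place :: "bit univ_field set \<Rightarrow> bool" where
  "is_place P \<longleftrightarrow> (\<exists>v. is_val P v)"

locale place =
  fixes P :: "bit univ_field set"
  assumes is_place: "is_place P"

sublocale place \<subseteq> valn P "ordv P"
proof unfold_locales
  show "is_val P (ordv P)"
    using is_place unfolding is_place_def ordv_def by (rule someI_ex)
qed

lemma placeI: "is_val P v \<Longrightarrow> is_place P"
  by (auto simp: is_place_def)

lemma ordv_eq: "is_val P v \<Longrightarrow> f \<in> FF \<Longrightarrow> f \<noteq> 0 \<Longrightarrow> ordv P f = v f"
  by (rule is_val_unique[of P]) (auto simp: ordv_def intro: someI[of "is_val P"])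

section \<open>Finite spaces over the field with two elements\<close>

lemma UNIV_bit: "UNIV = {0, 1 :: bit}"
  by auto

lemma card_bit [simp]: "CARD(bit) = 2"
  by (simp add: UNIV_bit)

text \<open>Coefficient functions on a basis B correspond to vectors, so a finite space over F_2 has
  2^|B| elements. This turns the later dimension counts into counts of elements.\<close>

lemma finite_subspace_basis:
  fixes scale :: "bit \<Rightarrow> 'v::ab_group_add \<Rightarrow> 'v"
  assumes vs: "vector_space scale" and sub: "module.subspace scale V" and fin: "finite V"
  obtains B where "B \<subseteq> V" "finite B" "card V = 2 ^ card B" "card B = vector_space.dim scale V"
    "\<And>x. x \<in> V \<Longrightarrow> \<exists>f. x = (\<Sum>b\<in>B. scale (f b) b)"
    "\<And>f. (\<Sum>b\<in>B. scale (f b) b) = 0 \<Longrightarrow> \<forall>b\<in>B. f b = 0"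
    "\<not> module.dependent scale B"
proof -
  interpret vector_space scale by fact
  obtain B where B: "B \<subseteq> V" "independent B" "V \<subseteq> span B" "card B = dim V" by (rule basis_exists)
  have finB: "finite B" using B(1) fin by (rule finite_subset)
  have sp: "span B = V" using span_mono[OF B(1)] span_eq_iff[of V] sub B(3) by (metis subset_antisym)
  define F where "F f = (\<Sum>b\<in>B. scale (f b) b)" for f
  have ind: "\<forall>b\<in>B. f b = 0" if "F f = 0" for f
    using independentD[OF B(2) finB subset_refl] that by (auto simp: F_def)
  have im: "F ` (B \<rightarrow>\<^sub>E UNIV) = V"
  proof -
    have "F f \<in> F ` (B \<rightarrow>\<^sub>E UNIV)" for f
    proof (rule image_eqI)
      show "F f = F (restrict f B)" unfolding F_def by (intro sum.cong) auto
    qed simp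
    then have "range F \<subseteq> F ` (B \<rightarrow>\<^sub>E UNIV)" by blast
    moreover have "V = range F" using span_finite[OF finB] sp by (simp add: F_def)
    ultimately show ?thesis by auto
  qed
  have "inj_on F (B \<rightarrow>\<^sub>E UNIV)"
  proof (rule inj_onI)
    fix f g assume fg: "f \<in> B \<rightarrow>\<^sub>E UNIV" "g \<in> B \<rightarrow>\<^sub>E UNIV" "F f = F g"
    have "F (\<lambda>b. f b - g b) = F f - F g"
      by (simp only: F_def scale_left_diff_distrib sum_subtractf)
    then have "F (\<lambda>b. f b - g b) = 0" using fg by simp
    then have "\<forall>b\<in>B. f b - g b = 0" by (rule ind)
    then have "\<forall>b\<in>B. f b = g b" by (metis eq_iff_diff_eq_0)
    then show "f = g" using fg by (intro PiE_ext) auto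
  qed
  then have "card V = card (B \<rightarrow>\<^sub>E (UNIV :: bit set))" using im card_image by metis
  also have "\<dots> = 2 ^ card B" using finB by (simp add: card_PiE)
  finally have "card V = 2 ^ card B" .
  moreover have "\<exists>f. x = (\<Sum>b\<in>B. scale (f b) b)" if "x \<in> V" for x
    using that im by (auto simp: F_def)
  ultimately show ?thesis using that[of B] B finB ind by (auto simp: F_def)
qed

lemma card_subspace:
  fixes scale :: "bit \<Rightarrow> 'v::ab_group_add \<Rightarrow> 'v"
  assumes "vector_space scale" "module.subspace scale V" "finite V"
  shows "card V = 2 ^ vector_space.dim scale V"
  by (rule finite_subspace_basis[OF assms]) simp

lemma kspace_subspaceI:
  assumes "0 \<in> V" "\<And>x y. x \<in> V \<Longrightarrow> y \<in> V \<Longrightarrow> x + y \<in> V"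
  shows "kspace.subspace (V :: bit univ_field set)"
  using assms by (auto simp: kspace.subspace_def kscale_bit)

definition acscale :: "bit \<Rightarrow> bit alg_closure \<Rightarrow> bit alg_closure" where
  "acscale c x = to_ac c * x"

lemma acscale_bit: "acscale c x = (if c = 0 then 0 else x)"
  by (cases c) (simp_all add: acscale_def)

interpretation acspace: vector_space acscale
  by unfold_locales (simp_all add: acscale_def algebra_simps)

lemma acspace_subspaceI:
  assumes "0 \<in> V" "\<And>x y. x \<in> V \<Longrightarrow> y \<in> V \<Longrightarrow> x + y \<in> V"
  shows "acspace.subspace V"
  using assms by (auto simp: acspace.subspace_def acscale_bit)

section \<open>Finite fields of characteristic two\<close>

lemma Fqn_bit: "(Fqn n :: bit alg_closure set) = {x. x ^ (2 ^ n) = x}"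
  by (simp add: Fqn_def)

lemma Fqn_0 [simp]: "0 \<in> (Fqn n :: bit alg_closure set)" and Fqn_1 [simp]: "1 \<in> (Fqn n :: bit alg_closure set)"
  by (simp_all add: Fqn_bit)

lemma Fqn_add [simp]: "x \<in> Fqn n \<Longrightarrow> y \<in> Fqn n \<Longrightarrow> x + y \<in> (Fqn n :: bit alg_closure set)"
  by (simp add: Fqn_bit ac_sum_pow2)

lemma Fqn_mult [simp]: "x \<in> Fqn n \<Longrightarrow> y \<in> Fqn n \<Longrightarrow> x * y \<in> (Fqn n :: bit alg_closure set)"
  by (simp add: Fqn_bit power_mult_distrib)

lemma Fqn_power [simp]: "x \<in> Fqn n \<Longrightarrow> x ^ k \<in> (Fqn n :: bit alg_closure set)"
  by (induction k) simp_all

text \<open>The polynomial X^(2^n) + X has derivative 1, so all its roots are simple, and over an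
  algebraically closed field it has as many roots as its degree.\<close>

lemma finite_card_Fqn:
  assumes "n > 0"
  shows "finite (Fqn n :: bit alg_closure set) \<and> card (Fqn n :: bit alg_closure set) = 2 ^ n"
proof -
  define q :: "bit alg_closure poly" where "q = Polynomial.monom 1 (2 ^ n) + Polynomial.monom 1 1"
  have n2: "(2::nat) ^ n > 1" using assms by (rule one_less_power[rotated]) simp
  have deg: "Polynomial.degree q = 2 ^ n"
    unfolding q_def using n2 by (subst degree_add_eq_left) (auto simp: Polynomial.degree_monom_eq)
  then have q0: "q \<noteq> 0" by auto
  have roots: "{x. poly q x = 0} = Fqn n"
    by (auto simp: q_def Fqn_bit poly_monom)
  have "(of_nat (2 ^ n) :: bit alg_closure) = 0" using assms by simp
  then have pd: "pderiv q = [:1:]"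
    by (simp add: q_def pderiv_add pderiv_monom Polynomial.monom_0)
  have ord: "order a q \<le> 1" for a
  proof (rule ccontr)
    assume "\<not> order a q \<le> 1"
    then have "[:-a, 1:] ^ 2 dvd q" using q0 by (subst order_divides) auto
    then obtain h where "q = [:-a, 1:] ^ 2 * h" by (rule dvdE)
    then have "q = [:-a, 1:] * ([:-a, 1:] * h)" by (simp only: power2_eq_square mult.assoc)
    then have "poly (pderiv q) a = 0" by (simp only: pderiv_mult poly_add poly_mult) simp
    then show False by (simp add: pd)
  qed
  obtain A where A: "size A = Polynomial.degree q" "q = smult (Polynomial.lead_coeff q) (\<Prod>x\<in>#A. [:-x, 1:])"
    using alg_closed_imp_factorization[OF q0] by blast
  have lc: "Polynomial.lead_coeff q \<noteq> 0" using q0 by simp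
  have set: "set_mset A = {x. poly q x = 0}"
  proof -
    have "poly q x = 0 \<longleftrightarrow> x \<in># A" for x
    proof -
      have "poly (\<Prod>y\<in>#A. [:-y, 1:]) x = 0 \<longleftrightarrow> x \<in># A"
        by (induction A) auto
      then show ?thesis by (subst A(2)) (use lc in simp)
    qed
    then show ?thesis by auto
  qed
  have "count A x \<le> 1" for x
  proof -
    have "[:-x, 1:] ^ count A x dvd (\<Prod>y\<in>#A. [:-y, 1:])"
    proof -
      have "(\<Prod>y\<in>#replicate_mset (count A x) x. [:-y, 1:]) dvd (\<Prod>y\<in>#A. [:-y, 1:])"
        by (intro prod_mset_subset_imp_dvd image_mset_subseteq_mono) (simp flip: count_le_replicate_mset_subset_eq)
      then show ?thesis by simp
    qed
    then have "[:-x, 1:] ^ count A x dvd q" by (subst A(2)) (rule dvd_smult)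
    then have "count A x \<le> order x q" using q0 by (simp only: order_divides simp_thms)
    then show ?thesis using ord[of x] by simp
  qed
  then have "count A x = count (mset_set (set_mset A)) x" for x
    by (cases "x \<in># A") (auto simp: count_mset_set' not_in_iff Suc_le_eq intro!: le_antisym)
  then have "A = mset_set (set_mset A)"
    by (rule multiset_eqI)
  then have "size A = card (set_mset A)" by (metis size_mset_set)
  then show ?thesis using A(1) deg set roots by (metis finite_set_mset)
qed

lemma pow2_compose: "(x :: 'a::monoid_mult) ^ (2 ^ (m + k)) = (x ^ (2 ^ m)) ^ (2 ^ k)"
  by (simp add: power_add flip: power_mult)

lemma Fqn_iter: "x \<in> (Fqn m :: bit alg_closure set) \<Longrightarrow> x \<in> Fqn (m * k)"
  by (induction k) (simp_all add: Fqn_bit pow2_compose)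

lemma Fqn_mod:
  assumes "x \<in> (Fqn m :: bit alg_closure set)" "x \<in> Fqn n" shows "x \<in> Fqn (n mod m)"
proof -
  have "x = x ^ (2 ^ n)" using assms by (simp add: Fqn_bit)
  also have "\<dots> = (x ^ (2 ^ (m * (n div m)))) ^ (2 ^ (n mod m))"
    by (simp flip: pow2_compose)
  also have "x ^ (2 ^ (m * (n div m))) = x"
    using Fqn_iter[OF assms(1), of "n div m"] by (simp add: Fqn_bit)
  finally show ?thesis by (simp add: Fqn_bit)
qed

text \<open>Euclid's algorithm on the exponents of Frobenius.\<close>

lemma Fqn_gcd: "x \<in> (Fqn m :: bit alg_closure set) \<Longrightarrow> x \<in> Fqn n \<Longrightarrow> x \<in> Fqn (gcd m n)"
proof (induction m n rule: gcd_nat_induct)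
  case (step m n)
  then show ?case using Fqn_mod[of x n m] by (metis gcd_red_nat)
qed simp

text \<open>Multiplication by a nonzero a permutes the nonzero elements of S; comparing their
  products gives a^(|S| - 1) = 1, as in Fermat's theorem. As an F_2-space S has 2^m elements, so it
  fills \<open>Fqn m\<close>. Residue fields are later recognised by this count.\<close>

lemma finite_subring_Fqn:
  fixes S :: "bit alg_closure set"
  assumes fin: "finite S" and 01: "0 \<in> S" "1 \<in> S"
    and add: "\<And>x y. x \<in> S \<Longrightarrow> y \<in> S \<Longrightarrow> x + y \<in> S" and mult: "\<And>x y. x \<in> S \<Longrightarrow> y \<in> S \<Longrightarrow> x * y \<in> S"
  obtains m where "m > 0" "S = Fqn m" "card S = 2 ^ m"
proof -
  define m where "m = acspace.dim S"
  have card: "card S = 2 ^ m"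
    unfolding m_def by (rule card_subspace[OF acspace.vector_space_axioms acspace_subspaceI[OF 01(1) add] fin])
  have "card {0, 1 :: bit alg_closure} \<le> card S" using 01 fin by (intro card_mono) auto
  then have m0: "m > 0" using card by (cases m) auto
  have "a ^ (2 ^ m) = a" if a: "a \<in> S" for a
  proof (cases "a = 0")
    case False
    let ?T = "S - {0}"
    have "inj_on ((*) a) ?T" using False by (auto intro: inj_onI)
    moreover have "(*) a ` ?T \<subseteq> ?T" using a False mult by auto
    ultimately have im: "(*) a ` ?T = ?T" using fin by (intro endo_inj_surj) auto
    have "\<Prod>?T = (\<Prod>x\<in>?T. a * x)"
      using prod.reindex[OF \<open>inj_on ((*) a) ?T\<close>, of "\<lambda>x. x"] im by simp
    also have "\<dots> = a ^ card ?T * \<Prod>?T" by (simp add: prod.distrib)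
    finally have "a ^ card ?T = 1" using fin by simp
    moreover have "card ?T = 2 ^ m - 1" using 01 fin card by simp
    ultimately have "a * a ^ (2 ^ m - 1) = a" by simp
    moreover have "(2 :: nat) ^ m = Suc (2 ^ m - 1)" by simp
    ultimately show ?thesis by (metis power_Suc)
  qed simp
  then have "S \<subseteq> Fqn m" by (auto simp: Fqn_bit)
  then have "S = Fqn m"
    using finite_card_Fqn[OF m0] card by (intro card_subset_eq) auto
  then show ?thesis using that m0 card by blast
qed

section \<open>Evaluation at geometric points\<close>

definition evp :: "bit poly \<Rightarrow> bit alg_closure \<Rightarrow> bit alg_closure" where
  "evp p a = poly (map_poly to_ac p) a"

lemma evp_0 [simp]: "evp 0 a = 0"
  by (simp add: evp_def)

lemma evp_pCons [simp]: "evp (pCons c p) a = to_ac c + a * evp p a"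
  by (simp add: evp_def map_poly_pCons)

lemma evp_1 [simp]: "evp 1 a = 1"
  by (simp add: evp_def)

lemma evp_add [simp]: "evp (p + q) a = evp p a + evp q a"
  by (induction p q rule: poly_induct2) (simp_all add: algebra_simps)

lemma evp_smult [simp]: "evp (smult c p) a = to_ac c * evp p a"
  by (cases c) simp_all

lemma evp_mult [simp]: "evp (p * q) a = evp p a * evp q a"
  by (induction p) (simp_all add: algebra_simps)

lemma ac_root_exists: "\<exists>p. p \<noteq> 0 \<and> evp p a = 0"
  using alg_closure_algebraic[of a] by (metis evp_def)

definition mp :: "bit alg_closure \<Rightarrow> bit poly" where
  "mp a = (ARG_MIN Polynomial.degree p. p \<noteq> 0 \<and> evp p a = 0)"

lemma mp_props: "mp a \<noteq> 0 \<and> evp (mp a) a = 0"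
  and mp_least: "p \<noteq> 0 \<Longrightarrow> evp p a = 0 \<Longrightarrow> Polynomial.degree (mp a) \<le> Polynomial.degree p"
proof -
  obtain p where "p \<noteq> 0 \<and> evp p a = 0" using ac_root_exists by blast
  then show "mp a \<noteq> 0 \<and> evp (mp a) a = 0" unfolding mp_def by (rule arg_min_natI)
  show "p \<noteq> 0 \<Longrightarrow> evp p a = 0 \<Longrightarrow> Polynomial.degree (mp a) \<le> Polynomial.degree p" for p
    unfolding mp_def by (rule arg_min_nat_le) simp
qed

lemma mp_nz [simp]: "mp a \<noteq> 0" and evp_mp [simp]: "evp (mp a) a = 0"
  using mp_props by auto

lemma mp_dvd_iff: "evp q a = 0 \<longleftrightarrow> mp a dvd q"
proof
  assume q: "evp q a = 0"
  have "q = q div mp a * mp a + q mod mp a" by simp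
  then have "evp q a = evp (q div mp a) a * evp (mp a) a + evp (q mod mp a) a" by (metis evp_add evp_mult)
  then have "evp (q mod mp a) a = 0" using q by simp
  then have "q mod mp a = 0"
    using mp_least[of "q mod mp a" a] degree_mod_less[OF mp_nz, of q a] by fastforce
  then show "mp a dvd q" by (simp add: mod_eq_0_iff_dvd)
qed (auto elim: dvdE)

lemma degree_mp_pos: "Polynomial.degree (mp a) > 0"
proof (rule ccontr)
  assume "\<not> ?thesis"
  then obtain c where "mp a = [:c:]" by (meson degree_eq_zeroE neq0_conv)
  moreover have "c \<noteq> 0" using mp_nz[of a] calculation by auto
  ultimately show False using evp_mp[of a] by simp
qed

lemma bit_poly_unit: "Polynomial.degree (p :: bit poly) = 0 \<Longrightarrow> p \<noteq> 0 \<Longrightarrow> p = 1"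
proof -
  assume "Polynomial.degree p = 0" "p \<noteq> 0"
  then obtain c where "p = [:c:]" "c \<noteq> 0" by (metis degree_eq_zeroE pCons_0_0)
  then show "p = 1" by (simp add: one_pCons)
qed

lemma mp_eqI:
  assumes "evp (mp a) b = 0" shows "mp b = mp a"
proof -
  have "mp b dvd mp a" using assms by (simp add: mp_dvd_iff)
  then obtain h where h: "mp a = mp b * h" by (rule dvdE)
  then have nz: "h \<noteq> 0" using mp_nz[of a] by auto
  have deg: "Polynomial.degree (mp a) = Polynomial.degree (mp b) + Polynomial.degree h"
    unfolding h using nz by (simp add: degree_mult_eq)
  have "evp (mp b) a * evp h a = 0" using evp_mp[of a] by (metis h evp_mult)
  moreover have "evp h a \<noteq> 0" using mp_least[of h a] nz deg degree_mp_pos[of b] by auto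
  ultimately have "evp (mp b) a = 0" by simp
  then have "Polynomial.degree h = 0" using mp_least[of "mp b" a] deg by simp
  then show ?thesis using h bit_poly_unit[OF _ nz] by simp
qed

lemma mp_factor:
  assumes "q \<noteq> 0"
  obtains k q' where "q = mp a ^ k * q'" "evp q' a \<noteq> 0"
  using assms
proof (induction "Polynomial.degree q" arbitrary: q thesis rule: less_induct)
  case less
  show ?case
  proof (cases "evp q a = 0")
    case False
    then show ?thesis using less(2)[of 0 q] by simp
  next
    case True
    then obtain h where h: "q = mp a * h" using mp_dvd_iff by (auto elim: dvdE)
    then have hnz: "h \<noteq> 0" using less by auto
    then have "Polynomial.degree h < Polynomial.degree q"
      using degree_mp_pos[of a] by (simp add: h degree_mult_eq)
    from less(1)[OF this _ hnz] obtain k q' where "h = mp a ^ k * q'" "evp q' a \<noteq> 0" by blast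
    then show ?thesis using less(2)[of "Suc k" q'] h by (simp add: mult_ac)
  qed
qed

text \<open>A point with coordinates in the algebraic closure of F_2. Closed points are Frobenius
  orbits of these, so different geometric points can define the same local ring.\<close>

type_synonym gpoint = "bit alg_closure \<times> bit alg_closure"

definition on_curve :: "gpoint \<Rightarrow> bool" where
  "on_curve z \<longleftrightarrow> snd z ^ 2 = snd z + evp cubic (fst z)"

definition ev :: "gpoint \<Rightarrow> coord \<Rightarrow> bit alg_closure" where
  "ev z r = evp (cst r) (fst z) + evp (lin r) (fst z) * snd z"

definition conjp :: "gpoint \<Rightarrow> gpoint" where "conjp z = (fst z, snd z + 1)"

lemma conjp_simps [simp]: "fst (conjp z) = fst z" "snd (conjp z) = snd z + 1" "conjp (conjp z) = z"
  by (simp_all add: conjp_def add.assoc prod_eq_iff)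

lemma on_curve_conjp [simp]: "on_curve (conjp z) \<longleftrightarrow> on_curve z"
  by (simp add: on_curve_def ac_sum_sq algebra_simps)

lemma ev_simps [simp]: "ev z 0 = 0" "ev z 1 = 1" "ev z (r + s) = ev z r + ev z s" "ev z (ofx p) = evp p (fst z)"
  by (simp_all add: ev_def algebra_simps)

lemma ev_conj: "ev z (conj r) = ev (conjp z) r"
  by (simp add: ev_def algebra_simps)

lemma ev_conjp: "ev (conjp z) r = ev z r + evp (lin r) (fst z)"
  by (simp add: ev_def algebra_simps)

lemma ev_mult [simp]: "on_curve z \<Longrightarrow> ev z (r * s) = ev z r * ev z s"
proof -
  assume "on_curve z"
  then have *: "snd z ^ 2 = snd z + evp cubic (fst z)" by (simp add: on_curve_def)
  let ?e = "\<lambda>p. evp p (fst z)"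
  have "ev z r * ev z s = ?e (cst r) * ?e (cst s) + (?e (cst r) * ?e (lin s) + ?e (lin r) * ?e (cst s)) * snd z
     + ?e (lin r) * ?e (lin s) * snd z ^ 2"
    by (simp add: ev_def algebra_simps power2_eq_square)
  then show ?thesis unfolding * by (simp add: ev_def algebra_simps)
qed

lemma ev_power [simp]: "on_curve z \<Longrightarrow> ev z (r ^ n) = ev z r ^ n"
  by (induction n) simp_all

lemma evp_nrm: "on_curve z \<Longrightarrow> evp (nrm r) (fst z) = ev z r * ev (conjp z) r"
proof -
  assume "on_curve z"
  then have "ev z (r * conj r) = ev z r * ev (conjp z) r" by (simp add: ev_conj)
  then show ?thesis by (simp only: mult_conj ev_simps)
qed

lemma lift_point: obtains b where "on_curve (a, b)"
proof -
  have "\<exists>y. poly [: evp cubic a, 1, 1 :] y = 0"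
    by (rule alg_closed_imp_poly_has_root) simp
  then obtain y where "poly [: evp cubic a, 1, 1 :] y = 0" ..
  then have "evp cubic a + (y + y^2) = 0"
    by (simp add: algebra_simps power2_eq_square)
  then have "evp cubic a = y + y^2" by (simp only: ac_add_eq_0)
  then have "y^2 = y + evp cubic a" by simp
  then show ?thesis using that[of y] by (simp add: on_curve_def)
qed

section \<open>The local ring at a geometric point\<close>

definition Pt :: "gpoint \<Rightarrow> bit univ_field set" where
  "Pt z = {emb r / emb s | r s. ev z s \<noteq> 0}"

definition Mz :: "gpoint \<Rightarrow> coord set" where "Mz z = {r. ev z r = 0}"

text \<open>A ring homomorphism of the local ring onto F_(2^n) inside the fixed algebraic closure,
  with the maximal ideal as kernel; n will be the degree of the point.\<close>

definition is_res :: "bit univ_field set \<Rightarrow> nat \<Rightarrow> (bit univ_field \<Rightarrow> bit alg_closure) \<Rightarrow> bool" where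
  "is_res P n \<rho> \<longleftrightarrow> n > 0 \<and> \<rho> 1 = 1 \<and> \<rho> ` P = Fqn n \<and>
     (\<forall>f\<in>P. \<forall>g\<in>P. \<rho> (f + g) = \<rho> f + \<rho> g \<and> \<rho> (f * g) = \<rho> f * \<rho> g) \<and>
     (\<forall>f\<in>P. \<rho> f = 0 \<longleftrightarrow> f = 0 \<or> 1 \<le> ordv P f)"

locale gpt =
  fixes z :: gpoint
  assumes oc: "on_curve z"
begin

abbreviation "e \<equiv> ev z"
abbreviation "p \<equiv> mp (fst z)"

lemma e_mult: "e (r * s) = e r * e s"
  using oc by simp

definition unit :: "bit univ_field \<Rightarrow> bool" where
  "unit u \<longleftrightarrow> (\<exists>r s. e r \<noteq> 0 \<and> e s \<noteq> 0 \<and> u = emb r / emb s)"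

lemma nz: "e r \<noteq> 0 \<Longrightarrow> r \<noteq> 0"
  by auto

lemma unit_nz: "unit u \<Longrightarrow> u \<noteq> 0 \<and> u \<in> FF"
  by (auto simp: unit_def dest!: nz intro: FF_I)

lemma unit_I: "e r \<noteq> 0 \<Longrightarrow> e s \<noteq> 0 \<Longrightarrow> unit (emb r / emb s)"
  by (auto simp: unit_def)

lemma unit_E: assumes "unit u" obtains r s where "e r \<noteq> 0" "e s \<noteq> 0" "u = emb r / emb s"
  using assms by (auto simp: unit_def)

lemma unit_mult: assumes "unit u" "unit w" shows "unit (u * w)"
proof -
  obtain r s where 1: "e r \<noteq> 0" "e s \<noteq> 0" "u = emb r / emb s" using assms(1) by (rule unit_E)
  obtain r' s' where 2: "e r' \<noteq> 0" "e s' \<noteq> 0" "w = emb r' / emb s'" using assms(2) by (rule unit_E)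
  show ?thesis using unit_I[of "r * r'" "s * s'"] 1 2 by (simp add: e_mult)
qed

lemma unit_inverse: assumes "unit u" shows "unit (inverse u)"
proof -
  obtain r s where "e r \<noteq> 0" "e s \<noteq> 0" "u = emb r / emb s" using assms by (rule unit_E)
  then show ?thesis using unit_I[of s r] by simp
qed

lemma unit_emb: "e r \<noteq> 0 \<Longrightarrow> unit (emb r)"
  unfolding unit_def by (rule exI[of _ r], rule exI[of _ 1]) simp

text \<open>The minimal polynomial p of the x-coordinate is a uniformizer. If r vanishes at z but
  its conjugate does not, then r times a unit is its norm, a polynomial in x. If both vanish, the
  values of r at z and its conjugate, which differ by that of \<open>lin r\<close>, show that both
  coefficients vanish at x, and p divides r; \<open>dg\<close> then decreases.\<close>

lemma coord_factor:
  assumes "r \<noteq> 0"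
  shows "\<exists>n s r'. e s \<noteq> 0 \<and> e r' \<noteq> 0 \<and> s * r = ofx p ^ n * r'"
  using assms
proof (induction "dg r" arbitrary: r rule: less_induct)
  case less
  consider "e r \<noteq> 0" | "e r = 0" "evp (lin r) (fst z) \<noteq> 0" | "e r = 0" "evp (lin r) (fst z) = 0" by blast
  then show ?case
  proof cases
    case 1
    then show ?thesis by (intro exI[of _ 0] exI[of _ 1] exI[of _ r]) simp
  next
    case 2
    then have c: "e (conj r) \<noteq> 0" by (simp add: ev_conj ev_conjp)
    obtain k q where "nrm r = p ^ k * q" "evp q (fst z) \<noteq> 0"
      using mp_factor[of "nrm r" "fst z"] less(2) by auto
    then have "conj r * r = ofx p ^ k * ofx q" "e (ofx q) \<noteq> 0"
      by (simp_all add: mult.commute[of "conj r"] mult_conj)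
    then show ?thesis using c by blast
  next
    case 3
    then have "evp (cst r) (fst z) = 0" by (simp add: ev_def)
    then obtain a b where ab: "cst r = p * a" "lin r = p * b" using 3 by (auto simp: mp_dvd_iff elim!: dvdE)
    define r1 where "r1 = Coord a b"
    have r: "r = ofx p * r1" by (simp add: coord_eq_iff r1_def ab)
    then have r1: "r1 \<noteq> 0" using less by auto
    have "dg r1 < dg r" unfolding r using r1 degree_mp_pos by (simp add: dg_mult)
    from less(1)[OF this r1] obtain n s r' where "e s \<noteq> 0" "e r' \<noteq> 0" "s * r1 = ofx p ^ n * r'" by blast
    then show ?thesis unfolding r
      by (intro exI[of _ "Suc n"] exI[of _ s] exI[of _ r']) (simp add: mult_ac)
  qed
qed

lemma emb_factor:
  assumes "r \<noteq> 0"
  shows "\<exists>n u. unit u \<and> emb r = ofp p ^ n * u"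
proof -
  obtain n s r' where *: "e s \<noteq> 0" "e r' \<noteq> 0" "s * r = ofx p ^ n * r'" using coord_factor[OF assms] by blast
  then have "emb s * emb r = ofp p ^ n * emb r'" by (metis emb_mult emb_ofx emb_power)
  moreover have "emb s \<noteq> 0" using *(1) nz by simp
  ultimately have "emb r = ofp p ^ n * (emb r' / emb s)" by (simp add: field_simps)
  moreover have "unit (emb r' / emb s)" using * by (auto simp: unit_def)
  ultimately show ?thesis by blast
qed

lemma ofp_p_nz: "ofp p \<noteq> 0"
  by simp

lemma FF_factor:
  assumes "f \<in> FF" "f \<noteq> 0"
  shows "\<exists>(n::int) u. unit u \<and> f = ofp p powi n * u"
proof -
  from FF_nz_E[OF assms] obtain r s where f: "f = emb r / emb s" "s \<noteq> 0" "r \<noteq> 0" .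
  obtain n u where 1: "unit u" "emb r = ofp p ^ n * u" using emb_factor[OF f(3)] by blast
  obtain m w where 2: "unit w" "emb s = ofp p ^ m * w" using emb_factor[OF f(2)] by blast
  have "f = ofp p powi (int n - int m) * (u * inverse w)"
    using 1 2 f by (simp add: power_int_diff divide_inverse mult_ac)
  moreover have "unit (u * inverse w)" using 1 2 by (intro unit_mult unit_inverse)
  ultimately show ?thesis by blast
qed

lemma unit_not_power: "unit (ofp p ^ n * u) \<Longrightarrow> unit u \<Longrightarrow> n = 0"
proof (rule ccontr)
  assume u: "unit (ofp p ^ n * u)" "unit u" and n: "n \<noteq> 0"
  obtain r s where 1: "e r \<noteq> 0" "e s \<noteq> 0" "u = emb r / emb s" using u(2) by (rule unit_E)
  obtain r' s' where 2: "e r' \<noteq> 0" "e s' \<noteq> 0" "ofp p ^ n * u = emb r' / emb s'" using u(1) by (rule unit_E)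
  have "emb s \<noteq> 0" "emb s' \<noteq> 0" using 1 2 by auto
  moreover have "(ofp p ^ n * emb r) / emb s = emb r' / emb s'" using 1 2 by simp
  ultimately have "ofp p ^ n * emb r * emb s' = emb r' * emb s" by (rule iffD1[OF frac_eq_eq])
  then have "emb (ofx p ^ n * r * s') = emb (r' * s)" by (simp add: emb_ofx)
  then have "ofx p ^ n * r * s' = r' * s" by (simp only: emb_eq_iff)
  then have "e (ofx p ^ n * r * s') = e (r' * s)" by simp
  then have "evp p (fst z) ^ n * e r * e s' = e r' * e s" by (simp add: oc)
  then have "e r' * e s = 0" using n by (simp add: power_0_left)
  then show False using 1 2 by simp
qed

lemma factor_unique:
  assumes "unit u" "unit w" "ofp p powi n * u = ofp p powi m * w"
  shows "n = m"
proof -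
  have *: "m \<le> n" if "unit u" "unit w" "ofp p powi n * u = ofp p powi m * w" for n m u w
  proof (rule ccontr)
    assume "\<not> m \<le> n"
    then have "ofp p powi m = ofp p powi (n + int (nat (m - n)))" by simp
    also have "\<dots> = ofp p powi n * ofp p ^ nat (m - n)"
      by (simp only: power_int_add[OF disjI1[OF ofp_p_nz]] power_int_of_nat)
    finally have "ofp p powi m = ofp p powi n * ofp p ^ nat (m - n)" .
    then have "u = ofp p ^ nat (m - n) * w" using that(3) ofp_p_nz by simp
    then have "nat (m - n) = 0" using unit_not_power[of "nat (m - n)" w] that(1,2) by simp
    then show False using \<open>\<not> m \<le> n\<close> by simp
  qed
  show ?thesis using *[OF assms] *[OF assms(2,1) assms(3)[symmetric]] by simp
qed

definition val :: "bit univ_field \<Rightarrow> int" where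
  "val f = (THE n. \<exists>u. unit u \<and> f = ofp p powi n * u)"

lemma val_eq: "unit u \<Longrightarrow> val (ofp p powi n * u) = n"
  unfolding val_def by (rule the_equality) (use factor_unique in blast)+

lemma val_E:
  assumes "f \<in> FF" "f \<noteq> 0" obtains u where "unit u" "f = ofp p powi (val f) * u"
  using FF_factor[OF assms] val_eq by metis

lemma Pt_unit: "unit u \<Longrightarrow> u \<in> Pt z"
  by (auto simp: unit_def Pt_def)

lemma Pt_I: "e s \<noteq> 0 \<Longrightarrow> emb r / emb s \<in> Pt z"
  by (auto simp: Pt_def)

lemma Pt_E: assumes "f \<in> Pt z" obtains r s where "e s \<noteq> 0" "emb s \<noteq> 0" "f = emb r / emb s"
proof -
  from assms obtain r s where "e s \<noteq> 0" "f = emb r / emb s" by (auto simp: Pt_def)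
  moreover then have "emb s \<noteq> 0" by auto
  ultimately show ?thesis using that by blast
qed

lemma Pt_add: assumes "f \<in> Pt z" "g \<in> Pt z" shows "f + g \<in> Pt z"
proof -
  obtain r s where 1: "e s \<noteq> 0" "emb s \<noteq> 0" "f = emb r / emb s" using assms(1) by (rule Pt_E)
  obtain r' s' where 2: "e s' \<noteq> 0" "emb s' \<noteq> 0" "g = emb r' / emb s'" using assms(2) by (rule Pt_E)
  have "f + g = emb (r * s' + r' * s) / emb (s * s')" using 1 2 by (simp add: field_simps)
  then show ?thesis using Pt_I[of "s * s'" "r * s' + r' * s"] 1 2 by (simp add: e_mult)
qed

lemma Pt_mult: assumes "f \<in> Pt z" "g \<in> Pt z" shows "f * g \<in> Pt z"
proof -
  obtain r s where 1: "e s \<noteq> 0" "emb s \<noteq> 0" "f = emb r / emb s" using assms(1) by (rule Pt_E)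
  obtain r' s' where 2: "e s' \<noteq> 0" "emb s' \<noteq> 0" "g = emb r' / emb s'" using assms(2) by (rule Pt_E)
  show ?thesis using Pt_I[of "s * s'" "r * r'"] 1 2 by (simp add: e_mult)
qed

lemma Pt_emb: "emb r \<in> Pt z"
  unfolding Pt_def by (rule CollectI, rule exI[of _ r], rule exI[of _ 1]) simp

lemma Pt_FF: "f \<in> Pt z \<Longrightarrow> f \<in> FF"
  using nz by (auto simp: Pt_def intro: FF_I)

lemma Pt_power_unit: "n \<ge> 0 \<Longrightarrow> unit u \<Longrightarrow> ofp p powi n * u \<in> Pt z"
proof -
  assume "n \<ge> 0" "unit u"
  moreover have "ofp p ^ k \<in> Pt z" for k using Pt_emb[of "ofx p ^ k"] by (simp add: emb_ofx)
  ultimately show ?thesis by (auto simp: power_int_def intro: Pt_mult Pt_unit)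
qed

lemma val_nonneg: "f \<in> Pt z \<Longrightarrow> f \<noteq> 0 \<Longrightarrow> val f \<ge> 0"
proof -
  assume "f \<in> Pt z" "f \<noteq> 0"
  then obtain r s where f: "e s \<noteq> 0" "f = emb r / emb s" "r \<noteq> 0" by (auto simp: Pt_def)
  obtain n u where 1: "unit u" "emb r = ofp p ^ n * u" using emb_factor[OF f(3)] by blast
  have "f = ofp p powi int n * (u * inverse (emb s))" using f 1 by (simp add: divide_inverse)
  then show ?thesis using val_eq[of "u * inverse (emb s)" "int n"] unit_mult unit_inverse unit_emb f 1 by simp
qed

lemma is_val_Pt: "is_val (Pt z) val"
proof -
  have mult: "val (f * g) = val f + val g" if fg: "f \<in> FF" "g \<in> FF" "f \<noteq> 0" "g \<noteq> 0" for f g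
  proof -
    obtain u w where *: "unit u" "f = ofp p powi (val f) * u" "unit w" "g = ofp p powi (val g) * w"
      using val_E fg by metis
    have "f * g = ofp p powi (val f + val g) * (u * w)"
      by (subst *(2), subst *(4)) (simp add: power_int_add ofp_p_nz)
    then show ?thesis using val_eq unit_mult * by metis
  qed
  have sub: "f \<in> Pt z" if "f \<in> FF" "f \<noteq> 0" "val f \<ge> 0" for f
    using val_E[OF that(1,2)] Pt_power_unit[OF that(3)] by metis
  have add: "min (val f) (val g) \<le> val (f + g)"
    if fg: "f \<in> FF" "g \<in> FF" "f \<noteq> 0" "g \<noteq> 0" "f + g \<noteq> 0" for f g
  proof -
    define n where "n = min (val f) (val g)"
    \<comment> \<open>Multiplication by this power moves f and g into the local ring, so the
      ultrametric inequality becomes closure under addition.\<close>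
    let ?t = "ofp p powi (- n)"
    have t: "?t \<in> FF" "?t \<noteq> 0" by simp_all
    have vt: "val ?t = - n" using val_eq[of 1 "- n"] unit_emb[of 1] by simp
    have "?t * f \<in> Pt z" "?t * g \<in> Pt z"
      using fg t mult vt by (auto intro!: sub simp: n_def)
    then have "?t * f + ?t * g \<in> Pt z" by (rule Pt_add)
    then have "?t * (f + g) \<in> Pt z" by (simp only: distrib_left)
    then have "val (?t * (f + g)) \<ge> 0" using fg t by (intro val_nonneg) auto
    then show ?thesis using mult[of ?t "f + g"] fg t vt by (simp add: n_def)
  qed
  have t: "val (ofp p) = 1" using val_eq[of 1 1] unit_emb[of 1] by simp
  show ?thesis
    unfolding is_val_def
  proof (intro conjI ballI impI)
    show "\<exists>t\<in>FF. t \<noteq> 0 \<and> val t = 1" using t by (intro bexI[of _ "ofp p"]) simp_all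
    have "0 \<in> Pt z" using Pt_emb[of 0] by simp
    then show "Pt z = {f \<in> FF. f = 0 \<or> 0 \<le> val f}" using sub val_nonneg Pt_FF by blast
  qed (use mult add in auto)
qed

lemma place_Pt: "is_place (Pt z)"
  using is_val_Pt by (rule placeI)

lemma ordv_p: "ordv (Pt z) (ofp p) = 1"
  using ordv_eq[OF is_val_Pt, of "ofp p"] val_eq[of 1 1] unit_emb[of 1] by simp

section \<open>The residue field of a geometric point\<close>

definition res :: "bit univ_field \<Rightarrow> bit alg_closure" where
  "res f = (THE c. \<exists>r s. e s \<noteq> 0 \<and> f = emb r / emb s \<and> c = e r / e s)"

lemma res_eq: "e s \<noteq> 0 \<Longrightarrow> res (emb r / emb s) = e r / e s"
  unfolding res_def
proof (rule the_equality)
  fix c assume s: "e s \<noteq> 0" and "\<exists>r' s'. e s' \<noteq> 0 \<and> emb r / emb s = emb r' / emb s' \<and> c = e r' / e s'"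
  then obtain r' s' where *: "e s' \<noteq> 0" "emb r / emb s = emb r' / emb s'" "c = e r' / e s'" by blast
  have "emb s \<noteq> 0" "emb s' \<noteq> 0" using s * by auto
  then have "emb (r * s') = emb (r' * s)" using *(2) by (simp add: field_simps)
  then have "r * s' = r' * s" by (simp only: emb_eq_iff)
  then have "e r * e s' = e r' * e s" by (metis e_mult)
  then show "c = e r / e s" unfolding *(3) using *(1) s by (simp add: frac_eq_eq)
qed blast

definition kres :: "bit alg_closure set" where "kres = range e"

lemma finite_range_evp: "finite (range (\<lambda>q. evp q a))"
proof -
  have "range (\<lambda>q. evp q a) \<subseteq> (\<lambda>q. evp q a) ` {q. Polynomial.degree q \<le> Polynomial.degree (mp a)}"
  proof
    fix x assume "x \<in> range (\<lambda>q. evp q a)"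
    then obtain q where x: "x = evp q a" by auto
    have "q = q div mp a * mp a + q mod mp a" by simp
    then have "evp q a = evp (q div mp a) a * evp (mp a) a + evp (q mod mp a) a" by (metis evp_add evp_mult)
    then have "x = evp (q mod mp a) a" using x by simp
    moreover have "Polynomial.degree (q mod mp a) \<le> Polynomial.degree (mp a)"
      by (metis degree_mod_less' degree_0 le0 less_imp_le mp_nz)
    ultimately show "x \<in> (\<lambda>q. evp q a) ` {q. Polynomial.degree q \<le> Polynomial.degree (mp a)}" by blast
  qed
  moreover have "finite {q :: bit poly. Polynomial.degree q \<le> n}" for n
  proof -
    have "{q :: bit poly. Polynomial.degree q \<le> n} \<subseteq> Poly ` {xs. set xs \<subseteq> UNIV \<and> length xs \<le> Suc n}"
    proof
      fix q :: "bit poly" assume "q \<in> {q. Polynomial.degree q \<le> n}"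
      then have "length (Polynomial.coeffs q) \<le> Suc n" by (cases "q = 0") (simp_all add: length_coeffs)
      then show "q \<in> Poly ` {xs. set xs \<subseteq> UNIV \<and> length xs \<le> Suc n}"
        by (intro image_eqI[of _ _ "Polynomial.coeffs q"]) simp_all
    qed
    moreover have "finite {xs :: bit list. set xs \<subseteq> UNIV \<and> length xs \<le> Suc n}"
      by (rule finite_lists_length_le) simp
    ultimately show ?thesis by (meson finite_imageI finite_subset)
  qed
  ultimately show ?thesis by (meson finite_imageI finite_subset)
qed

lemma finite_kres: "finite kres"
proof -
  have "kres \<subseteq> (\<lambda>(u, v). u + v * snd z) ` (range (\<lambda>q. evp q (fst z)) \<times> range (\<lambda>q. evp q (fst z)))"
    by (force simp: kres_def ev_def)
  then show ?thesis by (rule finite_subset) (intro finite_imageI finite_cartesian_product finite_range_evp)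
qed

lemma kres_closed: "x \<in> kres \<Longrightarrow> y \<in> kres \<Longrightarrow> x + y \<in> kres" "x \<in> kres \<Longrightarrow> y \<in> kres \<Longrightarrow> x * y \<in> kres"
  "0 \<in> kres" "1 \<in> kres"
  by (auto simp: kres_def simp flip: e_mult ev_simps(3))
    (metis ev_simps(1) rangeI, metis ev_simps(2) rangeI)

lemma kres_Fqn: obtains m where "m > 0" "kres = Fqn m" "card kres = 2 ^ m"
  by (rule finite_subring_Fqn[of kres]) (use finite_kres kres_closed in auto)

lemma Fqn_divide: "m > 0 \<Longrightarrow> x \<in> Fqn m \<Longrightarrow> y \<in> Fqn m \<Longrightarrow> x / y \<in> (Fqn m :: bit alg_closure set)"
  by (simp add: Fqn_bit power_divide)

lemma is_res_Pt:
  assumes "kres = Fqn m" "m > 0"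
  shows "is_res (Pt z) m res"
proof -
  have "res ` Pt z = Fqn m"
  proof (rule antisym)
    have "e r \<in> Fqn m" for r using assms(1) by (auto simp: kres_def)
    then show "res ` Pt z \<subseteq> Fqn m"
      using assms(2) by (auto simp: Pt_def res_eq intro!: Fqn_divide)
    show "Fqn m \<subseteq> res ` Pt z"
    proof
      fix x :: "bit alg_closure" assume "x \<in> Fqn m"
      then obtain r where "x = e r" using assms by (auto simp: kres_def)
      then have "x = res (emb r)" using res_eq[of 1 r] by simp
      then show "x \<in> res ` Pt z" using Pt_emb by blast
    qed
  qed
  moreover have "res 1 = 1" using res_eq[of 1 1] by simp
  moreover have "res (f + g) = res f + res g \<and> res (f * g) = res f * res g"
    if fg: "f \<in> Pt z" "g \<in> Pt z" for f g
  proof -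
    obtain r s where 1: "e s \<noteq> 0" "emb s \<noteq> 0" "f = emb r / emb s" using fg(1) by (rule Pt_E)
    obtain r' s' where 2: "e s' \<noteq> 0" "emb s' \<noteq> 0" "g = emb r' / emb s'" using fg(2) by (rule Pt_E)
    have fg1: "f + g = emb (r * s' + r' * s) / emb (s * s')" using 1 2 by (simp add: field_simps)
    have fg2: "f * g = emb (r * r') / emb (s * s')" using 1 2 by simp
    have "res (f + g) = e (r * s' + r' * s) / e (s * s')" "res (f * g) = e (r * r') / e (s * s')"
      unfolding fg1 fg2 by (rule res_eq, use 1 2 in \<open>simp add: e_mult\<close>)+
    moreover have "res f = e r / e s" "res g = e r' / e s'" using 1 2 by (simp_all add: res_eq)
    ultimately show ?thesis using 1(1) 2(1) by (simp only: e_mult ev_simps(3) add_frac_eq times_divide_times_eq simp_thms not_False_eq_True)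
  qed
  moreover have "res f = 0 \<longleftrightarrow> f = 0 \<or> 1 \<le> ordv (Pt z) f" if f: "f \<in> Pt z" for f
  proof -
    obtain r s where *: "e s \<noteq> 0" "emb s \<noteq> 0" "f = emb r / emb s" using f by (rule Pt_E)
    show ?thesis
    proof (cases "f = 0")
      case True
      then have "r = 0" using * by auto
      then show ?thesis using * True res_eq[of s 0] by simp
    next
      case False
      interpret pl: place "Pt z" by unfold_locales (rule place_Pt)
      obtain u where u: "unit u" "f = ofp p powi (val f) * u" using val_E[OF Pt_FF[OF f] False] .
      have ov: "ordv (Pt z) f = val f" using ordv_eq[OF is_val_Pt Pt_FF[OF f] False] .
      have v0: "val f \<ge> 0" using val_nonneg f False by simp
      have "res f \<noteq> 0 \<longleftrightarrow> unit f"
      proof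
        assume "res f \<noteq> 0"
        then have "e r \<noteq> 0" using *(1) res_eq[OF *(1), of r] *(3) by auto
        then show "unit f" using unit_I * by simp
      next
        assume "unit f"
        then obtain r s where "e r \<noteq> 0" "e s \<noteq> 0" "f = emb r / emb s" by (rule unit_E)
        then show "res f \<noteq> 0" using res_eq by simp
      qed
      moreover have "unit f \<longleftrightarrow> val f = 0"
      proof
        assume "unit f" then show "val f = 0" using val_eq[of f 0] by simp
      next
        assume "val f = 0" then have "f = u" using u(2) by simp
        then show "unit f" using u(1) by simp
      qed
      ultimately show ?thesis using ov v0 False by auto
    qed
  qed
  ultimately show ?thesis using assms by (simp add: is_res_def)
qed

end

section \<open>The place at infinity\<close>

lemma degree_add_less_bit:
  fixes p q :: "bit poly"
  assumes "Polynomial.degree p = Polynomial.degree q" "p \<noteq> 0" "q \<noteq> 0" "p + q \<noteq> 0"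
  shows "Polynomial.degree (p + q) < Polynomial.degree p"
proof -
  have le: "Polynomial.degree (p + q) \<le> Polynomial.degree p"
    using assms(1) by (intro degree_add_le) simp_all
  have one: "Polynomial.coeff r (Polynomial.degree r) = 1" if "r \<noteq> 0" for r :: "bit poly"
    using that leading_coeff_0_iff[of r] bit_not_zero_iff by blast
  have "Polynomial.coeff (p + q) (Polynomial.degree p) = 0"
    using one[OF assms(2)] one[OF assms(3)] assms(1) by simp
  then have "Polynomial.degree (p + q) \<noteq> Polynomial.degree p"
    using one[OF assms(4)] by auto
  then show ?thesis using le by simp
qed

text \<open>The parity of the pole order tells which of the two coefficients carries it, and the
  leading coefficient of that one is 1 for both functions, so it cancels. This is why the residue
  field at infinity is F_2.\<close>

lemma dg_add_less:
  assumes "r \<noteq> 0" "s \<noteq> 0" "dg r = dg s" "r + s \<noteq> 0"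
  shows "dg (r + s) < dg r"
proof -
  have d: "dg (r + s) \<le> dg r" using dg_add[of r s] assms(3) by simp
  have "dg (r + s) \<noteq> dg r"
  proof
    assume eq: "dg (r + s) = dg r"
    have par: "dg u = 2 * Polynomial.degree (cst u) \<and> cst u \<noteq> 0 \<and> even (dg u) \<or> lin u \<noteq> 0 \<and> dg u = 2 * Polynomial.degree (lin u) + 3 \<and> odd (dg u)"
      if "u \<noteq> 0" for u
      using that by (cases "lin u = 0") (auto simp: dg_eq coord_eq_iff max_def)
    show False
    proof (cases "even (dg r)")
      case True
      have "cst r \<noteq> 0" "cst s \<noteq> 0" "Polynomial.degree (cst r) = Polynomial.degree (cst s)" "cst r + cst s \<noteq> 0" "Polynomial.degree (cst r + cst s) = Polynomial.degree (cst r)"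
        using par[OF assms(1)] par[OF assms(2)] par[OF assms(4)] eq assms(3) True by auto
      then show False using degree_add_less_bit[of "cst r" "cst s"] by simp
    next
      case False
      have "lin r \<noteq> 0" "lin s \<noteq> 0" "Polynomial.degree (lin r) = Polynomial.degree (lin s)" "lin r + lin s \<noteq> 0" "Polynomial.degree (lin r + lin s) = Polynomial.degree (lin r)"
        using par[OF assms(1)] par[OF assms(2)] par[OF assms(4)] eq assms(3) False by auto
      then show False using degree_add_less_bit[of "lin r" "lin s"] by simp
    qed
  qed
  then show ?thesis using d by simp
qed

definition vinf :: "bit univ_field \<Rightarrow> int" where
  "vinf f = (THE n. \<exists>r s. r \<noteq> 0 \<and> s \<noteq> 0 \<and> f = emb r / emb s \<and> n = int (dg s) - int (dg r))"

lemma vinf_eq: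
  assumes "r \<noteq> 0" "s \<noteq> 0" shows "vinf (emb r / emb s) = int (dg s) - int (dg r)"
  unfolding vinf_def
proof (rule the_equality)
  fix n assume "\<exists>r' s'. r' \<noteq> 0 \<and> s' \<noteq> 0 \<and> emb r / emb s = emb r' / emb s' \<and> n = int (dg s') - int (dg r')"
  then obtain r' s' where *: "r' \<noteq> 0" "s' \<noteq> 0" "emb r / emb s = emb r' / emb s'" "n = int (dg s') - int (dg r')" by blast
  have "emb r * emb s' = emb r' * emb s" using *(3) assms * by (subst (asm) frac_eq_eq) auto
  then have "emb (r * s') = emb (r' * s)" by simp
  then have "r * s' = r' * s" by (simp only: emb_eq_iff)
  then have "dg r + dg s' = dg r' + dg s" using assms * by (metis dg_mult)
  then show "n = int (dg s) - int (dg r)" using * by simp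
qed (use assms in blast)

lemma vinf_emb: "r \<noteq> 0 \<Longrightarrow> vinf (emb r) = - int (dg r)"
  using vinf_eq[of r 1] by simp

definition Pinf :: "bit univ_field set" where
  "Pinf = {f \<in> FF. f = 0 \<or> 0 \<le> vinf f}"

lemma is_val_Pinf: "is_val Pinf vinf"
  unfolding is_val_def
proof (intro conjI ballI impI)
  fix f g assume fg: "f \<in> FF" "g \<in> FF" "f \<noteq> 0" "g \<noteq> 0"
  obtain r s where 1: "f = emb r / emb s" "s \<noteq> 0" "r \<noteq> 0" using FF_nz_E fg by metis
  obtain r' s' where 2: "g = emb r' / emb s'" "s' \<noteq> 0" "r' \<noteq> 0" using FF_nz_E fg by metis
  have "f * g = emb (r * r') / emb (s * s')" using 1 2 by simp
  then have "vinf (f * g) = int (dg (s * s')) - int (dg (r * r'))" using 1 2 vinf_eq[of "r * r'" "s * s'"] by simp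
  then show "vinf (f * g) = vinf f + vinf g" using 1 2 by (simp add: vinf_eq dg_mult)
  assume "f + g \<noteq> 0"
  have fg': "f + g = emb (r * s' + r' * s) / emb (s * s')" using 1 2 by (simp add: add_frac_eq)
  then have nz: "r * s' + r' * s \<noteq> 0" using \<open>f + g \<noteq> 0\<close> by (metis div_0 emb_hom(1))
  have "vinf (f + g) = int (dg (s * s')) - int (dg (r * s' + r' * s))"
    unfolding fg' by (rule vinf_eq) (use nz 1 2 in auto)
  moreover have "dg (r * s' + r' * s) \<le> max (dg r + dg s') (dg r' + dg s)"
    using dg_add[of "r * s'" "r' * s"] 1 2 by (simp add: dg_mult)
  ultimately show "min (vinf f) (vinf g) \<le> vinf (f + g)" using 1 2 by (simp add: vinf_eq dg_mult)
next
  \<comment> \<open>The quotient x/y of functions with pole orders 2 and 3 is a uniformizer at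
    infinity.\<close>
  have "vinf (emb (ofx [:0, 1:]) / emb (Coord 0 1)) = 1"
    by (subst vinf_eq) (simp_all add: coord_eq_iff dg_eq)
  then show "\<exists>t\<in>FF. t \<noteq> 0 \<and> vinf t = 1"
    by (intro bexI[of _ "emb (ofx [:0, 1:]) / emb (Coord 0 1)"]) (simp_all add: coord_eq_iff)
qed (simp add: Pinf_def)

lemma place_Pinf: "is_place Pinf"
  using is_val_Pinf by (rule placeI)

interpretation inf: valn Pinf vinf
  by unfold_locales (rule is_val_Pinf)

lemma ordv_Pinf: "f \<in> FF \<Longrightarrow> f \<noteq> 0 \<Longrightarrow> ordv Pinf f = vinf f"
  by (rule ordv_eq[OF is_val_Pinf])

text \<open>If adding 1 sends every unit into the maximal ideal, there are only two residue classes,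
  so mapping units to 1 and all else to 0 respects sums and products.\<close>

lemma rational_place_res:
  assumes "is_place P" and one: "\<And>f. f \<in> P \<Longrightarrow> f \<noteq> 0 \<Longrightarrow> ordv P f = 0 \<Longrightarrow> f + 1 \<noteq> 0 \<Longrightarrow> 1 \<le> ordv P (f + 1)"
  shows "is_res P 1 (\<lambda>f. if f \<noteq> 0 \<and> ordv P f = 0 then 1 else 0)"
proof -
  interpret place P by unfold_locales fact
  let ?\<rho> = "\<lambda>f. if f \<noteq> 0 \<and> ordv P f = 0 then 1 else (0 :: bit alg_closure)"
  have pos: "f = 0 \<or> ordv P f \<ge> 1 \<longleftrightarrow> \<not> (f \<noteq> 0 \<and> ordv P f = 0)" if "f \<in> P" for f
    using that P_iff by force
  have m: "f + g = 0 \<or> ordv P (f + g) \<ge> 1"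
    if "f \<in> P" "g \<in> P" "f = 0 \<or> ordv P f \<ge> 1" "g = 0 \<or> ordv P g \<ge> 1" for f g
    using that v_add[of f g] P_iff by (cases "f = 0"; cases "g = 0"; cases "f = g") auto
  have u: "f + g \<noteq> 0 \<and> ordv P (f + g) = 0"
    if "f \<in> P" "g \<in> P" "f \<noteq> 0 \<and> ordv P f = 0" "g = 0 \<or> ordv P g \<ge> 1" for f g
  proof (rule ccontr)
    assume "\<not> (f + g \<noteq> 0 \<and> ordv P (f + g) = 0)"
    then have "f + g = 0 \<or> ordv P (f + g) \<ge> 1"
      using pos[of "f + g"] closed_ringD(3)[OF closed_ring_P] that by blast
    then have "(f + g) + g = 0 \<or> ordv P ((f + g) + g) \<ge> 1"
      using m[of "f + g" g] closed_ringD(3)[OF closed_ring_P that(1,2)] that by blast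
    moreover have "(f + g) + g = f" by (simp add: add.assoc)
    ultimately show False using that by simp
  qed
  have uu: "f + g = 0 \<or> ordv P (f + g) \<ge> 1"
    if "f \<in> P" "g \<in> P" "f \<noteq> 0 \<and> ordv P f = 0" "g \<noteq> 0 \<and> ordv P g = 0" for f g
  proof -
    have "f + 1 \<in> P" "g + 1 \<in> P" using that closed_ringD[OF closed_ring_P] by auto
    moreover have "f + 1 = 0 \<or> ordv P (f + 1) \<ge> 1" "g + 1 = 0 \<or> ordv P (g + 1) \<ge> 1" using one that by blast+
    ultimately have "(f + 1) + (g + 1) = 0 \<or> ordv P ((f + 1) + (g + 1)) \<ge> 1" by (rule m)
    moreover have "(f + 1) + (g + 1) = f + g" by (simp add: algebra_simps)
    ultimately show ?thesis by simp
  qed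
  have add: "?\<rho> (f + g) = ?\<rho> f + ?\<rho> g" if fg: "f \<in> P" "g \<in> P" for f g
  proof -
    consider "f \<noteq> 0 \<and> ordv P f = 0" "g \<noteq> 0 \<and> ordv P g = 0" | "f \<noteq> 0 \<and> ordv P f = 0" "g = 0 \<or> ordv P g \<ge> 1"
      | "f = 0 \<or> ordv P f \<ge> 1" "g \<noteq> 0 \<and> ordv P g = 0" | "f = 0 \<or> ordv P f \<ge> 1" "g = 0 \<or> ordv P g \<ge> 1"
      using pos fg by blast
    then show ?thesis
    proof cases
      case 1 then show ?thesis using uu[OF fg] by auto
    next
      case 2 then show ?thesis using u[OF fg] by auto
    next
      case 3 then show ?thesis using u[OF fg(2,1)] by (auto simp: add.commute)
    next
      case 4 then show ?thesis using m[OF fg] by auto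
    qed
  qed
  have mult: "?\<rho> (f * g) = ?\<rho> f * ?\<rho> g" if "f \<in> P" "g \<in> P" for f g
    using that v_mult[of f g] by (auto simp: P_iff)
  have F1: "Fqn 1 = {0, 1 :: bit alg_closure}"
  proof -
    have "x = 0 \<or> x = 1" if "x\<^sup>2 = x" for x :: "bit alg_closure"
      using that by (simp add: power2_eq_square)
    then show ?thesis by (auto simp: Fqn_bit)
  qed
  have im: "?\<rho> ` P = Fqn 1"
  proof -
    have "1 \<in> ?\<rho> ` P" by (rule image_eqI[of _ _ 1]) (use closed_ringD(2)[OF closed_ring_P] in auto)
    moreover have "0 \<in> ?\<rho> ` P" by (rule image_eqI[of _ _ 0]) (use closed_ringD(1)[OF closed_ring_P] in auto)
    ultimately show ?thesis unfolding F1 by auto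
  qed
  show ?thesis
    unfolding is_res_def
    using add mult im pos by (auto split: if_splits)
qed

lemma is_res_Pinf: "\<exists>\<rho>. is_res Pinf 1 \<rho>"
proof -
  have "1 \<le> ordv Pinf (f + 1)" if f: "f \<in> Pinf" "f \<noteq> 0" "ordv Pinf f = 0" "f + 1 \<noteq> 0" for f
  proof -
    have FF: "f \<in> FF" using f by (simp add: Pinf_def)
    obtain r s where 1: "f = emb r / emb s" "s \<noteq> 0" "r \<noteq> 0" using FF_nz_E FF f by metis
    then have eq: "dg r = dg s" using f(3) FF f(2) by (simp add: ordv_Pinf vinf_eq)
    have f1: "f + 1 = emb (r + s) / emb s" using 1 by (simp add: add_divide_distrib)
    then have "r + s \<noteq> 0" using f(4) by (metis div_0 emb_hom(1))
    then have "vinf (f + 1) = int (dg s) - int (dg (r + s))" "dg (r + s) < dg r"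
      unfolding f1 using 1 eq dg_add_less[of r s] vinf_eq[of "r + s" s] by auto
    then show ?thesis using FF f(4) eq by (simp add: ordv_Pinf)
  qed
  then show ?thesis using rational_place_res[OF place_Pinf] by blast
qed

section \<open>Localizations at maximal ideals\<close>

locale max_ideal =
  fixes C M :: "bit univ_field set"
  assumes C: "closed_ring C" "C \<subseteq> FF" and M: "is_max_ideal M C"
begin

abbreviation "L \<equiv> localization_at C M"

lemma M_sub: "x \<in> M \<Longrightarrow> x \<in> C" and M_0: "0 \<in> M" and M_1: "1 \<notin> M"
  and M_add: "x \<in> M \<Longrightarrow> y \<in> M \<Longrightarrow> x + y \<in> M" and M_mult: "c \<in> C \<Longrightarrow> x \<in> M \<Longrightarrow> c * x \<in> M"
  using M by (auto simp: is_max_ideal_def)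

lemma M_inv: "a \<in> C \<Longrightarrow> a \<notin> M \<Longrightarrow> \<exists>c\<in>C. c * a + 1 \<in> M"
  using M unfolding is_max_ideal_def by blast

lemma M_mult': "c \<in> C \<Longrightarrow> x \<in> M \<Longrightarrow> x * c \<in> M"
  using M_mult by (simp add: mult.commute)

lemma M_prime:
  assumes "a \<in> C" "b \<in> C" "a * b \<in> M" "a \<notin> M" shows "b \<in> M"
proof -
  obtain c where c: "c \<in> C" "c * a + 1 \<in> M" using M_inv assms by blast
  have "b = b * (c * a + 1) + c * (a * b)" by (simp add: algebra_simps)
  also have "\<dots> \<in> M" by (rule M_add[OF M_mult[OF assms(2) c(2)] M_mult[OF c(1) assms(3)]])
  finally show ?thesis .
qed

lemma L_I: "a \<in> C \<Longrightarrow> b \<in> C \<Longrightarrow> b \<notin> M \<Longrightarrow> a / b \<in> L"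
  by (auto simp: localization_at_def)

lemma L_E: assumes "f \<in> L" obtains a b where "a \<in> C" "b \<in> C" "b \<notin> M" "b \<noteq> 0" "f = a / b"
proof -
  from assms obtain a b where "a \<in> C" "b \<in> C" "b \<notin> M" "f = a / b" by (auto simp: localization_at_def)
  moreover then have "b \<noteq> 0" using M_0 by auto
  ultimately show ?thesis using that by blast
qed

lemma C_L: "a \<in> C \<Longrightarrow> a \<in> L"
  using L_I[of a 1] M_1 closed_ringD(2)[OF C(1)] by simp

lemma inv_L: "b \<in> C \<Longrightarrow> b \<notin> M \<Longrightarrow> inverse b \<in> L"
  using L_I[of 1 b] closed_ringD(2)[OF C(1)] by (simp add: divide_inverse)

lemma denom: "b \<in> C \<Longrightarrow> b \<notin> M \<Longrightarrow> d \<in> C \<Longrightarrow> d \<notin> M \<Longrightarrow> b * d \<in> C \<and> b * d \<notin> M"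
  using M_prime closed_ringD(4)[OF C(1)] by blast

lemma closed_ring_L: "closed_ring L"
  unfolding closed_ring_def
proof (intro conjI ballI)
  show "0 \<in> L" "1 \<in> L" using C_L closed_ringD[OF C(1)] by auto
  fix f g assume "f \<in> L" "g \<in> L"
  then obtain a b c d where *: "a \<in> C" "b \<in> C" "b \<notin> M" "b \<noteq> 0" "f = a / b" "c \<in> C" "d \<in> C" "d \<notin> M" "d \<noteq> 0" "g = c / d"
    by (metis L_E)
  have "f + g = (a * d + c * b) / (b * d)" "f * g = (a * c) / (b * d)" using * by (simp_all add: add_frac_eq)
  then show "f + g \<in> L" "f * g \<in> L"
    using * denom[of b d] closed_ringD(3,4)[OF C(1)] by (auto intro!: L_I)
qed

lemma L_FF: "L \<subseteq> FF"
proof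
  fix f assume "f \<in> L"
  then obtain a b where ab: "a \<in> C" "b \<in> C" "f = a / b" by (metis L_E)
  then have "a \<in> FF" "b \<in> FF" using C(2) by auto
  then show "f \<in> FF" using ab by simp
qed

definition nonunits :: "bit univ_field set" where "nonunits = {f \<in> L. f = 0 \<or> inverse f \<notin> L}"

lemma nonunits_iff: "f \<in> nonunits \<longleftrightarrow> (\<exists>a b. a \<in> M \<and> b \<in> C \<and> b \<notin> M \<and> f = a / b)"
proof
  assume "f \<in> nonunits"
  then have f: "f \<in> L" "f = 0 \<or> inverse f \<notin> L" by (auto simp: nonunits_def)
  then obtain a b where *: "a \<in> C" "b \<in> C" "b \<notin> M" "b \<noteq> 0" "f = a / b" by (metis L_E)
  have "a \<in> M"
  proof (rule ccontr)
    assume "a \<notin> M"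
    then have "a \<noteq> 0" "b / a \<in> L" using M_0 * by (auto intro: L_I)
    then show False using f * by auto
  qed
  then show "\<exists>a b. a \<in> M \<and> b \<in> C \<and> b \<notin> M \<and> f = a / b" using * by blast
next
  assume "\<exists>a b. a \<in> M \<and> b \<in> C \<and> b \<notin> M \<and> f = a / b"
  then obtain a b where *: "a \<in> M" "b \<in> C" "b \<notin> M" "f = a / b" by blast
  then have b0: "b \<noteq> 0" using M_0 by auto
  have "f \<in> L" using * M_sub by (auto intro: L_I)
  moreover have "inverse f \<notin> L" if "f \<noteq> 0"
  proof
    assume "inverse f \<in> L"
    then obtain c d where cd: "c \<in> C" "d \<in> C" "d \<notin> M" "d \<noteq> 0" "inverse f = c / d" by (metis L_E)
    have a0: "a \<noteq> 0" using that * by auto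
    have "b / a = c / d" using cd * by (simp add: inverse_divide)
    then have "b * d = c * a" using a0 cd by (subst (asm) frac_eq_eq) auto
    then have "b * d \<in> M" using M_mult cd * by simp
    then show False using denom[of b d] * cd by auto
  qed
  ultimately show "f \<in> nonunits" by (auto simp: nonunits_def)
qed

lemma M_nonunits: "a \<in> M \<Longrightarrow> a \<in> nonunits"
  unfolding nonunits_iff using closed_ringD(2)[OF C(1)] M_1 by (metis div_by_1)

lemma nonunits_add: assumes "f \<in> nonunits" "g \<in> nonunits" shows "f + g \<in> nonunits"
proof -
  obtain a b where 1: "a \<in> M" "b \<in> C" "b \<notin> M" "f = a / b" using assms nonunits_iff by blast
  obtain c d where 2: "c \<in> M" "d \<in> C" "d \<notin> M" "g = c / d" using assms nonunits_iff by blast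
  have "b \<noteq> 0" "d \<noteq> 0" using 1 2 M_0 by auto
  then have "f + g = (a * d + c * b) / (b * d)" using 1 2 by (simp add: add_frac_eq)
  moreover have "a * d + c * b \<in> M" using 1 2 by (intro M_add M_mult')
  ultimately show ?thesis unfolding nonunits_iff using denom[of b d] 1 2 by blast
qed

lemma nonunits_mult: assumes "f \<in> L" "g \<in> nonunits" shows "f * g \<in> nonunits"
proof -
  obtain a b where 1: "a \<in> C" "b \<in> C" "b \<notin> M" "f = a / b" using assms L_E by metis
  obtain c d where 2: "c \<in> M" "d \<in> C" "d \<notin> M" "g = c / d" using assms nonunits_iff by blast
  have "f * g = (a * c) / (b * d)" using 1 2 by simp
  moreover have "a * c \<in> M" using 1 2 by (intro M_mult)
  ultimately show ?thesis unfolding nonunits_iff using denom[of b d] 1 2 by blast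
qed

lemma nonunits_1: "1 \<notin> nonunits"
  using closed_ringD(2)[OF closed_ring_L] by (simp add: nonunits_def)

lemma unit_one_plus: assumes "f \<in> nonunits" shows "inverse (1 + f) \<in> L"
proof (rule ccontr)
  assume "inverse (1 + f) \<notin> L"
  moreover have "1 + f \<in> L" using assms closed_ringD[OF closed_ring_L] by (auto simp: nonunits_def)
  ultimately have "1 + f \<in> nonunits" by (simp add: nonunits_def)
  then have "(1 + f) + f \<in> nonunits" using assms by (rule nonunits_add)
  then show False using nonunits_1 by (simp add: add.assoc)
qed

text \<open>The non-units of L among the regular functions form a nonzero prime m. Norms give it a
  nonzero polynomial in x, and a root of one of least degree g is an x-coordinate a. One of the two
  points above a kills all of m, so its local ring lies in L, and \<open>maximal_subring\<close>
  gives equality.\<close>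

lemma affine_localization:
  assumes xy: "xgen \<in> L" "ygen \<in> L" and ne: "L \<noteq> FF"
  shows "\<exists>z. on_curve z \<and> L = Pt z"
proof -
  note LD = closed_ringD[OF closed_ring_L]
  have emb: "emb r \<in> L" for r by (rule emb_in_ring) (use xy LD in auto)
  define m where "m = {r. emb r \<in> nonunits}"
  have m_mult: "r * s \<in> m" if "s \<in> m" for r s using that emb nonunits_mult by (simp add: m_def)
  have m_add: "r + s \<in> m" if "r \<in> m" "s \<in> m" for r s using that nonunits_add by (simp add: m_def)
  have m_inv: "inverse (emb s) \<in> L" if "s \<notin> m" for s using that emb by (auto simp: m_def nonunits_def)
  have m_1: "1 \<notin> m" using nonunits_1 by (simp add: m_def)
  have m_0: "0 \<in> m" using LD by (simp add: m_def nonunits_def)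
  have "\<exists>r. r \<in> m \<and> r \<noteq> 0"
  proof (rule ccontr)
    assume no: "\<not> (\<exists>r. r \<in> m \<and> r \<noteq> 0)"
    have "FF \<subseteq> L"
    proof
      fix f assume "f \<in> FF"
      then obtain r s where "f = emb r / emb s" "s \<noteq> 0" by (rule FF_E)
      then show "f \<in> L" using m_inv[of s] no emb LD(4) by (auto simp: divide_inverse)
    qed
    then show False using ne L_FF by auto
  qed
  then obtain r where r: "r \<in> m" "r \<noteq> 0" by blast
  have "conj r * r \<in> m" using m_mult r by blast
  then have "ofx (nrm r) \<in> m" by (simp only: mult.commute[of "conj r"] mult_conj)
  moreover have "nrm r \<noteq> 0" using r by simp
  ultimately have ex: "\<exists>g. g \<noteq> 0 \<and> ofx g \<in> m" by blast
  define g where "g = (ARG_MIN Polynomial.degree g. g \<noteq> 0 \<and> ofx g \<in> m)"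
  have g: "g \<noteq> 0" "ofx g \<in> m" using ex arg_min_natI[of "\<lambda>g. g \<noteq> 0 \<and> ofx g \<in> m"] unfolding g_def by blast+
  have gmin: "Polynomial.degree g \<le> Polynomial.degree h" if "h \<noteq> 0" "ofx h \<in> m" for h
    unfolding g_def by (rule arg_min_nat_le) (use that in simp)
  have "Polynomial.degree g > 0"
  proof (rule ccontr)
    assume "\<not> ?thesis"
    then have "g = 1" using bit_poly_unit[of g] g by simp
    then show False using g m_1 by simp
  qed
  moreover have "Polynomial.degree (map_poly to_ac g) = Polynomial.degree g" by (rule degree_map_poly) simp
  ultimately obtain a where a: "evp g a = 0"
    using alg_closed_imp_poly_has_root[of "map_poly to_ac g"] by (auto simp: evp_def)
  have root: "evp q a = 0" if q: "ofx q \<in> m" for q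
  proof -
    have "q mod g = q + q div g * g" using bit_poly_diff minus_div_mult_eq_mod[of q g] by simp
    then have "ofx (q mod g) = ofx q + ofx (q div g) * ofx g" by simp
    also have "\<dots> \<in> m" using q g by (intro m_add m_mult)
    finally have "q mod g = 0" using gmin[of "q mod g"] degree_mod_less[OF g(1), of q] by fastforce
    then have "g dvd q" by (simp add: mod_eq_0_iff_dvd)
    then show ?thesis using a by (auto elim: dvdE)
  qed
  obtain b where b: "on_curve (a, b)" by (rule lift_point)
  \<comment> \<open>Prime avoidance: every element of m vanishes at one of the two points above a,
    since its norm vanishes at a. If r fails at the first point and s at the second, then r + s
    fails at both.\<close>
  have "\<exists>z. on_curve z \<and> fst z = a \<and> (\<forall>r\<in>m. ev z r = 0)"
  proof (rule ccontr)
    let ?z = "(a, b)"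
    assume "\<not> ?thesis"
    then obtain r s where rs: "r \<in> m" "ev ?z r \<noteq> 0" "s \<in> m" "ev (conjp ?z) s \<noteq> 0"
      using b by (metis conjp_simps(1) fst_conv on_curve_conjp)
    have no: "ev ?z h = 0 \<or> ev (conjp ?z) h = 0" if "h \<in> m" for h
    proof -
      have "ofx (nrm h) \<in> m" using m_mult[OF that, of "conj h"] by (simp only: mult.commute[of "conj h"] mult_conj)
      then have "evp (nrm h) (fst ?z) = 0" using root by simp
      then show ?thesis using evp_nrm[OF b, of h] by simp
    qed
    have "ev (conjp ?z) r = 0" "ev ?z s = 0" using no rs by blast+
    then show False using no[OF m_add[OF rs(1,3)]] rs by simp
  qed
  then obtain z where z: "on_curve z" "fst z = a" "\<And>r. r \<in> m \<Longrightarrow> ev z r = 0" by blast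
  interpret gpt z by unfold_locales (rule z(1))
  interpret valn "Pt z" val by unfold_locales (rule is_val_Pt)
  have sub: "Pt z \<subseteq> L"
  proof
    fix f assume "f \<in> Pt z"
    then obtain r s where "e s \<noteq> 0" "f = emb r / emb s" by (metis Pt_E)
    moreover then have "inverse (emb s) \<in> L" using m_inv z(3) by blast
    ultimately show "f \<in> L" using emb LD(4) by (simp add: divide_inverse)
  qed
  \<comment> \<open>The cofactor h has smaller degree than g, so it is a unit of L by the choice of
    g, and \<open>mp a\<close> is a non-unit.\<close>
  obtain h where h: "g = mp a * h" using a mp_dvd_iff by (auto elim: dvdE)
  then have hnz: "h \<noteq> 0" using g by auto
  have "ofx h \<notin> m"
    using gmin[OF hnz] h hnz degree_mp_pos[of a] by (auto simp: degree_mult_eq)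
  have "ofx (mp a) \<in> m"
  proof (rule ccontr)
    assume "ofx (mp a) \<notin> m"
    then have "inverse (emb (ofx (mp a))) \<in> L" by (rule m_inv)
    then have "inverse (emb (ofx (mp a))) * emb (ofx g) \<in> nonunits" using g by (intro nonunits_mult) (auto simp: m_def)
    then have "emb (ofx h) \<in> nonunits" by (simp add: h flip: mult.assoc)
    then show False using \<open>ofx h \<notin> m\<close> by (simp add: m_def)
  qed
  then have "inverse (ofp p) \<notin> L" using z(2) by (simp add: m_def nonunits_def emb_ofx)
  moreover have "val (ofp p) = 1" using ordv_p ordv_eq[OF is_val_Pt, of "ofp p"] by simp
  ultimately have "L = Pt z" using maximal_subring[OF closed_ring_L L_FF sub, of "ofp p"] by simp
  then show ?thesis using z(1) by blast
qed

text \<open>A localization equal to the whole field would force M = 0, and the chart would be a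
  field. This rules out the generic point once a chart has a nonzero non-unit.\<close>

lemma L_ne_FF:
  assumes "a \<in> C" "a \<noteq> 0" "inverse a \<notin> C" shows "L \<noteq> FF"
proof
  assume L: "L = FF"
  have M0: "x = 0" if "x \<in> M" for x
    using M_nonunits[OF that] L C(2) M_sub[OF that] by (auto simp: nonunits_def)
  then obtain c where "c \<in> C" "c * a + 1 \<in> M" using M_inv[OF assms(1)] assms(2) by blast
  then have "c * a = 1" using M0 by (metis Omega_add_eq_0)
  then have "c = inverse a" by (metis inverse_unique mult.commute inverse_inverse_eq)
  then show False using \<open>c \<in> C\<close> assms by simp
qed

end

lemma (in place) inverse_notin:
  assumes "C \<subseteq> P" "a \<in> FF" "a \<noteq> 0" "ordv P a \<ge> 1" shows "inverse a \<notin> C"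
proof
  assume "inverse a \<in> C"
  then have "inverse a \<in> P" using assms by auto
  then show False using v_inverse[of a] assms by (simp add: P_iff)
qed

section \<open>The closed points of the curve\<close>

lemma ygen_eq': "ygen ^ 2 + ygen = xgen ^ 3 + xgen"
proof -
  have "ofp cubic = xgen ^ 3 + xgen"
  proof -
    have "cubic = [:0, 1:] * ([:0, 1:] * [:0, 1:]) + [:0, 1:]" by (simp add: cubic_def)
    then have "ofp cubic = ofp ([:0, 1:] * ([:0, 1:] * [:0, 1:]) + [:0, 1:])" by simp
    then show ?thesis by (simp only: ofp_hom xgen_def power3_eq_cube mult.assoc)
  qed
  then show ?thesis using ygen_eq by (simp add: add.commute add.left_commute)
qed

context max_ideal begin

lemma chart_gen: "C = chart xi a \<Longrightarrow> b \<in> {1, xgen, ygen} \<Longrightarrow> b / a \<in> C"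
  unfolding chart_def by (auto intro!: generate_ring.incl)

text \<open>Dividing the equation by x^2 writes x as a polynomial in 1/x and y/x, so this chart has
  no point at infinity.\<close>

lemma chart_x_affine:
  assumes Cx: "C = chart xi xgen" shows "xgen \<in> L" "ygen \<in> L"
proof -
  note CD = closed_ringD[OF C(1)]
  define s where "s = 1 / xgen" define t where "t = ygen / xgen"
  have st: "s \<in> C" "t \<in> C" using chart_gen[OF Cx] by (simp_all add: s_def t_def)
  have "(ygen ^ 2 + ygen) / xgen ^ 2 = (xgen ^ 3 + xgen) / xgen ^ 2" using ygen_eq' by simp
  then have "t ^ 2 + t * s = xgen + s"
    by (simp add: s_def t_def add_divide_distrib power2_eq_square power3_eq_cube)
  then have x: "xgen = t ^ 2 + t * s + s" by (simp add: add.assoc)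
  also have "\<dots> \<in> C" using st CD by auto
  finally have "xgen \<in> C" .
  moreover then have "ygen \<in> C" using CD(4)[OF st(2)] by (force simp: t_def)
  ultimately show "xgen \<in> L" "ygen \<in> L" by (auto intro: C_L)
qed

lemma chart_y_affine:
  assumes Cy: "C = chart xi ygen" and s: "1 / ygen \<notin> M" shows "xgen \<in> L" "ygen \<in> L"
proof -
  have st: "1 / ygen \<in> C" "xgen / ygen \<in> C" using chart_gen[OF Cy] by simp_all
  have "inverse (1 / ygen) \<in> L" using inv_L st(1) s by blast
  then show y: "ygen \<in> L" by simp
  have "xgen / ygen * ygen \<in> L" using closed_ringD(4)[OF closed_ring_L C_L[OF st(2)] y] .
  then show "xgen \<in> L" by simp
qed

text \<open>With s = 1/y and t = x/y the equation reads t^3 = s (1 + s + t s). Where s vanishes the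
  second factor is a unit w, so t lies in M and s is t^3 up to a unit. Hence 1/x and y/x^2, which
  are s/t and s/t^2, lie in L, and these suffice to build every function without a pole at
  infinity.\<close>

lemma chart_y_infinite:
  assumes Cy: "C = chart xi ygen" and sM: "1 / ygen \<in> M" shows "L = Pinf"
proof -
  note CD = closed_ringD[OF C(1)] note LD = closed_ringD[OF closed_ring_L]
  define s where "s = 1 / ygen" define t where "t = xgen / ygen"
  have st: "s \<in> C" "t \<in> C" using chart_gen[OF Cy] by (simp_all add: s_def t_def)
  have nz: "s \<noteq> 0" "t \<noteq> 0" by (simp_all add: s_def t_def)
  define w where "w = 1 + (s + t * s)"
  have "(ygen ^ 2 + ygen) / ygen ^ 3 = (xgen ^ 3 + xgen) / ygen ^ 3" using ygen_eq' by simp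
  then have "s + s ^ 2 = t ^ 3 + t * s ^ 2"
    by (simp add: s_def t_def add_divide_distrib power2_eq_square power3_eq_cube)
  then have "t ^ 3 = (s + s ^ 2) + t * s ^ 2" by (simp add: add.assoc)
  then have t3: "t ^ 3 = s * w" by (simp add: w_def algebra_simps power2_eq_square)
  have sM': "s \<in> M" using sM by (simp add: s_def)
  have wm: "s + t * s \<in> M" using M_add[OF sM' M_mult[OF st(2) sM']] .
  have wC: "w \<in> C" unfolding w_def using CD(3)[OF CD(2) M_sub[OF wm]] .
  have wM: "w \<notin> M"
  proof
    assume "w \<in> M"
    then have "w + (s + t * s) \<in> M" using wm by (rule M_add)
    then show False using M_1 by (simp add: w_def add.assoc)
  qed
  have wnz: "w \<noteq> 0" using wM M_0 by auto
  have "w * s \<in> M" using M_mult[OF wC sM'] .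
  then have "t * (t * t) \<in> M" using t3 by (simp add: power3_eq_cube mult.commute mult.left_commute)
  then have tM: "t \<in> M" using M_prime[of t "t * t"] M_prime[of t t] st CD(4) by blast
  have iw: "inverse w \<in> L" using inv_L[OF wC wM] .
  define ix where "ix = 1 / xgen"
  have ix: "ix = s / t" by (simp add: ix_def s_def t_def)
  have sw: "s = t ^ 3 * inverse w" using t3 wnz by simp
  have tN: "t \<in> nonunits" using M_nonunits[OF tM] .
  then have tL: "t \<in> L" by (simp add: nonunits_def)
  have "ix = (t * inverse w) * t" using nz unfolding ix by (subst sw) (simp add: power3_eq_cube)
  then have ixN: "ix \<in> nonunits" using nonunits_mult[OF LD(4)[OF tL iw] tN] by simp
  then have ixL: "ix \<in> L" by (simp add: nonunits_def)
  have "ygen / xgen ^ 2 = s / t ^ 2" by (simp add: s_def t_def power2_eq_square)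
  also have "\<dots> = t * inverse w" using nz by (subst sw) (simp add: power3_eq_cube power2_eq_square)
  finally have yL: "ygen / xgen ^ 2 \<in> L" using LD(4)[OF tL iw] by simp
  have pL: "ofp q / xgen ^ n \<in> L" if "Polynomial.degree q \<le> n" for q n
    using that
  proof (induction q arbitrary: n)
    case (pCons c q)
    have "pCons c q = [:c:] + [:0, 1:] * q" by simp
    then have eq: "ofp (pCons c q) = ofp [:c:] + xgen * ofp q" by (simp only: ofp_hom xgen_def)
    have "ofp [:c:] \<in> L" using LD(1,2) by (cases c) (simp_all flip: one_pCons)
    then have c: "ofp [:c:] * ix ^ n \<in> L" using LD(4,5) ixL by blast
    show ?case
    proof (cases "q = 0")
      case True
      then show ?thesis using c by (simp add: ix_def divide_inverse power_inverse)
    next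
      case False
      then obtain m where n: "n = Suc m" "Polynomial.degree q \<le> m"
        using pCons.prems by (cases n) auto
      have "ofp (pCons c q) / xgen ^ n = ofp [:c:] * ix ^ n + ofp q / xgen ^ m"
        unfolding eq by (simp add: n ix_def add_divide_distrib divide_inverse power_inverse distrib_right)
      then show ?thesis using c pCons.IH[OF n(2)] LD(3) by simp
    qed
  qed (simp add: LD)
  \<comment> \<open>The leading coefficient of q is 1, so q divided by the top power of x is 1 plus
    a non-unit.\<close>
  have unitq: "inverse (ofp q / xgen ^ Polynomial.degree q) \<in> L" if "q \<noteq> 0" for q
  proof (cases "Polynomial.degree q")
    case 0
    then have "q = 1" using bit_poly_unit that by blast
    then show ?thesis using LD by simp
  next
    case (Suc m)
    define q' where "q' = q + Polynomial.monom 1 (Suc m)"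
    have lc: "Polynomial.coeff q (Suc m) = 1"
      using that Suc leading_coeff_0_iff[of q] bit_not_zero_iff by metis
    have "Polynomial.degree q' \<le> m"
    proof (rule degree_le, intro allI impI)
      fix i assume "m < i"
      then show "Polynomial.coeff q' i = 0"
        using lc Suc by (cases "i = Suc m") (auto simp: q'_def coeff_eq_0 simp del: monom_Suc)
    qed
    then have "ofp q' / xgen ^ m \<in> L" by (rule pL)
    then have N: "ofp q' / xgen ^ m * ix \<in> nonunits" using ixN by (rule nonunits_mult)
    have "ofp (Polynomial.monom 1 k) = xgen ^ k" for k
    proof (induction k)
      case (Suc k)
      have "Polynomial.monom 1 (Suc k) = [:0, 1:] * (Polynomial.monom 1 k :: bit poly)" by (simp add: Polynomial.monom_Suc)
      then show ?case using Suc by (simp only: ofp_hom xgen_def power_Suc)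
    qed (simp add: Polynomial.monom_0 flip: one_pCons)
    moreover have "q = Polynomial.monom 1 (Suc m) + q'" by (simp add: q'_def add.commute)
    ultimately have "ofp q = xgen ^ Suc m + ofp q'" by (metis (no_types) ofp_hom(3))
    then have "ofp q / xgen ^ Suc m = 1 + ofp q' / xgen ^ m * ix"
      by (simp add: add_divide_distrib ix_def)
    then show ?thesis using unit_one_plus[OF N] Suc by simp
  qed
  \<comment> \<open>A function r/q of nonnegative value has \<open>dg r\<close> at most 2 deg q;
    dividing numerator and denominator by x^(deg q) puts the numerator and the inverse of the
    denominator into L.\<close>
  have sub: "Pinf \<subseteq> L"
  proof
    fix f assume f: "f \<in> Pinf"
    then have fF: "f \<in> FF" by (simp add: Pinf_def)
    obtain r q where rq: "f = emb r / ofp q" "q \<noteq> 0" using FF_polyE[OF fF] .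
    show "f \<in> L"
    proof (cases "r = 0")
      case True then show ?thesis using rq LD by simp
    next
      case False
      let ?n = "Polynomial.degree q"
      have "vinf f = int (2 * ?n) - int (dg r)"
        using rq False vinf_eq[of r "ofx q"] by (simp add: emb_ofx)
      moreover have "f \<noteq> 0" using rq False by simp
      ultimately have "dg r \<le> 2 * ?n" using f by (simp add: Pinf_def)
      then have d: "Polynomial.degree (cst r) \<le> ?n" "lin r \<noteq> 0 \<Longrightarrow> Polynomial.degree (lin r) + 2 \<le> ?n"
        by (auto simp: dg_eq split: if_splits)
      have "ofp (lin r) * ygen / xgen ^ ?n \<in> L"
      proof (cases "lin r = 0")
        case False
        then have n: "?n = (?n - 2) + 2" using d(2) by simp
        have eq: "ofp (lin r) * ygen / xgen ^ ?n = ofp (lin r) / xgen ^ (?n - 2) * (ygen / xgen ^ 2)"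
          by (subst n) (simp add: power_add power2_eq_square)
        show ?thesis unfolding eq by (rule LD(4)[OF pL yL]) (use d(2)[OF False] in simp)
      qed (simp add: LD)
      then have "ofp (cst r) / xgen ^ ?n + ofp (lin r) * ygen / xgen ^ ?n \<in> L" using pL[OF d(1)] LD(3) by simp
      then have "(ofp (cst r) / xgen ^ ?n + ofp (lin r) * ygen / xgen ^ ?n) * inverse (ofp q / xgen ^ ?n) \<in> L"
        using unitq[OF rq(2)] by (rule LD(4))
      moreover have "f = (ofp (cst r) / xgen ^ ?n + ofp (lin r) * ygen / xgen ^ ?n) * inverse (ofp q / xgen ^ ?n)"
        using rq by (simp add: emb_def flip: add_divide_distrib)
      ultimately show ?thesis by simp
    qed
  qed
  have vt: "vinf t = 1"
    unfolding t_def xgen_emb ygen_emb by (subst vinf_eq) (simp_all add: coord_eq_iff dg_eq)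
  have "inverse t \<notin> L" using tN nz by (simp add: nonunits_def)
  then show ?thesis
    using inf.maximal_subring[OF closed_ring_L L_FF sub, of t] vt nz L_FF tL by auto
qed

end

text \<open>The residue field has 2^n elements, so modulo the kernel an element a outside it is
  inverted by a^(2^n - 2), a power which stays in C.\<close>

lemma contraction_max_ideal:
  assumes pl: "is_place P" and res: "is_res P n \<rho>" and C: "closed_ring C" "C \<subseteq> P"
  shows "is_max_ideal {f \<in> C. \<rho> f = 0} C"
proof -
  interpret place P by unfold_locales fact
  note PD = closed_ringD[OF closed_ring_P] note CD = closed_ringD[OF C(1)]
  have add: "\<rho> (f + g) = \<rho> f + \<rho> g" and mult: "\<rho> (f * g) = \<rho> f * \<rho> g" if "f \<in> P" "g \<in> P" for f g
    using res that by (auto simp: is_res_def)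
  have one: "\<rho> 1 = 1" and n: "n > 0" and im: "\<rho> ` P = Fqn n" using res by (auto simp: is_res_def)
  have zero: "\<rho> 0 = 0" using res PD(1) by (auto simp: is_res_def)
  have pow: "\<rho> (f ^ k) = \<rho> f ^ k" if "f \<in> P" for f k
    by (induction k) (use that one mult PD in auto)
  have inv: "\<exists>c\<in>C. c * a + 1 \<in> {f \<in> C. \<rho> f = 0}" if a: "a \<in> C" "\<rho> a \<noteq> 0" for a
  proof (rule bexI)
    have aP: "a \<in> P" using a C by auto
    then have "\<rho> a \<in> Fqn n" using im by auto
    then have F: "\<rho> a ^ (2 ^ n) = \<rho> a" by (simp add: Fqn_bit)
    have "(2::nat) \<le> 2 ^ n" using n by (metis One_nat_def Suc_leI power_increasing_iff one_less_numeral_iff power_one_right semiring_norm(76))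
    then have e: "(2::nat) ^ n = Suc (Suc (2 ^ n - 2))" by simp
    have c: "a ^ (2 ^ n - 2) \<in> C" using CD(5) a by blast
    show "a ^ (2 ^ n - 2) \<in> C" by (rule c)
    have "\<rho> a * (\<rho> a ^ (2 ^ n - 2) * \<rho> a) = \<rho> a" using F by (subst (asm) e) (simp add: mult_ac)
    then have "\<rho> a ^ (2 ^ n - 2) * \<rho> a = 1" using a(2) by simp
    then have "\<rho> (a ^ (2 ^ n - 2) * a + 1) = 0"
      using aP PD add mult pow one by simp
    moreover have "a ^ (2 ^ n - 2) * a + 1 \<in> C" using CD(2,3,4) c a(1) by blast
    ultimately show "a ^ (2 ^ n - 2) * a + 1 \<in> {f \<in> C. \<rho> f = 0}" by simp
  qed
  have CP: "x \<in> P" if "x \<in> C" for x using that C(2) by auto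
  show ?thesis
    unfolding is_max_ideal_def
    using inv CD(1-4) add[OF CP CP] mult[OF CP CP] zero one by auto
qed

lemma Pt_res: assumes "on_curve z" obtains m \<rho> where "is_res (Pt z) m \<rho>"
proof -
  interpret gpt z by unfold_locales fact
  obtain m where "m > 0" "kres = Fqn m" by (rule kres_Fqn)
  then show ?thesis using is_res_Pt that by blast
qed

lemma chart_Pt:
  assumes "on_curve z" "fst z \<noteq> 0" shows "chart xi xgen \<subseteq> Pt z"
proof -
  interpret gpt z by unfold_locales fact
  interpret valn "Pt z" val by unfold_locales (rule is_val_Pt)
  have "emb r / xgen \<in> Pt z" for r
    unfolding xgen_emb by (rule Pt_I) (use assms in simp)
  from this[of 1] this[of "ofx [:0, 1:]"] this[of "Coord 0 1"]
  have "b / xgen \<in> Pt z" if "b \<in> set xi" for b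
    using that by (auto simp: xgen_emb[symmetric] ygen_emb[symmetric])
  moreover have "kconst c \<in> Pt z" for c using closed_ringD(1,2)[OF closed_ring_P] by (simp add: kconst_bit)
  ultimately show ?thesis unfolding chart_def by (intro generate_ring_least closed_ring_P) auto
qed

lemma chart_Pinf: "chart xi ygen \<subseteq> Pinf"
proof -
  have "emb r / ygen \<in> Pinf" if "dg r \<le> 3" for r
  proof (cases "r = 0")
    case False
    have "vinf (emb r / ygen) = 3 - int (dg r)"
      unfolding ygen_emb using False by (subst vinf_eq) (simp_all add: coord_eq_iff dg_eq)
    then show ?thesis using that by (simp add: Pinf_def)
  qed (simp add: Pinf_def)
  from this[of 1] this[of "ofx [:0, 1:]"] this[of "Coord 0 1"]
  have "b / ygen \<in> Pinf" if "b \<in> set xi" for b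
    using that by (auto simp: xgen_emb[symmetric] ygen_emb[symmetric] dg_eq)
  moreover have "kconst c \<in> Pinf" for c by (simp add: kconst_bit Pinf_def)
  ultimately show ?thesis unfolding chart_def by (intro generate_ring_least inf.closed_ring_P) auto
qed

text \<open>Every maximal ideal of a chart belongs to an affine point, except one in the chart of y
  that contains 1/y. Conversely each of these local rings contains a chart, and the kernel of its
  residue map on that chart is a maximal ideal with the right localization.\<close>

theorem closed_points_xi: "closed_points xi = {Pt z | z. on_curve z} \<union> {Pinf}"
proof (rule antisym)
  show "closed_points xi \<subseteq> {Pt z | z. on_curve z} \<union> {Pinf}"
  proof
    fix P assume "P \<in> closed_points xi"
    then obtain a M where a: "a \<in> set xi" and M: "maximalideal M (Omega\<lparr>carrier := chart xi a\<rparr>)"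
      and P: "P = localization_at (chart xi a) M"
      by (auto simp: closed_points_def)
    interpret max_ideal "chart xi a" M
      by unfold_locales (use a M closed_ring_chart chart_subset_FF in \<open>auto simp: maximalideal_iff\<close>)
    consider "a = 1" | "a = xgen" | "a = ygen" "1 / ygen \<notin> M" | "a = ygen" "1 / ygen \<in> M" using a by auto
    then show "P \<in> {Pt z | z. on_curve z} \<union> {Pinf}"
    proof cases
      case 1
      have "xgen \<in> chart xi a" "ygen \<in> chart xi a" unfolding 1 chart_one xgen_emb ygen_emb by simp_all
      then have xy: "xgen \<in> L" "ygen \<in> L" by (auto intro: C_L)
      have "inverse xgen \<notin> range emb"
      proof
        assume "inverse xgen \<in> range emb"
        then obtain r where r: "emb r = inverse xgen" by (metis rangeE)
        then have "emb r * xgen = 1" by simp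
        then have "emb (r * ofx [:0, 1:]) = emb 1" by (simp only: emb_mult emb_hom xgen_emb)
        then have *: "r * ofx [:0, 1:] = 1" by (simp only: emb_eq_iff)
        then have "r \<noteq> 0" by auto
        then have "dg 1 \<ge> 2" using dg_mult[of r "ofx [:0, 1:]"] unfolding * by simp
        then show False by simp
      qed
      then have "L \<noteq> FF" by (intro L_ne_FF[of xgen]) (simp_all add: 1 chart_one, simp add: xgen_emb)
      then show ?thesis using affine_localization[OF xy] P by auto
    next
      case 2
      \<comment> \<open>A point with x = 1 shows that the chart is not a field: the element 1 + 1/x
        vanishes there.\<close>
      obtain b where z: "on_curve (1, b)" by (rule lift_point)
      interpret gpt "(1, b)" by unfold_locales (rule z)
      interpret place "Pt (1, b)" by unfold_locales (rule place_Pt)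
      obtain m where "m > 0" "kres = Fqn m" by (rule kres_Fqn)
      then have res: "is_res (Pt (1, b)) m res" using is_res_Pt by blast
      have sub: "chart xi a \<subseteq> Pt (1, b)" unfolding 2 by (rule chart_Pt[OF z]) simp
      define c where "c = 1 + 1 / xgen"
      have cC: "c \<in> chart xi a"
        using closed_ringD[OF closed_ring_chart[of xi a]] chart_gen[of a 1] by (simp add: c_def 2)
      have c: "c = emb (ofx [:1, 1:]) / emb (ofx [:0, 1:])"
      proof -
        have "[:1, 1:] = [:0, 1:] + (1 :: bit poly)" by (simp add: one_pCons)
        then have "emb (ofx [:1, 1:]) = xgen + 1" by (simp only: ofx_hom emb_hom xgen_emb)
        then show ?thesis by (simp add: c_def add_divide_distrib flip: xgen_emb)
      qed
      have "res c = 0" unfolding c by (subst res_eq) simp_all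
      moreover have "c \<noteq> 0" unfolding c by simp
      ultimately have "ordv (Pt (1, b)) c \<ge> 1" using res cC sub by (auto simp: is_res_def)
      then have "L \<noteq> FF" using L_ne_FF[OF cC \<open>c \<noteq> 0\<close>] inverse_notin[OF sub _ \<open>c \<noteq> 0\<close>] cC C(2) by auto
      then show ?thesis using affine_localization[OF chart_x_affine] 2 P by auto
    next
      case 3
      interpret place Pinf by unfold_locales (rule place_Pinf)
      have c: "1 / ygen \<in> chart xi a" using chart_gen[of a 1] 3 by simp
      have "vinf (1 / ygen) = 3"
        using vinf_eq[of 1 "Coord 0 1"] by (simp add: ygen_emb coord_eq_iff dg_eq)
      then have "ordv Pinf (1 / ygen) \<ge> 1" by (simp add: ordv_Pinf)
      then have "L \<noteq> FF"
        using L_ne_FF[OF c] inverse_notin[of "chart xi a" "1 / ygen"] chart_Pinf 3 by auto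
      then show ?thesis using affine_localization[OF chart_y_affine] 3 P by auto
    next
      case 4
      then show ?thesis using chart_y_infinite P by auto
    qed
  qed
  have "Pt z \<in> closed_points xi" if z: "on_curve z" for z
  proof -
    interpret gpt z by unfold_locales fact
    obtain m where m: "m > 0" "kres = Fqn m" by (rule kres_Fqn)
    then have res: "is_res (Pt z) m res" using is_res_Pt by blast
    have sub: "chart xi 1 \<subseteq> Pt z" unfolding chart_one using Pt_emb by auto
    let ?M = "{f \<in> chart xi 1. res f = 0}"
    have "is_max_ideal ?M (chart xi 1)" by (rule contraction_max_ideal[OF place_Pt res closed_ring_chart sub])
    then have "maximalideal ?M (Omega\<lparr>carrier := chart xi 1\<rparr>)" by (simp add: maximalideal_iff closed_ring_chart)
    moreover have "localization_at (chart xi 1) ?M = Pt z"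
    proof -
      have re: "res (emb r) = e r" for r using res_eq[of 1 r] by simp
      show ?thesis
      proof (intro Set.set_eqI iffI)
        fix x assume "x \<in> localization_at (chart xi 1) ?M"
        then show "x \<in> Pt z" unfolding localization_at_def chart_one using re by (auto intro: Pt_I)
      next
        fix x assume "x \<in> Pt z"
        then obtain r s where *: "e s \<noteq> 0" "x = emb r / emb s" by (metis Pt_E)
        have "emb s \<notin> ?M" using * re by simp
        then show "x \<in> localization_at (chart xi 1) ?M"
          unfolding localization_at_def chart_one using *(2) by blast
      qed
    qed
    ultimately show ?thesis unfolding closed_points_def by force
  qed
  moreover have "Pinf \<in> closed_points xi"
  proof -
    obtain \<rho> where res: "is_res Pinf 1 \<rho>" using is_res_Pinf by blast
    let ?M = "{f \<in> chart xi ygen. \<rho> f = 0}"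
    have M: "is_max_ideal ?M (chart xi ygen)"
      by (rule contraction_max_ideal[OF place_Pinf res closed_ring_chart chart_Pinf])
    interpret max_ideal "chart xi ygen" ?M
      by unfold_locales (use M closed_ring_chart chart_subset_FF in auto)
    have c: "1 / ygen \<in> chart xi ygen" using chart_gen[of ygen 1] by simp
    have "vinf (1 / ygen) = 3"
      using vinf_eq[of 1 "Coord 0 1"] by (simp add: ygen_emb coord_eq_iff dg_eq)
    then have "\<rho> (1 / ygen) = 0" using res c chart_Pinf by (auto simp: is_res_def ordv_Pinf)
    then have "L = Pinf" using chart_y_infinite c by simp
    moreover have "maximalideal ?M (Omega\<lparr>carrier := chart xi ygen\<rparr>)"
      using M by (simp add: maximalideal_iff closed_ring_chart)
    ultimately show ?thesis unfolding closed_points_def by force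
  qed
  ultimately show "{Pt z | z. on_curve z} \<union> {Pinf} \<subseteq> closed_points xi" by auto
qed

lemma Fqn_card: "n > 0 \<Longrightarrow> finite (Fqn n :: bit alg_closure set)" "n > 0 \<Longrightarrow> card (Fqn n :: bit alg_closure set) = 2 ^ n"
  using finite_card_Fqn by auto

lemma is_res_sum:
  assumes "is_place P" "is_res P n \<rho>" "finite B" "B \<subseteq> P"
  shows "(\<Sum>b\<in>B. kscale (f b) b) \<in> P \<and> \<rho> (\<Sum>b\<in>B. kscale (f b) b) = (\<Sum>b\<in>B. acscale (f b) (\<rho> b))"
  using assms(3,4)
proof (induction B rule: finite_induct)
  interpret place P by unfold_locales fact
  note PD = closed_ringD[OF closed_ring_P]
  {
    case empty
    then show ?case using assms(2) PD(1) by (auto simp: is_res_def)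
  next
    case (insert b B)
    have z: "\<rho> 0 = 0" using assms(2) PD(1) by (auto simp: is_res_def)
    have "kscale (f b) b \<in> P" using insert PD(1) by (auto simp: kscale_bit)
    moreover have "\<rho> (kscale (f b) b) = acscale (f b) (\<rho> b)" using z by (simp add: kscale_bit acscale_bit)
    ultimately show ?case using insert PD(3) assms(2) by (auto simp: is_res_def)
  }
qed

lemma is_res_kernel: "is_place P \<Longrightarrow> is_res P n \<rho> \<Longrightarrow> max_power P 1 = {f \<in> P. \<rho> f = 0}"
proof -
  assume P: "is_place P" and r: "is_res P n \<rho>"
  interpret place P by unfold_locales fact
  show ?thesis using r by (auto simp: max_power_eq P_iff is_res_def)
qed

text \<open>A basis of F_(2^n) lifts through the residue map, which gives existence. Any admissible
  B makes the coefficient functions on B correspond to F_(2^n), so 2^d = 2^n, which makes the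
  definite description well defined.\<close>

lemma point_degree_eq:
  assumes P: "is_place P" and r: "is_res P n \<rho>"
  shows "point_degree P = n"
proof -
  interpret place P by unfold_locales fact
  note PD = closed_ringD[OF closed_ring_P]
  have n: "n > 0" and im: "\<rho> ` P = Fqn n" using r by (auto simp: is_res_def)
  have radd: "\<rho> (f + g) = \<rho> f + \<rho> g" if "f \<in> P" "g \<in> P" for f g using r that by (auto simp: is_res_def)
  note ker = is_res_kernel[OF P r] note sm = is_res_sum[OF P r]
  define Q where "Q d B \<longleftrightarrow> B \<subseteq> P \<and> finite B \<and> card B = d \<and>
     (\<forall>x\<in>P. \<exists>f. x - (\<Sum>b\<in>B. kscale (f b) b) \<in> max_power P 1) \<and>
     (\<forall>f. (\<Sum>b\<in>B. kscale (f b) b) \<in> max_power P 1 \<longrightarrow> (\<forall>b\<in>B. f b = 0))" for d B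
  have "\<exists>B. Q n B"
  proof -
    have "acspace.subspace (Fqn n)" by (rule acspace_subspaceI) simp_all
    then obtain B0 where B0: "B0 \<subseteq> Fqn n" "finite B0" "card (Fqn n :: bit alg_closure set) = 2 ^ card B0"
      "card B0 = acspace.dim (Fqn n)"
      "\<And>x. x \<in> Fqn n \<Longrightarrow> \<exists>f. x = (\<Sum>b\<in>B0. acscale (f b) b)"
      "\<And>f. (\<Sum>b\<in>B0. acscale (f b) b) = 0 \<Longrightarrow> \<forall>b\<in>B0. f b = 0"
      "acspace.independent B0"
      by (rule finite_subspace_basis[OF acspace.vector_space_axioms _ Fqn_card(1)[OF n]]) (rule that; blast)
    have cB: "card B0 = n" using B0(3) Fqn_card(2)[OF n] by simp
    have "\<exists>g. \<forall>b\<in>B0. g b \<in> P \<and> \<rho> (g b) = b"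
    proof (rule bchoice, rule ballI)
      fix b assume "b \<in> B0"
      then have "b \<in> \<rho> ` P" using B0(1) im by auto
      then show "\<exists>x. x \<in> P \<and> \<rho> x = b" by auto
    qed
    then obtain g where g: "\<And>b. b \<in> B0 \<Longrightarrow> g b \<in> P \<and> \<rho> (g b) = b" by blast
    then have inj: "inj_on g B0" by (metis inj_onI)
    let ?B = "g ` B0"
    have B: "?B \<subseteq> P" "finite ?B" "card ?B = n" using g B0 cB card_image[OF inj] by auto
    have sm': "\<rho> (\<Sum>b\<in>?B. kscale (f b) b) = (\<Sum>b\<in>B0. acscale (f (g b)) b)" for f
      using sm[OF B(2,1)] sum.reindex[OF inj, of "\<lambda>b. acscale (f b) (\<rho> b)"] g by simp
    have "\<exists>f. x - (\<Sum>b\<in>?B. kscale (f b) b) \<in> max_power P 1" if x: "x \<in> P" for x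
    proof -
      have "\<rho> x \<in> Fqn n" using im x by auto
      then obtain h where h: "\<rho> x = (\<Sum>b\<in>B0. acscale (h b) b)" using B0(5) by blast
      let ?f = "\<lambda>y. h (\<rho> y)"
      have "(\<Sum>b\<in>B0. acscale (?f (g b)) b) = \<rho> x" unfolding h using g by (intro sum.cong) auto
      then have "\<rho> (x + (\<Sum>b\<in>?B. kscale (?f b) b)) = 0" using radd[OF x] sm[OF B(2,1)] sm'[of ?f] by simp
      moreover have "x + (\<Sum>b\<in>?B. kscale (?f b) b) \<in> P" by (rule PD(3)[OF x conjunct1[OF sm[OF B(2,1)]]])
      ultimately have "x - (\<Sum>b\<in>?B. kscale (?f b) b) \<in> max_power P 1" by (simp add: ker)
      then show ?thesis by (rule exI[of _ ?f])
    qed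
    moreover have "\<forall>b\<in>?B. f b = 0" if "(\<Sum>b\<in>?B. kscale (f b) b) \<in> max_power P 1" for f
      using B0(6)[of "\<lambda>b. f (g b)"] that sm' by (simp add: ker)
    ultimately have "Q n ?B" using B by (simp add: Q_def)
    then show ?thesis ..
  qed
  moreover have "d = n" if "Q d B" for d B
  proof -
    from that have B: "B \<subseteq> P" "finite B" "card B = d" by (simp_all add: Q_def)
    let ?F = "\<lambda>f. \<rho> (\<Sum>b\<in>B. kscale (f b) b)"
    have "inj_on ?F (B \<rightarrow>\<^sub>E UNIV)"
    proof (rule inj_onI)
      fix f g assume fg: "f \<in> B \<rightarrow>\<^sub>E UNIV" "g \<in> B \<rightarrow>\<^sub>E UNIV" "?F f = ?F g"
      have eq: "(\<Sum>b\<in>B. kscale (f b) b) + (\<Sum>b\<in>B. kscale (g b) b) = (\<Sum>b\<in>B. kscale (f b + g b) b)"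
        by (simp add: kspace.scale_left_distrib sum.distrib)
      have "\<rho> (\<Sum>b\<in>B. kscale (f b + g b) b) = 0"
        unfolding eq[symmetric] using radd sm[OF B(2,1)] fg(3) by simp
      then have "(\<Sum>b\<in>B. kscale (f b + g b) b) \<in> max_power P 1"
        unfolding ker using conjunct1[OF sm[OF B(2,1), of "\<lambda>b. f b + g b"]] by simp
      moreover have "\<forall>f. (\<Sum>b\<in>B. kscale (f b) b) \<in> max_power P 1 \<longrightarrow> (\<forall>b\<in>B. f b = 0)" using that by (simp add: Q_def)
      from this[THEN spec, of "\<lambda>b. f b + g b"]
      have "(\<Sum>b\<in>B. kscale (f b + g b) b) \<in> max_power P 1 \<longrightarrow> (\<forall>b\<in>B. f b + g b = 0)" .
      ultimately have *: "\<forall>b\<in>B. f b + g b = 0" by (rule rev_mp)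
      have "f b = g b" if "b \<in> B" for b using bspec[OF * that] by (cases "f b"; cases "g b") auto
      then show "f = g" using fg by (intro PiE_ext) auto
    qed
    then have "card (?F ` (B \<rightarrow>\<^sub>E UNIV)) = 2 ^ d" using B by (simp add: card_image card_PiE)
    moreover have "?F ` (B \<rightarrow>\<^sub>E UNIV) = Fqn n"
    proof (rule antisym)
      have "?F f \<in> Fqn n" for f unfolding im[symmetric] by (rule imageI[OF conjunct1[OF sm[OF B(2,1)]]])
      then show "?F ` (B \<rightarrow>\<^sub>E UNIV) \<subseteq> Fqn n" by auto
      show "Fqn n \<subseteq> ?F ` (B \<rightarrow>\<^sub>E UNIV)"
      proof
        fix y :: "bit alg_closure" assume "y \<in> Fqn n"
        then obtain x where x: "x \<in> P" "y = \<rho> x" using im by auto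
        have "\<forall>x\<in>P. \<exists>f. x - (\<Sum>b\<in>B. kscale (f b) b) \<in> max_power P 1"
          using that unfolding Q_def by (elim conjE)
        from bspec[OF this x(1)] obtain f where f: "x - (\<Sum>b\<in>B. kscale (f b) b) \<in> max_power P 1"
          by (rule exE)
        then have "\<rho> x + ?F f = 0" using radd[OF x(1)] sm[OF B(2,1)] by (simp add: ker)
        then have "y = ?F f" using x by simp
        also have "\<dots> = ?F (restrict f B)" by (intro arg_cong[of _ _ \<rho>] sum.cong) auto
        finally show "y \<in> ?F ` (B \<rightarrow>\<^sub>E UNIV)" by (rule image_eqI[of _ ?F "restrict f B"]) simp
      qed
    qed
    ultimately show "d = n" using Fqn_card(2)[OF n] by simp
  qed
  ultimately have "(THE d. \<exists>B. Q d B) = n" by (intro the_equality) blast+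
  then show ?thesis unfolding point_degree_def Q_def .
qed

abbreviation CP :: "bit univ_field set set" where "CP \<equiv> closed_points xi"

lemma CP_cases:
  assumes "P \<in> CP" obtains "P = Pinf" | z where "on_curve z" "P = Pt z"
  using assms that unfolding closed_points_xi by blast

lemma Pt_CP [simp]: "on_curve z \<Longrightarrow> Pt z \<in> CP" and Pinf_CP [simp]: "Pinf \<in> CP"
  unfolding closed_points_xi by blast+

lemma CP_place: "P \<in> CP \<Longrightarrow> is_place P"
  using gpt.place_Pt gpt.intro place_Pinf by (metis CP_cases)

lemma CP_res: assumes "P \<in> CP" obtains \<rho> where "is_res P (point_degree P) \<rho>"
proof -
  have "\<exists>n \<rho>. is_res P n \<rho>" using assms Pt_res is_res_Pinf by (metis CP_cases)
  then show ?thesis using that point_degree_eq CP_place[OF assms] by metis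
qed

lemma point_degree_pos: "P \<in> CP \<Longrightarrow> point_degree P > 0"
  by (erule CP_res) (simp add: is_res_def)

lemma point_degree_Pinf [simp]: "point_degree Pinf = 1"
  using is_res_Pinf point_degree_eq place_Pinf by metis

lemma Pt_not_Pinf [simp]: "Pt z \<noteq> Pinf" if "on_curve z"
proof -
  interpret gpt z by unfold_locales fact
  have "xgen \<in> Pt z" using Pt_emb by (simp add: xgen_emb)
  moreover have "vinf xgen = -2" by (simp add: xgen_emb vinf_emb coord_eq_iff dg_eq)
  ultimately show ?thesis by (auto simp: Pinf_def)
qed

context gpt begin

lemma point_degree_Pt: "kres = Fqn m \<Longrightarrow> m > 0 \<Longrightarrow> point_degree (Pt z) = m"
  using point_degree_eq[OF place_Pt is_res_Pt] by blast

lemma card_kres: "card kres = 2 ^ point_degree (Pt z)"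
proof -
  obtain m where "m > 0" "kres = Fqn m" "card kres = 2 ^ m" by (rule kres_Fqn)
  then show ?thesis using point_degree_Pt by simp
qed

lemma ordv_emb:
  assumes "r \<noteq> 0" shows "ordv (Pt z) (emb r) \<ge> 0" "ordv (Pt z) (emb r) \<ge> 1 \<longleftrightarrow> e r = 0"
proof -
  interpret place "Pt z" by unfold_locales (rule place_Pt)
  show "ordv (Pt z) (emb r) \<ge> 0" using Pt_emb[of r] assms by (simp add: P_iff)
  obtain m where "m > 0" "kres = Fqn m" by (rule kres_Fqn)
  then have "res (emb r) = 0 \<longleftrightarrow> emb r = 0 \<or> ordv (Pt z) (emb r) \<ge> 1"
    using is_res_Pt Pt_emb[of r] by (auto simp: is_res_def)
  moreover have "res (emb r) = e r" using res_eq[of 1 r] by simp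
  ultimately show "ordv (Pt z) (emb r) \<ge> 1 \<longleftrightarrow> e r = 0" using assms by simp
qed

lemma ordv_emb_factor:
  assumes "e s \<noteq> 0" "e r' \<noteq> 0" "s * r = ofx p ^ n * r'"
  shows "ordv (Pt z) (emb r) = int n"
proof -
  have "emb s \<noteq> 0" using assms(1) by auto
  have "emb s * emb r = ofp p ^ n * emb r'" using assms(3) by (metis emb_mult emb_ofx emb_power)
  then have eq: "emb r = ofp p powi int n * (emb r' / emb s)" using \<open>emb s \<noteq> 0\<close> by (simp add: field_simps)
  have u: "unit (emb r' / emb s)" using unit_I assms by blast
  have "emb r \<noteq> 0" unfolding eq using unit_nz[OF u] by simp
  then show ?thesis using ordv_eq[OF is_val_Pt, of "emb r"] val_eq[OF u, of "int n"] eq by simp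
qed

end

lemma gptI: "on_curve z \<Longrightarrow> gpt z"
  by unfold_locales

lemma conj_ofx_power: "conj (ofx q ^ n) = ofx q ^ n"
  using conj_ofx[of "q ^ n"] by simp

lemma ordv_conj:
  assumes z: "on_curve z" and r: "r \<noteq> 0"
  shows "ordv (Pt (conjp z)) (emb r) = ordv (Pt z) (emb (conj r))"
proof -
  interpret gpt z by unfold_locales fact
  interpret c: gpt "conjp z" by unfold_locales (simp add: z)
  obtain n s r' where *: "e s \<noteq> 0" "e r' \<noteq> 0" "s * conj r = ofx p ^ n * r'" using coord_factor[of "conj r"] r by auto
  have "conj (s * conj r) = conj (ofx p ^ n * r')" using *(3) by simp
  then have "conj s * r = ofx p ^ n * conj r'" by (simp only: conj_mult conj_conj conj_ofx_power)
  moreover have "ev (conjp z) (conj s) \<noteq> 0" "ev (conjp z) (conj r') \<noteq> 0" using * by (simp_all add: ev_conj)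
  ultimately have "ordv (Pt (conjp z)) (emb r) = int n" using c.ordv_emb_factor[of "conj s" "conj r'"] by simp
  then show ?thesis using ordv_emb_factor[OF *] by simp
qed

lemma point_degree_conj: assumes "on_curve z" shows "point_degree (Pt (conjp z)) = point_degree (Pt z)"
proof -
  interpret gpt z by unfold_locales fact
  interpret c: gpt "conjp z" by unfold_locales (simp add: assms)
  have "range (ev (conjp z)) = range (ev z)"
    by (metis (no_types, lifting) conj_conj ev_conj image_subset_iff rangeI subset_antisym)
  then show ?thesis using card_kres c.card_kres unfolding kres_def c.kres_def by simp
qed

text \<open>Several geometric points define one closed point, so conjugation of closed points has to
  be independent of the representative. The local ring at the conjugate is therefore described by
  valuations at the point itself.\<close>

lemma Pt_eq_conj: assumes z: "on_curve z" "on_curve w" and eq: "Pt z = Pt w" shows "Pt (conjp z) = Pt (conjp w)"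
proof -
  have *: "f \<in> Pt (conjp z) \<longleftrightarrow> f = 0 \<or> (\<exists>r s. f = emb r / emb s \<and> r \<noteq> 0 \<and> s \<noteq> 0 \<and> ordv (Pt z) (emb (conj r)) \<ge> ordv (Pt z) (emb (conj s)))"
    if z: "on_curve z" for f z
  proof -
    interpret c: gpt "conjp z" by unfold_locales (simp add: z)
    interpret place "Pt (conjp z)" by unfold_locales (rule c.place_Pt)
    have v: "ordv (Pt (conjp z)) (emb r / emb s) = ordv (Pt z) (emb (conj r)) - ordv (Pt z) (emb (conj s))"
      if "r \<noteq> 0" "s \<noteq> 0" for r s
      using that v_divide[of "emb r" "emb s"] ordv_conj[OF z] by simp
    show ?thesis
    proof (cases "f \<in> FF \<and> f \<noteq> 0")
      case True
      then obtain r s where rs: "f = emb r / emb s" "s \<noteq> 0" "r \<noteq> 0" using FF_nz_E by metis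
      show ?thesis
      proof
        assume "f \<in> Pt (conjp z)"
        then have "ordv (Pt z) (emb (conj r)) \<ge> ordv (Pt z) (emb (conj s))"
          using v[OF rs(3,2)] True rs(1) by (simp add: P_iff)
        then show "f = 0 \<or> (\<exists>r s. f = emb r / emb s \<and> r \<noteq> 0 \<and> s \<noteq> 0 \<and> ordv (Pt z) (emb (conj r)) \<ge> ordv (Pt z) (emb (conj s)))"
          using rs by blast
      next
        assume "f = 0 \<or> (\<exists>r s. f = emb r / emb s \<and> r \<noteq> 0 \<and> s \<noteq> 0 \<and> ordv (Pt z) (emb (conj r)) \<ge> ordv (Pt z) (emb (conj s)))"
        then obtain r s where rs: "f = emb r / emb s" "r \<noteq> 0" "s \<noteq> 0" "ordv (Pt z) (emb (conj r)) \<ge> ordv (Pt z) (emb (conj s))"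
          using True by blast
        show "f \<in> Pt (conjp z)" using v[OF rs(2,3)] True rs(1,4) by (simp add: P_iff)
      qed
    qed (auto simp: P_iff intro: FF_I)
  qed
  show ?thesis by (rule Set.set_eqI) (simp only: *[OF z(1)] *[OF z(2)] eq)
qed

section \<open>Principal divisors\<close>

definition divf :: "bit univ_field \<Rightarrow> bit univ_field set \<Rightarrow> int" where
  "divf f P = (if P \<in> CP then ordv P f else 0)"

lemma divisor_degree_sum:
  assumes "finite S" "supp D \<subseteq> S"
  shows "divisor_degree D = (\<Sum>P\<in>S. D P * int (point_degree P))"
  unfolding divisor_degree_def
  by (rule sum.mono_neutral_left) (use assms in \<open>auto simp: supp_def\<close>)

lemma divisor_degree_add:
  assumes "finite (supp D)" "finite (supp E)"
  shows "divisor_degree (\<lambda>P. D P + E P) = divisor_degree D + divisor_degree E"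
proof -
  let ?S = "supp D \<union> supp E"
  have "supp (\<lambda>P. D P + E P) \<subseteq> ?S" by (auto simp: supp_def)
  then show ?thesis
    using divisor_degree_sum[of ?S D] divisor_degree_sum[of ?S E] divisor_degree_sum[of ?S "\<lambda>P. D P + E P"] assms
    by (simp add: sum.distrib distrib_right)
qed

lemma on_curve_fiber: assumes "on_curve z" "on_curve w" "fst w = fst z" shows "w = z \<or> w = conjp z"
proof -
  have "snd z ^ 2 + snd z = snd w ^ 2 + snd w"
    using assms by (simp add: on_curve_def add.commute add.left_commute)
  then have "(snd z ^ 2 + snd z) + (snd w ^ 2 + snd w) = 0" by simp
  then have "(snd z + snd w) ^ 2 + (snd z + snd w) = 0" by (simp add: ac_sum_sq algebra_simps)
  then have "(snd z + snd w) * (snd z + snd w + 1) = 0" by (simp add: power2_eq_square algebra_simps)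
  then consider "snd z + snd w = 0" | "snd z + snd w + 1 = 0" by (metis mult_eq_0_iff)
  then have "snd w = snd z \<or> snd w = snd z + 1"
  proof cases
    case 2
    then have "(snd z + 1) + snd w = 0" by (simp only: add_ac)
    then have "snd z + 1 = snd w" by (simp only: ac_add_eq_0)
    then show ?thesis by simp
  qed simp
  then show ?thesis using assms(3) by (auto simp: prod_eq_iff)
qed

lemma finite_fiber: "finite {z. on_curve z \<and> fst z = a}"
proof -
  obtain b where b: "on_curve (a, b)" by (rule lift_point)
  have "{z. on_curve z \<and> fst z = a} \<subseteq> {(a, b), conjp (a, b)}" using on_curve_fiber[OF b] by auto
  then show ?thesis by (rule finite_subset) simp
qed

lemma finite_supp_emb: assumes "r \<noteq> 0" shows "finite {P \<in> CP. ordv P (emb r) \<noteq> 0}"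
proof -
  let ?A = "{a. evp (nrm r) a = 0}"
  have "finite ?A" unfolding evp_def by (rule poly_roots_finite) (use assms in \<open>simp add: map_poly_eq_0_iff\<close>)
  have "{P \<in> CP. ordv P (emb r) \<noteq> 0} \<subseteq> insert Pinf (Pt ` (\<Union>a\<in>?A. {z. on_curve z \<and> fst z = a}))"
  proof
    fix P assume P: "P \<in> {P \<in> CP. ordv P (emb r) \<noteq> 0}"
    then have "P \<in> CP" by simp
    then show "P \<in> insert Pinf (Pt ` (\<Union>a\<in>?A. {z. on_curve z \<and> fst z = a}))"
    proof (cases rule: CP_cases)
      case (2 z)
      interpret gpt z by unfold_locales fact
      have "e r = 0" using ordv_emb[OF assms] P 2 by auto
      then have "evp (nrm r) (fst z) = 0" using evp_nrm[OF 2(1), of r] by simp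
      then show ?thesis using 2 by blast
    qed simp
  qed
  then show ?thesis by (rule finite_subset) (use \<open>finite ?A\<close> finite_fiber in auto)
qed

lemma divf_mult: assumes "f \<in> FF" "g \<in> FF" "f \<noteq> 0" "g \<noteq> 0" shows "divf (f * g) = (\<lambda>P. divf f P + divf g P)"
proof
  fix P
  show "divf (f * g) P = divf f P + divf g P"
  proof (cases "P \<in> CP")
    case True
    interpret place P by unfold_locales (rule CP_place[OF True])
    show ?thesis using assms True by (simp add: divf_def v_mult)
  qed (simp add: divf_def)
qed

lemma divf_inverse: assumes "f \<in> FF" "f \<noteq> 0" shows "divf (inverse f) = (\<lambda>P. - divf f P)"
proof
  fix P
  show "divf (inverse f) P = - divf f P"
  proof (cases "P \<in> CP")
    case True
    interpret place P by unfold_locales (rule CP_place[OF True])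
    show ?thesis using assms True by (simp add: divf_def v_inverse)
  qed (simp add: divf_def)
qed

lemma supp_divf: "supp (divf f) = {P \<in> CP. ordv P f \<noteq> 0}"
  by (auto simp: supp_def divf_def)

lemma finite_supp_divf: assumes "f \<in> FF" "f \<noteq> 0" shows "finite (supp (divf f))"
proof -
  obtain r s where *: "f = emb r / emb s" "s \<noteq> 0" "r \<noteq> 0" using FF_nz_E assms by metis
  then have "divf f = (\<lambda>P. divf (emb r) P + - divf (emb s) P)"
    using divf_mult[of "emb r" "inverse (emb s)"] divf_inverse[of "emb s"] by (simp add: divide_inverse)
  then have "supp (divf f) \<subseteq> supp (divf (emb r)) \<union> supp (divf (emb s))" by (auto simp: supp_def)
  then show ?thesis by (rule finite_subset) (use finite_supp_emb * in \<open>simp add: supp_divf\<close>)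
qed

definition ddeg :: "bit univ_field \<Rightarrow> int" where "ddeg f = divisor_degree (divf f)"

lemma ddeg_mult: "f \<in> FF \<Longrightarrow> g \<in> FF \<Longrightarrow> f \<noteq> 0 \<Longrightarrow> g \<noteq> 0 \<Longrightarrow> ddeg (f * g) = ddeg f + ddeg g"
  by (simp add: ddeg_def divf_mult divisor_degree_add finite_supp_divf)

lemma ddeg_1 [simp]: "ddeg 1 = 0"
  using ddeg_mult[of 1 1] by simp

section \<open>Closed points over a point of the x-line\<close>

lemma card_small_polys: "finite {q :: bit poly. q = 0 \<or> Polynomial.degree q < d} \<and>
    card {q :: bit poly. q = 0 \<or> Polynomial.degree q < d} = 2 ^ d"
proof (induction d)
  case (Suc d)
  let ?T = "\<lambda>d. {q :: bit poly. q = 0 \<or> Polynomial.degree q < d}"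
  have "?T (Suc d) = (\<lambda>(c, q). pCons c q) ` (UNIV \<times> ?T d)"
  proof (rule antisym)
    show "?T (Suc d) \<subseteq> (\<lambda>(c, q). pCons c q) ` (UNIV \<times> ?T d)"
    proof
      fix q :: "bit poly" assume q: "q \<in> ?T (Suc d)"
      obtain c h where h: "q = pCons c h" by (rule pCons_cases)
      have "h \<in> ?T d" using q by (cases "h = 0") (auto simp: h)
      then show "q \<in> (\<lambda>(c, q). pCons c q) ` (UNIV \<times> ?T d)" by (intro image_eqI[of _ _ "(c, h)"]) (simp_all add: h)
    qed
    show "(\<lambda>(c, q). pCons c q) ` (UNIV \<times> ?T d) \<subseteq> ?T (Suc d)"
      by (auto simp: degree_pCons_eq_if split: if_splits)
  qed
  moreover have "inj_on (\<lambda>(c, q). pCons c q) (UNIV \<times> ?T d)" by (auto intro: inj_onI)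
  ultimately show ?case using Suc by (simp add: card_image card_cartesian_product)
qed simp

lemma card_range_evp:
  shows "finite (range (\<lambda>q. evp q a)) \<and> card (range (\<lambda>q. evp q a)) = 2 ^ Polynomial.degree (mp a)"
proof -
  let ?T = "{q :: bit poly. q = 0 \<or> Polynomial.degree q < Polynomial.degree (mp a)}"
  have "range (\<lambda>q. evp q a) = (\<lambda>q. evp q a) ` ?T"
  proof (rule antisym, rule subsetI)
    fix x assume "x \<in> range (\<lambda>q. evp q a)"
    then obtain q where x: "x = evp q a" by auto
    have "q = q div mp a * mp a + q mod mp a" by simp
    then have "evp q a = evp (q div mp a) a * evp (mp a) a + evp (q mod mp a) a" by (metis evp_add evp_mult)
    then have "x = evp (q mod mp a) a" using x by simp
    moreover have "q mod mp a \<in> ?T" using degree_mod_less[OF mp_nz, of q a] by auto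
    ultimately show "x \<in> (\<lambda>q. evp q a) ` ?T" by (rule image_eqI)
  qed auto
  moreover have "inj_on (\<lambda>q. evp q a) ?T"
  proof (rule inj_onI)
    fix p q assume pq: "p \<in> ?T" "q \<in> ?T" "evp p a = evp q a"
    have "evp (p + q) a = 0" using pq by simp
    moreover have "p + q = 0 \<or> Polynomial.degree (p + q) < Polynomial.degree (mp a)"
      using pq degree_add_less[of p "Polynomial.degree (mp a)" q] degree_mp_pos[of a] by auto
    ultimately have "p + q = 0" using mp_least[of "p + q" a] by fastforce
    then show "p = q" by (metis bit_poly_add_cancel add.right_neutral)
  qed
  ultimately show ?thesis using card_small_polys[of "Polynomial.degree (mp a)"] by (simp add: card_image)
qed

text \<open>The split and the inert case. The residue field is generated by the y-coordinate over
  the field K of the x-coordinate. If y lies in K nothing is added and the conjugates differ.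
  Otherwise 1 and y are independent over K, which doubles the degree, and a function vanishing at z
  has both coefficients zero at x, so it vanishes at the conjugate too.\<close>

lemma (in gpt) fiber_degree:
  shows "Pt z \<noteq> Pt (conjp z) \<and> point_degree (Pt z) = Polynomial.degree p \<and> snd z \<in> range (\<lambda>q. evp q (fst z)) \<or>
    Pt z = Pt (conjp z) \<and> point_degree (Pt z) = 2 * Polynomial.degree p \<and> snd z \<notin> range (\<lambda>q. evp q (fst z))"
proof -
  let ?K = "range (\<lambda>q. evp q (fst z))"
  have Kadd: "x + y \<in> ?K" if "x \<in> ?K" "y \<in> ?K" for x y
    using that by (auto simp flip: evp_add)
  have Kmult: "x * y \<in> ?K" if "x \<in> ?K" "y \<in> ?K" for x y
    using that by (auto simp flip: evp_mult)
  show ?thesis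
  proof (cases "snd z \<in> ?K")
    case True
    then obtain u where u: "snd z = evp u (fst z)" by auto
    have "kres = ?K"
    proof (rule antisym)
      show "kres \<subseteq> ?K" unfolding kres_def ev_def using True by (auto intro!: Kadd Kmult)
      have "evp q (fst z) \<in> kres" for q unfolding kres_def by (metis ev_simps(4) rangeI)
      then show "?K \<subseteq> kres" by auto
    qed
    then have deg: "point_degree (Pt z) = Polynomial.degree p" using card_kres card_range_evp[of "fst z"] by simp
    \<comment> \<open>The function u(x) + y takes the value 0 at z and 1 at its conjugate.\<close>
    let ?r = "Coord u 1"
    have r: "?r \<noteq> 0" "e ?r = 0" "ev (conjp z) ?r \<noteq> 0" by (simp_all add: coord_eq_iff ev_def u)
    interpret c: gpt "conjp z" by unfold_locales (simp add: oc)
    have "Pt z \<noteq> Pt (conjp z)"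
      using ordv_emb[OF r(1)] c.ordv_emb[OF r(1)] r(2,3) by auto
    then show ?thesis using deg True by blast
  next
    case False
    have inv: "inverse x \<in> ?K" if "x \<in> ?K" for x
    proof (cases "x = 0")
      case True
      then show ?thesis using that by simp
    next
      case False
      obtain m where m: "?K = Fqn m" "m > 0"
        by (rule finite_subring_Fqn[of ?K])
           (use card_range_evp[of "fst z"] Kadd Kmult range_eqI[of 0 "\<lambda>q. evp q (fst z)" 0] range_eqI[of 1 "\<lambda>q. evp q (fst z)" 1] in auto)
      then show ?thesis using that by (simp add: Fqn_bit power_inverse)
    qed
    have zero: "evp (cst r) (fst z) = 0 \<and> evp (lin r) (fst z) = 0" if "e r = 0" for r
    proof -
      have "evp (lin r) (fst z) = 0"
      proof (rule ccontr)
        assume nz: "evp (lin r) (fst z) \<noteq> 0"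
        have "evp (cst r) (fst z) = evp (lin r) (fst z) * snd z" using that by (simp add: ev_def)
        then have "snd z = evp (cst r) (fst z) * inverse (evp (lin r) (fst z))" using nz by simp
        moreover have "\<dots> \<in> ?K" by (intro Kmult inv) auto
        ultimately show False using False by simp
      qed
      then show ?thesis using that by (simp add: ev_def)
    qed
    have iff: "e r = 0 \<longleftrightarrow> ev (conjp z) r = 0" for r
    proof
      assume r: "e r = 0"
      show "ev (conjp z) r = 0" using zero[OF r] by (simp add: ev_def)
    next
      assume "ev (conjp z) r = 0"
      then have "e (conj r) = 0" by (simp add: ev_conj)
      then have "evp (cst (conj r)) (fst z) = 0 \<and> evp (lin (conj r)) (fst z) = 0" by (rule zero)
      then show "e r = 0" by (simp add: ev_def)
    qed
    then have eq: "Pt z = Pt (conjp z)" by (simp add: Pt_def)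
    have "kres = (\<lambda>(x, y). x + y * snd z) ` (?K \<times> ?K)"
    proof (rule antisym)
      show "kres \<subseteq> (\<lambda>(x, y). x + y * snd z) ` (?K \<times> ?K)" by (force simp: kres_def ev_def)
      have "evp a (fst z) + evp b (fst z) * snd z = e (Coord a b)" for a b by (simp add: ev_def)
      then show "(\<lambda>(x, y). x + y * snd z) ` (?K \<times> ?K) \<subseteq> kres" by (auto simp: kres_def)
    qed
    moreover have "inj_on (\<lambda>(x, y). x + y * snd z) (?K \<times> ?K)"
    proof (rule inj_onI, clarify)
      fix a b c d assume eq: "evp a (fst z) + evp b (fst z) * snd z = evp c (fst z) + evp d (fst z) * snd z"
      have "e (Coord (a + c) (b + d)) = (evp a (fst z) + evp b (fst z) * snd z) + (evp c (fst z) + evp d (fst z) * snd z)"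
        by (simp add: ev_def algebra_simps)
      also have "\<dots> = 0" using eq by simp
      finally show "evp a (fst z) = evp c (fst z) \<and> evp b (fst z) = evp d (fst z)"
        using zero[of "Coord (a + c) (b + d)"] by simp
    qed
    ultimately have "card kres = (2 ^ Polynomial.degree p) ^ 2"
      using card_range_evp[of "fst z"] by (simp add: card_image card_cartesian_product power2_eq_square)
    then have "(2::nat) ^ point_degree (Pt z) = 2 ^ (2 * Polynomial.degree p)"
      using card_kres by (simp add: power_mult[symmetric] mult.commute)
    then show ?thesis using eq False by simp
  qed
qed

text \<open>A function vanishing at w has a norm divisible by the common minimal polynomial, so it
  vanishes at z or at its conjugate. Prime avoidance, with the sum of two functions, makes the
  choice uniform, and maximality of valuation rings does the rest.\<close>

lemma Pt_over_mp:
  assumes z: "on_curve z" and w: "on_curve w" and eq: "mp (fst w) = mp (fst z)"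
  shows "Pt w = Pt z \<or> Pt w = Pt (conjp z)"
proof -
  have main: "Pt w = Pt z" if z: "on_curve z" and eq: "mp (fst w) = mp (fst z)" and sub: "\<And>r. ev w r = 0 \<Longrightarrow> ev z r = 0" for z
  proof -
    interpret z: gpt z by unfold_locales fact
    interpret w: gpt w by unfold_locales fact
    interpret place "Pt z" by unfold_locales (rule z.place_Pt)
    interpret pw: place "Pt w" by unfold_locales (rule w.place_Pt)
    have sub: "Pt z \<subseteq> Pt w" using sub unfolding Pt_def by blast
    have FF: "Pt w \<subseteq> FF" using w.Pt_FF by auto
    have "inverse (ofp (mp (fst z))) \<notin> Pt w"
      using pw.inverse_notin[of "Pt w" "ofp (mp (fst z))"] w.ordv_p eq by simp
    then show ?thesis
      using maximal_subring[OF pw.closed_ring_P FF sub, of "ofp (mp (fst z))"] z.ordv_p by simp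
  qed
  have "(\<forall>r. ev w r = 0 \<longrightarrow> ev z r = 0) \<or> (\<forall>r. ev w r = 0 \<longrightarrow> ev (conjp z) r = 0)"
  proof (rule ccontr)
    assume "\<not> ?thesis"
    then obtain r s where rs: "ev w r = 0" "ev z r \<noteq> 0" "ev w s = 0" "ev (conjp z) s \<noteq> 0" by blast
    have no: "ev z h = 0 \<or> ev (conjp z) h = 0" if "ev w h = 0" for h
    proof -
      have "evp (nrm h) (fst w) = 0" using evp_nrm[OF w, of h] that by simp
      then have "evp (nrm h) (fst z) = 0" by (simp add: mp_dvd_iff eq)
      then show ?thesis using evp_nrm[OF z, of h] by simp
    qed
    have "ev (conjp z) r = 0" "ev z s = 0" using no rs by blast+
    then show False using no[of "r + s"] rs by simp
  qed
  then show ?thesis using main[OF z eq] main[of "conjp z"] z eq by auto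
qed

lemma ordv_ofp_Pinf: "q \<noteq> 0 \<Longrightarrow> ordv Pinf (ofp q) = - 2 * int (Polynomial.degree q)"
  using ordv_Pinf[of "ofp q"] vinf_emb[of "ofx q"] by (simp add: emb_ofx)

lemma ordv_emb_Pinf: "r \<noteq> 0 \<Longrightarrow> ordv Pinf (emb r) = - int (dg r)"
  using ordv_Pinf[of "emb r"] vinf_emb[of r] by simp

lemma ordv_Pt_ofp:
  assumes "on_curve w" "q \<noteq> 0" shows "ordv (Pt w) (ofp q) \<ge> 0" "ordv (Pt w) (ofp q) \<ge> 1 \<longleftrightarrow> evp q (fst w) = 0"
  using gpt.ordv_emb[OF gptI[OF assms(1)], of "ofx q"] assms(2) by (simp_all add: emb_ofx)

text \<open>The zeros are simple: two points of degree deg p, or one of degree 2 deg p. They balance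
  the pole of order 2 deg p at infinity.\<close>

lemma ddeg_mp: "ddeg (ofp (mp a)) = 0"
proof -
  obtain b where z0: "on_curve (a, b)" by (rule lift_point)
  define z where "z = (a, b)"
  have z: "on_curve z" "fst z = a" using z0 by (simp_all add: z_def)
  have cz: "on_curve (conjp z)" "fst (conjp z) = a" using z by simp_all
  interpret gpt z by unfold_locales (rule z)
  interpret c: gpt "conjp z" by unfold_locales (rule cz)
  define A where "A = Pt z" define B where "B = Pt (conjp z)"
  let ?S = "{A, B, Pinf}"
  have "supp (divf (ofp p)) \<subseteq> ?S"
  proof
    fix P assume "P \<in> supp (divf (ofp p))"
    then have P: "P \<in> CP" "ordv P (ofp p) \<noteq> 0" by (auto simp: supp_divf)
    from P(1) show "P \<in> ?S"
    proof (cases rule: CP_cases)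
      case (2 w)
      have "evp p (fst w) = 0" using ordv_Pt_ofp[OF 2(1), of p] P(2) 2(2) by auto
      then have "mp (fst w) = mp (fst z)" by (rule mp_eqI)
      then show ?thesis using Pt_over_mp[OF z(1) 2(1)] 2(2) by (auto simp: A_def B_def)
    qed simp
  qed
  then have sm: "ddeg (ofp p) = (\<Sum>P\<in>?S. divf (ofp p) P * int (point_degree P))"
    unfolding ddeg_def by (intro divisor_degree_sum) simp
  have v: "divf (ofp p) A = 1" "divf (ofp p) B = 1" "divf (ofp p) Pinf = - 2 * int (Polynomial.degree p)"
    using ordv_p c.ordv_p z cz by (simp_all add: divf_def ordv_ofp_Pinf A_def B_def)
  have d: "point_degree B = point_degree A" unfolding A_def B_def by (rule point_degree_conj[OF z(1)])
  have n: "A \<noteq> Pinf" "B \<noteq> Pinf" using z cz by (simp_all add: A_def B_def)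
  have "A \<noteq> B \<and> point_degree A = Polynomial.degree p \<or> A = B \<and> point_degree A = 2 * Polynomial.degree p"
    unfolding A_def B_def using fiber_degree by blast
  then have "ddeg (ofp p) = 0" unfolding sm using v d n by (elim disjE conjE) simp_all
  then show ?thesis using z by simp
qed

lemma ddeg_ofp: "q \<noteq> 0 \<Longrightarrow> ddeg (ofp q) = 0"
proof (induction "Polynomial.degree q" arbitrary: q rule: less_induct)
  case less
  show ?case
  proof (cases "Polynomial.degree q = 0")
    case True
    then have "q = 1" using bit_poly_unit less by blast
    then show ?thesis by simp
  next
    case False
    have "Polynomial.degree (map_poly to_ac q) = Polynomial.degree q" by (rule degree_map_poly) simp
    then obtain a where "evp q a = 0"
      using alg_closed_imp_poly_has_root[of "map_poly to_ac q"] False by (auto simp: evp_def)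
    then obtain h where h: "q = mp a * h" using mp_dvd_iff by (auto elim: dvdE)
    then have hnz: "h \<noteq> 0" using less by auto
    then have "Polynomial.degree h < Polynomial.degree q"
      using degree_mp_pos[of a] by (simp add: h degree_mult_eq)
    then have "ddeg (ofp h) = 0" using less(1) hnz by blast
    then show ?thesis using ddeg_mult[of "ofp (mp a)" "ofp h"] ddeg_mp hnz by (simp add: h)
  qed
qed

text \<open>Conjugation on closed points; by \<open>Pt_eq_conj\<close> it does not depend on the
  geometric point that is chosen.\<close>

definition cj :: "bit univ_field set \<Rightarrow> bit univ_field set" where
  "cj P = (if P = Pinf then Pinf else Pt (conjp (SOME z. on_curve z \<and> P = Pt z)))"

lemma cj_Pinf [simp]: "cj Pinf = Pinf"
  by (simp add: cj_def)

lemma cj_Pt [simp]: assumes z: "on_curve z" shows "cj (Pt z) = Pt (conjp z)"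
proof -
  let ?w = "SOME w. on_curve w \<and> Pt z = Pt w"
  have "on_curve ?w \<and> Pt z = Pt ?w" by (rule someI[of _ z]) (simp add: z)
  then have "Pt (conjp ?w) = Pt (conjp z)" using Pt_eq_conj[OF z, of ?w] by simp
  then show ?thesis using z by (simp add: cj_def)
qed

lemma cj_props:
  assumes "P \<in> CP"
  shows "cj P \<in> CP" "cj (cj P) = P" "point_degree (cj P) = point_degree P"
    "r \<noteq> 0 \<Longrightarrow> ordv (cj P) (emb r) = ordv P (emb (conj r))"
  using assms by (cases rule: CP_cases; simp add: point_degree_conj ordv_conj ordv_emb_Pinf)+

lemma ddeg_conj: assumes "r \<noteq> 0" shows "ddeg (emb (conj r)) = ddeg (emb r)"
proof -
  let ?S = "supp (divf (emb r))" and ?T = "supp (divf (emb (conj r)))"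
  have S: "P \<in> ?S \<longleftrightarrow> P \<in> CP \<and> ordv P (emb r) \<noteq> 0" for P by (simp add: supp_divf)
  have T: "P \<in> ?T \<longleftrightarrow> P \<in> CP \<and> ordv P (emb (conj r)) \<noteq> 0" for P by (simp add: supp_divf)
  have "bij_betw cj ?T ?S"
  proof (rule bij_betw_byWitness[where f' = cj])
    show "\<forall>P\<in>?T. cj (cj P) = P" "\<forall>P\<in>?S. cj (cj P) = P" using cj_props(2) S T by blast+
    show "cj ` ?T \<subseteq> ?S" using cj_props(1) cj_props(4)[OF _ assms] S T by auto
    show "cj ` ?S \<subseteq> ?T"
    proof
      fix Q assume "Q \<in> cj ` ?S"
      then obtain P where P: "P \<in> CP" "ordv P (emb r) \<noteq> 0" "Q = cj P" using S by auto
      have "ordv (cj P) (emb (conj r)) = ordv P (emb r)"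
        using cj_props(4)[OF P(1), of "conj r"] assms by simp
      then show "Q \<in> ?T" using P T cj_props(1) by simp
    qed
  qed
  then have "(\<Sum>P\<in>?T. divf (emb r) (cj P) * int (point_degree (cj P))) = (\<Sum>P\<in>?S. divf (emb r) P * int (point_degree P))"
    by (rule sum.reindex_bij_betw)
  moreover have "divf (emb r) (cj P) * int (point_degree (cj P)) = divf (emb (conj r)) P * int (point_degree P)" if "P \<in> ?T" for P
    using that T cj_props[of P] assms by (simp add: divf_def)
  ultimately show ?thesis by (simp add: ddeg_def divisor_degree_def)
qed

text \<open>The divisors of r and of its conjugate have the same degree, and the two degrees add up
  to that of the norm, which is 0.\<close>

theorem principal_divisor_degree: assumes "f \<in> FF" "f \<noteq> 0" shows "ddeg f = 0"
proof -
  have e: "ddeg (emb r) = 0" if "r \<noteq> 0" for r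
  proof -
    have "ddeg (emb (r * conj r)) = 0" unfolding mult_conj emb_ofx by (rule ddeg_ofp) (use that in simp)
    then have "ddeg (emb r) + ddeg (emb (conj r)) = 0" using ddeg_mult[of "emb r" "emb (conj r)"] that by simp
    then show ?thesis using ddeg_conj[OF that] by simp
  qed
  obtain r s where *: "f = emb r / emb s" "s \<noteq> 0" "r \<noteq> 0" using FF_nz_E assms by metis
  then have "f * emb s = emb r" by simp
  then have "ddeg f + ddeg (emb s) = ddeg (emb r)" using ddeg_mult[of f "emb s"] assms * by simp
  then show ?thesis using e * by simp
qed

section \<open>Riemann-Roch spaces\<close>

abbreviation LL :: "(bit univ_field set \<Rightarrow> int) \<Rightarrow> bit univ_field set" where
  "LL D \<equiv> global_sections xi D"

lemma stalk_iff: assumes "P \<in> CP" shows "f \<in> stalk D P \<longleftrightarrow> f \<in> FF \<and> (f = 0 \<or> - D P \<le> ordv P f)"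
proof -
  interpret place P by unfold_locales (rule CP_place[OF assms])
  show ?thesis by (simp add: stalk_def max_power_eq)
qed

lemma LL_iff: "f \<in> LL D \<longleftrightarrow> f \<in> FF \<and> (f = 0 \<or> (\<forall>P\<in>CP. - D P \<le> ordv P f))"
  by (auto simp: global_sections_def function_field_xi stalk_iff)

lemma LL_0 [simp]: "0 \<in> LL D"
  by (simp add: LL_iff)

lemma LL_add: assumes "f \<in> LL D" "g \<in> LL D" shows "f + g \<in> LL D"
proof (cases "f = 0 \<or> g = 0 \<or> f + g = 0")
  case False
  have "- D P \<le> ordv P (f + g)" if "P \<in> CP" for P
  proof -
    interpret place P by unfold_locales (rule CP_place[OF that])
    have "min (ordv P f) (ordv P g) \<le> ordv P (f + g)" using assms False by (intro v_add) (auto simp: LL_iff)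
    moreover have "- D P \<le> ordv P f" "- D P \<le> ordv P g" using assms False that by (auto simp: LL_iff)
    ultimately show ?thesis by simp
  qed
  then show ?thesis using assms by (simp add: LL_iff)
qed (use assms in auto)

lemma LL_subspace: "kspace.subspace (LL D)"
  by (rule kspace_subspaceI) (auto intro: LL_add)

lemma LL_card: "finite (LL D) \<Longrightarrow> card (LL D) = 2 ^ kspace.dim (LL D)"
  by (rule card_subspace[OF kspace.vector_space_axioms LL_subspace])

text \<open>D + div f is effective and has the degree of D, since principal divisors have degree 0.
  An effective divisor of degree 0 is zero because all points have positive degree.\<close>

lemma LL_degree:
  assumes D: "finite (supp D)" "supp D \<subseteq> CP" and f: "f \<in> LL D" "f \<noteq> 0"
  shows "divisor_degree D \<ge> 0" "divisor_degree D = 0 \<Longrightarrow> P \<in> CP \<Longrightarrow> ordv P f = - D P"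
proof -
  have FF: "f \<in> FF" using f by (simp add: LL_iff)
  let ?E = "\<lambda>P. D P + divf f P"
  have finE: "finite (supp D \<union> supp (divf f))" using D finite_supp_divf[OF FF f(2)] by simp
  have "divisor_degree ?E = divisor_degree D + ddeg f"
    unfolding ddeg_def by (rule divisor_degree_add) (use D finite_supp_divf[OF FF f(2)] in auto)
  then have E: "divisor_degree D = divisor_degree ?E" using principal_divisor_degree[OF FF f(2)] by simp
  have sE: "supp ?E \<subseteq> supp D \<union> supp (divf f)" by (auto simp: supp_def)
  then have fE: "finite (supp ?E)" using finE by (rule finite_subset)
  have nn: "?E P \<ge> 0" for P
  proof (cases "P \<in> CP")
    case True
    then have "- D P \<le> ordv P f" using f by (simp add: LL_iff)
    then show ?thesis using True by (simp add: divf_def)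
  next
    case False
    then have "D P = 0" using D(2) unfolding supp_def by blast
    then show ?thesis using False by (simp add: divf_def)
  qed
  then have t: "?E P * int (point_degree P) \<ge> 0" for P by simp
  have "divisor_degree ?E \<ge> 0" unfolding divisor_degree_def using t by (rule sum_nonneg)
  then show "divisor_degree D \<ge> 0" using E by simp
  show "ordv P f = - D P" if "divisor_degree D = 0" "P \<in> CP"
  proof (rule ccontr)
    assume "ordv P f \<noteq> - D P"
    then have ne: "?E P \<noteq> 0" using that(2) by (simp add: divf_def)
    then have "P \<in> supp ?E" by (simp add: supp_def)
    moreover have "(\<Sum>P\<in>supp ?E. ?E P * int (point_degree P)) = 0" using that(1) E by (simp add: divisor_degree_def)
    moreover have "(\<Sum>P\<in>supp ?E. ?E P * int (point_degree P)) = 0 \<longleftrightarrow> (\<forall>P\<in>supp ?E. ?E P * int (point_degree P) = 0)"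
      by (rule sum_nonneg_eq_0_iff[OF fE t])
    ultimately have "?E P * int (point_degree P) = 0" by blast
    then show False using ne point_degree_pos[OF that(2)] by simp
  qed
qed

text \<open>The coordinate ring is integrally closed. If q has a root a, regularity forces the
  numerator to vanish at both points above a, hence both its coefficients are divisible by
  \<open>mp a\<close>, and this factor cancels.\<close>

lemma regular_emb:
  assumes "f \<in> FF" "\<And>z. on_curve z \<Longrightarrow> f \<in> Pt z" shows "\<exists>r. f = emb r"
proof -
  have "\<exists>r'. emb r / ofp q = emb r'" if "q \<noteq> 0" "\<And>z. on_curve z \<Longrightarrow> emb r / ofp q \<in> Pt z" for r q
    using that
  proof (induction "Polynomial.degree q" arbitrary: q r rule: less_induct)
    case less
    show ?case
    proof (cases "Polynomial.degree q = 0 \<or> r = 0")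
      case True
      then show ?thesis
      proof
        assume "Polynomial.degree q = 0"
        then have "q = 1" using bit_poly_unit less by blast
        then show ?thesis by auto
      next
        assume "r = 0"
        then show ?thesis by (intro exI[of _ 0]) simp
      qed
    next
      case False
      have "Polynomial.degree (map_poly to_ac q) = Polynomial.degree q" by (rule degree_map_poly) simp
      then obtain a where a: "evp q a = 0"
        using alg_closed_imp_poly_has_root[of "map_poly to_ac q"] False by (auto simp: evp_def)
      then obtain h where h: "q = mp a * h" using mp_dvd_iff by (auto elim: dvdE)
      then have hnz: "h \<noteq> 0" using less by auto
      obtain b where z: "on_curve (a, b)" by (rule lift_point)
      have ev0: "ev z r = 0" if z: "on_curve z" "fst z = a" for z
      proof -
        interpret gpt z by unfold_locales (rule z)
        interpret place "Pt z" by unfold_locales (rule place_Pt)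
        have "emb r / ofp q \<in> Pt z" using less(3) z by blast
        then have "ordv (Pt z) (emb r) \<ge> ordv (Pt z) (ofp q)"
          using v_divide[of "emb r" "ofp q"] False less(2) by (simp add: P_iff)
        moreover have "ordv (Pt z) (ofp q) \<ge> 1" using ordv_Pt_ofp[OF z(1) less(2)] a z(2) by simp
        ultimately show ?thesis using ordv_emb(2)[of r] False by simp
      qed
      have 0: "ev (a, b) r = 0" "ev (conjp (a, b)) r = 0" using ev0[of "(a, b)"] ev0[of "conjp (a, b)"] z by simp_all
      then have l: "evp (lin r) a = 0" by (simp add: ev_conjp)
      then have "evp (cst r) a = 0" using 0(1) by (simp add: ev_def)
      then obtain u v where uv: "cst r = mp a * u" "lin r = mp a * v" using l by (auto simp: mp_dvd_iff elim!: dvdE)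
      define r1 where "r1 = Coord u v"
      have r: "r = ofx (mp a) * r1" by (simp add: coord_eq_iff r1_def uv)
      have eq: "emb r / ofp q = emb r1 / ofp h" unfolding r h by (simp add: emb_ofx)
      have "Polynomial.degree h < Polynomial.degree q"
        using degree_mp_pos[of a] hnz by (simp add: h degree_mult_eq)
      then have "\<exists>r'. emb r1 / ofp h = emb r'"
        by (rule less(1)) (use hnz less(3) in \<open>simp_all flip: eq\<close>)
      then show ?thesis unfolding eq .
    qed
  qed
  moreover obtain r q where "f = emb r / ofp q" "q \<noteq> 0" using FF_polyE[OF assms(1)] .
  ultimately show ?thesis using assms(2) by blast
qed

section \<open>Functions with a bounded pole at infinity\<close>

definition LO :: "nat \<Rightarrow> bit univ_field set" where "LO N = emb ` {r. r = 0 \<or> dg r \<le> N}"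

text \<open>In a + b y the bound 2 deg a <= N leaves N div 2 + 1 coefficients and 2 deg b + 3 <= N
  leaves (N - 1) div 2. For N >= 1 they add up to N, the dimension expected in genus one.\<close>

lemma card_LO: "finite (LO N) \<and> card (LO N) = 2 ^ (N div 2 + 1 + (N - 1) div 2)"
proof -
  let ?T = "\<lambda>d. {q :: bit poly. q = 0 \<or> Polynomial.degree q < d}"
  have "{r. r = 0 \<or> dg r \<le> N} = (\<lambda>(a, b). Coord a b) ` (?T (N div 2 + 1) \<times> ?T ((N - 1) div 2))"
  proof (rule Set.set_eqI)
    fix r
    have "r = 0 \<or> dg r \<le> N \<longleftrightarrow> cst r \<in> ?T (N div 2 + 1) \<and> lin r \<in> ?T ((N - 1) div 2)"
      by (cases "cst r = 0"; cases "lin r = 0") (auto simp: dg_eq coord_eq_iff)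
    also have "\<dots> \<longleftrightarrow> r \<in> (\<lambda>(a, b). Coord a b) ` (?T (N div 2 + 1) \<times> ?T ((N - 1) div 2))"
      by (cases r) auto
    finally show "r \<in> {r. r = 0 \<or> dg r \<le> N} \<longleftrightarrow> r \<in> (\<lambda>(a, b). Coord a b) ` (?T (N div 2 + 1) \<times> ?T ((N - 1) div 2))"
      by simp
  qed
  moreover have "inj_on (\<lambda>(a, b). Coord a b) A" for A by (auto intro: inj_onI)
  ultimately have "finite {r. r = 0 \<or> dg r \<le> N} \<and> card {r. r = 0 \<or> dg r \<le> N} = 2 ^ (N div 2 + 1) * 2 ^ ((N - 1) div 2)"
    using card_small_polys[of "N div 2 + 1"] card_small_polys[of "(N - 1) div 2"]
    by (simp add: card_image card_cartesian_product)
  moreover have "inj_on emb {r. r = 0 \<or> dg r \<le> N}" by (rule inj_onI) simp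
  ultimately show ?thesis unfolding LO_def by (simp add: card_image power_add)
qed

lemma card_LO_pos: "N \<ge> 1 \<Longrightarrow> card (LO N) = 2 ^ N"
proof -
  assume "N \<ge> 1"
  then have "N div 2 + 1 + (N - 1) div 2 = N" by presburger
  then show ?thesis using card_LO[of N] by simp
qed

text \<open>This is div(q) + (n + 2 deg q) O, linearly equivalent to a multiple of O, so its
  sections are known explicitly. Such divisors dominate all others, which makes them the comparison
  objects for Riemann's inequality.\<close>

definition twist :: "bit poly \<Rightarrow> nat \<Rightarrow> bit univ_field set \<Rightarrow> int" where
  "twist q n P = (if P = Pinf then int n else divf (ofp q) P)"

lemma twist_divisor:
  assumes "q \<noteq> 0"
  shows "is_divisor xi (twist q n)" "divisor_degree (twist q n) = int (n + 2 * Polynomial.degree q)"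
proof -
  let ?c = "int (n + 2 * Polynomial.degree q)"
  let ?E = "\<lambda>P. if P = Pinf then ?c else 0"
  have eq: "twist q n = (\<lambda>P. divf (ofp q) P + ?E P)"
    using assms by (auto simp: twist_def divf_def ordv_ofp_Pinf)
  have fin: "finite (supp (divf (ofp q)))" by (rule finite_supp_divf) (use assms in auto)
  have E: "supp ?E \<subseteq> {Pinf}" by (auto simp: supp_def)
  have "divisor_degree ?E = ?c" by (subst divisor_degree_sum[OF _ E]) simp_all
  then show "divisor_degree (twist q n) = ?c"
    unfolding eq using divisor_degree_add[OF fin, of ?E] finite_subset[OF E] principal_divisor_degree[of "ofp q"] assms
    by (simp add: ddeg_def)
  have "supp (twist q n) \<subseteq> insert Pinf (supp (divf (ofp q)))" by (auto simp: supp_def twist_def)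
  moreover have "supp (divf (ofp q)) \<subseteq> CP" by (auto simp: supp_divf)
  ultimately show "is_divisor xi (twist q n)" using fin by (auto simp: is_divisor_def intro: finite_subset)
qed

lemma LL_twist:
  assumes q: "q \<noteq> 0" shows "LL (twist q n) = (\<lambda>g. g / ofp q) ` LO (n + 2 * Polynomial.degree q)"
proof (rule antisym)
  let ?N = "n + 2 * Polynomial.degree q"
  show "LL (twist q n) \<subseteq> (\<lambda>g. g / ofp q) ` LO ?N"
  proof
    fix f assume f: "f \<in> LL (twist q n)"
    then have FF: "f \<in> FF" by (simp add: LL_iff)
    show "f \<in> (\<lambda>g. g / ofp q) ` LO ?N"
    proof (cases "f = 0")
      case True
      then show ?thesis by (intro image_eqI[of _ _ 0]) (auto simp: LO_def intro: image_eqI[of _ _ 0])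
    next
      case False
      have "f * ofp q \<in> Pt z" if z: "on_curve z" for z
      proof -
        interpret place "Pt z" by unfold_locales (rule CP_place, simp add: z)
        have "- twist q n (Pt z) \<le> ordv (Pt z) f" using f False z by (simp add: LL_iff)
        then have "0 \<le> ordv (Pt z) (f * ofp q)"
          using v_mult[of f "ofp q"] FF False q z by (simp add: twist_def divf_def)
        then show ?thesis using FF by (simp add: P_iff)
      qed
      then obtain r where r: "f * ofp q = emb r" using regular_emb[of "f * ofp q"] FF by auto
      have rnz: "r \<noteq> 0"
      proof
        assume "r = 0"
        then show False using r False q by simp
      qed
      interpret place Pinf by unfold_locales (rule place_Pinf)
      have "\<forall>P\<in>CP. - twist q n P \<le> ordv P f" using f False by (simp add: LL_iff)
      from bspec[OF this Pinf_CP] have "- int n \<le> ordv Pinf f" by (simp add: twist_def)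
      moreover have "ordv Pinf (emb r) = ordv Pinf f + ordv Pinf (ofp q)"
        unfolding r[symmetric] using v_mult[of f "ofp q"] FF False q by simp
      ultimately have "dg r \<le> ?N" using ordv_emb_Pinf[OF rnz] ordv_ofp_Pinf[OF q] by simp
      then have "emb r \<in> LO ?N" by (simp add: LO_def)
      moreover have "f = emb r / ofp q" using r q by (simp add: field_simps)
      ultimately show ?thesis by (rule rev_image_eqI)
    qed
  qed
  show "(\<lambda>g. g / ofp q) ` LO ?N \<subseteq> LL (twist q n)"
  proof
    fix f assume "f \<in> (\<lambda>g. g / ofp q) ` LO ?N"
    then obtain r where r: "f = emb r / ofp q" "r = 0 \<or> dg r \<le> ?N" by (auto simp: LO_def)
    show "f \<in> LL (twist q n)"
    proof (cases "r = 0")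
      case False
      have "- twist q n P \<le> ordv P f" if P: "P \<in> CP" for P
      proof -
        interpret place P by unfold_locales (rule CP_place[OF P])
        have v: "ordv P f = ordv P (emb r) - ordv P (ofp q)" unfolding r(1) using False q by (intro v_divide) auto
        from P show ?thesis
        proof (cases rule: CP_cases)
          case 1
          then show ?thesis using v r(2) False ordv_emb_Pinf[OF False] ordv_ofp_Pinf[OF q] by (simp add: twist_def)
        next
          case (2 z)
          then show ?thesis
            using v gpt.ordv_emb(1)[OF gptI[OF 2(1)] False] by (simp add: twist_def divf_def)
        qed
      qed
      then show ?thesis using r by (simp add: LL_iff)
    qed (simp add: r)
  qed
qed

lemma card_LL_twist:
  assumes "q \<noteq> 0" "n \<ge> 1"
  shows "finite (LL (twist q n)) \<and> card (LL (twist q n)) = 2 ^ (n + 2 * Polynomial.degree q)"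
proof -
  have "inj_on (\<lambda>g. g / ofp q) A" for A by (rule inj_onI) (use assms in simp)
  then show ?thesis
    unfolding LL_twist[OF assms(1)] using card_LO card_LO_pos[of "n + 2 * Polynomial.degree q"] assms
    by (simp add: card_image)
qed

text \<open>Each affine point is a zero of the minimal polynomial of its x-coordinate, so a product
  of powers of such polynomials exceeds D at the affine points; n takes care of infinity.\<close>

lemma twist_dominates:
  assumes D: "is_divisor xi D"
  shows "\<exists>q n. q \<noteq> 0 \<and> n \<ge> 1 \<and> (\<forall>P. D P \<le> twist q n P)"
proof -
  have nn: "twist q n P \<ge> 0" if "q \<noteq> 0" for q n P
  proof (cases "P \<in> CP")
    case True
    then show ?thesis using ordv_Pt_ofp[OF _ that] by (cases rule: CP_cases) (auto simp: twist_def divf_def)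
  qed (auto simp: twist_def divf_def)
  have "finite S \<Longrightarrow> S \<subseteq> CP \<Longrightarrow> \<exists>q n. q \<noteq> 0 \<and> n \<ge> 1 \<and> (\<forall>P\<in>S. D P \<le> twist q n P)" for S
  proof (induction S rule: finite_induct)
    case empty
    show ?case by (rule exI[of _ 1], rule exI[of _ 1]) simp
  next
    case (insert P S)
    then obtain q n where qn: "q \<noteq> 0" "n \<ge> 1" "\<forall>P\<in>S. D P \<le> twist q n P" by auto
    have "P \<in> CP" using insert by simp
    then show ?case
    proof (cases rule: CP_cases)
      case 1
      have "D R \<le> twist q (n + nat (D Pinf)) R" if "R \<in> insert P S" for R
        using that qn(3) 1 by (cases "R = Pinf") (auto simp: twist_def split: if_splits)
      then show ?thesis using qn by (intro exI[of _ q] exI[of _ "n + nat (D Pinf)"]) auto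
    next
      case (2 z)
      interpret z: gpt z by unfold_locales (rule 2(1))
      let ?h = "mp (fst z) ^ nat (D P)"
      have tw: "twist (q * ?h) n R = twist q n R + twist ?h n R" if "R \<noteq> Pinf" for R
        using divf_mult[of "ofp q" "ofp ?h"] qn(1) that by (simp add: twist_def)
      have ofpow: "ofp (mp (fst z) ^ k) = ofp (mp (fst z)) ^ k" for k by (induction k) simp_all
      have "D R \<le> twist (q * ?h) n R" if R: "R \<in> insert P S" for R
      proof (cases "R = Pinf")
        case True
        then have "R \<in> S" using R Pt_not_Pinf[OF 2(1)] 2(2) by (metis insertE)
        then have "D R \<le> twist q n R" using qn(3) by blast
        then show ?thesis using True by (simp add: twist_def)
      next
        case False
        show ?thesis
        proof (cases "R = P")
          case True
          interpret place P unfolding 2(2) by unfold_locales (rule z.place_Pt)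
          have "twist ?h n P = int (nat (D P))"
            using False True 2 v_power[of "ofp (mp (fst z))" "nat (D P)"] z.ordv_p by (simp add: twist_def divf_def ofpow)
          then show ?thesis using tw[OF False] nn[OF qn(1), of n R] True by simp
        next
          case False2: False
          then show ?thesis using tw[OF False] nn[of ?h n R] qn(3) R by force
        qed
      qed
      then show ?thesis using qn by (intro exI[of _ "q * ?h"] exI[of _ n]) auto
    qed
  qed
  from this[of "supp D"] obtain q n where *: "q \<noteq> 0" "n \<ge> 1" "\<forall>P\<in>supp D. D P \<le> twist q n P"
    using D by (auto simp: is_divisor_def)
  have "D P \<le> twist q n P" for P
    using * nn[OF *(1), of n P] by (cases "P \<in> supp D") (auto simp: supp_def)
  then show ?thesis using * by blast
qed

text \<open>Rank-nullity as an inequality of cardinalities: s picks one element in each fiber, and x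
  is recovered from its image together with its sum with the picked element.\<close>

lemma card_le_kernel_image:
  fixes V K :: "bit univ_field set" and \<phi> :: "bit univ_field \<Rightarrow> 'b"
  assumes W: "finite W" "\<phi> ` V \<subseteq> W" and K: "finite K"
    and ker: "\<And>x y. x \<in> V \<Longrightarrow> y \<in> V \<Longrightarrow> \<phi> x = \<phi> y \<Longrightarrow> x + y \<in> K"
  shows "finite V \<and> card V \<le> card K * card W"
proof -
  define s where "s w = (SOME x. x \<in> V \<and> \<phi> x = w)" for w
  have s: "s (\<phi> x) \<in> V \<and> \<phi> (s (\<phi> x)) = \<phi> x" if "x \<in> V" for x
    unfolding s_def by (rule someI[of _ x]) (simp add: that)
  define g where "g x = (x + s (\<phi> x), \<phi> x)" for x
  have sub: "g ` V \<subseteq> K \<times> W" using ker s W by (auto simp: g_def)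
  have inj: "inj_on g V"
  proof (rule inj_onI)
    fix x y assume xy: "x \<in> V" "y \<in> V" "g x = g y"
    from xy(3) have "x + s (\<phi> x) = y + s (\<phi> y) \<and> \<phi> x = \<phi> y" unfolding g_def prod.inject .
    then show "x = y" by (metis add_right_imp_eq)
  qed
  have fin: "finite (K \<times> W)" using K W by simp
  have "finite V" by (rule finite_imageD[OF finite_subset[OF sub fin] inj])
  moreover have "card V \<le> card (K \<times> W)" by (rule card_inj_on_le[OF inj sub fin])
  ultimately show ?thesis by (simp add: card_cartesian_product)
qed

text \<open>Allowing one more pole order at P adds at most the leading coefficient there.
  Multiplication by u turns it into a value in the residue field, and sections in which it agrees
  differ by a section of D.\<close>

lemma LL_step:
  assumes P: "P \<in> CP" and fin: "finite (LL D)"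
  shows "card (LL (D(P := D P + 1))) \<le> card (LL D) * 2 ^ point_degree P"
proof -
  interpret place P by unfold_locales (rule CP_place[OF P])
  let ?d = "point_degree P" and ?E = "D(P := D P + 1)"
  obtain \<rho> where r: "is_res P ?d \<rho>" by (rule CP_res[OF P])
  obtain t where t: "t \<in> FF" "t \<noteq> 0" "ordv P t = 1" by (rule ex_unif)
  define u where "u = t powi (D P + 1)"
  have u: "u \<in> FF" "u \<noteq> 0" "ordv P u = D P + 1" using t v_powi[of t "D P + 1"] by (simp_all add: u_def)
  have uP: "u * f \<in> P" if "f \<in> LL ?E" for f
  proof (cases "f = 0")
    case False
    then have "- ?E P \<le> ordv P f" "f \<in> FF" using that P by (auto simp: LL_iff)
    then show ?thesis using u v_mult[of u f] False by (simp add: P_iff)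
  qed (simp add: P_iff)
  have "\<rho> (u * f) \<in> Fqn ?d" if "f \<in> LL ?E" for f
    using uP[OF that] r by (auto simp: is_res_def)
  then have im: "(\<lambda>f. \<rho> (u * f)) ` LL ?E \<subseteq> Fqn ?d" by auto
  have ker: "f + g \<in> LL D" if fg: "f \<in> LL ?E" "g \<in> LL ?E" "\<rho> (u * f) = \<rho> (u * g)" for f g
  proof (cases "f + g = 0")
    case False
    have "\<rho> (u * f + u * g) = 0" using r uP fg by (simp add: is_res_def)
    then have r0: "\<rho> (u * (f + g)) = 0" by (simp only: distrib_left)
    have s: "f + g \<in> LL ?E" using fg LL_add by blast
    then have FF: "f + g \<in> FF" by (simp add: LL_iff)
    have "u * (f + g) \<noteq> 0" using u False by (metis mult_eq_0_iff)
    then have "1 \<le> ordv P (u * (f + g))" using r0 r uP[OF s] by (auto simp: is_res_def)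
    then have a: "- D P \<le> ordv P (f + g)" using v_mult[of u "f + g"] u FF False by simp
    have b: "- ?E R \<le> ordv R (f + g)" if "R \<in> CP" for R using s False that unfolding LL_iff by blast
    have "- D R \<le> ordv R (f + g)" if "R \<in> CP" for R
    proof (cases "R = P")
      case True then show ?thesis using a by simp
    next
      case False then show ?thesis using b[OF that] by simp
    qed
    then show ?thesis using FF by (simp add: LL_iff)
  qed (simp only: LL_0)
  have c: "finite (Fqn ?d :: bit alg_closure set)" "card (Fqn ?d :: bit alg_closure set) = 2 ^ ?d"
    using Fqn_card[of ?d] point_degree_pos[OF P] by blast+
  have "finite (LL ?E) \<and> card (LL ?E) \<le> card (LL D) * card (Fqn ?d :: bit alg_closure set)"
    by (rule card_le_kernel_image[OF c(1) im fin]) (rule ker)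
  then show ?thesis unfolding c(2) by (rule conjunct2)
qed

lemma LL_mono: assumes "\<And>P. P \<in> CP \<Longrightarrow> D P \<le> E P" shows "LL D \<subseteq> LL E"
  using assms by (fastforce simp: LL_iff)

text \<open>Iterates \<open>LL_step\<close>, raising D towards E by one at a single point each
  time.\<close>

lemma LL_compare:
  assumes fin: "finite S" "S \<subseteq> CP" and le: "\<And>P. D P \<le> E P" and eq: "\<And>P. P \<notin> S \<Longrightarrow> D P = E P"
    and fE: "finite (LL E)"
  shows "card (LL E) \<le> card (LL D) * 2 ^ nat (\<Sum>P\<in>S. (E P - D P) * int (point_degree P))"
  using le eq
proof (induction "nat (\<Sum>P\<in>S. E P - D P)" arbitrary: D)
  case 0
  then have "(\<Sum>P\<in>S. E P - D P) \<le> 0" by simp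
  moreover have "(\<Sum>P\<in>S. E P - D P) \<ge> 0" using 0 by (intro sum_nonneg) simp
  ultimately have "\<forall>P\<in>S. E P - D P = 0" using sum_nonneg_eq_0_iff[OF fin(1), of "\<lambda>P. E P - D P"] 0 by simp
  then have "D = E" using 0 by (metis eq_iff_diff_eq_0 ext)
  then show ?case by simp
next
  case (Suc k)
  have "\<exists>P\<in>S. D P < E P"
  proof (rule ccontr)
    assume "\<not> ?thesis"
    then have "(\<Sum>P\<in>S. E P - D P) = 0" using Suc by (intro sum.neutral) (metis eq_iff_diff_eq_0 order_le_less)
    then show False using Suc by simp
  qed
  then obtain P where P: "P \<in> S" "D P < E P" by blast
  let ?D = "D(P := D P + 1)"
  have s1: "(\<Sum>R\<in>S. E R - D R) = (\<Sum>R\<in>S. E R - ?D R) + 1"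
    using fin(1) P(1) by (simp add: sum.remove[of S P])
  have s2: "(\<Sum>R\<in>S. (E R - D R) * int (point_degree R)) = (\<Sum>R\<in>S. (E R - ?D R) * int (point_degree R)) + int (point_degree P)"
    using fin(1) P(1) by (simp add: sum.remove[of S P] algebra_simps)
  have leD: "?D R \<le> E R" for R using Suc P by auto
  have nn: "(\<Sum>R\<in>S. (E R - ?D R) * int (point_degree R)) \<ge> 0"
    using leD by (intro sum_nonneg mult_nonneg_nonneg) (auto simp del: fun_upd_apply)
  have "card (LL E) \<le> card (LL ?D) * 2 ^ nat (\<Sum>R\<in>S. (E R - ?D R) * int (point_degree R))"
    using Suc s1 P leD by (intro Suc(1)) auto
  moreover have "finite (LL D)" using LL_mono[of D E] Suc fE by (meson finite_subset)
  then have "card (LL ?D) \<le> card (LL D) * 2 ^ point_degree P" using LL_step P fin by blast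
  ultimately have "card (LL E) \<le> card (LL D) * 2 ^ point_degree P * 2 ^ nat (\<Sum>R\<in>S. (E R - ?D R) * int (point_degree R))"
    by (meson mult_le_mono1 order_trans)
  then show ?case unfolding s2 using nn by (simp add: nat_add_distrib power_add mult_ac)
qed

text \<open>D is enlarged to a twist E with dim L(E) = deg E. On the way the dimension grows by at
  most the increase of the degree, so dim L(D) cannot fall below deg D.\<close>

theorem riemann_inequality:
  assumes D: "is_divisor xi D"
  shows "finite (LL D)" "divisor_degree D \<le> int (kspace.dim (LL D))"
proof -
  obtain q n where qn: "q \<noteq> 0" "n \<ge> 1" "\<And>P. D P \<le> twist q n P" using twist_dominates[OF D] by blast
  let ?E = "twist q n"
  have E: "finite (LL ?E)" "card (LL ?E) = 2 ^ (n + 2 * Polynomial.degree q)" using card_LL_twist[OF qn(1,2)] by auto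
  note tE = twist_divisor[OF qn(1), of n]
  show fin: "finite (LL D)" using LL_mono[of D ?E] qn(3) E(1) by (meson finite_subset)
  let ?S = "supp D \<union> supp ?E"
  have S: "finite ?S" "?S \<subseteq> CP" using D tE(1) by (auto simp: is_divisor_def)
  have "(\<Sum>P\<in>?S. (?E P - D P) * int (point_degree P)) = divisor_degree ?E - divisor_degree D"
    using divisor_degree_sum[of ?S D] divisor_degree_sum[of ?S ?E] S by (simp add: left_diff_distrib sum_subtractf)
  moreover have "card (LL ?E) \<le> card (LL D) * 2 ^ nat (\<Sum>P\<in>?S. (?E P - D P) * int (point_degree P))"
    by (rule LL_compare[OF S qn(3) _ E(1)]) (auto simp: supp_def)
  moreover have "(\<Sum>P\<in>?S. (?E P - D P) * int (point_degree P)) \<ge> 0"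
    using qn(3) by (intro sum_nonneg mult_nonneg_nonneg) auto
  ultimately have le: "(2::nat) ^ (n + 2 * Polynomial.degree q) \<le> 2 ^ (kspace.dim (LL D) + nat (divisor_degree ?E - divisor_degree D))"
    and nn: "divisor_degree ?E - divisor_degree D \<ge> 0"
    using E(2) LL_card[OF fin] by (simp_all add: power_add)
  from le have "n + 2 * Polynomial.degree q \<le> kspace.dim (LL D) + nat (divisor_degree ?E - divisor_degree D)"
    by (subst (asm) power_increasing_iff) simp_all
  then show "divisor_degree D \<le> int (kspace.dim (LL D))" using tE(2) nn by linarith
qed

theorem has_genus_xi: "has_genus xi 1"
  unfolding has_genus_def
proof (intro conjI allI impI)
  fix D assume "is_divisor xi D"
  then show "divisor_degree D - int (kspace.dim (LL D)) + 1 \<le> int 1"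
    using riemann_inequality(2) by fastforce
next
  \<comment> \<open>The divisor O attains the bound: it has degree 1, and its only sections are
    constants.\<close>
  have "card (LL (twist 1 1)) = 2 ^ 1" using card_LL_twist[of 1 1] by simp
  then have "(2 :: nat) ^ kspace.dim (LL (twist 1 1)) = 2 ^ 1" using LL_card[of "twist 1 1"] card_LL_twist[of 1 1] by simp
  then have "kspace.dim (LL (twist 1 1)) = 1" by (subst (asm) power_inject_exp) simp_all
  then show "\<exists>D. is_divisor xi D \<and> divisor_degree D - int (kspace.dim (LL D)) + 1 = int 1"
    using twist_divisor[of 1 1] by (intro exI[of _ "twist 1 1"]) simp
qed

lemma (in valn) v_add_eq:
  assumes "f \<in> FF" "g \<in> FF" "f \<noteq> 0" "g \<noteq> 0" "v f < v g"
  shows "f + g \<noteq> 0" "v (f + g) = v f"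
proof -
  show nz: "f + g \<noteq> 0" using assms by auto
  have "v f \<le> v (f + g)" using v_add[OF assms(1-4) nz] assms(5) by simp
  moreover have "min (v (f + g)) (v g) \<le> v ((f + g) + g)" using assms nz by (intro v_add) (auto simp: add.assoc)
  ultimately show "v (f + g) = v f" using assms(5) by (simp add: add.assoc)
qed

text \<open>At a pole of f the leading term of a polynomial in f has strictly the smallest value, so
  no nonzero polynomial vanishes at f. Algebraic elements thus have no poles and are
  constants.\<close>

lemma algebraic_ordv:
  assumes "P \<in> CP" "f \<in> FF" "f \<noteq> 0" "algebraic_over_k f" shows "ordv P f \<ge> 0"
proof (rule ccontr)
  interpret place P by unfold_locales (rule CP_place[OF assms(1)])
  assume neg: "\<not> 0 \<le> ordv P f"
  have "q \<noteq> 0 \<Longrightarrow> poly (map_poly kconst q) f \<in> FF \<and> poly (map_poly kconst q) f \<noteq> 0 \<and>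
      ordv P (poly (map_poly kconst q) f) = int (Polynomial.degree q) * ordv P f" for q :: "bit poly"
  proof (induction q)
    case (pCons c q)
    show ?case
    proof (cases "q = 0")
      case True
      then have "c = 1" using pCons by auto
      then show ?thesis using True by (simp add: map_poly_pCons)
    next
      case False
      let ?g = "f * poly (map_poly kconst q) f"
      have g: "?g \<in> FF" "?g \<noteq> 0" "ordv P ?g = int (Suc (Polynomial.degree q)) * ordv P f"
        using pCons False assms v_mult[of f "poly (map_poly kconst q) f"] by (simp_all add: algebra_simps)
      have "ordv P ?g < 0" unfolding g(3) using neg by (simp add: mult_pos_neg)
      then have "?g + 1 \<noteq> 0 \<and> ordv P (?g + 1) = ordv P ?g" using v_add_eq[of ?g 1] g by simp
      then show ?thesis using False g by (cases c) (simp_all add: map_poly_pCons add.commute)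
    qed
  qed simp
  then show False using assms(4) by (auto simp: algebraic_over_k_def)
qed

lemma LL_zero: "LL (\<lambda>_. 0) = {0, 1}"
proof -
  have eq: "(\<lambda>_. 0) = twist 1 0"
  proof
    fix P
    have "ordv P 1 = 0" if "P \<in> CP"
    proof -
      interpret place P by unfold_locales (rule CP_place[OF that])
      show ?thesis by (rule v_1)
    qed
    then show "0 = twist 1 0 P" by (simp add: twist_def divf_def)
  qed
  have "{r. r = 0 \<or> dg r \<le> 0} = {0, 1}"
  proof -
    have "r = 1" if "r \<noteq> 0" "dg r = 0" for r
    proof -
      have "lin r = 0" "Polynomial.degree (cst r) = 0" using that(2) by (auto simp: dg_eq split: if_splits)
      moreover then have "cst r \<noteq> 0" using that(1) by (auto simp: coord_eq_iff)
      ultimately show ?thesis using bit_poly_unit by (auto simp: coord_eq_iff)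
    qed
    then show ?thesis by auto
  qed
  then have "LO 0 = {0, 1}" by (simp add: LO_def)
  then show ?thesis unfolding eq LL_twist[OF one_neq_zero] by simp
qed

theorem smooth_projective_curve_xi: "smooth_projective_curve xi"
  unfolding smooth_projective_curve_def function_field_xi
proof (intro conjI ballI impI)
  show "\<exists>a\<in>set xi. a \<noteq> 0" by simp
  have "poly (map_poly kconst q) xgen = ofp q" for q :: "bit poly"
  proof (induction q)
    case (pCons c q)
    have "pCons c q = [:c:] + [:0, 1:] * q" by simp
    then have "ofp (pCons c q) = ofp [:c:] + xgen * ofp q" by (simp only: ofp_hom xgen_def)
    moreover have "ofp [:c:] = kconst c" by (cases c) (simp_all flip: one_pCons)
    ultimately show ?case using pCons by (simp add: map_poly_pCons)
  qed simp
  then have "\<not> algebraic_over_k xgen" by (simp add: algebraic_over_k_def)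
  then show "\<exists>x\<in>FF. \<not> algebraic_over_k x" using xgen_FF by blast
  show "x \<in> range kconst" if "x \<in> FF" "algebraic_over_k x" for x
  proof -
    have "x \<in> LL (\<lambda>_. 0)" using algebraic_ordv that by (auto simp: LL_iff)
    then show ?thesis unfolding LL_zero range_kconst .
  qed
  show "\<exists>t. uniformizer P t" if "P \<in> CP" for P
  proof -
    interpret place P by unfold_locales (rule CP_place[OF that])
    show ?thesis using ex_unif uniformizer_iff by metis
  qed
qed

section \<open>A point of large prime degree\<close>

text \<open>On \<open>Fqn n\<close> this is the absolute trace.\<close>

definition ftr :: "nat \<Rightarrow> bit alg_closure \<Rightarrow> bit alg_closure" where
  "ftr n x = (\<Sum>i<n. x ^ (2 ^ i))"

lemma ftr_add: "ftr n (x + y) = ftr n x + ftr n y"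
  by (simp add: ftr_def ac_sum_pow2 sum.distrib)

lemma ac_sum_square: "(\<Sum>i\<in>A. f i :: bit alg_closure) ^ 2 = (\<Sum>i\<in>A. f i ^ 2)"
  by (induction A rule: infinite_finite_induct) (simp_all add: ac_sum_sq)

lemma ftr_square: "ftr n x ^ 2 = ftr n (x ^ 2)"
  by (simp add: ftr_def ac_sum_square flip: power_mult) (simp add: mult.commute)

lemma ftr_shift: "ftr n (x ^ 2) + x = ftr n x + x ^ (2 ^ n)"
proof -
  have "ftr n (x ^ 2) = (\<Sum>i<n. x ^ (2 ^ Suc i))"
    by (simp add: ftr_def flip: power_mult)
  then show ?thesis
    using sum.lessThan_Suc_shift[of "\<lambda>i. x ^ (2 ^ i)" n] sum.lessThan_Suc[of "\<lambda>i. x ^ (2 ^ i)" n]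
    by (simp add: ftr_def add.commute)
qed

lemma ftr_01: assumes "x \<in> Fqn n" shows "ftr n x = 0 \<or> ftr n x = 1"
proof -
  have "ftr n (x ^ 2) + x = ftr n x + x" using ftr_shift[of n x] assms by (simp add: Fqn_bit)
  then have "ftr n x ^ 2 = ftr n x" by (simp add: ftr_square)
  then show ?thesis by (simp add: power2_eq_square)
qed

lemma evp_cubic [simp]: "evp cubic a = a ^ 3 + a"
proof -
  have "evp cubic a = a * (1 + a * a)" by (simp add: cubic_def)
  then show ?thesis by (simp add: algebra_simps power3_eq_cube)
qed

text \<open>Iterated squaring accumulates the conjugates of c. Hence, by Artin and Schreier, b lies
  in F_(2^n) exactly when the n-fold sum vanishes; here c is the value of x^3 + x and b is the
  y-coordinate.\<close>

lemma frobenius_lift: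
  assumes "b ^ 2 = b + c" shows "b ^ (2 ^ k) = b + ftr k (c :: bit alg_closure)"
proof (induction k)
  case (Suc k)
  have "b ^ (2 ^ Suc k) = (b ^ (2 ^ k)) ^ 2" by (simp add: power_mult[symmetric] mult.commute)
  also have "\<dots> = b + (c + ftr k (c ^ 2))" by (simp add: Suc ac_sum_sq assms ftr_square add.assoc)
  also have "c + ftr k (c ^ 2) = ftr (Suc k) c" using ftr_shift[of k c] by (simp add: ftr_def add.commute)
  finally show ?case .
qed (simp add: ftr_def)

text \<open>If the quadratic form $\mathrm{Tr}(x^3+x)$ took the value one outside $\mathbb{F}_2$, its polar
  form would do so on pairs independent modulo $\mathbb{F}_2$, which contradicts bilinearity.\<close>

lemma exists_trace_zero:
  assumes n: "n \<ge> 5"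
  obtains a where "a \<in> Fqn n" "a \<noteq> 0" "a \<noteq> 1" "ftr n (a ^ 3 + a) = 0"
proof (rule ccontr)
  assume "\<not> thesis"
  then have no: "ftr n (a ^ 3 + a) = 1" if "a \<in> Fqn n" "a \<noteq> 0" "a \<noteq> 1" for a
    using that ftr_01[of "a ^ 3 + a" n] \<open>\<And>a. \<lbrakk>a \<in> Fqn n; a \<noteq> 0; a \<noteq> 1; ftr n (a ^ 3 + a) = 0\<rbrakk> \<Longrightarrow> thesis\<close> by auto
  let ?F = "Fqn n :: bit alg_closure set"
  have F: "finite ?F" "card ?F = 2 ^ n" using Fqn_card[of n] n by auto
  have "(2::nat) ^ 5 \<le> 2 ^ n" using n by (intro power_increasing) auto
  then have big: "card ?F \<ge> 32" using F by simp
  have ex: "\<exists>x\<in>?F. x \<notin> set xs" if "length xs \<le> 8" for xs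
  proof (rule ccontr)
    assume "\<not> ?thesis"
    then have "?F \<subseteq> set xs" by auto
    then have "card ?F \<le> card (set xs)" by (intro card_mono) auto
    also have "\<dots> \<le> 8" using card_length[of xs] that by simp
    finally show False using big by simp
  qed
  obtain a where a: "a \<in> ?F" "a \<notin> set [0, 1]" using ex[of "[0, 1]"] by auto
  obtain g where g: "g \<in> ?F" "g \<notin> set [0, 1, a, a + 1]" using ex[of "[0, 1, a, a + 1]"] by auto
  \<comment> \<open>The list is the F_2-span of 1, a and g. Then each of g, h and g + h avoids the
    span of 1 and a.\<close>
  obtain h where h: "h \<in> ?F" "h \<notin> set [0, 1, a, a + 1, g, g + 1, g + a, g + (a + 1)]"
    using ex[of "[0, 1, a, a + 1, g, g + 1, g + a, g + (a + 1)]"] by auto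
  define B where "B y = ftr n (a ^ 2 * y + a * y ^ 2)" for y
  have Badd: "B (x + y) = B x + B y" for x y
  proof -
    have "a ^ 2 * (x + y) + a * (x + y) ^ 2 = (a ^ 2 * x + a * x ^ 2) + (a ^ 2 * y + a * y ^ 2)"
      by (simp add: ac_sum_sq algebra_simps)
    then show ?thesis unfolding B_def by (simp only: ftr_add)
  qed
  have polar: "ftr n ((a + y) ^ 3 + (a + y)) = ftr n (a ^ 3 + a) + ftr n (y ^ 3 + y) + B y" for y
  proof -
    have "(a + y) ^ 3 = (a + y) * (a ^ 2 + y ^ 2)" by (simp add: power3_eq_cube power2_eq_square ac_sum_sq[unfolded power2_eq_square] mult.assoc)
    also have "\<dots> = a ^ 3 + y ^ 3 + (a ^ 2 * y + a * y ^ 2)"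
      by (simp add: algebra_simps power3_eq_cube power2_eq_square)
    finally have "(a + y) ^ 3 + (a + y) = (a ^ 3 + a) + (y ^ 3 + y) + (a ^ 2 * y + a * y ^ 2)" by (simp only: add_ac)
    then show ?thesis unfolding B_def by (simp only: ftr_add)
  qed
  have B1: "B y = 1" if y: "y \<in> ?F" "y \<noteq> 0" "y \<noteq> 1" "y \<noteq> a" "y \<noteq> a + 1" for y
  proof -
    have "a + y \<noteq> 1"
    proof
      assume "a + y = 1"
      then have "y = a + 1" by (metis ac_add_cancel)
      then show False using y by simp
    qed
    then have "ftr n ((a + y) ^ 3 + (a + y)) = 1" using a y by (intro no) auto
    moreover have "ftr n (a ^ 3 + a) = 1" "ftr n (y ^ 3 + y) = 1" using no a y by auto
    ultimately show ?thesis using polar[of y] by simp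
  qed
  have gh: "g + h \<noteq> 0" "g + h \<noteq> 1" "g + h \<noteq> a" "g + h \<noteq> a + 1"
  proof -
    have *: "h = g + x" if "g + h = x" for x using that by (metis ac_add_cancel)
    show "g + h \<noteq> 0" "g + h \<noteq> 1" "g + h \<noteq> a" "g + h \<noteq> a + 1" using *[of 0] *[of 1] *[of a] *[of "a + 1"] h(2) by auto
  qed
  \<comment> \<open>The additive B would take the value one at g, at h and at g + h, but 1 + 1 =
    0.\<close>
  have "B (g + h) = 1" by (rule B1) (use g(1) h(1) gh in auto)
  moreover have "B g = 1" "B h = 1" using g h by (auto intro!: B1)
  ultimately show False using Badd[of g h] by simp
qed

text \<open>Vanishing trace puts the y-coordinate into F_(2^n) as well, and since n is prime an
  x-coordinate outside F_2 generates the whole field.\<close>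

theorem exists_point_of_prime_degree:
  assumes n: "prime (n::nat)" "n \<ge> 5"
  obtains z where "on_curve z" "point_degree (Pt z) = n"
proof -
  obtain a where a: "a \<in> Fqn n" "a \<noteq> 0" "a \<noteq> 1" "ftr n (a ^ 3 + a) = 0" using exists_trace_zero[OF n(2)] .
  obtain b where z: "on_curve (a, b)" by (rule lift_point)
  then have "b ^ 2 = b + (a ^ 3 + a)" by (simp add: on_curve_def)
  then have "b ^ (2 ^ n) = b" using frobenius_lift[of b _ n] a(4) by simp
  then have b: "b \<in> Fqn n" by (simp add: Fqn_bit)
  interpret gpt "(a, b)" by unfold_locales (rule z)
  have evF: "evp q x \<in> Fqn n" if "x \<in> Fqn n" for q x
    by (induction q) (use that in \<open>auto split: bit.split simp: acscale_bit[unfolded acscale_def, of _ 1, simplified]\<close>)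
  have sub: "kres \<subseteq> Fqn n" using evF a(1) b by (auto simp: kres_def ev_def)
  obtain m where m: "m > 0" "kres = Fqn m" "card kres = 2 ^ m" by (rule kres_Fqn)
  have "e (ofx [:0, 1:]) = a" by simp
  then have "a \<in> kres" unfolding kres_def by (metis rangeI)
  then have "a \<in> Fqn (gcd m n)" using Fqn_gcd a(1) m(2) by blast
  moreover have "gcd m n = 1 \<or> gcd m n = n" using n(1) by (meson gcd_dvd2 prime_nat_iff)
  moreover have "a \<notin> Fqn 1"
  proof
    assume "a \<in> Fqn 1"
    then have "a ^ 2 = a" by (simp add: Fqn_bit)
    then show False using a by (simp add: power2_eq_square)
  qed
  ultimately have "n dvd m" by (metis gcd_dvd1)
  then have "n \<le> m" using m(1) by (rule dvd_imp_le)
  moreover have "card kres \<le> card (Fqn n :: bit alg_closure set)"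
    using sub Fqn_card[of n] n by (intro card_mono) auto
  then have "(2::nat) ^ m \<le> 2 ^ n" using m(3) Fqn_card[of n] n by simp
  then have "m \<le> n" by (subst (asm) power_increasing_iff) simp_all
  ultimately have "m = n" by simp
  then show ?thesis using that[OF z] point_degree_Pt[OF m(2,1)] by simp
qed

section \<open>Computing modulo a binary polynomial\<close>

text \<open>Lists are coefficient lists, lowest degree first; a monic modulus of degree $n$ is given by its
  $n$ lower coefficients.\<close>

fun bp :: "bool list \<Rightarrow> bit poly" where
  "bp [] = 0"
| "bp (b # bs) = pCons (of_bool b) (bp bs)"

fun ladd :: "bool list \<Rightarrow> bool list \<Rightarrow> bool list" where
  "ladd (x # xs) (y # ys) = (x \<noteq> y) # ladd xs ys"
| "ladd _ _ = []"

text \<open>Multiplication by the class of x: shift, and if a coefficient moves to degree n, replace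
  x^n by the lower part of the modulus.\<close>

definition xtime :: "bool list \<Rightarrow> bool list \<Rightarrow> bool list" where
  "xtime p xs = (if last xs then ladd (False # butlast xs) p else False # butlast xs)"

text \<open>Horner's scheme in the first factor.\<close>

fun lmul :: "bool list \<Rightarrow> bool list \<Rightarrow> bool list \<Rightarrow> bool list" where
  "lmul p [] ys = map (\<lambda>_. False) p"
| "lmul p (x # xs) ys = (let r = xtime p (lmul p xs ys) in if x then ladd ys r else r)"

lemma length_ladd [simp]: "length xs = length ys \<Longrightarrow> length (ladd xs ys) = length ys"
  by (induction xs ys rule: ladd.induct) auto

lemma length_xtime [simp]: "p \<noteq> [] \<Longrightarrow> length xs = length p \<Longrightarrow> length (xtime p xs) = length p"
  by (auto simp: xtime_def)

lemma length_lmul [simp]: "p \<noteq> [] \<Longrightarrow> length ys = length p \<Longrightarrow> length (lmul p xs ys) = length p"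
  by (induction xs) (auto simp: Let_def)

lemma bp_ladd: "length xs = length ys \<Longrightarrow> bp (ladd xs ys) = bp xs + bp ys"
  by (induction xs ys rule: ladd.induct) auto

lemma bp_append: "bp (xs @ [b]) = bp xs + Polynomial.monom (of_bool b) (length xs)"
  by (induction xs) (auto simp: Polynomial.monom_0 Polynomial.monom_Suc)

lemma bp_zeros [simp]: "bp (map (\<lambda>_. False) p) = 0"
  by (induction p) auto

lemma degree_bp: "bp xs = 0 \<or> Polynomial.degree (bp xs) < length xs"
proof (induction xs)
  case (Cons b xs)
  then show ?case by (cases "bp xs = 0") (auto simp: degree_pCons_eq_if)
qed simp

lemma inj_bp: "length xs = length ys \<Longrightarrow> bp xs = bp ys \<Longrightarrow> xs = ys"
  by (induction xs ys rule: list_induct2) (auto split: if_splits simp: of_bool_def)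

lemma bp_surj: "q = 0 \<or> Polynomial.degree q < n \<Longrightarrow> \<exists>xs. length xs = n \<and> bp xs = q"
proof (induction n arbitrary: q)
  case 0
  then show ?case by auto
next
  case (Suc n)
  obtain c h where h: "q = pCons c h" by (rule pCons_cases)
  have "h = 0 \<or> Polynomial.degree h < n" using Suc.prems by (cases "h = 0") (auto simp: h)
  then obtain xs where "length xs = n" "bp xs = h" using Suc.IH by blast
  then show ?case by (intro exI[of _ "(c = 1) # xs"]) (cases c; simp add: h)
qed

definition monic :: "bool list \<Rightarrow> bit poly" where
  "monic p = bp p + Polynomial.monom 1 (length p)"

definition le :: "bit alg_closure \<Rightarrow> bool list \<Rightarrow> bit alg_closure" where
  "le a xs = evp (bp xs) a"

lemma le_Cons: "le a (x # xs) = of_bool x + a * le a xs"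
  by (cases x) (simp_all add: le_def)

lemma le_ladd: "length xs = length ys \<Longrightarrow> le a (ladd xs ys) = le a xs + le a ys"
  by (simp add: le_def bp_ladd)

lemma evp_monom: "evp (Polynomial.monom 1 k) a = a ^ k"
  by (induction k) (simp_all add: Polynomial.monom_0 Polynomial.monom_Suc)

lemma le_append: "le a (xs @ [b]) = le a xs + of_bool b * a ^ length xs"
  by (cases b) (simp_all add: le_def bp_append evp_monom)

context
  fixes p :: "bool list" and a :: "bit alg_closure"
  assumes p: "p \<noteq> []" and root: "evp (monic p) a = 0"
begin

lemma a_power: "a ^ length p = le a p"
  using root by (simp add: monic_def evp_monom le_def)

lemma le_xtime: assumes "length xs = length p" shows "le a (xtime p xs) = a * le a xs"
proof -
  have "xs \<noteq> []" using assms p by auto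
  then have xs: "xs = butlast xs @ [last xs]" by simp
  have l: "Suc (length (butlast xs)) = length p" using assms p by auto
  have "a * le a xs = a * (le a (butlast xs) + of_bool (last xs) * a ^ length (butlast xs))"
    using le_append[of a "butlast xs" "last xs"] xs by simp
  also have "\<dots> = a * le a (butlast xs) + of_bool (last xs) * (a * a ^ length (butlast xs))"
    by (simp only: distrib_left mult.left_commute)
  also have "a * a ^ length (butlast xs) = le a p" using a_power l by (metis power_Suc)
  finally have "a * le a xs = a * le a (butlast xs) + of_bool (last xs) * le a p" .
  then show ?thesis using l by (auto simp: xtime_def le_ladd le_Cons)
qed

lemma le_lmul: "length ys = length p \<Longrightarrow> le a (lmul p xs ys) = le a xs * le a ys"
proof (induction xs)
  case Nil
  show ?case by (simp add: le_def)
next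
  case (Cons x xs)
  then show ?case using p by (cases x) (simp_all add: Let_def le_xtime le_ladd le_Cons algebra_simps)
qed

end

section \<open>Tests for the degree and the splitting of a point\<close>

fun frob :: "bool list \<Rightarrow> nat \<Rightarrow> bool list \<Rightarrow> bool list" where
  "frob p 0 xs = xs"
| "frob p (Suc k) xs = frob p k (lmul p xs xs)"

text \<open>The power with exponent 1 + 2 + ... + 2^k. For k = n - 1 it is the norm to F_2, so the
  value 1 certifies that an element is not zero at any root of p.\<close>

fun lnorm :: "bool list \<Rightarrow> nat \<Rightarrow> bool list \<Rightarrow> bool list" where
  "lnorm p 0 xs = xs"
| "lnorm p (Suc k) xs = lmul p xs (lnorm p k (lmul p xs xs))"

fun ltr :: "bool list \<Rightarrow> nat \<Rightarrow> bool list \<Rightarrow> bool list" where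
  "ltr p 0 xs = map (\<lambda>_. False) p"
| "ltr p (Suc k) xs = ladd xs (ltr p k (lmul p xs xs))"

definition lone :: "nat \<Rightarrow> bool list" where "lone n = True # replicate (n - 1) False"

definition lx :: "nat \<Rightarrow> bool list" where "lx n = False # True # replicate (n - 2) False"

text \<open>\<open>deg_test p ds\<close> checks that a root of \<open>p\<close> lies in $\mathbb{F}_{2^n}$ but, its difference with
  its conjugate being invertible, in no $\mathbb{F}_{2^d}$ with \<open>d\<close> in \<open>ds\<close>.\<close>

definition deg_test :: "bool list \<Rightarrow> nat list \<Rightarrow> bool" where
  "deg_test p ds \<longleftrightarrow> (let n = length p in
     n \<ge> 2 \<and> frob p n (lx n) = lx n \<and>
     (\<forall>d\<in>set ds. lnorm p (n - 1) (ladd (frob p d (lx n)) (lx n)) = lone n))"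

text \<open>The list u is a y-coordinate over the root of p that is already a polynomial in that
  root.\<close>

definition split_test :: "bool list \<Rightarrow> bool list \<Rightarrow> bool" where
  "split_test p u \<longleftrightarrow> length u = length p \<and>
     ladd (lmul p u u) u = ladd (lmul p (lx (length p)) (lmul p (lx (length p)) (lx (length p)))) (lx (length p))"

text \<open>Trace one of x^3 + x means that y^2 + y = x^3 + x has no solution in the field generated
  by the root of p.\<close>

definition inert_test :: "bool list \<Rightarrow> bool" where
  "inert_test p \<longleftrightarrow> (let n = length p; x = lx n in
     ltr p n (ladd (lmul p x (lmul p x x)) x) = lone n)"

lemma le_replicate [simp]: "le a (replicate k False) = 0"
  by (induction k) (simp_all add: le_Cons, simp add: le_def)

lemma le_lone: "le a (lone n) = 1"
  by (simp add: lone_def le_Cons)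

lemma le_lx: "le a (lx n) = a"
  by (simp add: lx_def le_Cons)

lemma length_lx [simp]: "n \<ge> 2 \<Longrightarrow> length (lx n) = n"
  by (simp add: lx_def)

context
  fixes p :: "bool list" and a :: "bit alg_closure"
  assumes p: "p \<noteq> []" and root: "evp (monic p) a = 0"
begin

lemma le_frob: "length xs = length p \<Longrightarrow> length (frob p k xs) = length p \<and> le a (frob p k xs) = le a xs ^ (2 ^ k)"
proof (induction k arbitrary: xs)
  case (Suc k)
  then show ?case using p le_lmul[OF p root, of xs xs] Suc.IH[of "lmul p xs xs"]
    by (simp add: power_mult power2_eq_square)
qed simp

lemma le_lnorm_dvd: "length xs = length p \<Longrightarrow> length (lnorm p k xs) = length p \<and> (le a xs = 0 \<longrightarrow> le a (lnorm p k xs) = 0)"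
proof (induction k arbitrary: xs)
  case (Suc k)
  then show ?case using p Suc.IH[of "lmul p xs xs"] le_lmul[OF p root, of "lnorm p k (lmul p xs xs)" xs] by simp
qed simp

lemma le_ltr: "length xs = length p \<Longrightarrow> length (ltr p k xs) = length p \<and> le a (ltr p k xs) = ftr k (le a xs)"
proof (induction k arbitrary: xs)
  case 0
  then show ?case by (simp add: ftr_def le_def)
next
  case (Suc k)
  have s: "ftr (Suc k) x = x + ftr k (x ^ 2)" for x :: "bit alg_closure"
    using ftr_shift[of k x] by (simp add: ftr_def add.commute)
  show ?case using p Suc le_lmul[OF p root, of xs xs] Suc.IH[of "lmul p xs xs"]
    by (simp add: le_ladd s power2_eq_square)
qed

text \<open>The field generated by a is F_(2^m) with m dividing n. If m were proper, a would lie in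
  F_(2^d) for some d in \<open>ds\<close>, whereas the difference of a and a^(2^d) has norm 1. So m
  = n, and p, having the degree of the minimal polynomial of a, is equal to it; irreducibility comes
  as a result.\<close>

lemma deg_test_sound:
  assumes t: "deg_test p ds" and ds: "\<And>m. m dvd length p \<Longrightarrow> m \<noteq> length p \<Longrightarrow> \<exists>d\<in>set ds. m dvd d"
  shows "mp a = monic p" "Polynomial.degree (mp a) = length p" "range (\<lambda>q. evp q a) = Fqn (length p)"
proof -
  let ?n = "length p"
  let ?K = "range (\<lambda>q. evp q a)"
  have n2: "?n \<ge> 2" and fr: "frob p ?n (lx ?n) = lx ?n"
    and nm: "\<And>d. d \<in> set ds \<Longrightarrow> lnorm p (?n - 1) (ladd (frob p d (lx ?n)) (lx ?n)) = lone ?n"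
    using t by (auto simp: deg_test_def Let_def)
  have an: "a \<in> Fqn ?n" using le_frob[of "lx ?n" ?n] fr n2 by (simp add: le_lx Fqn_bit)
  have ad: "a \<notin> Fqn d" if "d \<in> set ds" for d
  proof
    assume "a \<in> Fqn d"
    then have "le a (ladd (frob p d (lx ?n)) (lx ?n)) = 0"
      using le_frob[of "lx ?n" d] n2 by (simp add: le_ladd le_lx Fqn_bit)
    moreover have "length (ladd (frob p d (lx ?n)) (lx ?n)) = ?n" using le_frob[of "lx ?n" d] n2 by simp
    ultimately have "le a (lone ?n) = 0"
      using le_lnorm_dvd[of "ladd (frob p d (lx ?n)) (lx ?n)" "?n - 1"] nm[OF that] by simp
    then show False by (simp add: le_lone)
  qed
  obtain m where m: "m > 0" "?K = Fqn m" "card ?K = 2 ^ m"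
  proof (rule finite_subring_Fqn[of ?K])
    show "finite ?K" using card_range_evp by blast
    show "0 \<in> ?K" by (rule range_eqI[of _ _ 0]) simp
    show "1 \<in> ?K" by (rule range_eqI[of _ _ 1]) simp
    show "x + y \<in> ?K" if "x \<in> ?K" "y \<in> ?K" for x y using that by (auto simp flip: evp_add)
    show "x * y \<in> ?K" if "x \<in> ?K" "y \<in> ?K" for x y using that by (auto simp flip: evp_mult)
  qed
  have aK: "a \<in> ?K" by (rule range_eqI[of _ _ "[:0, 1:]"]) simp
  then have ag: "a \<in> Fqn (gcd m ?n)" using Fqn_gcd an m(2) by blast
  have evF: "evp q a \<in> Fqn k" if "a \<in> Fqn k" for q k
    by (induction q) (use that in \<open>auto split: bit.split simp: acscale_bit[unfolded acscale_def, of _ 1, simplified]\<close>)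
  have "?K \<subseteq> Fqn (gcd m ?n)" using evF[OF ag] by auto
  moreover have g0: "gcd m ?n > 0" using m(1) by simp
  ultimately have "card ?K \<le> card (Fqn (gcd m ?n) :: bit alg_closure set)" using Fqn_card by (intro card_mono) auto
  then have "(2::nat) ^ m \<le> 2 ^ gcd m ?n" using m(3) Fqn_card(2)[OF g0] by simp
  then have "m \<le> gcd m ?n" by (subst (asm) power_increasing_iff) simp_all
  then have "gcd m ?n = m" using m(1) by (intro le_antisym gcd_le1_nat) simp_all
  then have md: "m dvd ?n" by (metis gcd_dvd2)
  have "m = ?n"
  proof (rule ccontr)
    assume "m \<noteq> ?n"
    then obtain d where d: "d \<in> set ds" "m dvd d" using ds md by blast
    then obtain k where "d = m * k" by (auto elim: dvdE)
    then have "a \<in> Fqn d" using aK m(2) Fqn_iter by simp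
    then show False using ad d by blast
  qed
  then show "?K = Fqn ?n" using m(2) by simp
  have "(2::nat) ^ Polynomial.degree (mp a) = 2 ^ ?n" using card_range_evp[of a] m(3) \<open>m = ?n\<close> by simp
  then show deg: "Polynomial.degree (mp a) = ?n" by simp
  have "mp a dvd monic p" using root mp_dvd_iff by blast
  then obtain h where h: "monic p = mp a * h" by (rule dvdE)
  have dm: "Polynomial.degree (monic p) = ?n"
    unfolding monic_def using degree_bp[of p] p by (subst degree_add_eq_right) (auto simp: Polynomial.degree_monom_eq)
  then have "monic p \<noteq> 0" using n2 by auto
  then have hnz: "h \<noteq> 0" using h by auto
  then have "Polynomial.degree h = 0" using dm deg unfolding h by (simp add: degree_mult_eq)
  then show "mp a = monic p" using h bit_poly_unit[OF _ hnz] by simp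
qed

end

lemma monic_root: assumes "p \<noteq> []" obtains a where "evp (monic p) a = 0"
proof -
  have "Polynomial.degree (monic p) = length p"
    unfolding monic_def using degree_bp[of p] assms by (subst degree_add_eq_right) (auto simp: Polynomial.degree_monom_eq)
  moreover have "Polynomial.degree (map_poly to_ac (monic p)) = Polynomial.degree (monic p)" by (rule degree_map_poly) simp
  ultimately show ?thesis
    using alg_closed_imp_poly_has_root[of "map_poly to_ac (monic p)"] assms that by (auto simp: evp_def)
qed

definition fiber :: "bit poly \<Rightarrow> bit univ_field set set" where
  "fiber q = {Pt z | z. on_curve z \<and> mp (fst z) = q}"

lemma fiber_eq: assumes "on_curve z" shows "fiber (mp (fst z)) = {Pt z, Pt (conjp z)}"
proof -
  have "fiber (mp (fst z)) \<subseteq> {Pt z, Pt (conjp z)}"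
    unfolding fiber_def using Pt_over_mp[OF assms] by blast
  moreover have "Pt z \<in> fiber (mp (fst z))" unfolding fiber_def using assms by blast
  moreover have "Pt (conjp z) \<in> fiber (mp (fst z))"
    unfolding fiber_def using assms by (intro CollectI exI[of _ "conjp z"]) simp
  ultimately show ?thesis by blast
qed

lemma fiber_disjoint: assumes "q \<noteq> q'" shows "fiber q \<inter> fiber q' = {}"
proof (rule ccontr)
  assume "fiber q \<inter> fiber q' \<noteq> {}"
  then obtain P where "P \<in> fiber q" "P \<in> fiber q'" by blast
  then obtain z w where zw: "on_curve z" "mp (fst z) = q" "on_curve w" "mp (fst w) = q'" "Pt z = Pt w"
    by (auto simp: fiber_def)
  interpret z: gpt z by unfold_locales (rule zw)
  interpret w: gpt w by unfold_locales (rule zw)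
  have "ordv (Pt w) (ofp (mp (fst z))) \<ge> 1" using z.ordv_p zw(5) by simp
  then have "evp (mp (fst z)) (fst w) = 0" using ordv_Pt_ofp[OF zw(3), of "mp (fst z)"] by simp
  then have "mp (fst w) = mp (fst z)" by (rule mp_eqI)
  then show False using zw assms by simp
qed

lemma fiber_CP: "fiber q \<subseteq> CP"
  by (auto simp: fiber_def)

text \<open>The y-coordinate already lies in the field of the x-coordinate, so the two conjugate
  points are distinct and have the degree of p.\<close>

lemma split_fiber:
  assumes t: "deg_test p ds" "split_test p u" and ds: "\<And>m. m dvd length p \<Longrightarrow> m \<noteq> length p \<Longrightarrow> \<exists>d\<in>set ds. m dvd d"
  shows "card (fiber (monic p)) = 2" "\<And>P. P \<in> fiber (monic p) \<Longrightarrow> point_degree P = length p"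
proof -
  have n2: "length p \<ge> 2" using t by (simp add: deg_test_def Let_def)
  then have p: "p \<noteq> []" by auto
  obtain a where a: "evp (monic p) a = 0" using monic_root[OF p] .
  note ds' = deg_test_sound[OF p a t(1) ds]
  define z where "z = (a, le a u)"
  let ?x = "lx (length p)"
  have lu: "length u = length p" and eq: "ladd (lmul p u u) u = ladd (lmul p ?x (lmul p ?x ?x)) ?x"
    using t(2) by (auto simp: split_test_def)
  have "le a (ladd (lmul p u u) u) = le a u ^ 2 + le a u"
    using le_lmul[OF p a, of u u] lu p by (simp add: le_ladd power2_eq_square)
  moreover have "le a (ladd (lmul p ?x (lmul p ?x ?x)) ?x) = a ^ 3 + a"
    using le_lmul[OF p a] n2 p by (simp add: le_ladd le_lx power3_eq_cube)
  ultimately have "le a u ^ 2 + le a u = a ^ 3 + a" using eq by simp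
  then have "le a u ^ 2 = le a u + (a ^ 3 + a)" by (metis ac_add_cancel add.commute)
  then have z: "on_curve z" by (simp add: on_curve_def z_def)
  interpret gpt z by unfold_locales (rule z)
  have mz: "mp (fst z) = monic p" using ds' by (simp add: z_def)
  have "snd z \<in> range (\<lambda>q. evp q (fst z))" by (simp add: z_def le_def)
  then have f: "Pt z \<noteq> Pt (conjp z)" "point_degree (Pt z) = length p"
    using fiber_degree ds'(2) by (auto simp: z_def)
  have fib: "fiber (monic p) = {Pt z, Pt (conjp z)}" using fiber_eq[OF z] mz by simp
  show "card (fiber (monic p)) = 2" unfolding fib using f(1) by simp
  show "point_degree P = length p" if "P \<in> fiber (monic p)" for P
    using that f(2) point_degree_conj[OF z] unfolding fib by auto
qed

text \<open>The trace keeps the y-coordinate out of the field of the x-coordinate, so one point of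
  twice the degree lies above p.\<close>

lemma inert_fiber:
  assumes t: "deg_test p ds" "inert_test p" and ds: "\<And>m. m dvd length p \<Longrightarrow> m \<noteq> length p \<Longrightarrow> \<exists>d\<in>set ds. m dvd d"
  shows "card (fiber (monic p)) = 1" "\<And>P. P \<in> fiber (monic p) \<Longrightarrow> point_degree P = 2 * length p"
proof -
  have n2: "length p \<ge> 2" using t by (simp add: deg_test_def Let_def)
  then have p: "p \<noteq> []" by auto
  obtain a where a: "evp (monic p) a = 0" using monic_root[OF p] .
  note ds' = deg_test_sound[OF p a t(1) ds]
  obtain b where z0: "on_curve (a, b)" by (rule lift_point)
  define z where "z = (a, b)"
  have z: "on_curve z" using z0 by (simp add: z_def)
  interpret gpt z by unfold_locales (rule z)
  let ?x = "lx (length p)"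
  have "b ^ 2 = b + (a ^ 3 + a)" using z0 by (simp add: on_curve_def)
  then have "b ^ (2 ^ length p) = b + ftr (length p) (a ^ 3 + a)" by (rule frobenius_lift)
  moreover have "le a (ladd (lmul p ?x (lmul p ?x ?x)) ?x) = a ^ 3 + a"
    using le_lmul[OF p a] n2 p by (simp add: le_ladd le_lx power3_eq_cube)
  then have "ftr (length p) (a ^ 3 + a) = 1"
    using le_ltr[OF p a, of "ladd (lmul p ?x (lmul p ?x ?x)) ?x" "length p"] t(2) n2 p
    by (simp add: inert_test_def Let_def le_lone)
  ultimately have "b \<notin> Fqn (length p)" by (simp add: Fqn_bit)
  then have "snd z \<notin> range (\<lambda>q. evp q (fst z))" using ds'(3) by (simp add: z_def)
  then have f: "Pt z = Pt (conjp z)" "point_degree (Pt z) = 2 * length p"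
    using fiber_degree ds'(2) by (auto simp: z_def)
  have mz: "mp (fst z) = monic p" using ds' by (simp add: z_def)
  then have fib: "fiber (monic p) = {Pt z}" using fiber_eq[OF z] f(1) by simp
  show "card (fiber (monic p)) = 1" unfolding fib by simp
  show "point_degree P = 2 * length p" if "P \<in> fiber (monic p)" for P
    using that f(2) unfolding fib by auto
qed

section \<open>Closed points of small degree\<close>

abbreviation (input) "b0 \<equiv> False"
abbreviation (input) "b1 \<equiv> True"

text \<open>The numbers in the names are the degrees of points of the curve. A polynomial $p$ over which
  there are two such points comes with a $u$ such that $u^2+u = x^3+x$ modulo $p$; an inert
  polynomial has half the degree of the single point over it.\<close>

definition split8 :: "(bool list \<times> bool list) list" where
  "split8 = [([b1, b1, b0, b1, b1, b0, b0, b0], [b0, b0, b1, b1, b0, b1, b0, b1]),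
    ([b1, b0, b1, b1, b1, b0, b0, b0], [b0, b0, b1, b0, b0, b0, b1, b1]),
    ([b1, b0, b1, b1, b0, b0, b1, b0], [b0, b0, b0, b0, b1, b0, b1, b1]),
    ([b1, b1, b1, b1, b1, b0, b1, b0], [b0, b0, b0, b1, b1, b1, b0, b1]),
    ([b1, b1, b1, b0, b0, b0, b0, b1], [b0, b0, b0, b0, b1, b0, b1, b0]),
    ([b1, b1, b0, b1, b0, b0, b0, b1], [b0, b0, b0, b0, b1, b1, b0, b0]),
    ([b1, b0, b1, b1, b0, b0, b0, b1], [b0, b0, b1, b0, b1, b1, b0, b0]),
    ([b1, b1, b1, b1, b1, b0, b0, b1], [b0, b0, b0, b0, b0, b0, b1, b0]),
    ([b1, b1, b1, b0, b0, b1, b1, b1], [b0, b1, b1, b0, b1, b0, b1, b0]),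
    ([b1, b1, b0, b0, b1, b1, b1, b1], [b0, b0, b0, b0, b0, b1, b0, b0]),
    ([b1, b0, b1, b0, b1, b1, b1, b1], [b0, b0, b1, b0, b0, b1, b0, b0]),
    ([b1, b0, b0, b1, b1, b1, b1, b1], [b0, b1, b1, b0, b0, b0, b1, b0])]"

definition split6 :: "(bool list \<times> bool list) list" where
  "split6 = [([b1, b1, b0, b0, b0, b0], [b0, b1, b0, b0, b1, b1]),
    ([b1, b1, b1, b0, b1, b0], [b0, b1, b0, b0, b0, b1]),
    ([b1, b0, b0, b0, b0, b1], [b0, b0, b1, b1, b1, b0]),
    ([b1, b1, b1, b0, b0, b1], [b0, b0, b0, b1, b1, b0])]"

definition split5 :: "(bool list \<times> bool list) list" where
  "split5 = [([b1, b0, b0, b1, b0], [b0, b0, b0, b0, b1]),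
    ([b1, b0, b1, b1, b1], [b0, b1, b0, b0, b1])]"

definition split4 :: "(bool list \<times> bool list) list" where
  "split4 = [([b1, b0, b0, b1], [b0, b0, b1, b1]),
    ([b1, b1, b1, b1], [b0, b0, b0, b1])]"

definition inert8 :: "bool list list" where
  "inert8 = [[b1, b1, b0, b0]]"

definition inert6 :: "bool list list" where
  "inert6 = [[b1, b1, b0], [b1, b0, b1]]"

definition inert4 :: "bool list list" where
  "inert4 = [[b1, b1]]"

definition test_points :: "(bool list \<times> bool list) list \<Rightarrow> bool list list \<Rightarrow> nat list \<Rightarrow> nat list \<Rightarrow> bool" where
  "test_points ss is ds es \<longleftrightarrow> (\<forall>(p, u)\<in>set ss. deg_test p ds \<and> split_test p u) \<and>
     (\<forall>p\<in>set is. deg_test p es \<and> inert_test p)"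

text \<open>Every proper divisor of 8 divides 4, and every proper divisor of 4, the degree of the
  inert polynomial, divides 2. The lists in the next tests are chosen likewise.\<close>

lemma test8: "test_points split8 inert8 [4] [2]"
  by code_simp

lemma test6: "test_points split6 inert6 [2, 3] [1]"
  by code_simp

lemma test5: "test_points split5 [] [1] []"
  by code_simp

lemma test4: "test_points split4 inert4 [2] [1]"
  by code_simp

section \<open>Symmetric multiplication algorithms from certificates\<close>

text \<open>A certificate of length $m$ for an algebra of dimension $n$ consists of the $m$ elements
  \<open>ws\<close> and the list \<open>cols\<close> of the values of all $m$ linear forms at the basis vectors.\<close>

fun units :: "nat \<Rightarrow> bool list list" where
  "units 0 = []"
| "units (Suc n) = (True # replicate n False) # map ((#) False) (units n)"

fun lin :: "nat \<Rightarrow> bool list list \<Rightarrow> bool list \<Rightarrow> bool list" where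
  "lin m (c # cs) (x # xs) = (if x then ladd c (lin m cs xs) else lin m cs xs)"
| "lin m _ _ = replicate m False"

text \<open>With the values of all forms at two basis vectors as first lists, this is the right-hand
  side of the multiplication algorithm at that pair.\<close>

fun csum :: "nat \<Rightarrow> bool list \<Rightarrow> bool list \<Rightarrow> bool list list \<Rightarrow> bool list" where
  "csum n (a # bs) (c # ds) (w # ws) =
     (if a then if c then ladd w (csum n bs ds ws) else csum n bs ds ws else csum n bs ds ws)"
| "csum n _ _ _ = replicate n False"

fun rowtest :: "bool list \<Rightarrow> bool list list \<Rightarrow> bool list list \<Rightarrow> bool list list \<Rightarrow> bool" where
  "rowtest c (v # vs) (d # ds) ws \<longleftrightarrow> v = csum (length v) c d ws \<and> rowtest c vs ds ws"
| "rowtest c _ _ ws \<longleftrightarrow> True"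

text \<open>The list \<open>vs\<close> starts as the unit vectors and is multiplied by x after each
  row, so row i is compared with the products of x^i and all basis vectors.\<close>

fun tabtest :: "bool list \<Rightarrow> bool list list \<Rightarrow> bool list list \<Rightarrow> bool list list \<Rightarrow> bool list list \<Rightarrow> bool" where
  "tabtest p vs (c # cs) cols ws \<longleftrightarrow> rowtest c vs cols ws \<and> tabtest p (map (xtime p) vs) cs cols ws"
| "tabtest p vs [] cols ws \<longleftrightarrow> True"

definition cert_test :: "bool list \<Rightarrow> bool list list \<Rightarrow> bool list list \<Rightarrow> bool" where
  "cert_test p cols ws \<longleftrightarrow> p \<noteq> [] \<and> length cols = length p \<and> (\<forall>c\<in>set cols. length c = length ws) \<and>
     (\<forall>w\<in>set ws. length w = length p) \<and> tabtest p (units (length p)) cols cols ws"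

text \<open>Row i lists the values of the forms at x^i. The nine columns form a 3 by 3 array: in
  each block of three the last is the sum of the others, and the third block is the sum of the first
  two. This is Karatsuba's pattern applied twice, 9 = 3 * 3.\<close>

definition field4_forms :: "bool list list" where
  "field4_forms =
   [[b0, b0, b0, b0, b1, b1, b0, b1, b1],
    [b0, b1, b1, b0, b1, b1, b0, b0, b0],
    [b0, b1, b1, b1, b0, b1, b1, b1, b0],
    [b1, b0, b1, b0, b1, b1, b1, b1, b0]]"

definition field4_vals :: "bool list list" where
  "field4_vals =
   [[b0, b1, b1, b0],
    [b1, b1, b1, b0],
    [b1, b0, b0, b0],
    [b0, b1, b0, b0],
    [b0, b0, b1, b1],
    [b0, b1, b1, b1],
    [b1, b1, b0, b0],
    [b0, b1, b0, b1],
    [b1, b0, b0, b1]]"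

definition field5_forms :: "bool list list" where
  "field5_forms =
   [[b1, b0, b1, b0, b1, b0, b0, b0, b0, b1, b1, b1, b0],
    [b0, b1, b1, b0, b0, b0, b0, b1, b1, b1, b0, b0, b1],
    [b0, b0, b0, b1, b1, b0, b1, b1, b0, b1, b0, b1, b1],
    [b0, b0, b0, b0, b0, b1, b1, b1, b0, b0, b1, b1, b1],
    [b0, b0, b0, b0, b0, b0, b0, b0, b1, b1, b1, b1, b1]]"

definition field5_vals :: "bool list list" where
  "field5_vals =
   [[b1, b0, b0, b1, b1],
    [b1, b1, b1, b0, b1],
    [b0, b1, b0, b1, b1],
    [b1, b1, b1, b1, b1],
    [b0, b1, b0, b0, b1],
    [b1, b0, b0, b1, b0],
    [b1, b1, b0, b1, b1],
    [b0, b0, b1, b1, b0],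
    [b1, b0, b0, b0, b0],
    [b0, b0, b0, b1, b1],
    [b0, b1, b1, b0, b0],
    [b0, b1, b1, b1, b0],
    [b0, b0, b1, b1, b1]]"

text \<open>The columns come in five triples of the form a, b, a + b, the pattern of three products
  for F_4; hence 15 = 3 * 5.\<close>

definition field6_forms :: "bool list list" where
  "field6_forms =
   [[b0, b1, b1, b0, b1, b1, b0, b0, b0, b0, b1, b1, b0, b1, b1],
    [b0, b1, b1, b0, b1, b1, b0, b1, b1, b1, b0, b1, b1, b0, b1],
    [b0, b1, b1, b0, b0, b0, b1, b1, b0, b0, b0, b0, b0, b1, b1],
    [b0, b0, b0, b0, b1, b1, b0, b1, b1, b0, b0, b0, b0, b1, b1],
    [b0, b1, b1, b1, b0, b1, b1, b1, b0, b0, b1, b1, b1, b0, b1],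
    [b1, b0, b1, b0, b0, b0, b1, b1, b0, b0, b1, b1, b1, b1, b0]]"

definition field6_vals :: "bool list list" where
  "field6_vals =
   [[b1, b1, b0, b1, b1, b1],
    [b0, b1, b0, b1, b1, b1],
    [b1, b0, b0, b0, b0, b0],
    [b1, b1, b1, b0, b1, b1],
    [b0, b1, b0, b0, b0, b0],
    [b1, b0, b1, b0, b1, b1],
    [b1, b1, b0, b1, b0, b0],
    [b1, b1, b1, b1, b1, b0],
    [b0, b0, b1, b0, b1, b0],
    [b0, b1, b0, b0, b1, b1],
    [b0, b0, b0, b0, b1, b0],
    [b0, b1, b0, b0, b0, b1],
    [b1, b1, b1, b1, b1, b1],
    [b1, b1, b0, b0, b1, b0],
    [b0, b0, b1, b1, b0, b1]]"

text \<open>Again triples a, b, a + b, now eight of them; hence 24 = 3 * 8.\<close>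

definition field8_forms :: "bool list list" where
  "field8_forms =
   [[b0, b0, b0, b0, b1, b1, b0, b1, b1, b0, b1, b1, b0, b0, b0, b0, b1, b1, b0, b0, b0, b1, b1, b0],
    [b0, b1, b1, b0, b1, b1, b0, b0, b0, b0, b1, b1, b0, b0, b0, b1, b1, b0, b1, b1, b0, b0, b1, b1],
    [b0, b1, b1, b0, b1, b1, b0, b0, b0, b1, b0, b1, b1, b1, b0, b0, b0, b0, b1, b1, b0, b0, b0, b0],
    [b0, b1, b1, b0, b1, b1, b0, b0, b0, b0, b1, b1, b1, b1, b0, b1, b0, b1, b1, b0, b1, b1, b0, b1],
    [b0, b1, b1, b1, b0, b1, b1, b1, b0, b1, b1, b0, b1, b0, b1, b0, b0, b0, b1, b0, b1, b1, b0, b1],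
    [b1, b0, b1, b0, b1, b1, b1, b1, b0, b0, b1, b1, b1, b0, b1, b0, b1, b1, b1, b0, b1, b1, b0, b1],
    [b0, b1, b1, b1, b1, b0, b1, b0, b1, b1, b1, b0, b1, b0, b1, b1, b0, b1, b0, b0, b0, b1, b0, b1],
    [b1, b1, b0, b0, b1, b1, b1, b0, b1, b1, b1, b0, b0, b0, b0, b0, b1, b1, b0, b1, b1, b1, b1, b0]]"

definition field8_vals :: "bool list list" where
  "field8_vals =
   [[b0, b1, b0, b1, b0, b1, b1, b0],
    [b0, b0, b0, b0, b0, b1, b0, b0],
    [b0, b1, b0, b1, b0, b0, b1, b0],
    [b0, b1, b1, b0, b0, b1, b0, b0],
    [b1, b0, b0, b1, b0, b1, b1, b1],
    [b1, b1, b1, b1, b0, b0, b1, b1],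
    [b0, b1, b1, b0, b0, b0, b0, b0],
    [b1, b1, b0, b0, b0, b1, b0, b1],
    [b1, b0, b1, b0, b0, b1, b0, b1],
    [b1, b1, b0, b1, b0, b1, b0, b0],
    [b1, b0, b0, b1, b0, b0, b0, b0],
    [b0, b1, b0, b0, b0, b1, b0, b0],
    [b1, b1, b0, b0, b1, b1, b0, b1],
    [b0, b0, b0, b0, b0, b0, b0, b1],
    [b1, b1, b0, b0, b1, b1, b0, b0],
    [b1, b1, b0, b1, b1, b1, b1, b1],
    [b1, b1, b0, b1, b0, b0, b0, b1],
    [b0, b0, b0, b0, b1, b1, b1, b0],
    [b1, b0, b1, b1, b1, b1, b1, b0],
    [b1, b1, b0, b1, b1, b0, b0, b0],
    [b0, b1, b1, b0, b0, b1, b1, b0],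
    [b1, b0, b1, b0, b1, b1, b1, b0],
    [b0, b0, b1, b0, b0, b0, b0, b1],
    [b1, b0, b0, b0, b1, b1, b1, b1]]"

text \<open>The mixed terms x_i y_j + x_j y_i come from (x_i + x_j)(y_i + y_j) and the products x_i
  y_i and x_j y_j. Modulo t^5 only the six pairs i < j with i + j <= 4 matter, so 5 + 6 = 11
  products suffice.\<close>

definition trunc5_forms :: "bool list list" where
  "trunc5_forms =
   [[b1, b0, b0, b0, b0, b1, b1, b1, b1, b0, b0],
    [b0, b1, b0, b0, b0, b1, b0, b0, b0, b1, b1],
    [b0, b0, b1, b0, b0, b0, b1, b0, b0, b1, b0],
    [b0, b0, b0, b1, b0, b0, b0, b1, b0, b0, b1],
    [b0, b0, b0, b0, b1, b0, b0, b0, b1, b0, b0]]"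

definition trunc5_vals :: "bool list list" where
  "trunc5_vals =
   [[b1, b1, b1, b1, b1],
    [b0, b1, b1, b1, b1],
    [b0, b0, b1, b1, b1],
    [b0, b0, b0, b1, b1],
    [b0, b0, b0, b0, b1],
    [b0, b1, b0, b0, b0],
    [b0, b0, b1, b0, b0],
    [b0, b0, b0, b1, b0],
    [b0, b0, b0, b0, b1],
    [b0, b0, b0, b1, b0],
    [b0, b0, b0, b0, b1]]"

text \<open>The same scheme modulo t^6: six coordinates and nine pairs i < j with i + j <=
  5.\<close>

definition trunc6_forms :: "bool list list" where
  "trunc6_forms =
   [[b1, b0, b0, b0, b0, b0, b1, b1, b1, b1, b1, b0, b0, b0, b0],
    [b0, b1, b0, b0, b0, b0, b1, b0, b0, b0, b0, b1, b1, b1, b0],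
    [b0, b0, b1, b0, b0, b0, b0, b1, b0, b0, b0, b1, b0, b0, b1],
    [b0, b0, b0, b1, b0, b0, b0, b0, b1, b0, b0, b0, b1, b0, b1],
    [b0, b0, b0, b0, b1, b0, b0, b0, b0, b1, b0, b0, b0, b1, b0],
    [b0, b0, b0, b0, b0, b1, b0, b0, b0, b0, b1, b0, b0, b0, b0]]"

definition trunc6_vals :: "bool list list" where
  "trunc6_vals =
   [[b1, b1, b1, b1, b1, b1],
    [b0, b1, b1, b1, b1, b1],
    [b0, b0, b1, b1, b1, b1],
    [b0, b0, b0, b1, b1, b1],
    [b0, b0, b0, b0, b1, b1],
    [b0, b0, b0, b0, b0, b1],
    [b0, b1, b0, b0, b0, b0],
    [b0, b0, b1, b0, b0, b0],
    [b0, b0, b0, b1, b0, b0],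
    [b0, b0, b0, b0, b1, b0],
    [b0, b0, b0, b0, b0, b1],
    [b0, b0, b0, b1, b0, b0],
    [b0, b0, b0, b0, b1, b0],
    [b0, b0, b0, b0, b0, b1],
    [b0, b0, b0, b0, b0, b1]]"

lemma field4_test: "cert_test [b1, b1, b0, b0] field4_forms field4_vals"
  by code_simp

lemma field5_test: "cert_test [b1, b0, b1, b0, b0] field5_forms field5_vals"
  by code_simp

lemma field6_test: "cert_test [b1, b1, b0, b0, b0, b0] field6_forms field6_vals"
  by code_simp

lemma field8_test: "cert_test [b1, b1, b0, b1, b1, b0, b0, b0] field8_forms field8_vals"
  by code_simp

text \<open>A monic modulus whose lower coefficients all vanish is t^5, so the arithmetic for fields
  also serves the truncated algebras.\<close>

lemma trunc5_test: "cert_test (replicate 5 False) trunc5_forms trunc5_vals"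
  by code_simp

lemma trunc6_test: "cert_test (replicate 6 False) trunc6_forms trunc6_vals"
  by code_simp

lemma vals_length:
  "length field4_vals = 9" "length field5_vals = 13" "length field6_vals = 15" "length field8_vals = 24"
  "length trunc5_vals = 11" "length trunc6_vals = 15"
  by code_simp+

lemma deg_test_field:
  "deg_test [b1, b1, b0, b0] [2]" "deg_test [b1, b0, b1, b0, b0] [1]" "deg_test [b1, b1, b0, b0, b0, b0] [2, 3]" "deg_test [b1, b1, b0, b1, b1, b0, b0, b0] [4]"
  by code_simp+

section \<open>Soundness of the certificates\<close>

lemma ladd_self: "ladd xs xs = map (\<lambda>_. False) xs"
  by (induction xs) auto

lemma units_length: "u \<in> set (units n) \<Longrightarrow> length u = n"
  by (induction n arbitrary: u) auto

lemma list_decompose: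
  assumes "length xs = n" "True \<in> set xs"
  shows "\<exists>u\<in>set (units n). \<exists>ys. length ys = n \<and> xs = ladd u ys \<and> count_list ys True < count_list xs True"
  using assms
proof (induction xs arbitrary: n)
  case (Cons x xs)
  then obtain k where n: "n = Suc k" "length xs = k" by auto
  show ?case
  proof (cases x)
    case True
    have "ladd (replicate k False) xs = xs" unfolding n(2)[symmetric] by (induction xs) auto
    then show ?thesis using n True by (intro bexI[of _ "True # replicate k False"] exI[of _ "False # xs"]) auto
  next
    case False
    then have "True \<in> set xs" using Cons.prems by auto
    from Cons.IH[OF n(2) this] obtain u ys where
      "u \<in> set (units k)" "length ys = k" "xs = ladd u ys" "count_list ys True < count_list xs True" by blast
    then show ?thesis using n False by (intro bexI[of _ "False # u"] exI[of _ "False # ys"]) auto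
  qed
qed simp

text \<open>Splitting off a unit vector lowers the number of ones, so additive maps are determined
  by the unit vectors.\<close>

lemma additive_ext:
  fixes F G :: "bool list \<Rightarrow> 'b::ab_group_add"
  assumes F: "\<And>xs ys. length xs = n \<Longrightarrow> length ys = n \<Longrightarrow> F (ladd xs ys) = F xs + F ys"
    and G: "\<And>xs ys. length xs = n \<Longrightarrow> length ys = n \<Longrightarrow> G (ladd xs ys) = G xs + G ys"
    and u: "\<And>u. u \<in> set (units n) \<Longrightarrow> F u = G u" and xs: "length xs = n"
  shows "F xs = G xs"
  using xs
proof (induction "count_list xs True" arbitrary: xs rule: less_induct)
  case less
  show ?case
  proof (cases "True \<in> set xs")
    case False
    then have "map (\<lambda>_. False) xs = xs" by (intro map_idI) auto
    then have "ladd xs xs = xs" using ladd_self by simp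
    then have "F xs = F xs + F xs" "G xs = G xs + G xs" using F[of xs xs] G[of xs xs] less by simp_all
    then show ?thesis by simp
  next
    case True
    obtain v ys where *: "v \<in> set (units n)" "length ys = n" "xs = ladd v ys" "count_list ys True < count_list xs True"
      using list_decompose[OF less(2) True] by blast
    then have "F ys = G ys" using less(1) by blast
    then show ?thesis using * F[of v ys] G[of v ys] u[of v] units_length[of v n] by simp
  qed
qed

lemma nth_ladd: "k < length xs \<Longrightarrow> k < length ys \<Longrightarrow> ladd xs ys ! k = (xs ! k \<noteq> ys ! k)"
  by (induction xs ys arbitrary: k rule: ladd.induct) (auto simp: nth_Cons split: nat.split)

lemma ladd_zero: "length xs = n \<Longrightarrow> ladd xs (replicate n False) = xs"
  by (induction xs arbitrary: n) auto

lemma length_lin: "\<forall>c\<in>set cs. length c = m \<Longrightarrow> length (lin m cs xs) = m"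
  by (induction m cs xs rule: lin.induct) auto

lemma lin_ladd:
  assumes "\<forall>c\<in>set cs. length c = m" "length xs = length cs" "length ys = length cs" "k < m"
  shows "lin m cs (ladd xs ys) ! k = (lin m cs xs ! k \<noteq> lin m cs ys ! k)"
  using assms
proof (induction cs arbitrary: xs ys)
  case (Cons c cs)
  then obtain x xs' y ys' where "xs = x # xs'" "ys = y # ys'" by (metis length_Suc_conv)
  then show ?case using Cons length_lin[of cs m] by (auto simp: nth_ladd)
qed simp

lemma lin_zero: "lin m cs (replicate n False) = replicate m False"
  by (induction cs arbitrary: n) (simp, case_tac n, auto)

lemma lin_unit: "\<forall>c\<in>set cs. length c = m \<Longrightarrow> i < length cs \<Longrightarrow> lin m cs (units (length cs) ! i) = cs ! i"
proof (induction cs arbitrary: i)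
  case (Cons c cs)
  have "length (units k) = k" for k by (induction k) auto
  then show ?case using Cons by (cases i) (auto simp: lin_zero ladd_zero)
qed simp

lemma length_units [simp]: "length (units n) = n"
  by (induction n) auto

lemma xtime_zero: "p \<noteq> [] \<Longrightarrow> xtime p (replicate (length p) False) = replicate (length p) False"
proof -
  assume "p \<noteq> []"
  then obtain n where n: "length p = Suc n" by (cases p) auto
  have "replicate (Suc n) False = replicate n False @ [False]" by (simp add: replicate_append_same)
  then show ?thesis unfolding n xtime_def by (simp del: replicate_Suc) simp
qed

lemma lmul_zero: "p \<noteq> [] \<Longrightarrow> lmul p (replicate k False) ys = replicate (length p) False"
  by (induction k) (auto simp: map_replicate_const xtime_zero)

text \<open>Links the rows that \<open>tabtest\<close> generates by repeated \<open>xtime\<close> to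
  genuine products with x^i.\<close>

lemma lmul_unit:
  "p \<noteq> [] \<Longrightarrow> length ys = length p \<Longrightarrow> i < n \<Longrightarrow> lmul p (units n ! i) ys = (xtime p ^^ i) ys"
proof (induction n arbitrary: i)
  case (Suc n)
  then show ?case by (cases i) (simp_all add: lmul_zero xtime_zero ladd_zero Let_def)
qed simp

lemma rowtestD: "rowtest c vs ds ws \<Longrightarrow> j < length vs \<Longrightarrow> j < length ds \<Longrightarrow> vs ! j = csum (length (vs ! j)) c (ds ! j) ws"
  by (induction c vs ds ws arbitrary: j rule: rowtest.induct) (auto simp: nth_Cons split: nat.split)

lemma tabtestD:
  "tabtest p vs cs cols ws \<Longrightarrow> i < length cs \<Longrightarrow> j < length vs \<Longrightarrow> j < length cols \<Longrightarrow>
   (xtime p ^^ i) (vs ! j) = csum (length ((xtime p ^^ i) (vs ! j))) (cs ! i) (cols ! j) ws"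
proof (induction p vs cs cols ws arbitrary: i rule: tabtest.induct)
  case (1 p vs c cs cols ws)
  show ?case
  proof (cases i)
    case 0
    then show ?thesis using 1 rowtestD[of c vs cols ws j] by simp
  next
    case (Suc k)
    have "(xtime p ^^ Suc k) (vs ! j) = (xtime p ^^ k) (map (xtime p) vs ! j)" using 1 by (simp add: funpow_swap1)
    then show ?thesis using 1 Suc by simp
  qed
qed simp

lemma finsum_eq_sum:
  fixes A :: "(bit, 'b::ab_group_add, 'm) module_scheme"
  assumes z: "\<zero>\<^bsub>A\<^esub> = 0" "\<And>x y. x \<oplus>\<^bsub>A\<^esub> y = x + y" and cl: "0 \<in> carrier A" "\<And>x y. x \<in> carrier A \<Longrightarrow> y \<in> carrier A \<Longrightarrow> x + y \<in> carrier A"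
    and f: "\<And>i. i \<in> I \<Longrightarrow> f i \<in> carrier A" and I: "finite I"
  shows "finsum A f I = (\<Sum>i\<in>I. f i)" "(\<Sum>i\<in>I. f i) \<in> carrier A"
proof -
  interpret abelian_monoid A
    by (rule abelian_monoidI) (use z cl in \<open>auto simp: add_ac\<close>)
  show "finsum A f I = (\<Sum>i\<in>I. f i)" using I f by (induction I rule: finite_induct) (simp_all add: z)
  show "(\<Sum>i\<in>I. f i) \<in> carrier A" using I f by (induction I rule: finite_induct) (simp_all add: cl)
qed

text \<open>Both sides of the identity of the algorithm are additive in each factor, so it suffices
  to test pairs of basis vectors, which the certificate does. The map h carries coordinate lists to
  the algebra, where addition and multiplication become \<open>ladd\<close> and
  \<open>lmul\<close>.\<close>

lemma mu_sym_le_cert: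
  fixes A :: "(bit, 'b::ab_group_add, 'm) module_scheme" and h :: "bool list \<Rightarrow> 'b"
  assumes A: "\<zero>\<^bsub>A\<^esub> = 0" "\<And>x y. x \<oplus>\<^bsub>A\<^esub> y = x + y" "\<And>c x. c \<odot>\<^bsub>A\<^esub> x = (if c = 0 then 0 else x)"
    and cl: "0 \<in> carrier A" "\<And>x y. x \<in> carrier A \<Longrightarrow> y \<in> carrier A \<Longrightarrow> x + y \<in> carrier A"
    and dist: "\<And>x y z. x \<in> carrier A \<Longrightarrow> y \<in> carrier A \<Longrightarrow> z \<in> carrier A \<Longrightarrow> (x + y) \<otimes>\<^bsub>A\<^esub> z = x \<otimes>\<^bsub>A\<^esub> z + y \<otimes>\<^bsub>A\<^esub> z"
      "\<And>x y z. x \<in> carrier A \<Longrightarrow> y \<in> carrier A \<Longrightarrow> z \<in> carrier A \<Longrightarrow> z \<otimes>\<^bsub>A\<^esub> (x + y) = z \<otimes>\<^bsub>A\<^esub> x + z \<otimes>\<^bsub>A\<^esub> y"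
    and h: "bij_betw h {xs. length xs = length p} (carrier A)"
      "\<And>xs ys. length xs = length p \<Longrightarrow> length ys = length p \<Longrightarrow> h (ladd xs ys) = h xs + h ys"
      "\<And>xs ys. length xs = length p \<Longrightarrow> length ys = length p \<Longrightarrow> h xs \<otimes>\<^bsub>A\<^esub> h ys = h (lmul p xs ys)"
    and t: "cert_test p cols ws"
  shows "mu_sym A \<le> enat (length ws)"
proof -
  let ?n = "length p" and ?L = "{xs. length xs = length p}"
  have hA: "h xs \<in> carrier A" if "length xs = ?n" for xs using h(1) that by (auto simp: bij_betw_def)
  define g where "g = inv_into ?L h"
  have g: "length (g x) = ?n" "h (g x) = x" if "x \<in> carrier A" for x
    using that h(1) inv_into_into[of x h ?L] f_inv_into_f[of x h ?L] by (auto simp: g_def bij_betw_def)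
  have gh: "g (h xs) = xs" if "length xs = ?n" for xs
    using h(1) that by (simp add: g_def bij_betw_def)
  have gadd: "g (x + y) = ladd (g x) (g y)" if "x \<in> carrier A" "y \<in> carrier A" for x y
    using gh[of "ladd (g x) (g y)"] h(2)[of "g x" "g y"] g[OF that(1)] g[OF that(2)] by simp
  have h0: "h (replicate ?n False) = 0"
  proof -
    have "ladd (replicate ?n False) (replicate ?n False) = replicate ?n False" by (simp add: ladd_self)
    then show ?thesis using h(2)[of "replicate ?n False" "replicate ?n False"] by simp
  qed
  let ?lin = "lin (length ws) cols"
  have cols: "length cols = ?n" "\<forall>c\<in>set cols. length c = length ws" "\<forall>w\<in>set ws. length w = ?n" "p \<noteq> []"
    and tab: "tabtest p (units ?n) cols cols ws" using t by (simp_all add: cert_test_def)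
  define \<phi> where "\<phi> j x = (of_bool (?lin (g x) ! j) :: bit)" for j x
  define w where "w j = h (ws ! j)" for j
  define S where "S xs ys = (\<Sum>j<length ws. if ?lin xs ! j \<and> ?lin ys ! j then h (ws ! j) else 0)" for xs ys
  have lenj: "length (ws ! j) = ?n" if "j < length ws" for j using cols(3) that by simp
  have two: "x + x = 0" if "x \<in> carrier A" for x
    using h(2)[of "g x" "g x"] g[OF that] h0 by (simp add: ladd_self map_replicate_const)
  have ce: "h (csum ?n (?lin xs) (?lin ys) ws) = S xs ys" for xs ys
  proof -
    have "h (csum ?n cs ds vs) = (\<Sum>j<length vs. if cs ! j \<and> ds ! j then h (vs ! j) else 0) \<and> length (csum ?n cs ds vs) = ?n"
      if "length cs = length vs" "length ds = length vs" "\<forall>v\<in>set vs. length v = ?n" for cs ds vs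
      using that
    proof (induction vs arbitrary: cs ds)
      case (Cons v vs)
      then obtain a as' c ds' where "cs = a # as'" "ds = c # ds'" by (metis length_Suc_conv)
      then show ?case using Cons h(2)
        by (simp add: sum.lessThan_Suc_shift del: sum.lessThan_Suc cong del: if_weak_cong)
    qed (simp add: h0)
    from this[of "?lin xs" ws "?lin ys"] show ?thesis using length_lin[OF cols(2)] cols(3) by (simp add: S_def)
  qed
  have hw: "h (ws ! j) \<in> carrier A" if "j < length ws" for j using hA lenj that by blast
  have Sadd: "S (ladd xs ys) zs = S xs zs + S ys zs" "S zs (ladd xs ys) = S zs xs + S zs ys"
    if "length xs = ?n" "length ys = ?n" for xs ys zs
    unfolding S_def sum.distrib[symmetric]
    by (intro sum.cong refl; use that cols lin_ladd[OF cols(2)] two[OF hw] in auto)+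
  have unit: "h u \<otimes>\<^bsub>A\<^esub> h v = S u v" if uv: "u \<in> set (units ?n)" "v \<in> set (units ?n)" for u v
  proof -
    obtain i j where ij: "i < ?n" "j < ?n" "u = units ?n ! i" "v = units ?n ! j" using uv by (auto simp: in_set_conv_nth)
    have len: "length u = ?n" "length v = ?n" using units_length uv by auto
    have "lmul p u v = (xtime p ^^ i) (units ?n ! j)" using lmul_unit[OF cols(4) len(2) ij(1)] ij(3,4) by simp
    moreover have "length (lmul p u v) = ?n" using cols(4) len by simp
    ultimately have "lmul p u v = csum ?n (cols ! i) (cols ! j) ws"
      using tabtestD[OF tab, of i j] ij cols(1) by simp
    moreover have "?lin u = cols ! i" "?lin v = cols ! j"
      using lin_unit[OF cols(2)] ij cols(1) by simp_all
    ultimately show ?thesis using h(3)[OF len] ce[of u v] by simp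
  qed
  have 1: "h u \<otimes>\<^bsub>A\<^esub> h ys = S u ys" if "u \<in> set (units ?n)" "length ys = ?n" for u ys
    by (rule additive_ext[where n = ?n and F = "\<lambda>ys. h u \<otimes>\<^bsub>A\<^esub> h ys" and G = "S u"])
       (use that units_length[OF that(1)] in \<open>simp_all add: unit Sadd h(2) dist hA\<close>)
  have 2: "h xs \<otimes>\<^bsub>A\<^esub> h ys = S xs ys" if "length xs = ?n" "length ys = ?n" for xs ys
    by (rule additive_ext[where n = ?n and F = "\<lambda>xs. h xs \<otimes>\<^bsub>A\<^esub> h ys" and G = "\<lambda>xs. S xs ys"])
       (use that in \<open>simp_all add: 1 Sadd h(2) dist hA\<close>)
  have "sym_mult_algorithm A {..<length ws} \<phi> w"
    unfolding sym_mult_algorithm_def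
  proof (intro conjI ballI)
    show "linear_form A (\<phi> j)" if j: "j \<in> {..<length ws}" for j
    proof -
      have "\<phi> j (x + y) = \<phi> j x + \<phi> j y" if "x \<in> carrier A" "y \<in> carrier A" for x y
        using lin_ladd[OF cols(2), of "g x" "g y" j] gadd[OF that] g(1) that cols(1) j by (auto simp: \<phi>_def)
      moreover have "\<phi> j (c \<odot>\<^bsub>A\<^esub> x) = c * \<phi> j x" if "x \<in> carrier A" for c x
      proof (cases c)
        case zero
        have "\<phi> j 0 = \<phi> j 0 + \<phi> j 0" using calculation[OF cl(1) cl(1)] by simp
        then have "\<phi> j 0 = 0" by simp
        then show ?thesis using zero by (simp add: A)
      qed (simp add: A)
      ultimately show ?thesis by (simp add: linear_form_def A)
    qed
    show wc: "w j \<in> carrier A" if "j \<in> {..<length ws}" for j using hw that by (simp add: w_def)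
    fix x y assume xy: "x \<in> carrier A" "y \<in> carrier A"
    have "x \<otimes>\<^bsub>A\<^esub> y = S (g x) (g y)" using 2[of "g x" "g y"] g xy by simp
    also have "\<dots> = (\<Sum>j<length ws. (\<phi> j x * \<phi> j y) \<odot>\<^bsub>A\<^esub> w j)"
      unfolding S_def by (intro sum.cong) (auto simp: \<phi>_def w_def A)
    also have "\<dots> = (\<Oplus>\<^bsub>A\<^esub>j\<in>{..<length ws}. (\<phi> j x * \<phi> j y) \<odot>\<^bsub>A\<^esub> w j)"
      by (rule finsum_eq_sum(1)[OF A(1,2) cl, symmetric]) (use wc cl in \<open>auto simp: A\<close>)
    finally show "x \<otimes>\<^bsub>A\<^esub> y = (\<Oplus>\<^bsub>A\<^esub>j\<in>{..<length ws}. (\<phi> j x * \<phi> j y) \<odot>\<^bsub>A\<^esub> w j)" .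
  qed simp
  then show ?thesis unfolding mu_sym_def by (intro Inf_lower) blast
qed

lemma card_lists_bool: "finite {xs :: bool list. length xs = n} \<and> card {xs :: bool list. length xs = n} = 2 ^ n"
  using card_lists_length_eq[of "UNIV :: bool set" n] finite_lists_length_eq[of "UNIV :: bool set" n]
  by simp

lemma smult_to_ac: "Polynomial.smult (to_ac c) p = (if c = 0 then 0 else p)" for c :: bit
  by (cases c) simp_all

lemma trunc_carrier_1: "carrier (trunc_algebra n 1 :: (bit, bit alg_closure poly) module) = (\<lambda>x. [:x:]) ` Fqn n"
proof (rule antisym)
  show "carrier (trunc_algebra n 1 :: (bit, bit alg_closure poly) module) \<subseteq> (\<lambda>x. [:x:]) ` Fqn n"
  proof
    fix q :: "bit alg_closure poly" assume "q \<in> carrier (trunc_algebra n 1 :: (bit, bit alg_closure poly) module)"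
    then have "Polynomial.degree q = 0" "\<forall>i. Polynomial.coeff q i \<in> Fqn n" by (auto simp: trunc_algebra_def)
    then obtain c where "q = [:c:]" "c \<in> Fqn n" by (metis coeff_pCons_0 degree_eq_zeroE)
    then show "q \<in> (\<lambda>x. [:x:]) ` Fqn n" by blast
  qed
qed (auto simp: trunc_algebra_def coeff_pCons split: nat.split)

text \<open>Coordinates are taken with respect to 1, a, ..., a^(n-1) for a root a of the modulus.
  Evaluation reaches all of F_(2^n), and both sides have 2^n elements, so it is bijective.\<close>

lemma mu_sym_field:
  assumes t: "deg_test p ds" and ds: "\<And>m. m dvd length p \<Longrightarrow> m \<noteq> length p \<Longrightarrow> \<exists>d\<in>set ds. m dvd d"
    and c: "cert_test p cols ws"
  shows "mu_sym (trunc_algebra (length p) 1 :: (bit, bit alg_closure poly) module) \<le> enat (length ws)"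
proof -
  have n2: "length p \<ge> 2" using t by (simp add: deg_test_def Let_def)
  then have p: "p \<noteq> []" by auto
  obtain a where a: "evp (monic p) a = 0" using monic_root[OF p] .
  note ds' = deg_test_sound[OF p a t ds]
  let ?A = "trunc_algebra (length p) 1 :: (bit, bit alg_closure poly) module"
  let ?L = "{xs :: bool list. length xs = length p}"
  have im: "le a ` ?L = Fqn (length p)"
  proof (rule antisym)
    have "evp q a \<in> Fqn (length p)" for q using ds'(3) by (metis rangeI)
    then show "le a ` ?L \<subseteq> Fqn (length p)" by (auto simp: le_def)
    show "Fqn (length p) \<subseteq> le a ` ?L"
    proof
      fix x :: "bit alg_closure" assume "x \<in> Fqn (length p)"
      then have "x \<in> range (\<lambda>q. evp q a)" using ds'(3) by simp
      then obtain q where x: "x = evp q a" by auto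
      have "q = q div mp a * mp a + q mod mp a" by simp
      then have "evp q a = evp (q div mp a) a * evp (mp a) a + evp (q mod mp a) a" by (metis evp_add evp_mult)
      then have x': "x = evp (q mod mp a) a" using x by simp
      have "q mod mp a = 0 \<or> Polynomial.degree (q mod mp a) < length p"
        using degree_mod_less[OF mp_nz, of q a] ds'(2) by auto
      from bp_surj[OF this] obtain xs where "length xs = length p" "bp xs = q mod mp a" by blast
      then show "x \<in> le a ` ?L" using x' by (intro image_eqI[of _ _ xs]) (simp_all add: le_def)
    qed
  qed
  have "inj_on (le a) ?L"
    by (rule eq_card_imp_inj_on) (use card_lists_bool[of "length p"] im Fqn_card(2)[of "length p"] p in auto)
  then have bij: "bij_betw (\<lambda>xs. [:le a xs:]) ?L (carrier ?A)"
    unfolding bij_betw_def trunc_carrier_1 im[symmetric] image_image by (auto simp: inj_on_def)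
  show ?thesis
  proof (rule mu_sym_le_cert[OF _ _ _ _ _ _ _ bij _ _ c])
    fix x y z :: "bit alg_closure poly" assume "x \<in> carrier ?A" "y \<in> carrier ?A" "z \<in> carrier ?A"
    show "(x + y) \<otimes>\<^bsub>?A\<^esub> z = x \<otimes>\<^bsub>?A\<^esub> z + y \<otimes>\<^bsub>?A\<^esub> z" "z \<otimes>\<^bsub>?A\<^esub> (x + y) = z \<otimes>\<^bsub>?A\<^esub> x + z \<otimes>\<^bsub>?A\<^esub> y"
      by (simp_all add: trunc_algebra_def distrib_left distrib_right poly_mod_add_left)
  next
    fix xs ys :: "bool list" assume l: "length xs = length p" "length ys = length p"
    show "[:le a (ladd xs ys):] = [:le a xs:] + [:le a ys:]" using l by (simp add: le_ladd)
    show "[:le a xs:] \<otimes>\<^bsub>?A\<^esub> [:le a ys:] = [:le a (lmul p xs ys):]"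
      using le_lmul[OF p a l(2), of xs] by (simp add: trunc_algebra_def mod_poly_less Polynomial.degree_monom_eq)
  next
    show "0 \<in> carrier ?A" "\<And>x y. x \<in> carrier ?A \<Longrightarrow> y \<in> carrier ?A \<Longrightarrow> x + y \<in> carrier ?A"
      unfolding trunc_carrier_1 by (auto simp: image_iff intro: bexI[of _ 0])
  qed (simp_all add: trunc_algebra_def smult_to_ac)
qed

section \<open>Truncated polynomial algebras over F_2\<close>

lemma map_to_ac_add: "map_poly to_ac (p + q) = map_poly to_ac p + map_poly to_ac q" for p q :: "bit poly"
  by (rule poly_eqI) (simp add: coeff_map_poly)

lemma map_to_ac_mult: "map_poly to_ac (p * q) = map_poly to_ac p * map_poly to_ac q" for p q :: "bit poly"
proof (induction p)
  case (pCons c p)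
  have "map_poly to_ac (Polynomial.smult c q) = Polynomial.smult (to_ac c) (map_poly to_ac q)"
    by (rule poly_eqI) (simp add: coeff_map_poly)
  then show ?case using pCons by (simp add: map_to_ac_add map_poly_pCons)
qed simp

lemma map_to_ac_degree: "Polynomial.degree (map_poly to_ac p) = Polynomial.degree p" for p :: "bit poly"
  by (rule degree_map_poly) simp

lemma map_to_ac_monom: "map_poly to_ac (Polynomial.monom 1 n) = Polynomial.monom 1 n"
  by (rule poly_eqI) (simp add: coeff_map_poly)

lemma Fqn_Suc_0: "Fqn (Suc 0) = range (to_ac :: bit \<Rightarrow> _)"
proof -
  have "range (to_ac :: bit \<Rightarrow> _) = {0, 1}" unfolding UNIV_bit by simp
  moreover have "x = 0 \<or> x = 1" if "x\<^sup>2 = x" for x :: "bit alg_closure"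
    using that by (simp add: power2_eq_square)
  ultimately show ?thesis by (auto simp: Fqn_bit)
qed

lemma trunc_carrier_rational:
  assumes "l > 0"
  shows "carrier (trunc_algebra 1 l :: (bit, bit alg_closure poly) module) =
    map_poly to_ac ` {q. q = 0 \<or> Polynomial.degree q < l}"
proof (rule antisym)
  show "carrier (trunc_algebra 1 l :: (bit, bit alg_closure poly) module) \<subseteq>
    map_poly to_ac ` {q. q = 0 \<or> Polynomial.degree q < l}"
  proof
    fix q :: "bit alg_closure poly" assume "q \<in> carrier (trunc_algebra 1 l :: (bit, bit alg_closure poly) module)"
    then have q: "Polynomial.degree q < l" "\<forall>i. Polynomial.coeff q i \<in> range to_ac"
      by (auto simp: trunc_algebra_def Fqn_Suc_0)
    have "q = map_poly to_ac (map_poly of_ac q)"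
      by (rule poly_eqI) (simp add: coeff_map_poly to_ac_of_ac q(2))
    moreover have "Polynomial.degree (map_poly of_ac q) < l"
      using q(1) map_poly_degree_leq[of of_ac q] by simp
    ultimately show "q \<in> map_poly to_ac ` {q. q = 0 \<or> Polynomial.degree q < l}" by blast
  qed
qed (use assms in \<open>auto simp: trunc_algebra_def Fqn_Suc_0 map_to_ac_degree coeff_map_poly\<close>)

lemma bp_xtime_zero:
  assumes "length xs = l" "l > 0"
  shows "[:0, 1:] * bp xs = bp (xtime (replicate l False) xs) + Polynomial.monom (of_bool (last xs)) l"
proof -
  have "xs \<noteq> []" using assms by auto
  then have xs: "xs = butlast xs @ [last xs]" by simp
  have z: "ladd ys (replicate (length ys) False) = ys" for ys by (induction ys) auto
  have "length (False # butlast xs) = l" using assms by simp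
  then have "xtime (replicate l False) xs = False # butlast xs" using z[of "False # butlast xs"] by (simp add: xtime_def)
  moreover have "[:0, 1:] * bp xs = pCons 0 (bp (butlast xs)) + Polynomial.monom (of_bool (last xs)) l"
  proof -
    have "bp xs = bp (butlast xs) + Polynomial.monom (of_bool (last xs)) (l - 1)"
      using bp_append[of "butlast xs" "last xs"] xs assms by simp
    then show ?thesis using assms(2) by (cases l) (simp_all add: Polynomial.monom_Suc)
  qed
  ultimately show ?thesis by simp
qed

lemma bp_lmul_zero:
  assumes "length ys = l" "l > 0"
  shows "(bp xs * bp ys) mod Polynomial.monom 1 l = bp (lmul (replicate l False) xs ys)"
proof -
  let ?z = "replicate l False"
  have len: "length (lmul ?z xs ys) = l" for xs using assms by simp
  have "\<exists>k. bp xs * bp ys = bp (lmul ?z xs ys) + Polynomial.monom 1 l * k"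
  proof (induction xs)
    case Nil
    show ?case by (intro exI[of _ 0]) (simp del: map_replicate)
  next
    case (Cons x xs)
    then obtain k where k: "bp xs * bp ys = bp (lmul ?z xs ys) + Polynomial.monom 1 l * k" by blast
    let ?b = "of_bool (last (lmul ?z xs ys)) :: bit"
    have m: "Polynomial.monom ?b l = Polynomial.monom 1 l * [:?b:]" by (simp add: smult_monom)
    have "bp (x # xs) * bp ys = Polynomial.smult (of_bool x) (bp ys) + [:0, 1:] * (bp xs * bp ys)" by simp
    also have "[:0, 1:] * (bp xs * bp ys) = [:0, 1:] * bp (lmul ?z xs ys) + Polynomial.monom 1 l * ([:0, 1:] * k)"
      unfolding k by (simp add: distrib_left mult_ac)
    also have "[:0, 1:] * bp (lmul ?z xs ys) = bp (xtime ?z (lmul ?z xs ys)) + Polynomial.monom 1 l * [:?b:]"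
      using bp_xtime_zero[OF len assms(2), of xs] m by simp
    finally have "bp (x # xs) * bp ys = (Polynomial.smult (of_bool x) (bp ys) + bp (xtime ?z (lmul ?z xs ys))) +
        Polynomial.monom 1 l * ([:?b:] + [:0, 1:] * k)" by (simp add: algebra_simps)
    moreover have "Polynomial.smult (of_bool x) (bp ys) + bp (xtime ?z (lmul ?z xs ys)) = bp (lmul ?z (x # xs) ys)"
    proof -
      have "length (xtime ?z (lmul ?z xs ys)) = l" using assms len[of xs] by (subst length_xtime) auto
      then show ?thesis using assms by (cases x) (simp_all add: Let_def bp_ladd)
    qed
    ultimately show ?case by metis
  qed
  then obtain k where "bp xs * bp ys = bp (lmul ?z xs ys) + Polynomial.monom 1 l * k" by blast
  then have "(bp xs * bp ys) mod Polynomial.monom 1 l = bp (lmul ?z xs ys) mod Polynomial.monom 1 l" by simp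
  also have "\<dots> = bp (lmul ?z xs ys)"
  proof -
    have "Polynomial.degree (bp (lmul ?z xs ys)) < l" using degree_bp[of "lmul ?z xs ys"] len[of xs] assms(2) by auto
    then show ?thesis by (intro mod_poly_less) (simp add: Polynomial.degree_monom_eq)
  qed
  finally show ?thesis .
qed

lemma map_to_ac_mod: "map_poly to_ac (p mod q) = map_poly to_ac p mod map_poly to_ac q" for p q :: "bit poly"
proof (cases "q = 0")
  case False
  have "map_poly to_ac p = map_poly to_ac q * map_poly to_ac (p div q) + map_poly to_ac (p mod q)"
    unfolding map_to_ac_mult[symmetric] map_to_ac_add[symmetric] by simp
  moreover have "map_poly to_ac (p mod q) = 0 \<or>
      Polynomial.degree (map_poly to_ac (p mod q)) < Polynomial.degree (map_poly to_ac q)"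
    using degree_mod_less[OF False, of p] by (auto simp: map_to_ac_degree)
  moreover have "map_poly to_ac q \<noteq> 0" using False by (simp add: map_poly_eq_0_iff)
  ultimately show ?thesis
    by (cases "map_poly to_ac (p mod q) = 0") (simp_all add: mod_poly_less)
qed simp

lemma mu_sym_trunc:
  assumes c: "cert_test (replicate l False) cols ws"
  shows "mu_sym (trunc_algebra 1 l :: (bit, bit alg_closure poly) module) \<le> enat (length ws)"
proof -
  let ?A = "trunc_algebra 1 l :: (bit, bit alg_closure poly) module"
  let ?p = "replicate l False"
  have l: "l > 0" using c by (auto simp: cert_test_def)
  let ?L = "{xs :: bool list. length xs = length ?p}"
  have im: "(\<lambda>xs. map_poly to_ac (bp xs)) ` ?L = carrier ?A"
  proof (rule antisym)
    show "(\<lambda>xs. map_poly to_ac (bp xs)) ` ?L \<subseteq> carrier ?A"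
      unfolding trunc_carrier_rational[OF l] using degree_bp by fastforce
    show "carrier ?A \<subseteq> (\<lambda>xs. map_poly to_ac (bp xs)) ` ?L"
    proof
      fix x assume "x \<in> carrier ?A"
      then obtain q where "x = map_poly to_ac q" "q = 0 \<or> Polynomial.degree q < l" unfolding trunc_carrier_rational[OF l] by blast
      moreover then obtain xs where "length xs = l" "bp xs = q" using bp_surj by blast
      ultimately show "x \<in> (\<lambda>xs. map_poly to_ac (bp xs)) ` ?L" by (intro image_eqI[of _ _ xs]) simp_all
    qed
  qed
  have inj: "inj_on (\<lambda>xs. map_poly to_ac (bp xs)) ?L"
  proof (rule inj_onI)
    fix xs ys :: "bool list" assume a: "xs \<in> ?L" "ys \<in> ?L" "map_poly to_ac (bp xs) = map_poly to_ac (bp ys)"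
    have "Polynomial.coeff (bp xs) i = Polynomial.coeff (bp ys) i" for i
      using arg_cong[OF a(3), of "\<lambda>q. Polynomial.coeff q i"] by (simp add: coeff_map_poly)
    then show "xs = ys" using a by (intro inj_bp poly_eqI) simp_all
  qed
  then have bij: "bij_betw (\<lambda>xs. map_poly to_ac (bp xs)) ?L (carrier ?A)" using im by (simp add: bij_betw_def)
  show ?thesis
  proof (rule mu_sym_le_cert[OF _ _ _ _ _ _ _ bij _ _ c])
    fix x y z :: "bit alg_closure poly" assume "x \<in> carrier ?A" "y \<in> carrier ?A" "z \<in> carrier ?A"
    show "(x + y) \<otimes>\<^bsub>?A\<^esub> z = x \<otimes>\<^bsub>?A\<^esub> z + y \<otimes>\<^bsub>?A\<^esub> z" "z \<otimes>\<^bsub>?A\<^esub> (x + y) = z \<otimes>\<^bsub>?A\<^esub> x + z \<otimes>\<^bsub>?A\<^esub> y"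
      by (simp_all add: trunc_algebra_def distrib_left distrib_right poly_mod_add_left)
  next
    fix xs ys :: "bool list" assume xy: "length xs = length ?p" "length ys = length ?p"
    show "map_poly to_ac (bp (ladd xs ys)) = map_poly to_ac (bp xs) + map_poly to_ac (bp ys)"
      using xy by (simp add: bp_ladd map_to_ac_add)
    show "map_poly to_ac (bp xs) \<otimes>\<^bsub>?A\<^esub> map_poly to_ac (bp ys) = map_poly to_ac (bp (lmul ?p xs ys))"
      using bp_lmul_zero[of ys l xs] xy l
      by (simp add: trunc_algebra_def map_to_ac_mod map_to_ac_mult map_to_ac_monom del: map_replicate flip: bp_lmul_zero)
  next
    show "0 \<in> carrier ?A" using l by (simp add: trunc_algebra_def)
    show "x + y \<in> carrier ?A" if "x \<in> carrier ?A" "y \<in> carrier ?A" for x y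
      using that by (auto simp: trunc_algebra_def intro: degree_add_less)
  qed (simp_all add: trunc_algebra_def smult_to_ac)
qed

section \<open>Residue maps\<close>

text \<open>A polynomial over F_2 evaluated at a uniformizer t: the truncated Taylor expansions at a
  rational point.\<close>

definition kp :: "bit poly \<Rightarrow> bit univ_field \<Rightarrow> bit univ_field" where
  "kp q t = poly (map_poly kconst q) t"

lemma kp_0 [simp]: "kp 0 t = 0"
  by (simp add: kp_def)

lemma kp_pCons [simp]: "kp (pCons c q) t = kconst c + t * kp q t"
  by (simp add: kp_def map_poly_pCons)

lemma kconst_hom: "kconst (a + b) = kconst a + kconst b" "kconst (a * b) = kconst a * (kconst b :: bit univ_field)"
  by (rule kconst_add, rule kconst_mult)

lemma kp_add [simp]: "kp (p + q) t = kp p t + kp q t"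
  by (induction p q rule: poly_induct2) (simp_all add: algebra_simps kconst_hom)

lemma kp_smult [simp]: "kp (Polynomial.smult c q) t = kconst c * kp q t"
  by (cases c) simp_all

lemma kp_mult [simp]: "kp (p * q) t = kp p t * kp q t"
  by (induction p) (simp_all add: algebra_simps)

lemma kp_monom: "kp (Polynomial.monom 1 l) t = t ^ l"
  by (induction l) (simp_all add: Polynomial.monom_0 Polynomial.monom_Suc)

lemma kp_1 [simp]: "kp 1 t = 1"
  using kp_pCons[of 1 0 t] by (simp flip: one_pCons)

context place begin

lemma kp_P: "t \<in> P \<Longrightarrow> kp q t \<in> P"
proof (induction q)
  case (pCons c q)
  have "kconst c \<in> P" using closed_ringD(1,2)[OF closed_ring_P] by (simp add: kconst_bit)
  then show ?case using pCons closed_ringD(3,4)[OF closed_ring_P] by simp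
qed (simp add: closed_ringD(1)[OF closed_ring_P])

text \<open>The lowest nonzero coefficient decides the value, and its index is at most the degree.
  So a polynomial of degree below l in t is not in the l-th power of the maximal ideal, which gives
  uniqueness of expansions.\<close>

lemma kp_ord:
  assumes t: "t \<in> FF" "t \<noteq> 0" "ordv P t = 1"
  shows "q \<noteq> 0 \<Longrightarrow> kp q t \<in> FF \<and> kp q t \<noteq> 0 \<and> ordv P (kp q t) \<le> int (Polynomial.degree q)"
proof (induction q)
  case (pCons c q)
  show ?case
  proof (cases "q = 0")
    case True
    then have "c = 1" using pCons by auto
    then show ?thesis using True by simp
  next
    case False
    let ?g = "t * kp q t"
    have g: "?g \<in> FF" "?g \<noteq> 0" "ordv P ?g = 1 + ordv P (kp q t)"
      using pCons False t v_mult[of t "kp q t"] by auto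
    have "kp q t \<in> P" using kp_P t by (simp add: P_iff)
    then have "ordv P (kp q t) \<ge> 0" using pCons False by (simp add: P_iff)
    then have pos: "ordv P ?g > 0" using g by simp
    show ?thesis
    proof (cases c)
      case zero
      then show ?thesis using g pCons False by simp
    next
      case one
      have "1 + ?g \<noteq> 0" "ordv P (1 + ?g) = ordv P 1" using v_add_eq[of 1 ?g] g pos by simp_all
      then show ?thesis using one g by simp
    qed
  qed
qed simp

lemma max_power_add: assumes "f \<in> max_power P n" "g \<in> max_power P n" shows "f + g \<in> max_power P n"
proof (cases "f = 0 \<or> g = 0 \<or> f + g = 0")
  case True
  then show ?thesis using assms by (auto simp: max_power_eq)
next
  case False
  have "min (ordv P f) (ordv P g) \<le> ordv P (f + g)" using assms False by (intro v_add) (simp_all add: max_power_eq)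
  moreover have "n \<le> ordv P f" "n \<le> ordv P g" using assms False by (simp_all add: max_power_eq)
  ultimately have "n \<le> ordv P (f + g)" by linarith
  then show ?thesis using assms by (simp add: max_power_eq)
qed

lemma max_power_mult: assumes "f \<in> P" "g \<in> max_power P n" shows "f * g \<in> max_power P n"
proof (cases "f = 0 \<or> g = 0")
  case True
  then show ?thesis using assms by (auto simp: max_power_eq P_iff)
next
  case False
  then have "ordv P (f * g) = ordv P f + ordv P g" using assms by (intro v_mult) (simp_all add: max_power_eq P_iff)
  then show ?thesis using assms False by (simp add: max_power_eq P_iff)
qed

lemma max_power_mult_unit:
  assumes f: "f \<in> FF" "f \<noteq> 0" and g: "g \<in> FF"
  shows "f * g \<in> max_power P (n + ordv P f) \<longleftrightarrow> g \<in> max_power P n"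
proof (cases "g = 0")
  case False
  then have "ordv P (f * g) = ordv P f + ordv P g" using f g by (intro v_mult) simp_all
  then show ?thesis using f g False by (simp add: max_power_eq)
qed (simp add: max_power_eq)

lemma max_power_FF: "f \<in> max_power P n \<Longrightarrow> f \<in> FF"
  by (simp add: max_power_eq)

lemma max_power_sub: "n \<ge> 0 \<Longrightarrow> max_power P n \<subseteq> P"
  unfolding max_power_eq by (auto simp: P_iff)

text \<open>The residue of f is 0 or 1; remove this constant, divide by t and repeat.\<close>

lemma taylor_exists:
  assumes t: "t \<in> FF" "t \<noteq> 0" "ordv P t = 1" and r: "is_res P 1 \<rho>"
  shows "f \<in> P \<Longrightarrow> \<exists>q. (q = 0 \<or> Polynomial.degree q < l) \<and> f + kp q t \<in> max_power P (int l)"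
proof (induction l arbitrary: f)
  case 0
  then show ?case by (intro exI[of _ 0]) (auto simp: max_power_eq P_iff)
next
  case (Suc l)
  have "\<rho> f \<in> Fqn 1" using r Suc(2) by (auto simp: is_res_def)
  then have "\<rho> f * \<rho> f = \<rho> f" by (simp add: Fqn_bit power2_eq_square)
  then have "\<rho> f = 0 \<or> \<rho> f = 1" by simp
  then obtain c where c: "\<rho> f = to_ac c" by (metis to_ac_0 to_ac_1)
  have kP: "kconst c \<in> P" using closed_ringD(1,2)[OF closed_ring_P] by (simp add: kconst_bit)
  have "\<rho> 0 = 0" using r closed_ringD(1)[OF closed_ring_P] by (auto simp: is_res_def)
  then have "\<rho> (kconst c) = to_ac c" using r by (cases c) (auto simp: is_res_def)
  then have z: "\<rho> (f + kconst c) = 0" using r Suc(2) kP c by (auto simp: is_res_def)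
  have fP: "f + kconst c \<in> P" using closed_ringD(3)[OF closed_ring_P] Suc(2) kP by blast
  define f1 where "f1 = (f + kconst c) / t"
  have "f1 \<in> P"
  proof (cases "f + kconst c = 0")
    case True
    then show ?thesis using closed_ringD(1)[OF closed_ring_P] by (simp only: f1_def div_0)
  next
    case False
    then have "ordv P (f + kconst c) \<ge> 1" using r z fP unfolding is_res_def by blast
    then show ?thesis using False fP t v_divide[of "f + kconst c" t] by (simp add: f1_def P_iff)
  qed
  from Suc(1)[OF this] obtain q where q: "q = 0 \<or> Polynomial.degree q < l" "f1 + kp q t \<in> max_power P (int l)" by blast
  have "t * (f1 + kp q t) \<in> max_power P (int l + ordv P t)"
    using q(2) max_power_mult_unit[OF t(1,2) max_power_FF[OF q(2)]] by blast
  moreover have "t * (f1 + kp q t) = f + kp (pCons c q) t"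
    using t by (simp add: f1_def distrib_left add.assoc)
  ultimately have "f + kp (pCons c q) t \<in> max_power P (int (Suc l))" using t by (simp add: add.commute)
  moreover have "Polynomial.degree (pCons c q) < Suc l" using q(1) by (auto simp: degree_pCons_eq_if)
  ultimately show ?case by blast
qed

lemma taylor_unique:
  assumes t: "t \<in> FF" "t \<noteq> 0" "ordv P t = 1"
    and q: "q = 0 \<or> Polynomial.degree q < l" "f + kp q t \<in> max_power P (int l)"
    and q': "q' = 0 \<or> Polynomial.degree q' < l" "f + kp q' t \<in> max_power P (int l)"
  shows "q = q'"
proof (rule ccontr)
  assume "q \<noteq> q'"
  then have nz: "q + q' \<noteq> 0" by (metis bit_poly_add_cancel add.right_neutral)
  have "(f + kp q t) + (f + kp q' t) = kp (q + q') t" by (simp add: add.assoc add.left_commute)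
  then have "kp (q + q') t \<in> max_power P (int l)" using max_power_add[OF q(2) q'(2)] by simp
  then have "ordv P (kp (q + q') t) \<ge> int l" using kp_ord[OF t nz] unfolding max_power_eq by blast
  moreover have "Polynomial.degree (q + q') < l" using q q' nz by (cases "q = 0"; cases "q' = 0") (auto intro: degree_add_less)
  ultimately show False using kp_ord[OF t nz] by simp
qed

end

lemma map_to_ac_inj: "map_poly to_ac p = map_poly to_ac q \<Longrightarrow> p = (q :: bit poly)"
proof -
  assume a: "map_poly to_ac p = map_poly to_ac q"
  have "Polynomial.coeff p i = Polynomial.coeff q i" for i
    using arg_cong[OF a, of "\<lambda>q. Polynomial.coeff q i"] by (simp add: coeff_map_poly)
  then show ?thesis by (rule poly_eqI)
qed

lemma ring_hom_Omega_I:
  fixes A :: "(bit, 'b::ab_group_add, 'm) module_scheme"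
  assumes "\<And>x. x \<in> P \<Longrightarrow> \<pi> x \<in> carrier A" "\<And>x y. x \<in> P \<Longrightarrow> y \<in> P \<Longrightarrow> \<pi> (x * y) = \<pi> x \<otimes>\<^bsub>A\<^esub> \<pi> y"
    "\<And>x y. x \<in> P \<Longrightarrow> y \<in> P \<Longrightarrow> \<pi> (x + y) = \<pi> x \<oplus>\<^bsub>A\<^esub> \<pi> y" "\<pi> 1 = \<one>\<^bsub>A\<^esub>"
  shows "\<pi> \<in> ring_hom (Omega\<lparr>carrier := P\<rparr>) A"
  by (rule ring_hom_memI) (use assms in auto)

lemma residue_map_field:
  assumes P: "is_place P" and r: "is_res P n \<rho>"
  shows "residue_map P 1 (Fqn_algebra n :: (bit, bit alg_closure) module) \<rho>"
proof -
  interpret place P by unfold_locales (rule P)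
  have z: "\<rho> 0 = 0" using r closed_ringD(1)[OF closed_ring_P] by (auto simp: is_res_def)
  have sc: "\<rho> (kscale c x) = to_ac c * \<rho> x" for c x by (cases c) (simp_all add: kscale_bit z)
  have "\<rho> \<in> ring_hom (Omega\<lparr>carrier := P\<rparr>) (Fqn_algebra n :: (bit, bit alg_closure) module)"
    by (rule ring_hom_Omega_I) (use r in \<open>auto simp: is_res_def Fqn_algebra_def\<close>)
  then show ?thesis
    unfolding residue_map_def using sc r is_res_kernel[OF P r] by (auto simp: Fqn_algebra_def is_res_def)
qed

lemma residue_map_trunc:
  assumes P: "is_place P" and r: "is_res P n \<rho>"
  shows "residue_map P 1 (trunc_algebra n 1 :: (bit, bit alg_closure poly) module) (\<lambda>f. [:\<rho> f:])"
proof -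
  interpret place P by unfold_locales (rule P)
  let ?A = "trunc_algebra n 1 :: (bit, bit alg_closure poly) module"
  have z: "\<rho> 0 = 0" using r closed_ringD(1)[OF closed_ring_P] by (auto simp: is_res_def)
  have sc: "[:\<rho> (kscale c x):] = c \<odot>\<^bsub>?A\<^esub> [:\<rho> x:]" for c x
    by (cases c) (simp_all add: kscale_bit z trunc_algebra_def)
  have m: "[:u:] \<otimes>\<^bsub>?A\<^esub> [:v:] = [:u * v:]" for u v
    by (simp add: trunc_algebra_def mod_poly_less Polynomial.degree_monom_eq)
  have "(\<lambda>f. [:\<rho> f:]) \<in> ring_hom (Omega\<lparr>carrier := P\<rparr>) ?A"
  proof (rule ring_hom_Omega_I)
    show "[:\<rho> x:] \<in> carrier ?A" if "x \<in> P" for x using r that unfolding trunc_carrier_1 by (auto simp: is_res_def)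
    show "[:\<rho> (x * y):] = [:\<rho> x:] \<otimes>\<^bsub>?A\<^esub> [:\<rho> y:]" if "x \<in> P" "y \<in> P" for x y
      using r that unfolding m by (auto simp: is_res_def)
  qed (use r in \<open>auto simp: is_res_def trunc_algebra_def one_pCons\<close>)
  moreover have im: "\<rho> ` P = Fqn n" using r by (simp add: is_res_def)
  have "(\<lambda>f. [:\<rho> f:]) ` P = carrier ?A"
    unfolding trunc_carrier_1 im[symmetric] image_image by (rule refl)
  moreover have "{x \<in> P. [:\<rho> x:] = \<zero>\<^bsub>?A\<^esub>} = max_power P (int 1)"
    using is_res_kernel[OF P r] by (simp add: trunc_algebra_def)
  ultimately show ?thesis unfolding residue_map_def using sc by blast
qed

text \<open>At a rational point, truncated expansion in a uniformizer identifies the local ring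
  modulo the l-th power of its maximal ideal with F_2[t]/(t^l). The points of G of multiplicity
  above one are all rational.\<close>

lemma residue_map_taylor:
  assumes P: "is_place P" and r: "is_res P 1 \<rho>" and l: "l > 0"
  shows "\<exists>\<tau>. residue_map P l (trunc_algebra 1 l :: (bit, bit alg_closure poly) module) \<tau>"
proof -
  interpret place P by unfold_locales (rule P)
  let ?A = "trunc_algebra 1 l :: (bit, bit alg_closure poly) module"
  let ?m = "max_power P (int l)"
  note PD = closed_ringD[OF closed_ring_P]
  obtain t where t: "t \<in> FF" "t \<noteq> 0" "ordv P t = 1" by (rule ex_unif)
  then have tP: "t \<in> P" by (simp add: P_iff)
  define T where "T f = (THE q. (q = 0 \<or> Polynomial.degree q < l) \<and> f + kp q t \<in> ?m)" for f
  have T_eq: "T f = q" if "q = 0 \<or> Polynomial.degree q < l" "f + kp q t \<in> ?m" for f q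
    unfolding T_def by (rule the_equality) (use that taylor_unique[OF t] in blast)+
  have T: "T f = 0 \<or> Polynomial.degree (T f) < l" "f + kp (T f) t \<in> ?m" if f: "f \<in> P" for f
  proof -
    obtain q where q: "q = 0 \<or> Polynomial.degree q < l" "f + kp q t \<in> ?m" using taylor_exists[OF t r f] by blast
    then show "T f = 0 \<or> Polynomial.degree (T f) < l" "f + kp (T f) t \<in> ?m" using T_eq[OF q] by simp_all
  qed
  have m0: "0 \<in> ?m" by (simp add: max_power_eq)
  have T_kp: "T (kp q t) = q" if "q = 0 \<or> Polynomial.degree q < l" for q
    by (rule T_eq[OF that]) (simp add: m0)
  have T_add: "T (f + g) = T f + T g" if fg: "f \<in> P" "g \<in> P" for f g
  proof (rule T_eq)
    show "T f + T g = 0 \<or> Polynomial.degree (T f + T g) < l"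
      using T(1)[OF fg(1)] T(1)[OF fg(2)] by (cases "T f = 0"; cases "T g = 0") (auto intro: degree_add_less)
    have "(f + kp (T f) t) + (g + kp (T g) t) \<in> ?m" using max_power_add[OF T(2)[OF fg(1)] T(2)[OF fg(2)]] .
    moreover have "(f + kp (T f) t) + (g + kp (T g) t) = (f + g) + kp (T f + T g) t" by (simp only: kp_add add_ac)
    ultimately show "f + g + kp (T f + T g) t \<in> ?m" by simp
  qed
  have T_mult: "T (f * g) = (T f * T g) mod Polynomial.monom 1 l" if fg: "f \<in> P" "g \<in> P" for f g
  proof (rule T_eq)
    let ?x = "Polynomial.monom 1 l :: bit poly"
    have dx: "Polynomial.degree ?x = l" "?x \<noteq> 0" by (simp_all add: Polynomial.degree_monom_eq)
    show "(T f * T g) mod ?x = 0 \<or> Polynomial.degree ((T f * T g) mod ?x) < l"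
      using degree_mod_less[OF dx(2), of "T f * T g"] dx(1) by auto
    let ?a = "kp (T f) t" and ?b = "kp (T g) t" and ?r = "kp ((T f * T g) mod ?x) t"
    let ?k = "kp ((T f * T g) div ?x) t"
    have "T f * T g = (T f * T g) div ?x * ?x + (T f * T g) mod ?x" by (rule div_mult_mod_eq[symmetric])
    then have "kp (T f * T g) t = kp ((T f * T g) div ?x * ?x + (T f * T g) mod ?x) t" by simp
    then have ab: "?a * ?b = ?k * t ^ l + ?r" by (simp only: kp_mult kp_add kp_monom)
    have aP: "?a \<in> P" and kP: "?k \<in> P" using kp_P[OF tP] by blast+
    have "t ^ l \<in> ?m" using t v_power[of t l] by (simp add: max_power_eq)
    then have 1: "?k * t ^ l \<in> ?m" by (rule max_power_mult[OF kP])
    have 2: "?a * (g + ?b) \<in> ?m" by (rule max_power_mult[OF aP T(2)[OF fg(2)]])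
    have 3: "g * (f + ?a) \<in> ?m" by (rule max_power_mult[OF fg(2) T(2)[OF fg(1)]])
    \<comment> \<open>With a and b the expansions of f and g one has f g + a b = g (f + a) + a (g +
      b), and a b differs from its remainder by a multiple of t^l.\<close>
    have "g * (f + ?a) + (?a * (g + ?b) + ?k * t ^ l) \<in> ?m" by (rule max_power_add[OF 3 max_power_add[OF 2 1]])
    moreover have "g * (f + ?a) + (?a * (g + ?b) + ?k * t ^ l) = f * g + ?r"
    proof -
      have "g * (f + ?a) + (?a * (g + ?b) + ?k * t ^ l) = f * g + ((?a * g + ?a * g) + (?a * ?b + ?k * t ^ l))"
        by (simp only: distrib_left mult_ac add_ac)
      also have "\<dots> = f * g + ((?k * t ^ l + ?k * t ^ l) + ?r)" unfolding ab by (simp only: Omega_add_self add_ac add_0_left)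
      finally show ?thesis by simp
    qed
    ultimately show "f * g + ?r \<in> ?m" by simp
  qed
  define \<tau> where "\<tau> f = map_poly to_ac (T f)" for f
  have carrier: "carrier ?A = map_poly to_ac ` {q. q = 0 \<or> Polynomial.degree q < l}"
    by (rule trunc_carrier_rational[OF l])
  have hom: "\<tau> \<in> ring_hom (Omega\<lparr>carrier := P\<rparr>) ?A"
  proof (rule ring_hom_Omega_I)
    show "\<tau> x \<in> carrier ?A" if "x \<in> P" for x unfolding carrier \<tau>_def using T(1)[OF that] by blast
    show "\<tau> (x * y) = \<tau> x \<otimes>\<^bsub>?A\<^esub> \<tau> y" if "x \<in> P" "y \<in> P" for x y
      unfolding \<tau>_def T_mult[OF that] by (simp add: trunc_algebra_def map_to_ac_mod map_to_ac_mult map_to_ac_monom)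
    show "\<tau> (x + y) = \<tau> x \<oplus>\<^bsub>?A\<^esub> \<tau> y" if "x \<in> P" "y \<in> P" for x y
      unfolding \<tau>_def T_add[OF that] by (simp add: trunc_algebra_def map_to_ac_add)
    have "T 1 = 1" using T_kp[of 1] l by simp
    then show "\<tau> 1 = \<one>\<^bsub>?A\<^esub>" by (simp add: \<tau>_def trunc_algebra_def)
  qed
  have T0: "T 0 = 0" using T_kp[of 0] by simp
  have sc: "\<tau> (kscale c x) = c \<odot>\<^bsub>?A\<^esub> \<tau> x" for c x
    by (cases c) (simp_all add: kscale_bit \<tau>_def T0 trunc_algebra_def)
  have im: "\<tau> ` P = carrier ?A"
  proof (rule antisym)
    show "\<tau> ` P \<subseteq> carrier ?A" unfolding carrier \<tau>_def using T(1) by blast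
    show "carrier ?A \<subseteq> \<tau> ` P"
    proof
      fix y assume "y \<in> carrier ?A"
      then obtain q where q: "y = map_poly to_ac q" "q = 0 \<or> Polynomial.degree q < l" unfolding carrier by blast
      have "y = \<tau> (kp q t)" unfolding \<tau>_def T_kp[OF q(2)] by (rule q(1))
      then show "y \<in> \<tau> ` P" using kp_P[OF tP] by blast
    qed
  qed
  have ker: "{x \<in> P. \<tau> x = \<zero>\<^bsub>?A\<^esub>} = ?m"
  proof (rule Set.set_eqI)
    fix x
    have "\<tau> x = \<zero>\<^bsub>?A\<^esub> \<longleftrightarrow> T x = 0" using map_to_ac_inj[of "T x" 0] by (auto simp: \<tau>_def trunc_algebra_def)
    moreover have "x \<in> P \<and> T x = 0 \<longleftrightarrow> x \<in> ?m"
    proof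
      assume "x \<in> P \<and> T x = 0" then show "x \<in> ?m" using T(2)[of x] by simp
    next
      assume x: "x \<in> ?m"
      then have "T x = 0" by (intro T_eq) simp_all
      then show "x \<in> P \<and> T x = 0" using x max_power_sub[of "int l"] by auto
    qed
    ultimately show "x \<in> {x \<in> P. \<tau> x = \<zero>\<^bsub>?A\<^esub>} \<longleftrightarrow> x \<in> ?m" by blast
  qed
  show ?thesis unfolding residue_map_def using hom sc im ker by blast
qed

section \<open>The multiplication algorithm of symmetric Chudnovsky data\<close>

text \<open>The only F_2-vector space structure on a group of exponent two. It lets additive maps be
  extended by linear algebra.\<close>

definition fscale :: "bit \<Rightarrow> 'a::ab_group_add \<Rightarrow> 'a" where
  "fscale c x = (if c = 0 then 0 else x)"

lemma fscale_vector_space: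
  assumes "\<And>x :: 'a::ab_group_add. x + x = 0" shows "vector_space (fscale :: bit \<Rightarrow> 'a \<Rightarrow> 'a)"
proof unfold_locales
  fix a b :: bit and x :: 'a
  show "fscale (a + b) x = fscale a x + fscale b x" using assms[of x] by (cases a; cases b) (simp_all add: fscale_def)
qed (auto simp: fscale_def)

lemma additive_sum:
  fixes R :: "'a::comm_monoid_add \<Rightarrow> 'b::ab_group_add"
  assumes "\<And>x y. R (x + y) = R x + R y"
  shows "R (\<Sum>i\<in>S. f i) = (\<Sum>i\<in>S. R (f i))"
proof -
  have "R 0 = 0" using assms[of 0 0] by simp
  then show ?thesis by (induction S rule: infinite_finite_induct) (simp_all add: assms)
qed

lemma sum_fun_apply: "(\<Sum>i\<in>S. f i) x = (\<Sum>i\<in>S. f i x)" for f :: "'i \<Rightarrow> 'b \<Rightarrow> 'c::comm_monoid_add"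
  by (induction S rule: infinite_finite_induct) (simp_all add: plus_fun_def zero_fun_def)

text \<open>On the image of V the map sending the value of \<Phi> at h to \<kappa> h is well defined
  and additive by injectivity. Being F_2-linear, it extends from a basis of the image to the whole
  space without leaving F. This is the linear recovery in the interpolation step.\<close>

lemma additive_extension:
  fixes V :: "bit univ_field set" and \<Phi> :: "bit univ_field \<Rightarrow> 'w::ab_group_add" and \<kappa> :: "bit univ_field \<Rightarrow> 'c::ab_group_add"
  assumes w2: "\<And>x :: 'w. x + x = 0" and c2: "\<And>x :: 'c. x + x = 0"
    and V: "finite V" "0 \<in> V" "\<And>x y. x \<in> V \<Longrightarrow> y \<in> V \<Longrightarrow> x + y \<in> V"
    and \<Phi>: "\<And>x y. x \<in> V \<Longrightarrow> y \<in> V \<Longrightarrow> \<Phi> (x + y) = \<Phi> x + \<Phi> y" "inj_on \<Phi> V"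
    and \<kappa>: "\<And>x y. x \<in> V \<Longrightarrow> y \<in> V \<Longrightarrow> \<kappa> (x + y) = \<kappa> x + \<kappa> y"
    and F: "\<And>x. x \<in> V \<Longrightarrow> \<kappa> x \<in> F" "0 \<in> F" "\<And>x y. x \<in> F \<Longrightarrow> y \<in> F \<Longrightarrow> x + y \<in> F"
  shows "\<exists>R. (\<forall>x y. R (x + y) = R x + R y) \<and> (\<forall>x. R x \<in> F) \<and> (\<forall>h\<in>V. R (\<Phi> h) = \<kappa> h)"
proof -
  have vw: "vector_space (fscale :: bit \<Rightarrow> 'w \<Rightarrow> 'w)" by (rule fscale_vector_space) (rule w2)
  have vc: "vector_space (fscale :: bit \<Rightarrow> 'c \<Rightarrow> 'c)" by (rule fscale_vector_space) (rule c2)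
  interpret W: vector_space "fscale :: bit \<Rightarrow> 'w \<Rightarrow> 'w" by (rule vw)
  interpret C: vector_space "fscale :: bit \<Rightarrow> 'c \<Rightarrow> 'c" by (rule vc)
  interpret vector_space_pair "fscale :: bit \<Rightarrow> 'w \<Rightarrow> 'w" "fscale :: bit \<Rightarrow> 'c \<Rightarrow> 'c" ..
  have \<Phi>0: "\<Phi> 0 = 0" using \<Phi>(1)[OF V(2,2)] by simp
  have \<kappa>0: "\<kappa> 0 = 0" using \<kappa>[OF V(2,2)] by simp
  define U where "U = \<Phi> ` V"
  have U0: "0 \<in> U" unfolding U_def using imageI[OF V(2), of \<Phi>] \<Phi>0 by simp
  have Uadd: "x + y \<in> U" if xy: "x \<in> U" "y \<in> U" for x y
  proof -
    obtain a b where ab: "a \<in> V" "b \<in> V" "x = \<Phi> a" "y = \<Phi> b" using xy by (auto simp: U_def)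
    then show ?thesis unfolding U_def using \<Phi>(1)[OF ab(1,2)] V(3)[OF ab(1,2)] by (metis imageI)
  qed
  have "W.subspace U" using U0 Uadd by (auto simp: W.subspace_def fscale_def)
  moreover have "finite U" using V by (simp add: U_def)
  ultimately obtain B where B: "B \<subseteq> U" "finite B" "card U = 2 ^ card B" "card B = W.dim U"
    "\<And>x. x \<in> U \<Longrightarrow> \<exists>f. x = (\<Sum>b\<in>B. fscale (f b) b)"
    "\<And>f. (\<Sum>b\<in>B. fscale (f b) b) = 0 \<Longrightarrow> \<forall>b\<in>B. f b = 0" "W.independent B"
    by (rule finite_subspace_basis[OF vw]) (rule that; blast)
  define g where "g u = \<kappa> (inv_into V \<Phi> u)" for u
  have g: "g (\<Phi> h) = \<kappa> h" if "h \<in> V" for h using \<Phi>(2) that by (simp add: g_def)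
  have gadd: "g (x + y) = g x + g y" if xy: "x \<in> U" "y \<in> U" for x y
  proof -
    obtain a b where ab: "a \<in> V" "b \<in> V" "x = \<Phi> a" "y = \<Phi> b" using xy by (auto simp: U_def)
    have "g (x + y) = g (\<Phi> (a + b))" unfolding ab(3,4) using \<Phi>(1)[OF ab(1,2)] by simp
    then show ?thesis using ab g V(3)[OF ab(1,2)] \<kappa>[OF ab(1,2)] by simp
  qed
  have g0: "g 0 = 0" using g[OF V(2)] \<Phi>0 \<kappa>0 by simp
  obtain R where R: "Vector_Spaces.linear fscale fscale R" "\<forall>x\<in>B. R x = g x" "range R = C.span (g ` B)"
    using linear_independent_extend_subspace[OF B(7), of g] by blast
  interpret R: Vector_Spaces.linear "fscale :: bit \<Rightarrow> 'w \<Rightarrow> 'w" "fscale :: bit \<Rightarrow> 'c \<Rightarrow> 'c" R by (rule R(1))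
  have Fs: "C.subspace F" using F by (auto simp: C.subspace_def fscale_def)
  have "g ` B \<subseteq> F" using B(1) F(1) g by (auto simp: U_def)
  then have RF: "R x \<in> F" for x using R(3) C.span_minimal[OF _ Fs, of "g ` B"] by blast
  have Rg: "R (\<Sum>b\<in>S. fscale (f b) b) = g (\<Sum>b\<in>S. fscale (f b) b) \<and> (\<Sum>b\<in>S. fscale (f b) b) \<in> U"
    if "S \<subseteq> B" for S f
    using finite_subset[OF that B(2)] that
  proof (induction S rule: finite_induct)
    case empty
    then show ?case using g0 U0 R.zero by simp
  next
    case (insert b S)
    have bU: "fscale (f b) b \<in> U" using insert B(1) U0 by (auto simp: fscale_def)
    have "R (fscale (f b) b) = g (fscale (f b) b)" using insert R(2) g0 R.zero by (auto simp: fscale_def)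
    then show ?case using insert bU gadd Uadd R.add by simp
  qed
  have "R (\<Phi> h) = \<kappa> h" if h: "h \<in> V" for h
  proof -
    obtain f where "\<Phi> h = (\<Sum>b\<in>B. fscale (f b) b)" using B(5)[of "\<Phi> h"] h by (auto simp: U_def)
    then have "R (\<Phi> h) = g (\<Phi> h)" using Rg[of B f] by simp
    then show ?thesis using g[OF h] by simp
  qed
  then show ?thesis using R.add RF by blast
qed

lemma stalk_generator_exists:
  assumes "P \<in> CP"
  obtains e where "e \<in> FF" "e \<noteq> 0" "ordv P e = - D P" "stalk_generator D P e"
proof -
  interpret place P by unfold_locales (rule CP_place[OF assms])
  obtain t where t: "t \<in> FF" "t \<noteq> 0" "ordv P t = 1" by (rule ex_unif)
  define e where "e = t powi (- D P)"
  have e: "e \<in> FF" "e \<noteq> 0" "ordv P e = - D P" using t v_powi[of t "- D P"] by (simp_all add: e_def)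
  have "stalk D P = (\<lambda>a. e * a) ` P"
  proof (rule Set.set_eqI)
    fix f
    have "f \<in> stalk D P \<longleftrightarrow> f \<in> FF \<and> f / e \<in> P"
      using v_divide[of f e] e by (cases "f = 0") (auto simp: stalk_iff[OF assms] P_iff)
    also have "\<dots> \<longleftrightarrow> f \<in> (\<lambda>a. e * a) ` P"
    proof
      assume "f \<in> FF \<and> f / e \<in> P"
      then show "f \<in> (\<lambda>a. e * a) ` P" using e by (intro image_eqI[of _ _ "f / e"]) simp_all
    next
      assume "f \<in> (\<lambda>a. e * a) ` P"
      then obtain a where "f = e * a" "a \<in> P" by blast
      then show "f \<in> FF \<and> f / e \<in> P" using e by (simp add: P_iff)
    qed
    finally show "f \<in> stalk D P \<longleftrightarrow> f \<in> (\<lambda>a. e * a) ` P" .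
  qed
  then show ?thesis using that[OF e] e by (simp add: stalk_generator_def)
qed

lemma mu_sym_attained:
  fixes A :: "('k::field, 'a, 'm) module_scheme"
  assumes "mu_sym A \<noteq> \<infinity>"
  obtains m \<psi> v where "enat m = mu_sym A" "sym_mult_algorithm A {..<m} \<psi> v"
proof -
  let ?S = "{enat m | m. \<exists>\<phi> w. sym_mult_algorithm A {..<m} \<phi> w}"
  have "?S \<noteq> {}" using assms unfolding mu_sym_def by (metis Inf_empty top_enat_def)
  then obtain k where "k \<in> ?S" by blast
  then have "(LEAST x. x \<in> ?S) \<in> ?S" by (rule LeastI)
  then have "Inf ?S \<in> ?S" using \<open>?S \<noteq> {}\<close> by (simp only: Inf_enat_def if_False)
  then have "mu_sym A \<in> ?S" by (simp only: mu_sym_def)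
  then show ?thesis using that by auto
qed

lemma enat_sum: "enat (\<Sum>i\<in>S. f i) = (\<Sum>i\<in>S. enat (f i))"
  by (induction S rule: infinite_finite_induct) (simp_all add: zero_enat_def flip: plus_enat_simps(1))

lemma residue_mapD:
  fixes A :: "(bit, 'b::ab_group_add, 'm) module_scheme"
  assumes "residue_map P u A \<pi>"
  shows "x \<in> P \<Longrightarrow> \<pi> x \<in> carrier A" "x \<in> P \<Longrightarrow> y \<in> P \<Longrightarrow> \<pi> (x * y) = \<pi> x \<otimes>\<^bsub>A\<^esub> \<pi> y"
    "x \<in> P \<Longrightarrow> y \<in> P \<Longrightarrow> \<pi> (x + y) = \<pi> x \<oplus>\<^bsub>A\<^esub> \<pi> y"
    "x \<in> P \<Longrightarrow> \<pi> x = \<zero>\<^bsub>A\<^esub> \<longleftrightarrow> x \<in> max_power P (int u)" "\<pi> ` P = carrier A"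
proof -
  have h: "\<pi> \<in> ring_hom (Omega\<lparr>carrier := P\<rparr>) A" using assms by (simp add: residue_map_def)
  show "x \<in> P \<Longrightarrow> \<pi> x \<in> carrier A" using ring_hom_closed[OF h] by simp
  show "x \<in> P \<Longrightarrow> y \<in> P \<Longrightarrow> \<pi> (x * y) = \<pi> x \<otimes>\<^bsub>A\<^esub> \<pi> y" using ring_hom_mult[OF h, of x y] by simp
  show "x \<in> P \<Longrightarrow> y \<in> P \<Longrightarrow> \<pi> (x + y) = \<pi> x \<oplus>\<^bsub>A\<^esub> \<pi> y" using ring_hom_add[OF h, of x y] by simp
  show "x \<in> P \<Longrightarrow> \<pi> x = \<zero>\<^bsub>A\<^esub> \<longleftrightarrow> x \<in> max_power P (int u)" using assms unfolding residue_map_def by blast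
  show "\<pi> ` P = carrier A" using assms by (simp add: residue_map_def)
qed

lemma eval_thick_eq_iff:
  assumes "P \<in> CP" "f \<in> FF" "g \<in> FF"
  shows "eval_thick D P u f = eval_thick D P u g \<longleftrightarrow> f + g \<in> max_power P (int u - D P)"
proof -
  interpret place P by unfold_locales (rule CP_place[OF assms(1)])
  let ?M = "max_power P (int u - D P)"
  have 0: "0 \<in> ?M" by (simp add: max_power_eq)
  show ?thesis
  proof
    assume eq: "eval_thick D P u f = eval_thick D P u g"
    have "f = f + 0" by simp
    then have "f \<in> eval_thick D P u f" using 0 unfolding eval_thick_def by blast
    then have "f \<in> eval_thick D P u g" using eq by simp
    then obtain h where "h \<in> ?M" "f = g + h" unfolding eval_thick_def by blast
    then show "f + g \<in> ?M" by (simp add: add.commute)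
  next
    assume M: "f + g \<in> ?M"
    have "f + h = g + ((f + g) + h)" for h by (simp add: add_ac)
    moreover have "g + h = f + ((f + g) + h)" for h by (simp add: add_ac)
    ultimately show "eval_thick D P u f = eval_thick D P u g"
      unfolding eval_thick_def using max_power_add[OF M] by blast
  qed
qed

lemma LL_div: assumes "P \<in> CP" "f \<in> LL D" "e \<in> FF" "e \<noteq> 0" "ordv P e = - D P" shows "f / e \<in> P"
proof -
  interpret place P by unfold_locales (rule CP_place[OF assms(1)])
  show ?thesis using assms v_divide[of f e] by (cases "f = 0") (auto simp: LL_iff P_iff)
qed

lemma LL_mult: assumes "f \<in> LL D" "g \<in> LL D" shows "f * g \<in> LL (\<lambda>P. 2 * D P)"
proof (cases "f = 0 \<or> g = 0")
  case False
  have "- (2 * D P) \<le> ordv P (f * g)" if P: "P \<in> CP" for P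
  proof -
    interpret place P by unfold_locales (rule CP_place[OF P])
    have "ordv P (f * g) = ordv P f + ordv P g" using assms False by (intro v_mult) (auto simp: LL_iff)
    moreover have "- D P \<le> ordv P f" "- D P \<le> ordv P g" using assms False P by (auto simp: LL_iff)
    ultimately show ?thesis by simp
  qed
  then show ?thesis using assms by (simp add: LL_iff)
qed auto

text \<open>The product x y is the value at Q of the section s x * s y of 2D. That value is a linear
  function of the values along G, where the local algorithms multiply. Composing their forms with
  lifting and evaluation gives the global forms, and recovery carries their elements back.\<close>

theorem chudnovsky_interpolation:
  fixes D G :: "bit univ_field set \<Rightarrow> int"
  defines "A \<equiv> \<lambda>P. trunc_algebra (point_degree P) (nat (G P)) :: (bit, bit alg_closure poly) module"
  assumes data: "sym_chudnovsky_data xi n 1 Q D G" and n: "n > 0"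
    and fin: "finite (LL (\<lambda>P. 2 * D P))"
    and \<pi>: "is_res Q n \<pi>" and e: "e \<in> FF" "e \<noteq> 0" "ordv Q e = - D Q" "stalk_generator D Q e"
    and inj: "\<And>f. f \<in> LL D \<Longrightarrow> \<pi> (f / e) = 0 \<Longrightarrow> f = 0"
    and res: "\<And>P. P \<in> supp G \<Longrightarrow> \<exists>\<rho>. residue_map P (nat (G P)) (A P) \<rho>"
    and mu: "\<And>P. P \<in> supp G \<Longrightarrow> mu_sym (A P) \<noteq> \<infinity>"
  shows "\<exists>I \<phi> w. chudnovsky_algorithm xi 1 Q D G (Fqn_algebra n :: (bit, bit alg_closure) module) I \<phi> w \<and>
     sym_mult_algorithm (Fqn_algebra n :: (bit, bit alg_closure) module) I \<phi> w \<and> enat (card I) = data_length G"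
proof -
  let ?B = "Fqn_algebra n :: (bit, bit alg_closure) module"
  let ?V = "LL (\<lambda>P. 2 * D P)"
  have B: "carrier ?B = Fqn n" "\<And>x y. x \<otimes>\<^bsub>?B\<^esub> y = x * y" "\<And>x y. x \<oplus>\<^bsub>?B\<^esub> y = x + y" "\<zero>\<^bsub>?B\<^esub> = 0"
    "\<And>c x. c \<odot>\<^bsub>?B\<^esub> x = fscale c x"
    by (simp_all add: Fqn_algebra_def) (simp add: fscale_def)
  have A: "\<And>P x y. x \<oplus>\<^bsub>A P\<^esub> y = x + y" "\<And>P. \<zero>\<^bsub>A P\<^esub> = 0" "\<And>P c x. c \<odot>\<^bsub>A P\<^esub> x = fscale c x"
    by (simp_all add: A_def trunc_algebra_def) (simp add: fscale_def smult_to_ac)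
  have QCP: "Q \<in> CP" and G: "finite (supp G)" "supp G \<subseteq> CP" "\<And>P. G P \<ge> 0"
    and surj: "eval_thick D Q 1 ` LL D = restriction_thick D Q 1"
    and inj2: "inj_on (\<lambda>f. \<lambda>P\<in>supp G. eval_thick (\<lambda>P. 2 * D P) P (nat (G P)) f) ?V"
    using data by (simp_all add: sym_chudnovsky_data_def is_divisor_def)
  interpret Q: place Q by unfold_locales (rule CP_place[OF QCP])
  have rmB: "residue_map Q 1 ?B \<pi>" by (rule residue_map_field[OF CP_place[OF QCP] \<pi>])
  have \<pi>add: "\<pi> (f + g) = \<pi> f + \<pi> g" and \<pi>mult: "\<pi> (f * g) = \<pi> f * \<pi> g" if "f \<in> Q" "g \<in> Q" for f g
    using \<pi> that by (auto simp: is_res_def)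
  have Qe: "f / e \<in> Q" if "f \<in> LL D" for f using LL_div[OF QCP that e(1-3)] .

  have ex: "\<exists>f. f \<in> LL D \<and> \<pi> (f / e) = x" if x: "x \<in> Fqn n" for x
  proof -
    have "x \<in> \<pi> ` Q" using \<pi> x by (simp add: is_res_def)
    then obtain a where a: "a \<in> Q" "\<pi> a = x" by blast
    have st: "e * a \<in> stalk D Q" using e(4) a by (auto simp: stalk_generator_def)
    then have "eval_thick D Q 1 (e * a) \<in> eval_thick D Q 1 ` LL D" unfolding surj restriction_thick_def by blast
    then obtain f where f: "f \<in> LL D" "eval_thick D Q 1 f = eval_thick D Q 1 (e * a)" by (metis imageE)
    have "f \<in> FF" "e * a \<in> FF" using f(1) e(1) a Q.P_iff by (auto simp: LL_iff)
    then have "f + e * a \<in> max_power Q (int 1 - D Q)" using f(2) eval_thick_eq_iff[OF QCP] by blast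
    moreover have eq: "f + e * a = e * (f / e + a)" using e by (simp add: distrib_left)
    moreover have fa: "f / e + a \<in> Q" using Qe[OF f(1)] a closed_ringD(3)[OF Q.closed_ring_P] by blast
    ultimately have "f / e + a \<in> max_power Q (int 1)"
      using Q.max_power_mult_unit[OF e(1,2), of "f / e + a" "int 1"] e(3) Q.P_iff[of "f / e + a"] by simp
    then have "\<pi> (f / e + a) = 0" using is_res_kernel[OF CP_place[OF QCP] \<pi>] by auto
    then show ?thesis using \<pi>add[OF Qe[OF f(1)] a(1)] a f by auto
  qed
  \<comment> \<open>Evaluation at Q is injective on sections of D, so the lift is unique; this makes
    s additive although it is defined by choice.\<close>
  define s where "s x = (SOME f. f \<in> LL D \<and> \<pi> (f / e) = x)" for x
  have s: "s x \<in> LL D" "\<pi> (s x / e) = x" if "x \<in> Fqn n" for x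
    using someI_ex[OF ex[OF that]] by (simp_all add: s_def)
  have s_eq: "s x = f" if "x \<in> Fqn n" "f \<in> LL D" "\<pi> (f / e) = x" for x f
  proof -
    have "\<pi> ((s x + f) / e) = 0"
      using \<pi>add[OF Qe[OF s(1)[OF that(1)]] Qe[OF that(2)]] s(2)[OF that(1)] that(3) by (simp add: add_divide_distrib)
    then have "s x + f = 0" using inj LL_add[OF s(1)[OF that(1)] that(2)] by blast
    then show ?thesis by simp
  qed
  have s_add: "s (x + y) = s x + s y" if xy: "x \<in> Fqn n" "y \<in> Fqn n" for x y
    by (rule s_eq) (use xy s LL_add \<pi>add[OF Qe[OF s(1)] Qe[OF s(1)]] in \<open>simp_all add: add_divide_distrib\<close>)
  have \<pi>0: "\<pi> 0 = 0" using \<pi> closed_ringD(1)[OF Q.closed_ring_P] by (auto simp: is_res_def)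
  have s0: "s 0 = 0" by (rule s_eq) (simp_all add: \<pi>0)
  have s_scale: "s (fscale c x) = kscale c (s x)" for c x by (simp add: fscale_def kscale_bit s0)

  have "\<exists>\<epsilon>. \<forall>P\<in>supp G. \<epsilon> P \<in> FF \<and> \<epsilon> P \<noteq> 0 \<and> ordv P (\<epsilon> P) = - D P \<and> stalk_generator D P (\<epsilon> P)"
    by (rule bchoice) (metis stalk_generator_exists G(2) subsetD)
  then obtain \<epsilon> where \<epsilon>: "\<And>P. P \<in> supp G \<Longrightarrow> \<epsilon> P \<in> FF \<and> \<epsilon> P \<noteq> 0 \<and> ordv P (\<epsilon> P) = - D P \<and> stalk_generator D P (\<epsilon> P)" by blast
  have "\<exists>\<rho>. \<forall>P\<in>supp G. residue_map P (nat (G P)) (A P) (\<rho> P)"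
    by (rule bchoice) (use res in blast)
  then obtain \<rho> where \<rho>: "\<And>P. P \<in> supp G \<Longrightarrow> residue_map P (nat (G P)) (A P) (\<rho> P)" by blast
  have "\<exists>F. \<forall>P\<in>supp G. enat (fst (F P)) = mu_sym (A P) \<and> sym_mult_algorithm (A P) {..<fst (F P)} (fst (snd (F P))) (snd (snd (F P)))"
  proof (rule bchoice, rule ballI)
    fix P assume "P \<in> supp G"
    from mu_sym_attained[OF mu[OF this]] obtain m \<psi> v where "enat m = mu_sym (A P)" "sym_mult_algorithm (A P) {..<m} \<psi> v" .
    then show "\<exists>F. enat (fst F) = mu_sym (A P) \<and> sym_mult_algorithm (A P) {..<fst F} (fst (snd F)) (snd (snd F))"
      by (intro exI[of _ "(m, \<psi>, v)"]) simp
  qed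
  then obtain F where F: "\<And>P. P \<in> supp G \<Longrightarrow> enat (fst (F P)) = mu_sym (A P) \<and> sym_mult_algorithm (A P) {..<fst (F P)} (fst (snd (F P))) (snd (snd (F P)))" by blast
  define m where "m P = fst (F P)" for P
  define \<psi> where "\<psi> P = fst (snd (F P))" for P
  define v where "v P = snd (snd (F P))" for P
  have alg: "enat (m P) = mu_sym (A P)" "sym_mult_algorithm (A P) {..<m P} (\<psi> P) (v P)" if "P \<in> supp G" for P
    using F[OF that] by (simp_all add: m_def \<psi>_def v_def)
  have acl: "0 \<in> carrier (A P)" "\<And>x y. x \<in> carrier (A P) \<Longrightarrow> y \<in> carrier (A P) \<Longrightarrow> x + y \<in> carrier (A P)" if "P \<in> supp G" for P
  proof -
    have "nat (G P) > 0" using that G(3)[of P] by (auto simp: supp_def)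
    then show "0 \<in> carrier (A P)" "\<And>x y. x \<in> carrier (A P) \<Longrightarrow> y \<in> carrier (A P) \<Longrightarrow> x + y \<in> carrier (A P)"
      by (auto simp: A_def trunc_algebra_def intro: degree_add_less)
  qed
  have Pe: "f / \<epsilon> P \<in> P" if "P \<in> supp G" "f \<in> LL D" for P f
    using LL_div[of P f D "\<epsilon> P"] \<epsilon>[OF that(1)] G(2) that by blast
  have Pe2: "h / (\<epsilon> P)\<^sup>2 \<in> P" if "P \<in> supp G" "h \<in> ?V" for P h
  proof -
    have PC: "P \<in> CP" using G(2) that by blast
    interpret place P by unfold_locales (rule CP_place[OF PC])
    have "ordv P ((\<epsilon> P)\<^sup>2) = - (2 * D P)" using v_power[of "\<epsilon> P" 2] \<epsilon>[OF that(1)] by simp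
    then show ?thesis using LL_div[OF PC that(2), of "(\<epsilon> P)\<^sup>2"] \<epsilon>[OF that(1)] by simp
  qed
  have \<rho>add: "\<rho> P (x + y) = \<rho> P x + \<rho> P y" if "P \<in> supp G" "x \<in> P" "y \<in> P" for P x y
    using residue_mapD(3)[OF \<rho>[OF that(1)] that(2,3)] by (simp add: A)

  \<comment> \<open>Joint evaluation along G. The product of the local algebras is represented by
    families of polynomials that vanish off \<open>supp G\<close>, which form an ordinary function
    space.\<close>
  define \<Phi> where "\<Phi> h = (\<lambda>P. if P \<in> supp G then \<rho> P (h / (\<epsilon> P)\<^sup>2) else 0)" for h
  have \<Phi>add: "\<Phi> (x + y) = \<Phi> x + \<Phi> y" if "x \<in> ?V" "y \<in> ?V" for x y
    unfolding \<Phi>_def plus_fun_def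
    by (rule ext) (use that \<rho>add Pe2 in \<open>simp add: add_divide_distrib\<close>)
  have \<Phi>inj: "inj_on \<Phi> ?V"
  proof (rule inj_onI)
    fix x y assume xy: "x \<in> ?V" "y \<in> ?V" "\<Phi> x = \<Phi> y"
    have xyF: "x \<in> FF" "y \<in> FF" using xy by (auto simp: LL_iff)
    have "eval_thick (\<lambda>P. 2 * D P) P (nat (G P)) x = eval_thick (\<lambda>P. 2 * D P) P (nat (G P)) y" if P: "P \<in> supp G" for P
    proof -
      have PC: "P \<in> CP" using G(2) P by blast
      interpret place P by unfold_locales (rule CP_place[OF PC])
      let ?e = "(\<epsilon> P)\<^sup>2"
      have oe: "?e \<in> FF" "?e \<noteq> 0" "ordv P ?e = - (2 * D P)" using v_power[of "\<epsilon> P" 2] \<epsilon>[OF P] by simp_all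
      have "\<rho> P (x / ?e) = \<rho> P (y / ?e)" using fun_cong[OF xy(3), of P] P by (simp add: \<Phi>_def)
      then have "\<rho> P (x / ?e + y / ?e) = 0"
        using \<rho>add[OF P Pe2[OF P xy(1)] Pe2[OF P xy(2)]] by (simp add: poly_eq_iff)
      moreover have "x / ?e + y / ?e \<in> P" using Pe2[OF P xy(1)] Pe2[OF P xy(2)] closed_ringD(3)[OF closed_ring_P] by blast
      ultimately have "x / ?e + y / ?e \<in> max_power P (int (nat (G P)))"
        using residue_mapD(4)[OF \<rho>[OF P]] A(2) by simp
      then have "?e * (x / ?e + y / ?e) \<in> max_power P (int (nat (G P)) + ordv P ?e)"
        using max_power_mult_unit[OF oe(1,2)] max_power_FF by blast
      moreover have "?e * (x / ?e + y / ?e) = x + y" using oe(2) by (simp add: distrib_left)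
      ultimately have "x + y \<in> max_power P (int (nat (G P)) - 2 * D P)" using oe(3) by simp
      then show ?thesis using eval_thick_eq_iff[OF PC xyF, of "\<lambda>P. 2 * D P" "nat (G P)"] by simp
    qed
    then have "(\<lambda>P\<in>supp G. eval_thick (\<lambda>P. 2 * D P) P (nat (G P)) x) = (\<lambda>P\<in>supp G. eval_thick (\<lambda>P. 2 * D P) P (nat (G P)) y)"
      by (intro restrict_ext)
    then show "x = y" using inj2 xy(1,2) by (auto dest: inj_onD)
  qed
  have oe: "e\<^sup>2 \<in> FF" "e\<^sup>2 \<noteq> 0" "ordv Q (e\<^sup>2) = - (2 * D Q)" using Q.v_power[of e 2] e by simp_all
  have Qe2: "h / e\<^sup>2 \<in> Q" if "h \<in> ?V" for h using LL_div[OF QCP that oe(1,2)] oe(3) by simp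
  \<comment> \<open>Injectivity along G makes the value at Q a function of the values along G; R
    extends it additively to all families.\<close>
  have "\<exists>R. (\<forall>x y. R (x + y) = R x + R y) \<and> (\<forall>x. R x \<in> Fqn n) \<and> (\<forall>h\<in>?V. R (\<Phi> h) = \<pi> (h / e\<^sup>2))"
  proof (rule additive_extension)
    have "(p :: bit alg_closure poly) + p = 0" for p by (rule poly_eqI) (simp only: coeff_add ac_add_self coeff_0)
    then show "x + x = 0" for x :: "bit univ_field set \<Rightarrow> bit alg_closure poly"
      unfolding plus_fun_def zero_fun_def by (intro ext)
    show "\<pi> ((x + y) / e\<^sup>2) = \<pi> (x / e\<^sup>2) + \<pi> (y / e\<^sup>2)" if "x \<in> ?V" "y \<in> ?V" for x y
      using \<pi>add[OF Qe2[OF that(1)] Qe2[OF that(2)]] by (simp add: add_divide_distrib)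
    show "\<pi> (x / e\<^sup>2) \<in> Fqn n" if "x \<in> ?V" for x using residue_mapD(1)[OF rmB Qe2[OF that]] B(1) by simp
  qed (use fin LL_add \<Phi>add \<Phi>inj in simp_all)
  then obtain R where R: "\<And>x y. R (x + y) = R x + R y" "\<And>x. R x \<in> Fqn n" "\<And>h. h \<in> ?V \<Longrightarrow> R (\<Phi> h) = \<pi> (h / e\<^sup>2)" by blast
  \<comment> \<open>The component of R at P: its restriction to families concentrated at P.\<close>
  define r where "r P a = R (\<lambda>P'. if P' = P then a else 0)" for P a
  have r_add: "r P (a + b) = r P a + r P b" for P a b
    unfolding r_def R(1)[symmetric] by (rule arg_cong[of _ _ R]) (auto simp: plus_fun_def)
  have r0: "r P 0 = 0" for P using r_add[of P 0 0] by simp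
  have r_scale: "r P (fscale c a) = fscale c (r P a)" for P c a by (simp add: fscale_def r0)
  have rF: "r P a \<in> Fqn n" for P a by (simp add: r_def R(2))
  have interp: "\<pi> (h / e\<^sup>2) = (\<Sum>P\<in>supp G. r P (\<rho> P (h / (\<epsilon> P)\<^sup>2)))" if h: "h \<in> ?V" for h
  proof -
    have "\<Phi> h = (\<Sum>P\<in>supp G. (\<lambda>P'. if P' = P then \<rho> P (h / (\<epsilon> P)\<^sup>2) else 0))"
    proof
      fix P'
      have "(\<Sum>P\<in>supp G. (\<lambda>P'. if P' = P then \<rho> P (h / (\<epsilon> P)\<^sup>2) else 0)) P' =
          (\<Sum>P\<in>supp G. if P' = P then \<rho> P (h / (\<epsilon> P)\<^sup>2) else 0)"
        by (rule sum_fun_apply)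
      then show "\<Phi> h P' = (\<Sum>P\<in>supp G. (\<lambda>P'. if P' = P then \<rho> P (h / (\<epsilon> P)\<^sup>2) else 0)) P'"
        using G(1) by (simp add: \<Phi>_def)
    qed
    then show ?thesis unfolding r_def R(3)[OF h, symmetric] by (simp only: additive_sum[of R, OF R(1)])
  qed
  have fB: "finsum ?B f S = (\<Sum>i\<in>S. f i)" if "finite S" "\<And>i. i \<in> S \<Longrightarrow> f i \<in> Fqn n" for f S
    by (rule finsum_eq_sum(1)) (use that in \<open>simp_all add: B\<close>)
  let ?I = "Sigma (supp G) (\<lambda>P. {..<m P})"
  define \<phi> where "\<phi> i x = \<psi> (fst i) (snd i) (\<rho> (fst i) (s x / \<epsilon> (fst i)))" for i x
  define w where "w i = r (fst i) (v (fst i) (snd i))" for i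
  have chud: "chudnovsky_algorithm xi 1 Q D G ?B ?I \<phi> w"
    unfolding chudnovsky_algorithm_def
  proof (intro exI[of _ e] exI[of _ \<pi>] exI[of _ s] exI[of _ \<epsilon>] exI[of _ \<rho>] exI[of _ m] exI[of _ \<psi>] exI[of _ v] exI[of _ r] conjI)
    show "stalk_generator D Q e" by (rule e)
    show "residue_map Q 1 ?B \<pi>" by (rule rmB)
    show "\<forall>x\<in>carrier ?B. \<forall>y\<in>carrier ?B. s (x \<oplus>\<^bsub>?B\<^esub> y) = s x + s y" using s_add by (simp add: B)
    show "\<forall>c. \<forall>x\<in>carrier ?B. s (c \<odot>\<^bsub>?B\<^esub> x) = kscale c (s x)" using s_scale by (simp add: B)
    show "\<forall>x\<in>carrier ?B. s x \<in> LL D \<and> \<pi> (s x / e) = x" using s by (simp add: B)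
    show "\<forall>P\<in>supp G. let A = (trunc_algebra (point_degree P) (nat (G P)) :: (bit, _) module) in
             stalk_generator D P (\<epsilon> P) \<and> residue_map P (nat (G P)) A (\<rho> P) \<and>
             sym_mult_algorithm A {..<m P} (\<psi> P) (v P) \<and> enat (m P) = mu_sym A \<and> linear_map A ?B (r P)"
    proof
      fix P assume P: "P \<in> supp G"
      have "linear_map (A P) ?B (r P)" using r_add r_scale rF by (simp add: linear_map_def A B)
      then show "let A = (trunc_algebra (point_degree P) (nat (G P)) :: (bit, _) module) in
             stalk_generator D P (\<epsilon> P) \<and> residue_map P (nat (G P)) A (\<rho> P) \<and>
             sym_mult_algorithm A {..<m P} (\<psi> P) (v P) \<and> enat (m P) = mu_sym A \<and> linear_map A ?B (r P)"
        using \<epsilon>[OF P] \<rho>[OF P] alg[OF P] unfolding A_def Let_def by blast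
    qed
    show "\<forall>h\<in>?V. \<pi> (h / e\<^sup>2) = (\<Oplus>\<^bsub>?B\<^esub>P\<in>supp G. r P (\<rho> P (h / (\<epsilon> P)\<^sup>2)))"
      using interp fB[OF G(1)] rF by simp
    show "\<forall>P\<in>supp G. \<forall>j<m P. (\<forall>x\<in>carrier ?B. \<phi> (P, j) x = \<psi> P j (\<rho> P (s x / \<epsilon> P))) \<and> w (P, j) = r P (v P j)"
      by (simp add: \<phi>_def w_def)
  qed (rule refl)
  have lf: "\<psi> P j (a + b) = \<psi> P j a + \<psi> P j b" if "P \<in> supp G" "j < m P" "a \<in> carrier (A P)" "b \<in> carrier (A P)" for P j a b
    using alg(2)[OF that(1)] that(2-4) by (auto simp: sym_mult_algorithm_def linear_form_def A)
  have vc: "v P j \<in> carrier (A P)" if "P \<in> supp G" "j < m P" for P j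
    using alg(2)[OF that(1)] that(2) by (auto simp: sym_mult_algorithm_def)
  have \<rho>c: "\<rho> P a \<in> carrier (A P)" if "P \<in> supp G" "a \<in> P" for P a
    using residue_mapD(1)[OF \<rho>[OF that(1)] that(2)] .
  have \<phi>add: "\<phi> (P, j) (x + y) = \<phi> (P, j) x + \<phi> (P, j) y" if "P \<in> supp G" "j < m P" "x \<in> Fqn n" "y \<in> Fqn n" for P j x y
    unfolding \<phi>_def fst_conv snd_conv s_add[OF that(3,4)] add_divide_distrib
      \<rho>add[OF that(1) Pe[OF that(1) s(1)[OF that(3)]] Pe[OF that(1) s(1)[OF that(4)]]]
    by (rule lf[OF that(1,2)]; rule \<rho>c[OF that(1) Pe[OF that(1) s(1)]]) (use that in simp_all)
  have mult: "x * y = (\<Sum>i\<in>?I. fscale (\<phi> i x * \<phi> i y) (w i))" if xy: "x \<in> Fqn n" "y \<in> Fqn n" for x y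
  proof -
    have h: "s x * s y \<in> ?V" by (rule LL_mult[OF s(1)[OF xy(1)] s(1)[OF xy(2)]])
    have loc: "r P (\<rho> P (s x * s y / (\<epsilon> P)\<^sup>2)) = (\<Sum>j<m P. fscale (\<phi> (P, j) x * \<phi> (P, j) y) (w (P, j)))" if P: "P \<in> supp G" for P
    proof -
      let ?a = "\<rho> P (s x / \<epsilon> P)" and ?b = "\<rho> P (s y / \<epsilon> P)"
      have xP: "s x / \<epsilon> P \<in> P" "s y / \<epsilon> P \<in> P" using Pe[OF P s(1)] xy by blast+
      have "s x * s y / (\<epsilon> P)\<^sup>2 = (s x / \<epsilon> P) * (s y / \<epsilon> P)" by (simp add: power2_eq_square)
      then have "\<rho> P (s x * s y / (\<epsilon> P)\<^sup>2) = ?a \<otimes>\<^bsub>A P\<^esub> ?b" by (simp only: residue_mapD(2)[OF \<rho>[OF P] xP])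
      also have "\<dots> = (\<Oplus>\<^bsub>A P\<^esub>j\<in>{..<m P}. (\<psi> P j ?a * \<psi> P j ?b) \<odot>\<^bsub>A P\<^esub> v P j)"
        using alg(2)[OF P] \<rho>c[OF P xP(1)] \<rho>c[OF P xP(2)] unfolding sym_mult_algorithm_def by blast
      also have "\<dots> = (\<Sum>j<m P. fscale (\<psi> P j ?a * \<psi> P j ?b) (v P j))"
        unfolding A(3) by (rule finsum_eq_sum(1)[OF A(2,1) acl[OF P]]) (use vc[OF P] acl(1)[OF P] in \<open>auto simp: fscale_def\<close>)
      finally have "\<rho> P (s x * s y / (\<epsilon> P)\<^sup>2) = (\<Sum>j<m P. fscale (\<psi> P j ?a * \<psi> P j ?b) (v P j))" .
      then show ?thesis by (simp only: additive_sum[of "r P", OF r_add] r_scale \<phi>_def w_def fst_conv snd_conv)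
    qed
    have "s x * s y / e\<^sup>2 = (s x / e) * (s y / e)" by (simp add: power2_eq_square)
    then have "\<pi> (s x * s y / e\<^sup>2) = x * y"
      by (simp only: \<pi>mult[OF Qe[OF s(1)[OF xy(1)]] Qe[OF s(1)[OF xy(2)]]] s(2)[OF xy(1)] s(2)[OF xy(2)])
    then have "x * y = (\<Sum>P\<in>supp G. r P (\<rho> P (s x * s y / (\<epsilon> P)\<^sup>2)))" using interp[OF h] by simp
    also have "\<dots> = (\<Sum>P\<in>supp G. \<Sum>j<m P. fscale (\<phi> (P, j) x * \<phi> (P, j) y) (w (P, j)))"
      by (rule sum.cong[OF refl]) (rule loc)
    also have "\<dots> = (\<Sum>i\<in>?I. fscale (\<phi> i x * \<phi> i y) (w i))"
      using sum.Sigma[of "supp G" "\<lambda>P. {..<m P}" "\<lambda>P j. fscale (\<phi> (P, j) x * \<phi> (P, j) y) (w (P, j))"] G(1)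
      by (simp add: case_prod_beta)
    finally show ?thesis .
  qed
  have finI: "finite ?I" using G(1) by simp
  have wF: "w i \<in> Fqn n" for i by (simp add: w_def rF)
  have "sym_mult_algorithm ?B ?I \<phi> w"
    unfolding sym_mult_algorithm_def
  proof (intro conjI ballI)
    show "finite ?I" by (rule finI)
    show "w i \<in> carrier ?B" for i using wF by (simp add: B)
    show "linear_form ?B (\<phi> i)" if i: "i \<in> ?I" for i
    proof -
      obtain P j where ij: "i = (P, j)" "P \<in> supp G" "j < m P" using i by auto
      have add: "\<phi> i (x + y) = \<phi> i x + \<phi> i y" if "x \<in> Fqn n" "y \<in> Fqn n" for x y
        unfolding ij(1) by (rule \<phi>add[OF ij(2,3) that])
      have z: "\<phi> i 0 = 0" using add[of 0 0] by simp
      have "\<phi> i (fscale c x) = c * \<phi> i x" for c x by (cases c) (simp_all add: fscale_def z)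
      then show ?thesis using add by (simp add: linear_form_def B)
    qed
    fix x y assume xy: "x \<in> carrier ?B" "y \<in> carrier ?B"
    show "x \<otimes>\<^bsub>?B\<^esub> y = (\<Oplus>\<^bsub>?B\<^esub>i\<in>?I. (\<phi> i x * \<phi> i y) \<odot>\<^bsub>?B\<^esub> w i)"
      using mult[of x y] xy fB[OF finI, of "\<lambda>i. fscale (\<phi> i x * \<phi> i y) (w i)"] wF
      by (simp add: B fscale_def cong: sum.cong)
  qed
  moreover have "enat (card ?I) = data_length G"
  proof -
    have "card ?I = (\<Sum>P\<in>supp G. m P)" using G(1) by simp
    then have "enat (card ?I) = (\<Sum>P\<in>supp G. enat (m P))" by (simp only: enat_sum)
    also have "\<dots> = data_length G" unfolding data_length_def by (rule sum.cong) (use alg in \<open>simp_all add: A_def\<close>)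
    finally show ?thesis .
  qed
  ultimately show ?thesis using chud by blast
qed

section \<open>Closed points for the divisor of evaluation points\<close>

text \<open>A bounded and hence executable form of the condition on divisors in the degree
  tests.\<close>

definition divs_ok :: "nat \<Rightarrow> nat list \<Rightarrow> bool" where
  "divs_ok n ds \<longleftrightarrow> n > 0 \<and> (\<forall>m\<in>set [0..<Suc n]. m dvd n \<longrightarrow> m \<noteq> n \<longrightarrow> (\<exists>d\<in>set ds. m dvd d))"

lemma divs_okD: "divs_ok n ds \<Longrightarrow> m dvd n \<Longrightarrow> m \<noteq> n \<Longrightarrow> \<exists>d\<in>set ds. m dvd d"
  using dvd_imp_le[of m n] by (auto simp: divs_ok_def)

lemma divs_ok_small:
  "divs_ok 8 [4]" "divs_ok 6 [2, 3]" "divs_ok 5 [1]" "divs_ok 4 [2]" "divs_ok 3 [1]" "divs_ok 2 [1]"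
  by code_simp+

lemma degree_monic: "Polynomial.degree (monic p) = length p"
proof (cases "bp p = 0")
  case True
  then show ?thesis by (simp add: monic_def Polynomial.degree_monom_eq)
next
  case False
  then have "Polynomial.degree (bp p) < length p" using degree_bp[of p] by simp
  then show ?thesis unfolding monic_def by (subst degree_add_eq_right) (simp_all add: Polynomial.degree_monom_eq)
qed

lemma inj_monic: assumes "monic p = monic q" shows "p = q"
proof -
  have l: "length p = length q" using assms degree_monic by metis
  have "bp p = bp q" using assms unfolding monic_def l by (metis add_right_imp_eq)
  then show ?thesis using inj_bp[OF l] by simp
qed

lemma points_of_degree:
  assumes t: "test_points ss js ds es"
    and len: "\<forall>(p, u)\<in>set ss. length p = n" "\<forall>p\<in>set js. length p = k" "n = 2 * k \<or> js = []"
    and dv: "divs_ok n ds" "divs_ok k es \<or> js = []"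
    and dist: "distinct (map fst ss)" "distinct js"
  shows "\<exists>S \<subseteq> CP. finite S \<and> card S = 2 * length ss + length js \<and> (\<forall>P\<in>S. point_degree P = n)"
proof -
  let ?fib = "\<lambda>p. fiber (monic p)"
  let ?A = "set (map fst ss)" and ?B = "set js"
  have A: "card (?fib p) = 2" "\<forall>P\<in>?fib p. point_degree P = n" if pA: "p \<in> ?A" for p
  proof -
    obtain u where u: "(p, u) \<in> set ss" using pA by auto
    have *: "deg_test p ds" "split_test p u" "length p = n" using t len(1) u by (auto simp: test_points_def)
    have ds: "\<exists>d\<in>set ds. m dvd d" if "m dvd length p" "m \<noteq> length p" for m
      using divs_okD[OF dv(1)] that *(3) by simp
    show "card (?fib p) = 2" "\<forall>P\<in>?fib p. point_degree P = n"
      using split_fiber[OF *(1,2) ds] *(3) by auto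
  qed
  have B: "card (?fib p) = 1" "\<forall>P\<in>?fib p. point_degree P = n" if pB: "p \<in> ?B" for p
  proof -
    have *: "deg_test p es" "inert_test p" "length p = k" "js \<noteq> []" using t len(2) pB by (auto simp: test_points_def)
    have es: "\<exists>d\<in>set es. m dvd d" if "m dvd length p" "m \<noteq> length p" for m
      using divs_okD[of k es] dv(2) that *(3,4) by simp
    show "card (?fib p) = 1" "\<forall>P\<in>?fib p. point_degree P = n"
      using inert_fiber[OF *(1,2) es] *(3,4) len(3) by auto
  qed
  have fin: "finite (?fib p)" if "p \<in> ?A \<union> ?B" for p
  proof (rule card_ge_0_finite)
    show "0 < card (?fib p)"
      using A(1)[of p] B(1)[of p] that by (cases "p \<in> ?A") simp_all
  qed
  have disj: "?A \<inter> ?B = {}"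
  proof (rule ccontr)
    assume "?A \<inter> ?B \<noteq> {}"
    then obtain p where p: "p \<in> ?A" "p \<in> ?B" by blast
    have "length p = n" using p(1) len(1) by auto
    moreover have "length p = k" "js \<noteq> []" using p(2) len(2) by auto
    ultimately show False using len(3) dv(1) by (auto simp: divs_ok_def)
  qed
  let ?S = "\<Union>p\<in>?A \<union> ?B. ?fib p"
  have "card ?S = (\<Sum>p\<in>?A \<union> ?B. card (?fib p))"
  proof (rule card_UN_disjoint)
    show "\<forall>p\<in>?A \<union> ?B. finite (?fib p)" using fin by blast
    show "\<forall>p\<in>?A \<union> ?B. \<forall>q\<in>?A \<union> ?B. p \<noteq> q \<longrightarrow> ?fib p \<inter> ?fib q = {}"
      using fiber_disjoint inj_monic by metis
  qed simp
  also have "\<dots> = (\<Sum>p\<in>?A. card (?fib p)) + (\<Sum>p\<in>?B. card (?fib p))"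
    by (rule sum.union_disjoint) (use disj in simp_all)
  also have "(\<Sum>p\<in>?A. card (?fib p)) = (\<Sum>p\<in>?A. 2)" by (rule sum.cong) (use A in simp_all)
  also have "(\<Sum>p\<in>?B. card (?fib p)) = (\<Sum>p\<in>?B. 1)" by (rule sum.cong) (use B in simp_all)
  finally have "card ?S = 2 * card ?A + card ?B" by simp
  then have "card ?S = 2 * length ss + length js"
    using distinct_card[OF dist(1)] distinct_card[OF dist(2)] by simp
  moreover have "finite ?S" using fin by blast
  moreover have "?S \<subseteq> CP" using fiber_CP by blast
  moreover have "\<forall>P\<in>?S. point_degree P = n" using A(2) B(2) by blast
  ultimately show ?thesis by blast
qed

lemma test_data:
  "\<forall>(p, u)\<in>set split8. length p = 8" "\<forall>p\<in>set inert8. length p = 4" "distinct (map fst split8)" "distinct inert8"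
  "length split8 = 12" "length inert8 = 1"
  "\<forall>(p, u)\<in>set split6. length p = 6" "\<forall>p\<in>set inert6. length p = 3" "distinct (map fst split6)" "distinct inert6"
  "length split6 = 4" "length inert6 = 2"
  "\<forall>(p, u)\<in>set split5. length p = 5" "distinct (map fst split5)" "length split5 = 2"
  "\<forall>(p, u)\<in>set split4. length p = 4" "\<forall>p\<in>set inert4. length p = 2" "distinct (map fst split4)" "distinct inert4"
  "length split4 = 2" "length inert4 = 1"
  by code_simp+

text \<open>Two points over each split polynomial and one over each inert one: 25 = 2 * 12 + 1, 10 =
  2 * 4 + 2, 4 = 2 * 2 and 5 = 2 * 2 + 1.\<close>

lemma small_degree_points:
  "\<exists>S \<subseteq> CP. finite S \<and> card S = 25 \<and> (\<forall>P\<in>S. point_degree P = 8)"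
  "\<exists>S \<subseteq> CP. finite S \<and> card S = 10 \<and> (\<forall>P\<in>S. point_degree P = 6)"
  "\<exists>S \<subseteq> CP. finite S \<and> card S = 4 \<and> (\<forall>P\<in>S. point_degree P = 5)"
  "\<exists>S \<subseteq> CP. finite S \<and> card S = 5 \<and> (\<forall>P\<in>S. point_degree P = 4)"
  using points_of_degree[OF test8 test_data(1,2) _ divs_ok_small(1) _ test_data(3,4)]
    points_of_degree[OF test6 test_data(7,8) _ divs_ok_small(2) _ test_data(9,10)]
    points_of_degree[OF test5 test_data(13) _ _ divs_ok_small(3) _ test_data(14), of 0]
    points_of_degree[OF test4 test_data(16,17) _ divs_ok_small(4) _ test_data(18,19)]
    divs_ok_small test_data(5,6,11,12,15,20,21)
  by simp_all

lemma mu_sym_small: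
  "mu_sym (trunc_algebra 4 1 :: (bit, bit alg_closure poly) module) \<le> enat 9"
  "mu_sym (trunc_algebra 5 1 :: (bit, bit alg_closure poly) module) \<le> enat 13"
  "mu_sym (trunc_algebra 6 1 :: (bit, bit alg_closure poly) module) \<le> enat 15"
  "mu_sym (trunc_algebra 8 1 :: (bit, bit alg_closure poly) module) \<le> enat 24"
  "mu_sym (trunc_algebra 1 5 :: (bit, bit alg_closure poly) module) \<le> enat 11"
  "mu_sym (trunc_algebra 1 6 :: (bit, bit alg_closure poly) module) \<le> enat 15"
proof -
  have *: "mu_sym (trunc_algebra n 1 :: (bit, bit alg_closure poly) module) \<le> enat m"
    if "deg_test p ds" "divs_ok n ds" "cert_test p cols ws" "length ws = m" "length p = n" for n m p ds cols ws
    using mu_sym_field[OF that(1) _ that(3)] divs_okD[OF that(2)] unfolding that(4,5) by metis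
  show "mu_sym (trunc_algebra 4 1 :: (bit, bit alg_closure poly) module) \<le> enat 9"
    by (rule *[OF deg_test_field(1) divs_ok_small(4) field4_test vals_length(1)]) simp
  show "mu_sym (trunc_algebra 5 1 :: (bit, bit alg_closure poly) module) \<le> enat 13"
    by (rule *[OF deg_test_field(2) divs_ok_small(3) field5_test vals_length(2)]) simp
  show "mu_sym (trunc_algebra 6 1 :: (bit, bit alg_closure poly) module) \<le> enat 15"
    by (rule *[OF deg_test_field(3) divs_ok_small(2) field6_test vals_length(3)]) simp
  show "mu_sym (trunc_algebra 8 1 :: (bit, bit alg_closure poly) module) \<le> enat 24"
    by (rule *[OF deg_test_field(4) divs_ok_small(1) field8_test vals_length(4)]) simp
qed (use mu_sym_trunc[OF trunc5_test] mu_sym_trunc[OF trunc6_test] in \<open>simp_all add: vals_length\<close>)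

definition origin :: "bit univ_field set" where "origin = Pt (0, 0)"

text \<open>Besides infinity there are two points over x = 0 and two over x = 1, because x^3 + x
  vanishes at both and y = 0 or y = 1 solves the equation.\<close>

lemma rational_points:
  obtains S where "S \<subseteq> CP" "finite S" "card S = 5" "\<forall>P\<in>S. point_degree P = 1" "origin \<in> S" "Pinf \<in> S" "origin \<noteq> Pinf"
proof -
  let ?z = "(0, 0) :: gpoint" and ?w = "(1, 0) :: gpoint"
  have z: "on_curve ?z" "on_curve ?w" by (simp_all add: on_curve_def)
  interpret z: gpt ?z by unfold_locales (rule z)
  interpret w: gpt ?w by unfold_locales (rule z)
  have "Polynomial.degree (mp 0) = 1" using mp_least[of "[:0, 1:]" 0] degree_mp_pos[of 0] by simp
  moreover have "Polynomial.degree (mp 1) = 1" using mp_least[of "[:1, 1:]" 1] degree_mp_pos[of 1] by simp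
  moreover have "0 \<in> range (\<lambda>q. evp q a)" for a by (rule range_eqI[of _ _ 0]) simp
  ultimately have d: "Pt ?z \<noteq> Pt (conjp ?z)" "point_degree (Pt ?z) = 1" "Pt ?w \<noteq> Pt (conjp ?w)" "point_degree (Pt ?w) = 1"
    using z.fiber_degree w.fiber_degree by auto
  have "mp 0 \<noteq> mp 1"
  proof
    assume eq: "mp 0 = mp 1"
    have "mp 0 dvd [:0, 1:]" by (subst mp_dvd_iff[symmetric]) simp
    moreover have "mp 1 dvd [:1, 1:]" by (subst mp_dvd_iff[symmetric]) simp
    ultimately have "mp 0 dvd [:0, 1:] + [:1, 1:]" using eq by (intro dvd_add) simp_all
    moreover have "[:0, 1:] + [:1, 1:] = (1 :: bit poly)" by (simp add: one_pCons)
    ultimately have "mp 0 dvd 1" by metis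
    then show False using degree_mp_pos[of 0] by (simp add: is_unit_iff_degree)
  qed
  then have dj: "{Pt ?z, Pt (conjp ?z)} \<inter> {Pt ?w, Pt (conjp ?w)} = {}"
    using fiber_disjoint[of "mp 0" "mp 1"] fiber_eq[OF z(1)] fiber_eq[OF z(2)] by simp
  let ?S = "{Pinf} \<union> ({Pt ?z, Pt (conjp ?z)} \<union> {Pt ?w, Pt (conjp ?w)})"
  have zc: "on_curve (conjp ?z)" "on_curve (conjp ?w)" using z by simp_all
  have inf: "Pinf \<notin> {Pt ?z, Pt (conjp ?z)} \<union> {Pt ?w, Pt (conjp ?w)}"
    using Pt_not_Pinf[OF z(1)] Pt_not_Pinf[OF z(2)] Pt_not_Pinf[OF zc(1)] Pt_not_Pinf[OF zc(2)] by auto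
  have "card ({Pt ?z, Pt (conjp ?z)} \<union> {Pt ?w, Pt (conjp ?w)}) = 2 + 2"
    using card_Un_disjoint[OF _ _ dj] d(1,3) by simp
  then have "card ?S = 5" using inf by (subst card_Un_disjoint) auto
  moreover have "?S \<subseteq> CP" using z zc by auto
  moreover have "\<forall>P\<in>?S. point_degree P = 1"
    using d point_degree_conj[OF z(1)] point_degree_conj[OF z(2)] by auto
  moreover have "origin \<in> ?S" "Pinf \<in> ?S" by (simp_all add: origin_def)
  moreover have "origin \<noteq> Pinf" using Pt_not_Pinf[OF z(1)] by (simp add: origin_def)
  ultimately show ?thesis using that[of ?S] by blast
qed

section \<open>Existence of the Chudnovsky data\<close>

text \<open>Such a function would be a polynomial in x and y, whose pole order is 2 deg a or 2 deg b
  + 3 and never 1.\<close>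

lemma no_simple_pole:
  assumes "f \<in> FF" "f \<noteq> 0" "ordv Pinf f = -1" "\<And>P. P \<in> CP \<Longrightarrow> P \<noteq> Pinf \<Longrightarrow> 0 \<le> ordv P f"
  shows False
proof -
  have "f \<in> Pt z" if z: "on_curve z" for z
  proof -
    interpret place "Pt z" by unfold_locales (rule CP_place, simp add: z)
    show ?thesis using assms(1) assms(4)[of "Pt z"] z by (simp add: P_iff)
  qed
  then obtain r where r: "f = emb r" using regular_emb[OF assms(1)] by blast
  then have "r \<noteq> 0" using assms(2) by auto
  then have "dg r = 1" using ordv_emb_Pinf[of r] assms(3) r by simp
  then show False by (simp add: dg_eq max_def split: if_splits)
qed

text \<open>Evaluation is injective, and by Riemann's inequality its source has at least as many
  elements as F_(2^n).\<close>

lemma residue_surjective: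
  assumes D: "is_divisor xi D" "divisor_degree D = int n" and Q: "Q \<in> CP" and \<pi>: "is_res Q n \<pi>"
    and e: "e \<in> FF" "e \<noteq> 0" "ordv Q e = - D Q"
    and inj: "\<And>f. f \<in> LL D \<Longrightarrow> \<pi> (f / e) = 0 \<Longrightarrow> f = 0"
  shows "(\<lambda>f. \<pi> (f / e)) ` LL D = Fqn n"
proof -
  let ?\<phi> = "\<lambda>f. \<pi> (f / e)"
  have Qe: "f / e \<in> Q" if "f \<in> LL D" for f using LL_div[OF Q that e] .
  have n: "n > 0" and \<pi>im: "\<pi> ` Q = Fqn n" using \<pi> by (simp_all add: is_res_def)
  have "inj_on ?\<phi> (LL D)"
  proof (rule inj_onI)
    fix f g assume fg: "f \<in> LL D" "g \<in> LL D" "?\<phi> f = ?\<phi> g"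
    have "\<pi> (f / e + g / e) = \<pi> (f / e) + \<pi> (g / e)" using \<pi> Qe[OF fg(1)] Qe[OF fg(2)] by (simp add: is_res_def)
    then have "\<pi> ((f + g) / e) = 0" using fg(3) by (simp add: add_divide_distrib)
    then have "f + g = 0" using inj LL_add[OF fg(1,2)] by blast
    then show "f = g" by simp
  qed
  then have c: "card (?\<phi> ` LL D) = card (LL D)" by (rule card_image)
  have sub: "?\<phi> ` LL D \<subseteq> Fqn n" using Qe \<pi>im by blast
  have "(2 :: nat) ^ n \<le> 2 ^ kspace.dim (LL D)"
    using riemann_inequality(2)[OF D(1)] D(2) by (intro power_increasing) simp_all
  then have "card (Fqn n :: bit alg_closure set) \<le> card (?\<phi> ` LL D)"
    using c LL_card[OF riemann_inequality(1)[OF D(1)]] Fqn_card(2)[OF n] by simp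
  then show ?thesis using card_seteq[OF Fqn_card(1)[OF n] sub] by blast
qed

text \<open>The kernel of evaluation at Q is L(D - Q), and the kernel of evaluation along G is L(2D
  - G). When both vanish, the second condition holds at once and the first follows by
  counting.\<close>

lemma chudnovsky_data_exists:
  assumes D: "is_divisor xi D" "divisor_degree D = int n" and Q: "Q \<in> CP" "is_res Q n \<pi>"
    and G: "is_divisor xi G" "\<And>P. G P \<ge> 0"
    and e: "e \<in> FF" "e \<noteq> 0" "ordv Q e = - D Q" "stalk_generator D Q e"
    and kerD: "LL (\<lambda>P. D P - (if P = Q then 1 else 0)) = {0}"
    and kerG: "LL (\<lambda>P. 2 * D P - G P) = {0}"
  shows "sym_chudnovsky_data xi n 1 Q D G" "\<And>f. f \<in> LL D \<Longrightarrow> \<pi> (f / e) = 0 \<Longrightarrow> f = 0"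
proof -
  interpret Q: place Q by unfold_locales (rule CP_place[OF Q(1)])
  have Qe: "f / e \<in> Q" if "f \<in> LL D" for f using LL_div[OF Q(1) that e(1-3)] .
  show inj: "f = 0" if f: "f \<in> LL D" "\<pi> (f / e) = 0" for f
  proof (rule ccontr)
    assume nz: "f \<noteq> 0"
    have FF: "f \<in> FF" using f by (simp add: LL_iff)
    have "f / e = 0 \<or> 1 \<le> ordv Q (f / e)" using Q(2) Qe[OF f(1)] f(2) by (auto simp: is_res_def)
    then have "ordv Q f \<ge> 1 - D Q" using nz e Q.v_divide[OF FF e(1) nz e(2)] by simp
    moreover have "- D P \<le> ordv P f" if "P \<in> CP" for P using f(1) nz that by (simp add: LL_iff)
    ultimately have "f \<in> LL (\<lambda>P. D P - (if P = Q then 1 else 0))" using FF by (simp add: LL_iff)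
    then show False using kerD nz by simp
  qed
  have surj: "(\<lambda>f. \<pi> (f / e)) ` LL D = Fqn n" by (rule residue_surjective[OF D Q e(1-3) inj])
  have "eval_thick D Q 1 ` LL D = restriction_thick D Q 1"
  proof (rule antisym)
    have "LL D \<subseteq> stalk D Q" using Q(1) by (auto simp: LL_iff stalk_iff)
    then show "eval_thick D Q 1 ` LL D \<subseteq> restriction_thick D Q 1" by (auto simp: restriction_thick_def)
    show "restriction_thick D Q 1 \<subseteq> eval_thick D Q 1 ` LL D"
    proof
      fix y assume "y \<in> restriction_thick D Q 1"
      then obtain f where f: "f \<in> stalk D Q" "y = eval_thick D Q 1 f" by (auto simp: restriction_thick_def)
      then obtain a where a: "a \<in> Q" "f = e * a" using e(4) by (auto simp: stalk_generator_def)
      have "\<pi> a \<in> Fqn n" using Q(2) a(1) by (auto simp: is_res_def)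
      then obtain g where g: "g \<in> LL D" "\<pi> (g / e) = \<pi> a" unfolding surj[symmetric] by auto
      have "\<pi> (g / e + a) = \<pi> (g / e) + \<pi> a" using Q(2) Qe[OF g(1)] a(1) by (simp add: is_res_def)
      then have z: "\<pi> (g / e + a) = 0" using g(2) by simp
      have ga: "g / e + a \<in> Q" by (rule closed_ringD(3)[OF Q.closed_ring_P Qe[OF g(1)] a(1)])
      have "g / e + a \<in> max_power Q 1" unfolding is_res_kernel[OF CP_place[OF Q(1)] Q(2)] using z ga by simp
      then have "e * (g / e + a) \<in> max_power Q (1 + ordv Q e)"
        using Q.max_power_mult_unit[OF e(1,2)] Q.max_power_FF by blast
      moreover have "e * (g / e + a) = g + f" using e(2) a(2) by (simp add: distrib_left)
      ultimately have "g + f \<in> max_power Q (int 1 - D Q)" using e(3) by simp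
      moreover have "g \<in> FF" "f \<in> FF" using g(1) f(1) Q(1) by (simp_all add: LL_iff stalk_iff)
      ultimately have "eval_thick D Q 1 g = eval_thick D Q 1 f" using eval_thick_eq_iff[OF Q(1)] by blast
      then show "y \<in> eval_thick D Q 1 ` LL D" using g(1) f(2) by (intro image_eqI[of _ _ g]) simp_all
    qed
  qed
  moreover have "inj_on (\<lambda>f. \<lambda>P\<in>supp G. eval_thick (\<lambda>P. 2 * D P) P (nat (G P)) f) (LL (\<lambda>P. 2 * D P))"
  proof (rule inj_onI)
    fix f g assume fg: "f \<in> LL (\<lambda>P. 2 * D P)" "g \<in> LL (\<lambda>P. 2 * D P)"
      and eq: "(\<lambda>P\<in>supp G. eval_thick (\<lambda>P. 2 * D P) P (nat (G P)) f) = (\<lambda>P\<in>supp G. eval_thick (\<lambda>P. 2 * D P) P (nat (G P)) g)"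
    have FF: "f \<in> FF" "g \<in> FF" using fg by (simp_all add: LL_iff)
    have s: "f + g \<in> LL (\<lambda>P. 2 * D P)" by (rule LL_add[OF fg])
    have "f + g = 0 \<or> - (2 * D P - G P) \<le> ordv P (f + g)" if P: "P \<in> CP" for P
    proof (cases "P \<in> supp G")
      case True
      interpret place P by unfold_locales (rule CP_place[OF P])
      have "eval_thick (\<lambda>P. 2 * D P) P (nat (G P)) f = eval_thick (\<lambda>P. 2 * D P) P (nat (G P)) g"
        using fun_cong[OF eq, of P] True by simp
      then have "f + g \<in> max_power P (int (nat (G P)) - 2 * D P)" using eval_thick_eq_iff[OF P FF, of "\<lambda>P. 2 * D P"] by simp
      then show ?thesis using G(2)[of P] unfolding max_power_eq by auto
    next
      case False
      then have "G P = 0" by (simp add: supp_def)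
      then show ?thesis using s P by (auto simp: LL_iff)
    qed
    then have "f + g \<in> LL (\<lambda>P. 2 * D P - G P)" using FF by (auto simp: LL_iff)
    then have "f + g = 0" unfolding kerG by blast
    then show "f = g" by simp
  qed
  moreover have "point_degree Q = n" by (rule point_degree_eq[OF CP_place[OF Q(1)] Q(2)])
  ultimately show "sym_chudnovsky_data xi n 1 Q D G"
    using Q(1) D(1) G by (simp add: sym_chudnovsky_data_def)
qed

lemma LL_degree_zero:
  assumes "is_divisor xi E" "divisor_degree E = 0" "LL E \<noteq> {0}"
  obtains f where "f \<in> FF" "f \<noteq> 0" "\<And>P. P \<in> CP \<Longrightarrow> ordv P f = - E P"
proof -
  obtain f where f: "f \<in> LL E" "f \<noteq> 0" using assms(3) LL_0[of E] by blast
  moreover have "f \<in> FF" using f by (simp add: LL_iff)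
  ultimately show ?thesis
    using that[of f] LL_degree(2)[of E f] assms(1,2) by (auto simp: is_divisor_def)
qed

lemma point_divisor:
  assumes "P \<in> CP"
  shows "finite (supp (\<lambda>R. if R = P then c else 0)) \<and> supp (\<lambda>R. if R = P then c else 0) \<subseteq> CP \<and>
    divisor_degree (\<lambda>R. if R = P then c else 0) = c * int (point_degree P)"
proof -
  have s: "supp (\<lambda>R. if R = P then c else 0) \<subseteq> {P}" by (auto simp: supp_def)
  have "divisor_degree (\<lambda>R. if R = P then c else 0) = (\<Sum>R\<in>{P}. (if R = P then c else 0) * int (point_degree R))"
    by (rule divisor_degree_sum[OF _ s]) simp
  then show ?thesis using s assms finite_subset[OF s] by auto
qed

lemma is_divisor_add:
  assumes "is_divisor xi D" "is_divisor xi E"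
  shows "is_divisor xi (\<lambda>P. D P + E P)" "divisor_degree (\<lambda>P. D P + E P) = divisor_degree D + divisor_degree E"
proof -
  have "supp (\<lambda>P. D P + E P) \<subseteq> supp D \<union> supp E" by (auto simp: supp_def)
  then show "is_divisor xi (\<lambda>P. D P + E P)" using assms by (auto simp: is_divisor_def intro: finite_subset)
  show "divisor_degree (\<lambda>P. D P + E P) = divisor_degree D + divisor_degree E"
    using assms by (intro divisor_degree_add) (simp_all add: is_divisor_def)
qed

lemma is_divisor_uminus:
  assumes "is_divisor xi D"
  shows "is_divisor xi (\<lambda>P. - D P)" "divisor_degree (\<lambda>P. - D P) = - divisor_degree D"
  using assms by (simp_all add: is_divisor_def divisor_degree_def supp_def sum_negf)

text \<open>Were $E - A$ principal for both points $A$, the two points would be linearly equivalent.\<close>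

lemma choose_evaluation_divisor:
  assumes D: "is_divisor xi E" "divisor_degree E = 1" and deg: "point_degree origin = 1" and o: "origin \<in> CP" "origin \<noteq> Pinf"
  shows "\<exists>A\<in>{origin, Pinf}. LL (\<lambda>P. E P - (if P = A then 1 else 0)) = {0}"
proof (rule ccontr)
  assume no: "\<not> ?thesis"
  have ex: "\<exists>f. f \<in> FF \<and> f \<noteq> 0 \<and> (\<forall>P\<in>CP. ordv P f = (if P = A then 1 else 0) - E P)" if A: "A \<in> {origin, Pinf}" for A
  proof -
    let ?E = "\<lambda>P. E P + (if P = A then - 1 else 0)"
    have AC: "A \<in> CP" "point_degree A = 1" using A o deg by auto
    have pd: "is_divisor xi (\<lambda>P. if P = A then - 1 else 0)" using point_divisor[OF AC(1)] by (simp add: is_divisor_def)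
    have eq: "?E = (\<lambda>P. E P - (if P = A then 1 else 0))" by auto
    have deg: "divisor_degree ?E = 0" using is_divisor_add(2)[OF D(1) pd] point_divisor[OF AC(1), of "-1"] D(2) AC(2) by simp
    have "LL ?E \<noteq> {0}" unfolding eq using no A by blast
    then obtain f where "f \<in> FF" "f \<noteq> 0" "\<And>P. P \<in> CP \<Longrightarrow> ordv P f = - ?E P"
      using LL_degree_zero[OF is_divisor_add(1)[OF D(1) pd] deg] by metis
    then show ?thesis by (intro exI[of _ f]) auto
  qed
  obtain f where f: "f \<in> FF" "f \<noteq> 0" "\<forall>P\<in>CP. ordv P f = (if P = origin then 1 else 0) - E P" using ex[of origin] by blast
  obtain g where g: "g \<in> FF" "g \<noteq> 0" "\<forall>P\<in>CP. ordv P g = (if P = Pinf then 1 else 0) - E P" using ex[of Pinf] by blast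
  have v: "ordv P (f / g) = (if P = origin then 1 else 0) - (if P = Pinf then 1 else 0)" if P: "P \<in> CP" for P
  proof -
    interpret place P by unfold_locales (rule CP_place[OF P])
    show ?thesis using v_divide[OF f(1) g(1) f(2) g(2)] f(3) g(3) P by simp
  qed
  have "ordv Pinf (f / g) = -1" using v[OF Pinf_CP] o(2) by simp
  moreover have "0 \<le> ordv P (f / g)" if "P \<in> CP" "P \<noteq> Pinf" for P using v[OF that(1)] that(2) by simp
  ultimately show False using no_simple_pole[of "f / g"] f g by simp
qed

theorem mainTheorem4:
  shows "mu_sym_genus TYPE(bit) 1 163 \<le> 906 \<and>
    (\<exists>(\<xi> :: bit univ_field list) Q D G I \<phi> w.
       smooth_projective_curve \<xi> \<and> has_genus \<xi> 1 \<and>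
       sym_chudnovsky_data \<xi> 163 1 Q D G \<and>
       chudnovsky_algorithm \<xi> 1 Q D G (Fqn_algebra 163 :: (bit, bit alg_closure) module) I \<phi> w \<and>
       sym_mult_algorithm (Fqn_algebra 163 :: (bit, bit alg_closure) module) I \<phi> w \<and>
       card I \<le> 906)"
proof -
  define n :: nat where "n = 163"
  have pn: "prime n" "n \<ge> 5"
  proof -
    have "\<forall>m\<in>set [2..<163]. \<not> m dvd (163 :: nat)" by code_simp
    then have *: "\<forall>m\<in>{2..<163}. \<not> m dvd (163 :: nat)" by (simp only: set_upt)
    show "prime n" unfolding n_def prime_nat_iff' by (rule conjI[OF _ *]) simp
  qed (simp add: n_def)
  obtain z where z: "on_curve z" "point_degree (Pt z) = n" using exists_point_of_prime_degree[OF pn] .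
  define Q where "Q = Pt z"
  have Q: "Q \<in> CP" "point_degree Q = n" using z by (simp_all add: Q_def)
  obtain \<pi> where "is_res Q (point_degree Q) \<pi>" by (rule CP_res[OF Q(1)])
  then have \<pi>: "is_res Q n \<pi>" using Q(2) by simp

  obtain S1 where S1: "S1 \<subseteq> CP" "finite S1" "card S1 = 5" "\<forall>P\<in>S1. point_degree P = 1" "origin \<in> S1" "Pinf \<in> S1" "origin \<noteq> Pinf"
    by (rule rational_points)
  obtain S8 where S8: "S8 \<subseteq> CP" "finite S8" "card S8 = 25" "\<forall>P\<in>S8. point_degree P = 8" using small_degree_points(1) by blast
  obtain S6 where S6: "S6 \<subseteq> CP" "finite S6" "card S6 = 10" "\<forall>P\<in>S6. point_degree P = 6" using small_degree_points(2) by blast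
  obtain S5 where S5: "S5 \<subseteq> CP" "finite S5" "card S5 = 4" "\<forall>P\<in>S5. point_degree P = 5" using small_degree_points(3) by blast
  obtain S4 where S4: "S4 \<subseteq> CP" "finite S4" "card S4 = 5" "\<forall>P\<in>S4. point_degree P = 4" using small_degree_points(4) by blast
  define H where "H = S4 \<union> (S5 \<union> (S6 \<union> S8))"
  have dj: "S4 \<inter> (S5 \<union> (S6 \<union> S8)) = {}" "S5 \<inter> (S6 \<union> S8) = {}" "S6 \<inter> S8 = {}" "S1 \<inter> H = {}"
    using S1(4) S4(4) S5(4) S6(4) S8(4) unfolding H_def by fastforce+
  have H: "finite H" "H \<subseteq> CP" using S4 S5 S6 S8 by (auto simp: H_def)
  have sumH: "(\<Sum>P\<in>H. f P) = (\<Sum>P\<in>S4. f P) + ((\<Sum>P\<in>S5. f P) + ((\<Sum>P\<in>S6. f P) + (\<Sum>P\<in>S8. f P)))"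
    for f :: "_ \<Rightarrow> 'c::comm_monoid_add"
    unfolding H_def using S4(2) S5(2) S6(2) S8(2) dj(1-3) by (simp add: sum.union_disjoint)
  have sumT: "(\<Sum>P\<in>S1 \<union> H. f P) = (\<Sum>P\<in>S1. f P) + (\<Sum>P\<in>H. f P)" for f :: "_ \<Rightarrow> 'c::comm_monoid_add"
    using S1(2) H(1) dj(4) by (simp add: sum.union_disjoint)
  \<comment> \<open>Degree 325 is one less than deg 2D, so that the last unit can be placed at
    either of two rational points.\<close>
  define G0 :: "bit univ_field set \<Rightarrow> int" where "G0 P = (if P \<in> S1 then 5 else if P \<in> H then 1 else 0)" for P
  have G0s: "supp G0 = S1 \<union> H" by (auto simp: supp_def G0_def)
  have G0d: "is_divisor xi G0" using G0s S1 H by (simp add: is_divisor_def)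
  have H1: "P \<notin> S1" if "P \<in> H" for P using dj(4) that by blast
  have in_H: "P \<in> S4 \<Longrightarrow> P \<in> H" "P \<in> S5 \<Longrightarrow> P \<in> H" "P \<in> S6 \<Longrightarrow> P \<in> H" "P \<in> S8 \<Longrightarrow> P \<in> H" for P
    by (simp_all add: H_def)
  have "divisor_degree G0 = (\<Sum>P\<in>S1. G0 P * int (point_degree P)) + (\<Sum>P\<in>H. G0 P * int (point_degree P))"
    unfolding divisor_degree_def G0s by (rule sumT)
  also have "(\<Sum>P\<in>S1. G0 P * int (point_degree P)) = (\<Sum>P\<in>S1. 5)" by (rule sum.cong) (use S1(4) in \<open>simp_all add: G0_def\<close>)
  also have "(\<Sum>P\<in>H. G0 P * int (point_degree P)) = (\<Sum>P\<in>H. int (point_degree P))"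
    by (rule sum.cong) (use H1 in \<open>simp_all add: G0_def\<close>)
  \<comment> \<open>The sum 5 * 4 + 4 * 5 + 10 * 6 + 25 * 8.\<close>
  also have "\<dots> = 300" unfolding sumH using S4(3,4) S5(3,4) S6(3,4) S8(3,4) by simp
  finally have G0deg: "divisor_degree G0 = 325" using S1(3) by simp

  have oCP: "origin \<in> CP" "point_degree origin = 1" using S1 by auto
  let ?pt = "\<lambda>R c P. if P = R then c else (0 :: int)"
  have pt: "is_divisor xi (?pt R c)" "divisor_degree (?pt R c) = c * int (point_degree R)" if "R \<in> CP" for R c
    using point_divisor[OF that, of c] by (simp_all add: is_divisor_def)
  define D0 where "D0 P = ?pt origin 1 P + ?pt Pinf (- 1) P" for P
  define D where "D P = ?pt Q 1 P + D0 P" for P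
  have D0: "is_divisor xi D0" "divisor_degree D0 = 0"
    unfolding D0_def using is_divisor_add[OF pt(1)[OF oCP(1)] pt(1)[OF Pinf_CP]] pt(2)[OF oCP(1)] pt(2)[OF Pinf_CP] oCP(2) by simp_all
  have D: "is_divisor xi D" "divisor_degree D = int n"
    unfolding D_def using is_divisor_add[OF pt(1)[OF Q(1)] D0(1)] pt(2)[OF Q(1)] D0(2) Q(2) by simp_all
  have kerD: "LL (\<lambda>P. D P - (if P = Q then 1 else 0)) = {0}"
  proof (rule ccontr)
    have eq: "(\<lambda>P. D P - (if P = Q then 1 else 0)) = D0" by (auto simp: D_def)
    assume "LL (\<lambda>P. D P - (if P = Q then 1 else 0)) \<noteq> {0}"
    then have "LL D0 \<noteq> {0}" unfolding eq .
    then obtain f where f: "f \<in> FF" "f \<noteq> 0" "\<And>P. P \<in> CP \<Longrightarrow> ordv P f = - D0 P" using LL_degree_zero[OF D0] by blast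
    \<comment> \<open>The inverse of f has a simple zero at the origin and a simple pole at
      infinity, its only pole, which cannot occur.\<close>
    have "ordv P (inverse f) = D0 P" if P: "P \<in> CP" for P
    proof -
      interpret place P by unfold_locales (rule CP_place[OF P])
      show ?thesis using v_inverse[OF f(1,2)] f(3)[OF P] by simp
    qed
    then have "ordv Pinf (inverse f) = -1" "\<And>P. P \<in> CP \<Longrightarrow> P \<noteq> Pinf \<Longrightarrow> 0 \<le> ordv P (inverse f)"
      using S1(7) by (simp_all add: D0_def)
    then show False using no_simple_pole[of "inverse f"] f by simp
  qed
  \<comment> \<open>2D - G0, of degree 326 - 325 = 1; subtracting the right rational point leaves a
    divisor of degree zero without sections.\<close>
  define E where "E P = (D P + D P) + - G0 P" for P
  have E: "is_divisor xi E" "divisor_degree E = 1"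
    unfolding E_def
    using is_divisor_add[OF is_divisor_add(1)[OF D(1) D(1)] is_divisor_uminus(1)[OF G0d]]
      is_divisor_add(2)[OF D(1) D(1)] is_divisor_uminus(2)[OF G0d] D(2) G0deg by (simp_all add: n_def)
  obtain A where A: "A \<in> {origin, Pinf}" "LL (\<lambda>P. E P - (if P = A then 1 else 0)) = {0}"
    using choose_evaluation_divisor[OF E oCP(2,1) S1(7)] by blast
  have AS: "A \<in> S1" "A \<in> CP" using A(1) S1 by auto
  define G where "G P = G0 P + ?pt A 1 P" for P
  have Gv: "G P = (if P \<in> S1 then if P = A then 6 else 5 else if P \<in> H then 1 else 0)" for P
    using AS(1) by (auto simp: G_def G0_def)
  have Gs: "supp G = S1 \<union> H" by (auto simp: supp_def Gv)
  have G: "is_divisor xi G" "\<And>P. G P \<ge> 0" using Gs S1 H by (simp_all add: is_divisor_def Gv)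
  have kerG: "LL (\<lambda>P. 2 * D P - G P) = {0}"
  proof -
    have "(\<lambda>P. 2 * D P - G P) = (\<lambda>P. E P - (if P = A then 1 else 0))" by (auto simp: E_def G_def)
    then show ?thesis using A(2) by simp
  qed
  obtain e where e: "e \<in> FF" "e \<noteq> 0" "ordv Q e = - D Q" "stalk_generator D Q e"
    using stalk_generator_exists[OF Q(1)] by blast
  note data = chudnovsky_data_exists[OF D Q(1) \<pi> G e kerD kerG]

  let ?A = "\<lambda>P. trunc_algebra (point_degree P) (nat (G P)) :: (bit, bit alg_closure poly) module"
  define b where "b P = (if P \<in> S1 then if P = A then 15 else 11 else
     if P \<in> S4 then 9 else if P \<in> S5 then 13 else if P \<in> S6 then 15 else (24 :: nat))" for P
  have bnd: "mu_sym (?A P) \<le> enat (b P)" if P: "P \<in> supp G" for P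
  proof -
    consider "P \<in> S1" | "P \<in> S4" | "P \<in> S5" | "P \<in> S6" | "P \<in> S8" using P unfolding Gs H_def by blast
    then show ?thesis
    proof cases
      case 1
      then show ?thesis using S1(4) mu_sym_small(5,6) by (simp add: Gv b_def)
    next
      case 2
      then show ?thesis using S4(4) mu_sym_small(1) H1[OF in_H(1)] in_H(1) by (simp add: Gv b_def)
    next
      case 3
      then have "P \<notin> S4" using dj(1) by blast
      then show ?thesis using 3 S5(4) mu_sym_small(2) H1[OF in_H(2)] in_H(2) by (simp add: Gv b_def)
    next
      case 4
      then have "P \<notin> S4" "P \<notin> S5" using dj(1,2) by blast+
      then show ?thesis using 4 S6(4) mu_sym_small(3) H1[OF in_H(3)] in_H(3) by (simp add: Gv b_def)
    next
      case 5
      then have "P \<notin> S4" "P \<notin> S5" "P \<notin> S6" using dj(1,2,3) by blast+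
      then show ?thesis using 5 S8(4) mu_sym_small(4) H1[OF in_H(4)] in_H(4) by (simp add: Gv b_def)
    qed
  qed
  have sb: "(\<Sum>P\<in>S1 \<union> H. b P) = 906"
  proof -
    \<comment> \<open>The point A has multiplicity six and costs 15; the other four rational points
      cost 11 each, which makes 59.\<close>
    have "(\<Sum>P\<in>S1. b P) = b A + (\<Sum>P\<in>S1 - {A}. b P)" using S1(2) AS(1) by (rule sum.remove)
    also have "(\<Sum>P\<in>S1 - {A}. b P) = (\<Sum>P\<in>S1 - {A}. 11)" by (rule sum.cong) (simp_all add: b_def)
    finally have 1: "(\<Sum>P\<in>S1. b P) = 59" using AS(1) S1(2,3) by (simp add: b_def)
    have 4: "(\<Sum>P\<in>S4. b P) = (\<Sum>P\<in>S4. 9)" by (rule sum.cong) (use H1 in_H in \<open>auto simp: b_def\<close>)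
    have 5: "(\<Sum>P\<in>S5. b P) = (\<Sum>P\<in>S5. 13)" by (rule sum.cong) (use H1 in_H dj in \<open>auto simp: b_def\<close>)
    have 6: "(\<Sum>P\<in>S6. b P) = (\<Sum>P\<in>S6. 15)" by (rule sum.cong) (use H1 in_H dj in \<open>auto simp: b_def\<close>)
    have 8: "(\<Sum>P\<in>S8. b P) = (\<Sum>P\<in>S8. 24)" by (rule sum.cong) (use H1 in_H dj in \<open>auto simp: b_def\<close>)
    \<comment> \<open>The total is 59 + 45 + 52 + 150 + 600.\<close>
    show ?thesis unfolding sumT sumH 1 4 5 6 8 using S4(3) S5(3) S6(3) S8(3) by simp
  qed
  have len: "data_length G \<le> 906"
  proof -
    have "data_length G \<le> (\<Sum>P\<in>supp G. enat (b P))" unfolding data_length_def by (rule sum_mono) (rule bnd)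
    also have "\<dots> = enat (\<Sum>P\<in>S1 \<union> H. b P)" unfolding Gs by (rule enat_sum[symmetric])
    also have "\<dots> = 906" unfolding sb by (simp add: numeral_eq_enat)
    finally show ?thesis .
  qed
  have "mu_sym_curve xi 163 \<le> data_length G"
    unfolding mu_sym_curve_def by (rule Inf_lower) (use data(1) in \<open>auto simp: n_def\<close>)
  moreover have "mu_sym_genus TYPE(bit) 1 163 \<le> mu_sym_curve xi 163"
    unfolding mu_sym_genus_def by (rule Inf_lower) (use smooth_projective_curve_xi has_genus_xi in blast)
  ultimately have 1: "mu_sym_genus TYPE(bit) 1 163 \<le> 906" using len by (meson order_trans)

  have res: "\<exists>\<rho>. residue_map P (nat (G P)) (?A P) \<rho>" if P: "P \<in> supp G" for P
  proof -
    have PC: "P \<in> CP" using P Gs S1(1) H(2) by blast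
    obtain \<rho> where \<rho>: "is_res P (point_degree P) \<rho>" by (rule CP_res[OF PC])
    show ?thesis
    proof (cases "P \<in> S1")
      case True
      then have "point_degree P = 1" using S1(4) by blast
      then show ?thesis using residue_map_taylor[OF CP_place[OF PC], of \<rho> "nat (G P)"] \<rho> True by (simp add: Gv)
    next
      case False
      then have "nat (G P) = 1" using P Gs by (simp add: Gv)
      then show ?thesis using residue_map_trunc[OF CP_place[OF PC] \<rho>] by auto
    qed
  qed
  have mu: "mu_sym (?A P) \<noteq> \<infinity>" if "P \<in> supp G" for P
    using enat_ile[OF bnd[OF that]] by (elim exE) (simp only: enat.distinct(1) not_False_eq_True)
  have fin: "finite (LL (\<lambda>P. 2 * D P))"
    using riemann_inequality(1)[OF is_divisor_add(1)[OF D(1) D(1)]] by (simp flip: mult_2)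
  have "n > 0" by (simp add: n_def)
  from chudnovsky_interpolation[OF data(1) this fin \<pi> e data(2) res mu]
  obtain I \<phi> w where alg: "chudnovsky_algorithm xi 1 Q D G (Fqn_algebra n :: (bit, bit alg_closure) module) I \<phi> w"
    "sym_mult_algorithm (Fqn_algebra n :: (bit, bit alg_closure) module) I \<phi> w" "enat (card I) = data_length G" by blast
  have "enat (card I) \<le> enat 906" using alg(3) len by (simp add: numeral_eq_enat)
  then have "card I \<le> 906" by simp
  then show ?thesis using 1 smooth_projective_curve_xi has_genus_xi data(1) alg(1,2) unfolding n_def by blast
qed

end
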